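(* Fix $\beta>0$ and $\gamma\in(0,1)$. Let $m=m(n)>n-1$ be real numbers with $n/m\to\gamma$ as $n\to\infty$, and let $\mu_n$ be the spectral measure of the random Jacobi matrix $L_{m,n,\beta}$ of the Wishart $\beta$-ensemble. Let $mp_\gamma$ be the Marchenko-Pastur distribution with parameter $\gamma$. (i) The measures $\mu_n$ converge weakly, almost surely, to $mp_\gamma$ as $n\to\infty$, that is, for any bounded continuous $f:\mathbb{R}\to\mathbb{R}$, $\langle\mu_n,f\rangle\to\langle mp_\gamma,f\rangle$ almost surely. (ii) For any differentiable function $f:\mathbb{R}\to\mathbb{R}$ whose derivative is continuous and of polynomial growth, $$\frac{\sqrt{n\beta}}{\sqrt2}\big(\langle\mu_n,f\rangle-\mathbb{E}[\langle\mu_n,f\rangle]\big)\to\mathcal{N}(0,\sigma^2(f))\quad\text{in distribution as } n\to\infty,$$ where $\sigma^2(f)=\langle mp_\gamma,f^2\rangle-\langle mp_\gamma,f\rangle^2$.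
   Context: Notation: $\langle\mu,f\rangle=\int f\,d\mu$; $\mathcal{N}(0,\sigma^2)$ is the normal distribution with variance $\sigma^2$; $\chi_k$ is the chi distribution with $k>0$ (real) degrees of freedom. A function $g$ is of polynomial growth if $|g|\le p$ on $\mathbb{R}$ for some polynomial $p$. $L_{m,n,\beta}=B_\beta B_\beta^t$, where $B_\beta$ is the $n\times n$ lower bidiagonal matrix with independent entries, diagonal entries $(B_\beta)_{i,i}\sim\frac{1}{\sqrt{m\beta}}\chi_{\beta(m-i+1)}$ ($1\le i\le n$) and subdiagonal entries $(B_\beta)_{i+1,i}\sim\frac1{\sqrt{m\beta}}\chi_{\beta(n-i)}$ ($1\le i\le n-1$). The matrices for different $n$ are defined on a common probability space. The spectral measure of an $n\times n$ Jacobi matrix $J$ (real symmetric tridiagonal with positive off-diagonal entries) is the unique probability measure $\mu$ on $\mathbb{R}$ with $\int x^k d\mu=J^k(1,1)$ for all $k\ge0$. The Marchenko-Pastur distribution $mp_\gamma$ with parameter $\gamma\in(0,1)$ has density $\frac{1}{2\pi\gamma x}\sqrt{(\lambda_+-x)(x-\lambda_-)}$ on $(\lambda_-,\lambda_+)$, where $\lambda_\pm=(1\pm\sqrt\gamma)^2$. *)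

theory Defs
  imports "HOL-Probability.Probability" "Jordan_Normal_Form.Matrix"
begin

definition chi_density :: "real \<Rightarrow> real \<Rightarrow> real" where
  "chi_density k x =
     (if x \<le> 0 then 0
      else 2 powr (1 - k / 2) * x powr (k - 1) * exp (- (x\<^sup>2) / 2) / Gamma (k / 2))"

definition chi_distribution :: "real \<Rightarrow> real measure" where
  "chi_distribution k = density lborel (\<lambda>x. ennreal (chi_density k x))"

text \<open>The library's \<open>normal_density\<close> is identically zero for standard deviation 0, so the
  degenerate law \<open>N(0,0)\<close>, the point mass at 0, needs its own clause.\<close>

definition centered_normal :: "real \<Rightarrow> real measure" where
  "centered_normal v =
     (if v = 0 then return borel 0
      else density lborel (\<lambda>x. ennreal (normal_density 0 (sqrt v) x)))"

definition mp_density :: "real \<Rightarrow> real \<Rightarrow> real" where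
  "mp_density \<gamma> x =
     (let l = (1 - sqrt \<gamma>)\<^sup>2; u = (1 + sqrt \<gamma>)\<^sup>2
      in if l < x \<and> x < u then sqrt ((u - x) * (x - l)) / (2 * pi * \<gamma> * x) else 0)"

definition marchenko_pastur :: "real \<Rightarrow> real measure" where
  "marchenko_pastur \<gamma> = density lborel (\<lambda>x. ennreal (mp_density \<gamma> x))"

text \<open>Matrix indices start at 0, so the \<open>(1,1)\<close> entry of the literature is the \<open>(0,0)\<close> entry here.
  The locale \<open>real_distribution\<close> describes the Borel probability measures on the real line.\<close>

definition is_spectral_measure :: "real mat \<Rightarrow> real measure \<Rightarrow> bool" where
  "is_spectral_measure J \<mu> \<longleftrightarrow>
     real_distribution \<mu> \<and>
     (\<forall>k. integrable \<mu> (\<lambda>x. x ^ k) \<and> (\<integral>x. x ^ k \<partial>\<mu>) = (J ^\<^sub>m k) $$ (0, 0))"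

definition spectral_measure :: "real mat \<Rightarrow> real measure" where
  "spectral_measure J = (THE \<mu>. is_spectral_measure J \<mu>)"

definition bidiagonal_indices :: "nat \<Rightarrow> (nat \<times> nat) set" where
  "bidiagonal_indices n = {(i, j). i < n \<and> j < n \<and> (i = j \<or> i = Suc j)}"

text \<open>With 0-based indices, the 1-based parameters \<open>\<beta> (m - i + 1)\<close> (diagonal) and
  \<open>\<beta> (n - i)\<close> (subdiagonal) become \<open>\<beta> (m - i)\<close> and \<open>\<beta> (n - i - 1)\<close>.\<close>

definition wishart_bidiagonal ::
  "'a measure \<Rightarrow> real \<Rightarrow> nat \<Rightarrow> real \<Rightarrow> ('a \<Rightarrow> real mat) \<Rightarrow> bool" where
  "wishart_bidiagonal M m n \<beta> B \<longleftrightarrow>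
     (\<forall>\<omega>\<in>space M. B \<omega> \<in> carrier_mat n n \<and>
        (\<forall>i<n. \<forall>j<n. (i, j) \<notin> bidiagonal_indices n \<longrightarrow> B \<omega> $$ (i, j) = 0)) \<and>
     prob_space.indep_vars M (\<lambda>_. borel) (\<lambda>ij \<omega>. B \<omega> $$ ij) (bidiagonal_indices n) \<and>
     (\<forall>i<n. distr M borel (\<lambda>\<omega>. B \<omega> $$ (i, i)) =
        distr (chi_distribution (\<beta> * (m - real i))) borel (\<lambda>x. 1 / sqrt (m * \<beta>) * x)) \<and>
     (\<forall>i. Suc i < n \<longrightarrow> distr M borel (\<lambda>\<omega>. B \<omega> $$ (Suc i, i)) =
        distr (chi_distribution (\<beta> * (real n - real i - 1))) borel (\<lambda>x. 1 / sqrt (m * \<beta>) * x))"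

definition polynomial_growth :: "(real \<Rightarrow> real) \<Rightarrow> bool" where
  "polynomial_growth g \<longleftrightarrow> (\<exists>p :: real poly. \<forall>x. \<bar>g x\<bar> \<le> poly p x)"

end

theory Submission
  imports Defs "HOL-Real_Asymp.Real_Asymp" "HOL-Computational_Algebra.Fundamental_Theorem_Algebra"
begin

text \<open>
  Let \<open>s\<close> list the entries of the bidiagonal matrix \<open>B\<close> in the order diagonal, subdiagonal,
  diagonal, \<dots>, and let \<open>T\<close> be the Jacobi matrix with zero diagonal and off-diagonal entries \<open>s\<close>.
  On the even sites \<open>T\<^sup>2\<close> acts as \<open>B B\<^sup>t\<close> (\<open>wishart_power_entry\<close>), so the spectral measure of
  \<open>B B\<^sup>t\<close> is the image under squaring of the spectral measure of \<open>T\<close>, and \<open>\<langle>\<mu>\<^sub>n, f\<rangle>\<close> is a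
  function \<open>jint s (\<lambda>x. f (x\<^sup>2))\<close> of the independent variables \<open>s\<close>.  These are chi variables
  scaled by \<open>\<theta>\<^sub>n = 1 / sqrt (m \<beta>)\<close>; they converge to the alternating sequence
  \<open>1, sqrt \<gamma>, 1, sqrt \<gamma>, \<dots>\<close>.

  Law of large numbers.  A moment of order \<open>N\<close> is a polynomial in the first \<open>N\<close> entries, hence
  converges almost surely to the moment of the alternating Jacobi matrix.  Those limits are the
  moments of the Marchenko-Pastur law (\<open>mp_moment\<close>): after the substitution
  \<open>x = 1 + \<gamma> - 2 sqrt \<gamma> cos \<phi>\<close> the three-term recurrence on the even sites is solved by combinations
  of sines.  Since the limit has compact support, convergence of moments gives weak convergence.

  Central limit theorem.  Chi laws satisfy the Poincare inequality \<open>Var g \<le> 1/2 E (g')\<^sup>2\<close> with a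
  constant that does not depend on the number of degrees of freedom (\<open>poincare\<close>); the Efron-Stein
  inequality extends it to functions of independent variables, and then
  \<open>Var F(s) \<le> \<theta>\<^sub>n\<^sup>2 / 2 * \<Sum>k. E (\<partial>\<^sub>k F)\<^sup>2\<close>.
  For \<open>F = jint s h\<close> the partial derivatives are twice the entries next to the diagonal of a matrix whose
  Hilbert-Schmidt norm is the \<open>L\<^sup>2\<close> norm of the divided difference of \<open>h\<close>
  (\<open>sum_jgrad_square_le\<close>).  Hence \<open>n Var (jint s h)\<close> is bounded by the size of \<open>h'\<close>
  (\<open>variance_jint\<close>), and polynomial approximation of \<open>f'\<close> reduces the theorem to polynomials.
  For a polynomial, subtract the linear combination of the \<open>s\<^sub>k\<^sup>2\<close> whose gradient agrees with that of
  the moment at the limit point: by the same inequality the difference is negligible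
  (\<open>lin_residual\<close>), and what remains is a fixed finite sum of independent centred squares of chi
  variables, which is asymptotically normal (\<open>zchar_approx\<close>, \<open>lin_clt\<close>).

  The variance.  The gradient at the alternating sequence is given by a convolution of walk counts,
  which collapses to a single walk count (\<open>jwalk_alt_convolution\<close>).  So the limiting variance is the
  sum of the squared coordinates of \<open>f (T\<^sup>2) e\<^sub>0\<close> at the even sites except the site 0, and
  self-adjointness of \<open>T\<close> identifies it as \<open>\<langle>mp, f\<^sup>2\<rangle> - \<langle>mp, f\<rangle>\<^sup>2\<close> (\<open>mp_poly_variance\<close>).
\<close>

section \<open>Jacobi matrices with zero diagonal\<close>

text \<open>\<open>jshift s\<close> is the infinite Jacobi matrix \<open>T\<close> with zero diagonal and off-diagonal entries \<open>s\<close>;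
  \<open>jwalk s N\<close> is the vector \<open>T\<^sup>N e\<^sub>0\<close>, a weighted count of walks of length \<open>N\<close> from the site 0.\<close>

definition jshift :: "(nat \<Rightarrow> real) \<Rightarrow> (nat \<Rightarrow> real) \<Rightarrow> nat \<Rightarrow> real" where
  "jshift s x i = s i * x (Suc i) + (if i = 0 then 0 else s (i - 1) * x (i - 1))"

primrec jwalk :: "(nat \<Rightarrow> real) \<Rightarrow> nat \<Rightarrow> nat \<Rightarrow> real" where
  "jwalk s 0 = (\<lambda>i. if i = 0 then 1 else 0)"
| "jwalk s (Suc N) = jshift s (jwalk s N)"

lemma jwalk_eq_0: "N < i \<Longrightarrow> jwalk s N i = 0"
  by (induction N arbitrary: i) (auto simp: jshift_def)

lemma jwalk_parity: "odd (N + i) \<Longrightarrow> jwalk s N i = 0"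
proof (induction N arbitrary: i)
  case 0 then show ?case by (cases i) auto
next
  case (Suc N)
  have "jwalk s N (Suc i) = 0" using Suc by auto
  moreover have "i \<noteq> 0 \<Longrightarrow> jwalk s N (i - 1) = 0" using Suc by (cases i) auto
  ultimately show ?case by (auto simp: jshift_def)
qed

lemma jwalk_beyond:
  assumes "\<And>k. k \<ge> K \<Longrightarrow> s k = 0" "i > K"
  shows "jwalk s N i = 0"
  using assms(2)
proof (induction N arbitrary: i)
  case (Suc N)
  have "s i = 0" "s (i - 1) = 0" using Suc.prems assms(1) by auto
  then show ?case by (simp add: jshift_def)
qed simp

lemma jshift_selfadjoint:
  assumes "x L = 0" "y L = 0"
  shows "(\<Sum>i<L. jshift s x i * y i) = (\<Sum>i<L. x i * jshift s y i)"
proof -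
  have "(\<Sum>i<n. jshift s x i * y i) - (\<Sum>i<n. x i * jshift s y i) =
     (if n = 0 then 0 else s (n - 1) * (x n * y (n - 1) - x (n - 1) * y n))" for n
  proof (induction n)
    case (Suc n)
    then show ?case by (cases n) (auto simp: jshift_def algebra_simps)
  qed simp
  from this[of L] show ?thesis using assms by (auto split: if_splits)
qed

text \<open>Self-adjointness of \<open>T\<close> moves all powers to one side: \<open>\<langle>T\<^sup>a e\<^sub>0, T\<^sup>b e\<^sub>0\<rangle> = \<langle>T\<^bsup>a + b\<^esup> e\<^sub>0, e\<^sub>0\<rangle>\<close>.
  The cut-off \<open>L\<close> is harmless because a walk of length \<open>a\<close> does not get beyond the site \<open>a\<close>.\<close>

lemma jwalk_shift_inner:
  assumes "a + b < L"
  shows "(\<Sum>i<L. jwalk s a i * jwalk s b i) = jwalk s (a + b) 0"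
  using assms
proof (induction b arbitrary: a)
  case 0
  then have "L \<noteq> 0" by auto
  have "(\<Sum>i<L. jwalk s a i * jwalk s 0 i) = (\<Sum>i<L. if i = 0 then jwalk s a i else 0)"
    by (intro sum.cong) auto
  then show ?case using 0 by (simp add: sum.delta)
next
  case (Suc b)
  have "(\<Sum>i<L. jwalk s a i * jwalk s (Suc b) i) = (\<Sum>i<L. jwalk s (Suc a) i * jwalk s b i)"
    using jshift_selfadjoint[of "jwalk s a" L "jwalk s b" s] Suc.prems by (simp add: jwalk_eq_0)
  then show ?case using Suc.IH[of "Suc a"] Suc.prems by simp
qed

text \<open>The partial derivative of \<open>T\<^sup>N e\<^sub>0\<close> in the entry \<open>s k\<close>, by the product rule.\<close>

primrec djwalk :: "(nat \<Rightarrow> real) \<Rightarrow> nat \<Rightarrow> nat \<Rightarrow> nat \<Rightarrow> real" where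
  "djwalk s k 0 = (\<lambda>i. 0)"
| "djwalk s k (Suc N) = (\<lambda>i. jshift s (djwalk s k N) i +
     (if i = k then jwalk s N (Suc k) else 0) + (if i = Suc k then jwalk s N k else 0))"

lemma has_derivative_jwalk:
  "((\<lambda>t. jwalk (s(k := t)) N i) has_real_derivative djwalk (s(k := t)) k N i) (at t)"
proof (induction N arbitrary: i)
  case (Suc N)
  have s: "((\<lambda>t. (s(k := t)) j) has_real_derivative (if j = k then 1 else 0)) (at t)" for j
    by (cases "j = k") (auto intro!: derivative_eq_intros)
  have prod: "((\<lambda>t. (s(k := t)) j * jwalk (s(k := t)) N l) has_real_derivative
      (if j = k then 1 else 0) * jwalk (s(k := t)) N l + djwalk (s(k := t)) k N l * (s(k := t)) j) (at t)" for j l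
    by (rule DERIV_mult[OF s Suc])
  show ?case
  proof (cases i)
    case 0
    have e: "(\<lambda>t. jwalk (s(k := t)) (Suc N) i) = (\<lambda>t. (s(k := t)) 0 * jwalk (s(k := t)) N (Suc 0))"
      using 0 by (simp only: jwalk.simps jshift_def) simp
    show ?thesis
      unfolding e
      by (rule DERIV_cong[OF prod])
         (use 0 in \<open>simp only: djwalk.simps jshift_def\<close>, simp add: mult.commute del: fun_upd_apply)
  next
    case (Suc i')
    have e: "(\<lambda>t. jwalk (s(k := t)) (Suc N) i) = (\<lambda>t. (s(k := t)) (Suc i') * jwalk (s(k := t)) N (Suc (Suc i'))
        + (s(k := t)) i' * jwalk (s(k := t)) N i')"
      using Suc by (simp only: jwalk.simps jshift_def) simp
    show ?thesis
      unfolding e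
      by (rule DERIV_cong[OF DERIV_add[OF prod prod]])
         (use Suc in \<open>simp only: djwalk.simps jshift_def\<close>, auto simp: mult.commute add_ac simp del: fun_upd_apply)
  qed
qed (auto intro!: derivative_eq_intros)

lemma djwalk_eq_0: "N < i \<Longrightarrow> djwalk s k N i = 0"
  by (induction N arbitrary: i) (auto simp: jshift_def jwalk_eq_0)

lemma djwalk_inner:
  assumes "N + M < L"
  shows "(\<Sum>i<L. djwalk s k N i * jwalk s M i) =
    (\<Sum>a<N. jwalk s a (Suc k) * jwalk s (M + N - 1 - a) k + jwalk s a k * jwalk s (M + N - 1 - a) (Suc k))"
  using assms
proof (induction N arbitrary: M)
  case (Suc N)
  have d: "(\<Sum>i<L. (if i = j then c else 0) * jwalk s M i) = c * jwalk s M j" if "M < L" for j c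
    using that by (cases "j < L") (auto simp: if_distrib[of "\<lambda>x. x * _"] sum.delta' jwalk_eq_0 cong: if_cong)
  have "(\<Sum>i<L. djwalk s k (Suc N) i * jwalk s M i) =
     (\<Sum>i<L. jshift s (djwalk s k N) i * jwalk s M i)
     + (\<Sum>i<L. (if i = k then jwalk s N (Suc k) else 0) * jwalk s M i)
     + (\<Sum>i<L. (if i = Suc k then jwalk s N k else 0) * jwalk s M i)"
    by (simp add: algebra_simps sum.distrib)
  also have "(\<Sum>i<L. jshift s (djwalk s k N) i * jwalk s M i) = (\<Sum>i<L. djwalk s k N i * jwalk s (Suc M) i)"
    using jshift_selfadjoint[of "djwalk s k N" L "jwalk s M" s] Suc.prems by (simp add: jwalk_eq_0 djwalk_eq_0)
  also have "\<dots> = (\<Sum>a<N. jwalk s a (Suc k) * jwalk s (M + N - a) k + jwalk s a k * jwalk s (M + N - a) (Suc k))"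
    using Suc.IH[of "Suc M"] Suc.prems by simp
  finally show ?case using Suc.prems by (simp add: d)
qed simp

text \<open>The derivative of \<open>T\<^sup>N\<close> is \<open>\<Sum>a. T\<^sup>a (dT) T\<^bsup>N - 1 - a\<^esup>\<close>, and \<open>dT\<close> has the two entries
  \<open>(k, k + 1)\<close> and \<open>(k + 1, k)\<close>; reversing the sum shows that they contribute equally.\<close>

lemma djwalk_0:
  "djwalk s k N 0 = 2 * (\<Sum>a<N. jwalk s a k * jwalk s (N - 1 - a) (Suc k))"
proof -
  have "djwalk s k N 0 = (\<Sum>i<Suc N. djwalk s k N i * jwalk s 0 i)"
    by (subst sum.lessThan_Suc_shift) simp
  also have "\<dots> = (\<Sum>a<N. jwalk s a (Suc k) * jwalk s (N - 1 - a) k) + (\<Sum>a<N. jwalk s a k * jwalk s (N - 1 - a) (Suc k))"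
    by (subst djwalk_inner) (auto simp: sum.distrib)
  also have "(\<Sum>a<N. jwalk s a (Suc k) * jwalk s (N - 1 - a) k) = (\<Sum>a<N. jwalk s a k * jwalk s (N - 1 - a) (Suc k))"
    by (subst sum.nat_diff_reindex[symmetric]) (auto intro!: sum.cong simp: mult.commute)
  finally show ?thesis by simp
qed

text \<open>\<open>jmom s p\<close> is \<open>\<langle>p(T) e\<^sub>0, e\<^sub>0\<rangle>\<close>, and \<open>jgrad s p k\<close> its partial derivative in \<open>s k\<close>.  The matrix
  \<open>jcross s p\<close> is the image of the divided difference \<open>divdiff p\<close> under the correspondence
  \<open>x\<^sup>a y\<^sup>b \<mapsto> T\<^sup>a e\<^sub>0 \<otimes> T\<^sup>b e\<^sub>0\<close>.\<close>

definition jmom :: "(nat \<Rightarrow> real) \<Rightarrow> real poly \<Rightarrow> real" where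
  "jmom s p = (\<Sum>N\<le>degree p. coeff p N * jwalk s N 0)"

definition jcross :: "(nat \<Rightarrow> real) \<Rightarrow> real poly \<Rightarrow> nat \<Rightarrow> nat \<Rightarrow> real" where
  "jcross s p k l = (\<Sum>N\<le>degree p. coeff p N * (\<Sum>a<N. jwalk s a k * jwalk s (N - 1 - a) l))"

definition jgrad :: "(nat \<Rightarrow> real) \<Rightarrow> real poly \<Rightarrow> nat \<Rightarrow> real" where
  "jgrad s p k = 2 * jcross s p k (Suc k)"

definition divdiff :: "real poly \<Rightarrow> real \<Rightarrow> real \<Rightarrow> real" where
  "divdiff p x y = (\<Sum>N\<le>degree p. coeff p N * (\<Sum>a<N. x ^ a * y ^ (N - 1 - a)))"

lemma has_derivative_jmom:
  "((\<lambda>t. jmom (s(k := t)) p) has_real_derivative jgrad (s(k := t)) p k) (at t)"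
  unfolding jmom_def jgrad_def jcross_def sum_distrib_left
  by (auto intro!: derivative_eq_intros has_derivative_jwalk simp: djwalk_0 sum_distrib_left mult_ac)

lemma jcross_commute: "jcross s p k l = jcross s p l k"
proof -
  have "(\<Sum>a<N. jwalk s a k * jwalk s (N - 1 - a) l) = (\<Sum>a<N. jwalk s a l * jwalk s (N - 1 - a) k)" for N
    by (subst sum.nat_diff_reindex[symmetric]) (auto intro!: sum.cong simp: mult.commute)
  then show ?thesis unfolding jcross_def by simp
qed

lemma divdiff_mvt:
  obtains z where "min x y \<le> z" "z \<le> max x y" "divdiff p x y = poly (pderiv p) z"
proof (cases "x = y")
  case True
  have "divdiff p x x = (\<Sum>N\<le>degree p. coeff p N * (real N * x ^ (N - 1)))"
    unfolding divdiff_def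
    by (intro sum.cong refl arg_cong2[where f="(*)"]) (simp flip: power_add)
  moreover have "poly (pderiv p) x = (\<Sum>N\<le>degree p. coeff p N * (real N * x ^ (N - 1)))"
  proof -
    have "((\<lambda>x. poly p x) has_real_derivative (\<Sum>N\<le>degree p. coeff p N * (real N * x ^ (N - 1)))) (at x)"
      unfolding poly_altdef by (auto intro!: derivative_eq_intros sum.cong)
    then show ?thesis using poly_DERIV[of p x] DERIV_unique by blast
  qed
  ultimately show ?thesis using True that[of x] by auto
next
  case False
  have d: "poly p u - poly p v = (u - v) * divdiff p u v" for u v
  proof -
    have "u ^ N - v ^ N = (u - v) * (\<Sum>a<N. u ^ a * v ^ (N - 1 - a))" for N
    proof (cases N)
      case (Suc m)
      have "u ^ Suc m - v ^ Suc m = (u - v) * (\<Sum>p<Suc m. u ^ p * v ^ (m - p))"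
        by (rule diff_power_eq_sum)
      then show ?thesis using Suc by simp
    qed simp
    then have "coeff p N * u ^ N - coeff p N * v ^ N = (u - v) * (coeff p N * (\<Sum>a<N. u ^ a * v ^ (N - 1 - a)))" for N
      by (metis mult.left_commute right_diff_distrib)
    then show ?thesis
      unfolding poly_altdef divdiff_def by (simp add: sum_subtractf[symmetric] sum_distrib_left[symmetric])
  qed
  have ex: "\<exists>z. u \<le> z \<and> z \<le> v \<and> poly p v - poly p u = (v - u) * poly (pderiv p) z" if "u < v" for u v
    using poly_MVT[OF that] less_imp_le by metis
  consider "x < y" | "y < x" using False by linarith
  then show ?thesis
  proof cases
    case 1
    then obtain z where "x \<le> z" "z \<le> y" "poly p y - poly p x = (y - x) * poly (pderiv p) z" using ex by blast
    then have "(x - y) * divdiff p x y = (x - y) * poly (pderiv p) z"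
      using d[of x y] by (simp add: algebra_simps)
    then show ?thesis using that[of z] 1 \<open>x \<le> z\<close> \<open>z \<le> y\<close> by auto
  next
    case 2
    then obtain z where "y \<le> z" "z \<le> x" "poly p x - poly p y = (x - y) * poly (pderiv p) z" using ex by blast
    then show ?thesis using that[of z] 2 d[of x y] by auto
  qed
qed

lemma sum_cross_square:
  assumes "finite T" "\<And>t u. t \<in> T \<Longrightarrow> u \<in> T \<Longrightarrow> A t u = (\<Sum>k<L. f t k * f u k)"
     "\<And>t u. t \<in> T \<Longrightarrow> u \<in> T \<Longrightarrow> B t u = (\<Sum>k<L. g t k * g u k)"
  shows "(\<Sum>k<L. \<Sum>l<L. (\<Sum>t\<in>T. c t * f t k * g t l)\<^sup>2) = (\<Sum>t\<in>T. \<Sum>u\<in>T. c t * c u * A t u * (B t u :: real))"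
proof -
  have "(\<Sum>k<L. \<Sum>l<L. (\<Sum>t\<in>T. c t * f t k * g t l)\<^sup>2) =
    (\<Sum>k<L. \<Sum>l<L. \<Sum>t\<in>T. \<Sum>u\<in>T. c t * c u * (f t k * f u k) * (g t l * g u l))"
    by (simp add: power2_eq_square sum_product mult_ac)
  also have "\<dots> = (\<Sum>k<L. \<Sum>t\<in>T. \<Sum>l<L. \<Sum>u\<in>T. c t * c u * (f t k * f u k) * (g t l * g u l))"
    by (intro sum.cong refl sum.swap)
  also have "\<dots> = (\<Sum>k<L. \<Sum>t\<in>T. \<Sum>u\<in>T. \<Sum>l<L. c t * c u * (f t k * f u k) * (g t l * g u l))"
    by (intro sum.cong refl sum.swap)
  also have "\<dots> = (\<Sum>t\<in>T. \<Sum>k<L. \<Sum>u\<in>T. \<Sum>l<L. c t * c u * (f t k * f u k) * (g t l * g u l))"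
    by (rule sum.swap)
  also have "\<dots> = (\<Sum>t\<in>T. \<Sum>u\<in>T. \<Sum>k<L. \<Sum>l<L. c t * c u * (f t k * f u k) * (g t l * g u l))"
    by (intro sum.cong refl sum.swap)
  also have "\<dots> = (\<Sum>t\<in>T. \<Sum>u\<in>T. c t * c u * A t u * B t u)"
    by (intro sum.cong refl) (simp add: assms sum_distrib_left sum_distrib_right mult_ac)
  finally show ?thesis .
qed

text \<open>The correspondence \<open>x\<^sup>a y\<^sup>b \<mapsto> T\<^sup>a e\<^sub>0 \<otimes> T\<^sup>b e\<^sub>0\<close> is an isometry from \<open>L\<^sup>2\<close> of two copies of the spectral
  measure, because inner products of powers are moments on both sides.  The gradient occupies the two
  diagonals next to the main one in the image of the divided difference, so its norm is bounded by
  the full Hilbert-Schmidt norm.\<close>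

lemma sum_jgrad_square_le:
  assumes S: "finite S" and rep: "\<And>N. jwalk s N 0 = (\<Sum>x\<in>S. wt x * x ^ N)"
  shows "(\<Sum>k<K. (jgrad s p k)\<^sup>2) \<le> 2 * (\<Sum>x\<in>S. \<Sum>y\<in>S. wt x * wt y * (divdiff p x y)\<^sup>2)"
proof -
  define T where "T = (SIGMA N:{..degree p}. {..<N})"
  define L where "L = max (Suc K) (2 * degree p + 1)"
  have T: "finite T" unfolding T_def by auto
  let ?w = "jwalk s"
  have cr: "jcross s p k l = (\<Sum>t\<in>T. coeff p (fst t) * ?w (snd t) k * ?w (fst t - 1 - snd t) l)" for k l
    unfolding T_def jcross_def by (simp add: sum.Sigma split_def sum_distrib_left mult_ac)
  have dd: "divdiff p x y = (\<Sum>t\<in>T. coeff p (fst t) * x ^ (snd t) * y ^ (fst t - 1 - snd t))" for x y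
    unfolding T_def divdiff_def by (simp add: sum.Sigma split_def sum_distrib_left mult_ac)
  have e: "(\<Sum>k<L. \<Sum>l<L. (jcross s p k l)\<^sup>2) = (\<Sum>t\<in>T. \<Sum>u\<in>T. coeff p (fst t) * coeff p (fst u) *
      ?w (snd t + snd u) 0 * ?w ((fst t - 1 - snd t) + (fst u - 1 - snd u)) 0)"
    unfolding cr
    by (intro sum_cross_square[OF T] jwalk_shift_inner[symmetric]) (auto simp: T_def L_def)
  have "(\<Sum>x\<in>S. \<Sum>y\<in>S. wt x * wt y * (divdiff p x y)\<^sup>2) =
    (\<Sum>x\<in>S. \<Sum>y\<in>S. \<Sum>t\<in>T. \<Sum>u\<in>T. coeff p (fst t) * coeff p (fst u) * (wt x * x ^ (snd t + snd u)) *
        (wt y * y ^ ((fst t - 1 - snd t) + (fst u - 1 - snd u))))"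
    unfolding dd by (simp add: power2_eq_square sum_product sum_distrib_left power_add mult_ac)
  also have "\<dots> = (\<Sum>x\<in>S. \<Sum>t\<in>T. \<Sum>y\<in>S. \<Sum>u\<in>T. coeff p (fst t) * coeff p (fst u) * (wt x * x ^ (snd t + snd u)) *
        (wt y * y ^ ((fst t - 1 - snd t) + (fst u - 1 - snd u))))"
    by (intro sum.cong refl sum.swap)
  also have "\<dots> = (\<Sum>x\<in>S. \<Sum>t\<in>T. \<Sum>u\<in>T. \<Sum>y\<in>S. coeff p (fst t) * coeff p (fst u) * (wt x * x ^ (snd t + snd u)) *
        (wt y * y ^ ((fst t - 1 - snd t) + (fst u - 1 - snd u))))"
    by (intro sum.cong refl sum.swap)
  also have "\<dots> = (\<Sum>t\<in>T. \<Sum>x\<in>S. \<Sum>u\<in>T. \<Sum>y\<in>S. coeff p (fst t) * coeff p (fst u) * (wt x * x ^ (snd t + snd u)) *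
        (wt y * y ^ ((fst t - 1 - snd t) + (fst u - 1 - snd u))))"
    by (intro sum.swap)
  also have "\<dots> = (\<Sum>t\<in>T. \<Sum>u\<in>T. \<Sum>x\<in>S. \<Sum>y\<in>S. coeff p (fst t) * coeff p (fst u) * (wt x * x ^ (snd t + snd u)) *
        (wt y * y ^ ((fst t - 1 - snd t) + (fst u - 1 - snd u))))"
    by (intro sum.cong refl sum.swap)
  also have "\<dots> = (\<Sum>k<L. \<Sum>l<L. (jcross s p k l)\<^sup>2)"
    unfolding e rep by (intro sum.cong refl) (simp add: sum_distrib_left sum_distrib_right mult_ac)
  finally have rhs: "(\<Sum>x\<in>S. \<Sum>y\<in>S. wt x * wt y * (divdiff p x y)\<^sup>2) = (\<Sum>k<L. \<Sum>l<L. (jcross s p k l)\<^sup>2)" .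
  have "2 * (\<Sum>k<K. (jcross s p k (Suc k))\<^sup>2) =
     (\<Sum>k<K. (jcross s p k (Suc k))\<^sup>2) + (\<Sum>k<K. (jcross s p (Suc k) k)\<^sup>2)"
    by (simp add: jcross_commute[of s p "Suc _" _])
  also have "\<dots> = (\<Sum>z\<in>(\<lambda>k. (k, Suc k)) ` {..<K}. (jcross s p (fst z) (snd z))\<^sup>2) +
                 (\<Sum>z\<in>(\<lambda>k. (Suc k, k)) ` {..<K}. (jcross s p (fst z) (snd z))\<^sup>2)"
    by (subst (1 2) sum.reindex) (auto simp: inj_on_def)
  also have "\<dots> = (\<Sum>z\<in>(\<lambda>k. (k, Suc k)) ` {..<K} \<union> (\<lambda>k. (Suc k, k)) ` {..<K}. (jcross s p (fst z) (snd z))\<^sup>2)"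
    by (subst sum.union_disjoint) auto
  also have "\<dots> \<le> (\<Sum>z\<in>{..<L} \<times> {..<L}. (jcross s p (fst z) (snd z))\<^sup>2)"
    by (intro sum_mono2) (auto simp: L_def)
  also have "\<dots> = (\<Sum>k<L. \<Sum>l<L. (jcross s p k l)\<^sup>2)"
    by (simp add: sum.cartesian_product split_def)
  finally show ?thesis unfolding rhs jgrad_def by (simp add: power_mult_distrib sum_distrib_left[symmetric])
qed

section \<open>Gauss quadrature for finite Jacobi matrices\<close>

definition jpoly :: "(nat \<Rightarrow> real) \<Rightarrow> real poly \<Rightarrow> nat \<Rightarrow> real" where
  "jpoly s p i = (\<Sum>N\<le>degree p. coeff p N * jwalk s N i)"

lemma jmom_eq_jpoly: "jmom s p = jpoly s p 0"
  by (simp add: jmom_def jpoly_def)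

lemma jpoly_altdef:
  assumes "degree p \<le> n"
  shows "jpoly s p i = (\<Sum>N\<le>n. coeff p N * jwalk s N i)"
  unfolding jpoly_def using assms
  by (intro sum.mono_neutral_left) (auto simp: coeff_eq_0)

lemma jpoly_add: "jpoly s (p + q) i = jpoly s p i + jpoly s q i"
proof -
  have "degree (p + q) \<le> max (degree p) (degree q)" by (rule degree_add_le) auto
  then show ?thesis
    by (subst (1 2 3) jpoly_altdef[where n = "max (degree p) (degree q)"])
       (auto simp: algebra_simps sum.distrib)
qed

lemma jpoly_smult: "jpoly s (Polynomial.smult c p) i = c * jpoly s p i"
  by (subst (1 2) jpoly_altdef[where n = "degree p"]) (auto simp: sum_distrib_left mult_ac)

lemma jpoly_0 [simp]: "jpoly s 0 i = 0"
  by (simp add: jpoly_def)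

lemma jpoly_sum: "jpoly s (\<Sum>x\<in>A. f x) i = (\<Sum>x\<in>A. jpoly s (f x) i)"
  by (induction A rule: infinite_finite_induct) (auto simp: jpoly_add)

lemma jpoly_pCons: "jpoly s (pCons a p) i = (if i = 0 then a else 0) + jshift s (jpoly s p) i"
proof -
  have "degree (pCons a p) \<le> Suc (degree p)" by (rule degree_pCons_le)
  then have "jpoly s (pCons a p) i = (if i = 0 then a else 0) + (\<Sum>N\<le>degree p. coeff p N * jshift s (jwalk s N) i)"
    by (subst jpoly_altdef[where n = "Suc (degree p)"]) (auto simp: sum.atMost_Suc_shift simp del: sum.atMost_Suc)
  moreover have "(\<Sum>N\<le>degree p. coeff p N * jshift s (jwalk s N) i) = jshift s (jpoly s p) i"
    by (auto simp: jshift_def jpoly_def algebra_simps sum.distrib sum_distrib_left)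
  ultimately show ?thesis by simp
qed

lemma jpoly_mult_ker:
  assumes "jpoly s q = (\<lambda>i. 0)"
  shows "jpoly s (q * h) = (\<lambda>i. 0)"
proof (induction h)
  case (pCons a h)
  then show ?case
    using assms by (auto simp: fun_eq_iff mult_pCons_right jpoly_add jpoly_smult jpoly_pCons jshift_def)
qed auto

lemma jpoly_inner:
  assumes "\<And>k. k \<ge> K \<Longrightarrow> s k = 0"
  shows "(\<Sum>i<Suc K. jpoly s p i * jpoly s q i) = jpoly s (p * q) 0"
proof (induction p arbitrary: q)
  case (pCons a p)
  have z: "jpoly s p (Suc K) = 0" for p
    unfolding jpoly_def using jwalk_beyond[of K s] assms by simp
  have "(\<Sum>i<Suc K. jpoly s (pCons a p) i * jpoly s q i) =
     (\<Sum>i<Suc K. (if i = 0 then a * jpoly s q i else 0)) + (\<Sum>i<Suc K. jshift s (jpoly s p) i * jpoly s q i)"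
    unfolding jpoly_pCons sum.distrib[symmetric] by (intro sum.cong) (auto simp: algebra_simps)
  also have "(\<Sum>i<Suc K. jshift s (jpoly s p) i * jpoly s q i) = (\<Sum>i<Suc K. jpoly s p i * jpoly s (pCons 0 q) i)"
    by (subst jshift_selfadjoint) (auto simp: z jpoly_pCons)
  also have "\<dots> = jpoly s (p * pCons 0 q) 0"
    by (rule pCons.IH)
  also have "(\<Sum>i<Suc K. (if i = 0 then a * jpoly s q i else 0)) = a * jpoly s q 0"
    by (subst sum.delta) auto
  finally show ?case by (simp add: jpoly_add jpoly_smult)
qed simp

text \<open>Gaussian elimination on the last coordinate.\<close>

lemma linear_dependence_finite:
  fixes v :: "'j \<Rightarrow> nat \<Rightarrow> real"
  assumes "finite J" "card J > n"
  shows "\<exists>c. (\<exists>j\<in>J. c j \<noteq> 0) \<and> (\<forall>i<n. (\<Sum>j\<in>J. c j * v j i) = 0)"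
  using assms
proof (induction n arbitrary: J v)
  case 0
  then obtain j where "j \<in> J" by fastforce
  then show ?case by (intro exI[of _ "\<lambda>_. 1"]) auto
next
  case (Suc n)
  show ?case
  proof (cases "\<forall>j\<in>J. v j n = 0")
    case True
    obtain c where c: "\<exists>j\<in>J. c j \<noteq> 0" "\<forall>i<n. (\<Sum>j\<in>J. c j * v j i) = 0"
      using Suc.IH[of J v] Suc.prems by auto
    then show ?thesis using True by (intro exI[of _ c]) (auto simp: less_Suc_eq)
  next
    case False
    then obtain j0 where j0: "j0 \<in> J" "v j0 n \<noteq> 0" by auto
    define v' where "v' j i = v j i - v j n / v j0 n * v j0 i" for j i
    obtain c where c: "\<exists>j\<in>J - {j0}. c j \<noteq> 0" "\<forall>i<n. (\<Sum>j\<in>J - {j0}. c j * v' j i) = 0"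
    proof -
      have "card (J - {j0}) > n" using Suc.prems j0 by simp
      then show ?thesis using Suc.IH[of "J - {j0}" v'] Suc.prems(1) that by blast
    qed
    define c' where "c' = c(j0 := - (\<Sum>j\<in>J - {j0}. c j * v j n / v j0 n))"
    have "(\<Sum>j\<in>J. c' j * v j i) = (\<Sum>j\<in>J - {j0}. c j * v' j i)" for i
    proof -
      have "(\<Sum>j\<in>J. c' j * v j i) = c' j0 * v j0 i + (\<Sum>j\<in>J - {j0}. c' j * v j i)"
        using j0 Suc.prems by (subst sum.remove) auto
      also have "(\<Sum>j\<in>J - {j0}. c' j * v j i) = (\<Sum>j\<in>J - {j0}. c j * v j i)"
        by (intro sum.cong) (auto simp: c'_def)
      finally show ?thesis
        by (simp add: c'_def v'_def algebra_simps sum_subtractf sum_distrib_left)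
    qed
    moreover have "v' j n = 0" for j using j0 by (simp add: v'_def)
    ultimately show ?thesis using c by (intro exI[of _ c']) (auto simp: less_Suc_eq c'_def)
  qed
qed

text \<open>A nonreal root \<open>a + i b\<close> comes with its conjugate: division by \<open>(x - a)\<^sup>2 + b\<^sup>2\<close>, the polynomial
  with these two roots, leaves a linear real remainder with a nonreal root, hence 0.\<close>

lemma real_root_or_quadratic_factor:
  fixes q :: "real poly"
  assumes "degree q > 0"
  obtains x where "[:-x, 1:] dvd q" | a b where "[:a\<^sup>2 + b\<^sup>2, -2 * a, 1:] dvd q"
proof -
  define e :: "real poly \<Rightarrow> complex \<Rightarrow> complex" where "e p z = poly (map_poly of_real p) z" for p z
  have e_pCons: "e (pCons a p) z = of_real a + z * e p z" for a p z
    by (simp add: e_def map_poly_pCons)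
  have e_add: "e (p + r) z = e p z + e r z" for p r z
  proof (induction p arbitrary: r)
    case (pCons a p)
    show ?case by (cases r) (auto simp: e_pCons pCons.IH distrib_left)
  qed (simp add: e_def)
  have e_smult: "e (Polynomial.smult c p) z = of_real c * e p z" for c p z
    by (induction p) (auto simp: e_pCons algebra_simps, simp add: e_def)
  have e_mult: "e (p * r) z = e p z * e r z" for p r z
    by (induction p) (auto simp: e_pCons e_add e_smult algebra_simps, simp add: e_def)
  have "degree (map_poly complex_of_real q) > 0" using assms by (subst degree_map_poly) auto
  then have "\<not> constant (poly (map_poly complex_of_real q))"
    by (simp add: constant_degree)
  then obtain z where z: "e q z = 0"
    using fundamental_theorem_of_algebra unfolding e_def by blast
  show ?thesis
  proof (cases "Im z = 0")
    case True
    then have "z = of_real (Re z)" by (simp add: complex_eq_iff)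
    moreover have "e p (of_real x) = of_real (poly p x)" for p x
      by (induction p) (auto simp: e_pCons, simp add: e_def)
    ultimately have "poly q (Re z) = 0" using z by (metis of_real_eq_0_iff)
    then show ?thesis using that(1) poly_eq_0_iff_dvd by blast
  next
    case False
    define d where "d = [:(Re z)\<^sup>2 + (Im z)\<^sup>2, -2 * Re z, 1:]"
    have "e d z = 0"
      by (simp add: d_def e_pCons e_def[of 0] complex_eq_iff power2_eq_square algebra_simps)
    moreover have "e (d * (q div d) + q mod d) z = e q z" by simp
    ultimately have r: "e (q mod d) z = 0"
      using z e_add[of "d * (q div d)" "q mod d" z] e_mult[of d "q div d" z] by simp
    have "d \<noteq> 0" "degree d = 2" by (auto simp: d_def)
    then have deg: "degree (q mod d) < 2 \<or> q mod d = 0" using degree_mod_less[of d q] by auto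
    obtain u v where uv: "q mod d = [:u, v:]"
    proof (cases "q mod d = 0")
      case True then show ?thesis using that[of 0 0] by simp
    next
      case False
      then have "degree (q mod d) \<le> 1" using deg by auto
      then show ?thesis
        by (intro that[of "coeff (q mod d) 0" "coeff (q mod d) 1"] poly_eqI)
           (auto simp: coeff_pCons coeff_eq_0 split: nat.split)
    qed
    have "v = 0" "u = 0" using r False by (auto simp: uv e_pCons e_def[of 0] complex_eq_iff)
    then have "d dvd q" using uv by (simp add: mod_eq_0_iff_dvd)
    then show ?thesis using that(2) unfolding d_def by blast
  qed
qed

text \<open>The case \<open>b = 0\<close> of the excluded factors \<open>(x - a)\<^sup>2 + b\<^sup>2\<close> rules out repeated real roots, the other
  cases rule out complex roots.\<close>

lemma split_distinct_roots:
  fixes q :: "real poly"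
  assumes "q \<noteq> 0" "\<And>a b. \<not> [:a\<^sup>2 + b\<^sup>2, -2 * a, 1:] dvd q"
  shows "\<exists>S. finite S \<and> q = Polynomial.smult (lead_coeff q) (\<Prod>x\<in>S. [:-x, 1:])"
  using assms
proof (induction "degree q" arbitrary: q)
  case 0
  then have "q = [:lead_coeff q:]" by (metis degree_0_id)
  moreover have "Polynomial.smult (lead_coeff q) 1 = [:lead_coeff q:]" by (simp add: one_pCons)
  ultimately show ?case by (intro exI[of _ "{}"]) (metis finite.emptyI prod.empty)
next
  case (Suc n)
  obtain x where "[:-x, 1:] dvd q"
  proof (rule real_root_or_quadratic_factor[of q])
    show "degree q > 0" using Suc.hyps(2) by simp
  qed (use Suc.prems(2) in blast)+
  then obtain r where r: "q = [:-x, 1:] * r" by (auto elim: dvdE)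
  have "r \<noteq> 0" using Suc r by auto
  have "degree q = Suc (degree r)" using r \<open>r \<noteq> 0\<close> by (subst r, subst degree_mult_eq) auto
  moreover have "\<not> [:a\<^sup>2 + b\<^sup>2, -2 * a, 1:] dvd r" for a b using Suc.prems(2) r dvd_mult by blast
  ultimately obtain S where S: "finite S" "r = Polynomial.smult (lead_coeff r) (\<Prod>x\<in>S. [:-x, 1:])"
    using Suc.hyps(1)[of r] Suc.hyps(2) \<open>r \<noteq> 0\<close> by auto
  have lc: "lead_coeff q = lead_coeff r" using r by (simp only: lead_coeff_mult) simp
  have "x \<notin> S"
  proof
    assume "x \<in> S"
    then have "[:-x, 1:] dvd r" using S by (metis dvd_prodI dvd_smult)
    then have "[:-x, 1:] * [:-x, 1:] dvd q" using r by (simp only: mult_dvd_mono dvd_refl)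
    moreover have "[:-x, 1:] * [:-x, 1:] = [:x\<^sup>2 + 0\<^sup>2, -2 * x, 1:]" by (simp add: power2_eq_square)
    ultimately show False using Suc.prems(2) by metis
  qed
  define P where "P = (\<Prod>y\<in>S. [:-y, 1:])"
  have "q = [:-x, 1:] * Polynomial.smult (lead_coeff r) P"
    unfolding P_def S(2)[symmetric] by (rule r)
  also have "\<dots> = Polynomial.smult (lead_coeff q) ([:-x, 1:] * P)" by (simp only: mult_smult_right lc)
  also have "[:-x, 1:] * P = (\<Prod>y\<in>insert x S. [:-y, 1:])"
    using \<open>x \<notin> S\<close> S(1) unfolding P_def by (simp only: prod.insert not_False_eq_True)
  finally have "q = Polynomial.smult (lead_coeff q) (\<Prod>y\<in>insert x S. [:-y, 1:])" .
  then show ?case using S(1) by blast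
qed

lemma prod_linear_dvd:
  fixes p :: "real poly"
  assumes "finite S" "\<And>x. x \<in> S \<Longrightarrow> poly p x = 0"
  shows "(\<Prod>x\<in>S. [:-x, 1:]) dvd p"
  using assms
proof (induction S arbitrary: p rule: finite_induct)
  case (insert x S)
  then have "[:-x, 1:] dvd p" by (simp add: poly_eq_0_iff_dvd)
  then obtain r where r: "p = [:-x, 1:] * r" by (auto elim: dvdE)
  have "poly r y = 0" if "y \<in> S" for y
    using insert.prems[of y] that insert.hyps r by auto
  then have "(\<Prod>x\<in>S. [:-x, 1:]) dvd r" by (rule insert.IH)
  then show ?case using insert.hyps r by (subst prod.insert) (auto simp only: mult_dvd_mono dvd_refl)
qed simp

text \<open>A spectral theorem for the vector \<open>e\<^sub>0\<close> without eigenvectors: a polynomial of least degree with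
  \<open>q(T) e\<^sub>0 = 0\<close> has distinct real roots, and evaluating the functional \<open>p \<mapsto> \<langle>p(T) e\<^sub>0, e\<^sub>0\<rangle>\<close> on the
  Lagrange polynomials of these roots gives the weights.\<close>

lemma quadrature:
  assumes K: "\<And>k. k \<ge> K \<Longrightarrow> s k = 0"
  shows "\<exists>S wt. finite S \<and> (\<forall>x\<in>S. wt x \<ge> 0) \<and> (\<forall>p. jmom s p = (\<Sum>x\<in>S. wt x * poly p x))"
proof -
  let ?Z = "\<lambda>q. q \<noteq> 0 \<and> jpoly s q = (\<lambda>i. 0)"
  have ker: "jpoly s q = (\<lambda>i. 0)" if "jpoly s (q * q) 0 = 0" for q
  proof
    fix i
    have "(\<Sum>i<Suc K. jpoly s q i * jpoly s q i) = 0"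
      using that jpoly_inner[of K s q q] K by simp
    then have "\<forall>i\<in>{..<Suc K}. jpoly s q i * jpoly s q i = 0"
      by (subst (asm) sum_nonneg_eq_0_iff) auto
    then show "jpoly s q i = 0"
      using jwalk_beyond[of K s i] K by (cases "i < Suc K") (auto simp: jpoly_def)
  qed
  have nn: "jpoly s (p * p) 0 \<ge> 0" for p
  proof -
    have "0 \<le> (\<Sum>i<Suc K. jpoly s p i * jpoly s p i)" by (intro sum_nonneg) simp
    then show ?thesis using jpoly_inner[of K s p p] K by simp
  qed
  have "\<exists>q. ?Z q"
  proof -
    obtain c where c: "\<exists>j\<in>{..Suc K}. c j \<noteq> 0" "\<forall>i<Suc K. (\<Sum>j\<le>Suc K. c j * jwalk s j i) = 0"
      using linear_dependence_finite[of "{..Suc K}" "Suc K" "jwalk s"] by auto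
    define q where "q = (\<Sum>j\<le>Suc K. monom (c j) j)"
    have co: "coeff q j = (if j \<le> Suc K then c j else 0)" for j
      by (simp add: q_def coeff_sum)
    have "degree q \<le> Suc K" by (rule degree_le) (auto simp: co)
    then have "jpoly s q i = (\<Sum>j\<le>Suc K. c j * jwalk s j i)" for i
      by (subst jpoly_altdef) (auto simp: co)
    then have "jpoly s q i = 0" for i
      using c(2) jwalk_beyond[of K s i] K by (cases "i < Suc K") (auto simp del: sum.atMost_Suc jwalk.simps)
    moreover have "q \<noteq> 0" using c(1) co by (metis coeff_0 atMost_iff)
    ultimately show ?thesis by blast
  qed
  then obtain q0 where q0: "?Z q0" by blast
  define q where "q = arg_min degree ?Z"
  have q: "?Z q" and min: "\<And>r. ?Z r \<Longrightarrow> degree q \<le> degree r"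
    using arg_min_nat_lemma[of ?Z q0 degree, OF q0] unfolding q_def by blast+
  (* If \<open>q = ((x - a)\<^sup>2 + b\<^sup>2) t\<close>, then \<open>0 = \<langle>q(T) e\<^sub>0, t(T) e\<^sub>0\<rangle>\<close> is the sum of \<open>\<parallel>u(T) e\<^sub>0\<parallel>\<^sup>2\<close> for
     \<open>u = (x - a) t\<close> and a nonnegative term, so \<open>u\<close> contradicts the minimality of \<open>q\<close>. *)
  have "\<not> [:a\<^sup>2 + b\<^sup>2, -2 * a, 1:] dvd q" for a b
  proof
    assume "[:a\<^sup>2 + b\<^sup>2, -2 * a, 1:] dvd q"
    then obtain t where t: "q = [:a\<^sup>2 + b\<^sup>2, -2 * a, 1:] * t" by (auto elim: dvdE)
    have "t \<noteq> 0" using q t by auto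
    then have deg: "degree q = 2 + degree t" by (subst t, subst degree_mult_eq) auto
    define u where "u = [:-a, 1:] * t"
    have "degree u = 1 + degree t" using \<open>t \<noteq> 0\<close> unfolding u_def by (subst degree_mult_eq) auto
    have eq: "q * t = u * u + Polynomial.smult (b\<^sup>2) (t * t)"
    proof -
      have "[:a\<^sup>2 + b\<^sup>2, -2 * a, 1:] = [:-a, 1:] * [:-a, 1:] + [:b\<^sup>2:]" by (simp add: power2_eq_square)
      then have "q * t = ([:-a, 1:] * [:-a, 1:] + [:b\<^sup>2:]) * t * t" using t by simp
      also have "\<dots> = u * u + [:b\<^sup>2:] * (t * t)" unfolding u_def by (simp only: algebra_simps)
      finally show ?thesis by simp
    qed
    have "jpoly s (q * t) 0 = 0" using jpoly_mult_ker[of s q t] q by simp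
    then have e0: "jpoly s (u * u) 0 + b\<^sup>2 * jpoly s (t * t) 0 = 0"
      by (simp add: eq jpoly_add jpoly_smult)
    have "jpoly s (u * u) 0 = 0" using e0 nn[of u] nn[of t]
      by (metis add_nonneg_eq_0_iff zero_le_mult_iff zero_le_power2)
    then have "?Z u" using ker[of u] \<open>degree u = _\<close> by auto
    then show False using min[of u] deg \<open>degree u = _\<close> by auto
  qed
  then obtain S where S: "finite S" "q = Polynomial.smult (lead_coeff q) (\<Prod>x\<in>S. [:-x, 1:])"
    using split_distinct_roots q by blast
  have zero: "jpoly s p i = 0" if "\<And>x. x \<in> S \<Longrightarrow> poly p x = 0" for p i
  proof -
    have "(\<Prod>x\<in>S. [:-x, 1:]) dvd p" using prod_linear_dvd S(1) that by blast
    then have "Polynomial.smult (lead_coeff q) (\<Prod>x\<in>S. [:-x, 1:]) dvd p" using q by (simp add: smult_dvd_iff)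
    then have "q dvd p" by (subst S(2))
    then obtain h where "p = q * h" by (auto elim: dvdE)
    then show ?thesis using jpoly_mult_ker[of s q h] q by simp
  qed
  have eq: "jpoly s p i = jpoly s r i" if "\<And>x. x \<in> S \<Longrightarrow> poly p x = poly r x" for p r i
    using zero[of "p - r" i] jpoly_add[of s "p - r" r i] that by simp
  define l where "l x = (\<Prod>y\<in>S - {x}. Polynomial.smult (1 / (x - y)) [:-y, 1:])" for x :: real
  have l: "poly (l x) z = (if z = x then 1 else 0)" if "x \<in> S" "z \<in> S" for x z
  proof (cases "z = x")
    case True
    then show ?thesis by (auto simp: l_def poly_prod diff_divide_distrib[symmetric] intro!: prod.neutral)
  next
    case False
    then have "(\<Prod>y\<in>S - {x}. poly (Polynomial.smult (1 / (x - y)) [:-y, 1:]) z) = 0"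
      using that S(1) by (intro prod_zero) (auto intro!: bexI[of _ z])
    then show ?thesis using False by (simp add: l_def poly_prod)
  qed
  have rep: "jmom s p = (\<Sum>x\<in>S. jpoly s (l x) 0 * poly p x)" for p
  proof -
    have "jpoly s p 0 = jpoly s (\<Sum>x\<in>S. Polynomial.smult (poly p x) (l x)) 0"
      using S(1) by (intro eq) (auto simp: poly_sum l sum.delta' if_distrib cong: if_cong)
    then show ?thesis by (simp add: jmom_eq_jpoly jpoly_sum jpoly_smult mult.commute)
  qed
  have "jpoly s (l x) 0 \<ge> 0" if "x \<in> S" for x
  proof -
    (* On the roots a Lagrange polynomial takes the values 0 and 1 only, so it equals its square. *)
    have "jpoly s (l x) 0 = jpoly s (l x * l x) 0"
      using that by (intro eq) (auto simp: l)
    then show ?thesis using nn by simp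
  qed
  then show ?thesis using S(1) rep by (intro exI[of _ S] exI[of _ "\<lambda>x. jpoly s (l x) 0"]) auto
qed

section \<open>A Poincare inequality for chi laws\<close>

lemma chi_density_nonneg: "k > 0 \<Longrightarrow> chi_density k x \<ge> 0"
  by (auto simp: chi_density_def Gamma_real_pos intro!: mult_nonneg_nonneg divide_nonneg_nonneg Gamma_real_nonneg)

lemma measurable_chi_density [measurable]: "chi_density k \<in> borel_measurable borel"
  unfolding chi_density_def [abs_def] by measurable

lemma sets_chi [simp, measurable_cong]: "sets (chi_distribution k) = sets borel"
  and space_chi [simp]: "space (chi_distribution k) = UNIV"
  by (auto simp: chi_distribution_def)

lemma nn_integral_chi:
  assumes [measurable]: "f \<in> borel_measurable borel"
  shows "(\<integral>\<^sup>+x. f x \<partial>chi_distribution k) = (\<integral>\<^sup>+x. ennreal (chi_density k x) * f x \<partial>lborel)"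
  unfolding chi_distribution_def by (subst nn_integral_density) auto

lemma AE_chi_pos: "AE x in chi_distribution k. 0 < x"
  unfolding chi_distribution_def by (subst AE_density) (auto simp: chi_density_def)

lemma chi_density_eq:
  "x > 0 \<Longrightarrow> chi_density k x = 2 powr (1 - k / 2) / Gamma (k / 2) * (x powr (k - 1) * exp (- (x\<^sup>2) / 2))"
  by (simp add: chi_density_def)

text \<open>This is the Stein identity of the chi law: \<open>x\<close> is the Stein kernel of \<open>x\<^sup>2 - k\<close>.\<close>

lemma DERIV_chi:
  assumes "t > 0"
  shows "((\<lambda>t. t * chi_density k t) has_real_derivative (k - t\<^sup>2) * chi_density k t) (at t)"
proof -
  define c where "c = 2 powr (1 - k / 2) / Gamma (k / 2)"
  have "((\<lambda>t. c * (t powr k * exp (- (t\<^sup>2) / 2))) has_real_derivative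
     c * (k * t powr (k - 1) * exp (- (t\<^sup>2) / 2) + t powr k * (exp (- (t\<^sup>2) / 2) * (- t)))) (at t)"
    using assms by (auto intro!: derivative_eq_intros simp: power2_eq_square)
  also have "t powr k = t * t powr (k - 1)"
    using assms by (simp add: powr_diff powr_one)
  also have "c * (k * t powr (k - 1) * exp (- (t\<^sup>2) / 2) + t * t powr (k - 1) * (exp (- (t\<^sup>2) / 2) * (- t)))
      = (k - t\<^sup>2) * chi_density k t"
    using assms by (simp add: chi_density_eq c_def[symmetric] algebra_simps power2_eq_square)
  finally have *: "((\<lambda>t. c * (t powr k * exp (- (t\<^sup>2) / 2))) has_real_derivative (k - t\<^sup>2) * chi_density k t) (at t)" .
  show ?thesis
    by (rule has_field_derivative_transform_within_open[OF * open_greaterThan[of 0]])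
       (use assms in \<open>auto simp: chi_density_eq c_def powr_diff\<close>)
qed

lemma chi_decay_0: "k > 0 \<Longrightarrow> ((\<lambda>t. t * chi_density k t) \<longlongrightarrow> 0) (at_right 0)"
proof -
  assume k: "k > 0"
  define c where "c = 2 powr (1 - k / 2) / Gamma (k / 2)"
  have "((\<lambda>t::real. c * (t powr k * exp (- (t\<^sup>2) / 2))) \<longlongrightarrow> c * (0 powr k * exp (- (0\<^sup>2) / 2))) (at_right 0)"
    using k by (intro tendsto_intros tendsto_powr') (auto simp: eventually_at_filter intro!: tendsto_eq_intros)
  then have "((\<lambda>t::real. c * (t powr k * exp (- (t\<^sup>2) / 2))) \<longlongrightarrow> 0) (at_right 0)" by simp
  then show ?thesis
    by (rule Lim_transform_eventually) (auto simp: eventually_at_filter chi_density_eq c_def powr_diff)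
qed

lemma chi_decay_top: "((\<lambda>t. (1 + \<bar>t\<bar> ^ q) * (t * chi_density k t)) \<longlongrightarrow> 0) at_top"
proof -
  define c where "c = 2 powr (1 - k / 2) / Gamma (k / 2)"
  define a where "a = k"
  have "((\<lambda>t::real. c * ((1 + t powr real q) * (t powr a * exp (- (t\<^sup>2) / 2)))) \<longlongrightarrow> 0) at_top"
    by real_asymp
  then show ?thesis
    by (rule Lim_transform_eventually)
       (use eventually_gt_at_top[of 0] in \<open>eventually_elim, auto simp: chi_density_eq c_def a_def powr_diff powr_realpow\<close>)
qed

lemma chi_tail_integral:
  assumes "k > 0" "t > 0"
  shows "k \<le> t\<^sup>2 \<Longrightarrow> (\<integral>\<^sup>+x. ennreal ((x\<^sup>2 - k) * chi_density k x) * indicator {t..} x \<partial>lborel) = ennreal (t * chi_density k t)"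
    and "t\<^sup>2 \<le> k \<Longrightarrow> (\<integral>\<^sup>+x. ennreal ((k - x\<^sup>2) * chi_density k x) * indicator {0..t} x \<partial>lborel) = ennreal (t * chi_density k t)"
proof -
  assume kt: "k \<le> t\<^sup>2"
  have "(\<integral>\<^sup>+x. ennreal ((x\<^sup>2 - k) * chi_density k x) * indicator {t..} x \<partial>lborel) = ennreal (0 - (- (t * chi_density k t)))"
  proof (rule nn_integral_FTC_atLeast)
    fix x assume x: "t \<le> x"
    then have "t\<^sup>2 \<le> x\<^sup>2" using assms by (intro power_mono) auto
    then show "0 \<le> (x\<^sup>2 - k) * chi_density k x" using kt assms by (auto intro!: mult_nonneg_nonneg chi_density_nonneg)
    show "((\<lambda>t. - (t * chi_density k t)) has_real_derivative (x\<^sup>2 - k) * chi_density k x) (at x)"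
      using DERIV_minus[OF DERIV_chi[of x k]] x assms by (simp add: algebra_simps)
  next
    show "((\<lambda>a. - (a * chi_density k a)) \<longlongrightarrow> 0) at_top"
    proof -
      have "((\<lambda>t. (1 + \<bar>t\<bar> ^ 0) * (t * chi_density k t)) \<longlongrightarrow> 0) at_top" by (rule chi_decay_top)
      from tendsto_mult_left[OF this, of "-1/2"] show ?thesis by simp
    qed
  qed simp
  then show "(\<integral>\<^sup>+x. ennreal ((x\<^sup>2 - k) * chi_density k x) * indicator {t..} x \<partial>lborel) = ennreal (t * chi_density k t)" by simp
next
  assume kt: "t\<^sup>2 \<le> k"
  define F where "F x = (if x \<le> 0 then 0 else x * chi_density k x)" for x
  have eqF: "F x = x * chi_density k x" for x by (simp add: F_def chi_density_def)
  have lim: "(F \<longlongrightarrow> 0) (at_right 0)" using chi_decay_0[OF assms(1)] unfolding eqF[abs_def] by simp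
  have "((\<lambda>x. (k - x\<^sup>2) * chi_density k x) has_integral (F t - F 0)) {0..t}"
  proof (rule fundamental_theorem_of_calculus_interior)
    show "continuous_on {0..t} F"
    proof (rule continuous_at_imp_continuous_on, clarify)
      fix x :: real
      show "isCont F x"
      proof (cases "x = 0")
        case True
        have "(F \<longlongrightarrow> 0) (at_left 0)"
          by (rule Lim_transform_eventually[OF tendsto_const]) (auto simp: eventually_at_filter F_def)
        then show ?thesis using lim True unfolding isCont_def by (simp add: filterlim_split_at F_def)
      next
        case False
        show ?thesis
        proof (cases "x < 0")
          case True
          have "eventually (\<lambda>y. y < 0) (nhds x)" using True by (auto simp: eventually_nhds intro!: exI[of _ "{..<0}"])
          then show ?thesis
            by (subst isCont_cong[of _ "\<lambda>_. 0"]) (auto simp: F_def elim: eventually_mono)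
        next
          case False
          then show ?thesis using \<open>x \<noteq> 0\<close> DERIV_isCont[OF DERIV_chi[of x k]] unfolding eqF[abs_def] by auto
        qed
      qed
    qed
    show "(F has_vector_derivative (k - x\<^sup>2) * chi_density k x) (at x)" if "x \<in> {0<..<t}" for x
      using DERIV_chi[of x k] that unfolding eqF[abs_def] by (simp add: has_real_derivative_iff_has_vector_derivative)
  qed (use assms in auto)
  moreover have "0 \<le> (k - x\<^sup>2) * chi_density k x" if "x \<in> {0..t}" for x
  proof -
    have "x\<^sup>2 \<le> t\<^sup>2" using that by (intro power_mono) auto
    then show ?thesis using kt assms by (auto intro!: mult_nonneg_nonneg chi_density_nonneg)
  qed
  ultimately have "(\<integral>\<^sup>+x. ennreal ((k - x\<^sup>2) * chi_density k x) * indicator {0..t} x \<partial>lborel) = ennreal (F t - F 0)"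
    by (intro nn_integral_has_integral_lebesgue') auto
  then show "(\<integral>\<^sup>+x. ennreal ((k - x\<^sup>2) * chi_density k x) * indicator {0..t} x \<partial>lborel) = ennreal (t * chi_density k t)"
    using assms by (simp add: F_def)
qed

text \<open>Cauchy-Schwarz for \<open>g b - g a = \<integral> G\<close> with weights \<open>t\<close> and \<open>1 / t\<close>.  The weight is chosen to match
  the factor \<open>t\<close> on the right-hand side of \<open>chi_tail_integral\<close>.\<close>

lemma cauchy_schwarz_increment:
  fixes g G :: "real \<Rightarrow> real"
  assumes ab: "0 < a" "a \<le> b"
    and g: "\<And>t. a \<le> t \<Longrightarrow> t \<le> b \<Longrightarrow> (g has_real_derivative G t) (at t)"
    and G: "continuous_on {a..b} G"
  shows "ennreal ((g b - g a)\<^sup>2) \<le> (\<integral>\<^sup>+t. ennreal ((b\<^sup>2 - a\<^sup>2) / 2 * ((G t)\<^sup>2 / t)) * indicator {a..b} t \<partial>lborel)"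
proof (cases "a = b")
  case False
  define c where "c = b\<^sup>2 / 2 - a\<^sup>2 / 2"
  have "a\<^sup>2 < b\<^sup>2" using ab False by (intro power_strict_mono) auto
  then have c: "c > 0" by (simp add: c_def)
  define I where "I = integral {a..b} (\<lambda>t. (G t)\<^sup>2 / t)"
  have I: "((\<lambda>t. (G t)\<^sup>2 / t) has_integral I) {a..b}"
    unfolding I_def using ab
    by (intro integrable_integral integrable_continuous_interval continuous_intros G) auto
  have T: "((\<lambda>t. t) has_integral c) {a..b}"
    unfolding c_def using ab
    by (intro fundamental_theorem_of_calculus)
       (auto intro!: derivative_eq_intros simp: has_real_derivative_iff_has_vector_derivative[symmetric])
  have D: "(G has_integral (g b - g a)) {a..b}"
    using ab g
    by (intro fundamental_theorem_of_calculus)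
       (auto simp: has_real_derivative_iff_has_vector_derivative[symmetric] intro: has_field_derivative_at_within)
  (* The minimiser over \<open>l\<close> of \<open>\<integral> (l t - G t)\<^sup>2 / t\<close>, whose nonnegativity is the inequality. *)
  define l where "l = (g b - g a) / c"
  have "((\<lambda>t. l\<^sup>2 * t - (2 * l) * G t + (G t)\<^sup>2 / t) has_integral (l\<^sup>2 * c - (2 * l) * (g b - g a) + I)) {a..b}"
    by (intro has_integral_add has_integral_diff has_integral_mult_right T D I)
  then have "0 \<le> l\<^sup>2 * c - (2 * l) * (g b - g a) + I"
  proof (rule has_integral_nonneg)
    fix t assume t: "t \<in> {a..b}"
    have "l\<^sup>2 * t - (2 * l) * G t + (G t)\<^sup>2 / t = (l * t - G t)\<^sup>2 / t"
      using t ab by (simp add: field_simps power2_eq_square)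
    then show "0 \<le> l\<^sup>2 * t - (2 * l) * G t + (G t)\<^sup>2 / t" using t ab by simp
  qed
  moreover have lc: "l * c = g b - g a" using c by (simp add: l_def)
  ultimately have "l * (g b - g a) \<le> I" by (simp add: power2_eq_square mult.assoc)
  then have "c * (l * (g b - g a)) \<le> c * I" using c by (intro mult_left_mono) auto
  then have le: "(g b - g a)\<^sup>2 \<le> c * I"
    using lc by (simp add: power2_eq_square mult.assoc[symmetric] mult.commute)
  have "(\<integral>\<^sup>+t. ennreal (c * ((G t)\<^sup>2 / t)) * indicator {a..b} t \<partial>lborel) = ennreal (c * I)"
    using c ab by (intro nn_integral_has_integral_lebesgue' has_integral_mult_right I) auto
  moreover have "(b\<^sup>2 - a\<^sup>2) / 2 = c" by (simp add: c_def field_simps)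
  ultimately show ?thesis using le by (simp add: ennreal_leI)
qed simp

text \<open>The normalisation of the density is taken as an assumption.  For the entries of a random matrix it
  follows from the existence of a random variable with this law (\<open>prob_space_chi_of_distr\<close>).\<close>

locale chi_law = prob_space "chi_distribution k" for k :: real +
  assumes k_pos: "k > 0"
begin

text \<open>Bound the increment from \<open>sqrt k\<close> to \<open>x\<close> by Cauchy-Schwarz and exchange the integrals.  The inner
  integral of \<open>\<bar>x\<^sup>2 - k\<bar>\<close> over the part of the law beyond \<open>t\<close>, seen from \<open>sqrt k\<close>, is exactly \<open>t\<close> times the
  density, so nothing depending on \<open>k\<close> is left.\<close>

lemma poincare:
  fixes g G :: "real \<Rightarrow> real"
  assumes g: "\<And>t. (g has_real_derivative G t) (at t)" and G: "continuous_on UNIV G"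
  shows "(\<integral>\<^sup>+x. ennreal ((g x - g (sqrt k))\<^sup>2) \<partial>chi_distribution k) \<le> (\<integral>\<^sup>+x. ennreal ((G x)\<^sup>2 / 2) \<partial>chi_distribution k)"
proof -
  define r where "r = sqrt k"
  have r: "r > 0" "r\<^sup>2 = k" using k_pos by (auto simp: r_def)
  have [measurable]: "G \<in> borel_measurable borel" "g \<in> borel_measurable borel"
    using G g by (auto intro!: borel_measurable_continuous_onI continuous_at_imp_continuous_on DERIV_isCont)
  define H :: "real \<Rightarrow> real \<Rightarrow> ennreal" where
    "H x t = (if 0 < t \<and> (r \<le> t \<and> t \<le> x \<or> x \<le> t \<and> t < r) then ennreal (\<bar>x\<^sup>2 - k\<bar> / 2 * ((G t)\<^sup>2 / t)) else 0)" for x t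
  have [measurable]: "(\<lambda>(x, t). H x t) \<in> borel_measurable (borel \<Otimes>\<^sub>M borel)"
    unfolding H_def by measurable
  have incr: "ennreal ((g x - g r)\<^sup>2) \<le> (\<integral>\<^sup>+t. H x t \<partial>lborel)" if x: "x > 0" for x
  proof (cases "r \<le> x")
    case True
    have sq: "k \<le> x\<^sup>2" using True r power_mono[of r x 2] by auto
    have "ennreal ((g x - g r)\<^sup>2) \<le> (\<integral>\<^sup>+t. ennreal ((x\<^sup>2 - r\<^sup>2) / 2 * ((G t)\<^sup>2 / t)) * indicator {r..x} t \<partial>lborel)"
      using True r g by (intro cauchy_schwarz_increment) (auto intro: continuous_on_subset[OF G])
    also have "\<dots> \<le> (\<integral>\<^sup>+t. H x t \<partial>lborel)"
      using True r sq by (intro nn_integral_mono) (auto simp: H_def indicator_def)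
    finally show ?thesis .
  next
    case False
    have sq: "x\<^sup>2 \<le> k" using False r x power_mono[of x r 2] by auto
    have "ennreal ((g r - g x)\<^sup>2) \<le> (\<integral>\<^sup>+t. ennreal ((r\<^sup>2 - x\<^sup>2) / 2 * ((G t)\<^sup>2 / t)) * indicator {x..r} t \<partial>lborel)"
      using False r g x by (intro cauchy_schwarz_increment) (auto intro: continuous_on_subset[OF G])
    also have "\<dots> \<le> (\<integral>\<^sup>+t. H x t \<partial>lborel)"
    proof (intro nn_integral_mono_AE)
      show "AE t in lborel. ennreal ((r\<^sup>2 - x\<^sup>2) / 2 * ((G t)\<^sup>2 / t)) * indicator {x..r} t \<le> H x t"
        using AE_lborel_singleton[of r] by eventually_elim (use x r sq in \<open>auto simp: H_def indicator_def\<close>)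
    qed
    also have "(g r - g x)\<^sup>2 = (g x - g r)\<^sup>2" by (simp add: power2_commute)
    finally show ?thesis .
  qed
  have inner: "(\<integral>\<^sup>+x. ennreal (chi_density k x) * H x t \<partial>lborel) \<le> ennreal (chi_density k t) * ennreal ((G t)\<^sup>2 / 2)" if t: "t > 0" for t
  proof (cases "r \<le> t")
    case True
    have sq: "k \<le> t\<^sup>2" using True r power_mono[of r t 2] by auto
    have sq': "k \<le> x\<^sup>2" if "t \<le> x" for x
      by (rule order_trans[OF sq power_mono]) (use t that in auto)
    have "(\<integral>\<^sup>+x. ennreal (chi_density k x) * H x t \<partial>lborel) =
      (\<integral>\<^sup>+x. ennreal ((G t)\<^sup>2 / (2 * t)) * (ennreal ((x\<^sup>2 - k) * chi_density k x) * indicator {t..} x) \<partial>lborel)"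
      using True t sq' by (intro nn_integral_cong)
        (auto simp: H_def indicator_def ennreal_mult[symmetric] chi_density_nonneg k_pos intro!: arg_cong[where f = ennreal])
    also have "\<dots> = ennreal ((G t)\<^sup>2 / (2 * t)) * ennreal (t * chi_density k t)"
      by (subst nn_integral_cmult) (auto simp: chi_tail_integral(1)[OF k_pos t sq])
    also have "\<dots> = ennreal (chi_density k t) * ennreal ((G t)\<^sup>2 / 2)"
      using t by (auto simp: ennreal_mult[symmetric] chi_density_nonneg k_pos)
    finally show ?thesis by simp
  next
    case False
    have sq: "t\<^sup>2 \<le> k" using False r t power_mono[of t r 2] by auto
    have sq': "x\<^sup>2 \<le> k" if "0 \<le> x" "x \<le> t" for x
      by (rule order_trans[OF power_mono sq]) (use that in auto)
    have "(\<integral>\<^sup>+x. ennreal (chi_density k x) * H x t \<partial>lborel) \<le>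
      (\<integral>\<^sup>+x. ennreal ((G t)\<^sup>2 / (2 * t)) * (ennreal ((k - x\<^sup>2) * chi_density k x) * indicator {0..t} x) \<partial>lborel)"
    proof (intro nn_integral_mono)
      fix x
      show "ennreal (chi_density k x) * H x t \<le> ennreal ((G t)\<^sup>2 / (2 * t)) * (ennreal ((k - x\<^sup>2) * chi_density k x) * indicator {0..t} x)"
      proof (cases "0 < x \<and> x \<le> t")
        case True
        then show ?thesis using False t sq'[of x]
          by (auto simp: H_def indicator_def ennreal_mult[symmetric] chi_density_nonneg k_pos abs_if mult_ac)
      next
        case False
        then show ?thesis using \<open>\<not> r \<le> t\<close> t by (auto simp: H_def chi_density_def)
      qed
    qed
    also have "\<dots> = ennreal ((G t)\<^sup>2 / (2 * t)) * ennreal (t * chi_density k t)"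
      by (subst nn_integral_cmult) (auto simp: chi_tail_integral(2)[OF k_pos t sq])
    also have "\<dots> = ennreal (chi_density k t) * ennreal ((G t)\<^sup>2 / 2)"
      using t by (auto simp: ennreal_mult[symmetric] chi_density_nonneg k_pos)
    finally show ?thesis by simp
  qed
  have "(\<integral>\<^sup>+x. ennreal ((g x - g r)\<^sup>2) \<partial>chi_distribution k) \<le> (\<integral>\<^sup>+x. (\<integral>\<^sup>+t. H x t \<partial>lborel) \<partial>chi_distribution k)"
    by (intro nn_integral_mono_AE, use AE_chi_pos in eventually_elim) (rule incr)
  also have "\<dots> = (\<integral>\<^sup>+x. (\<integral>\<^sup>+t. ennreal (chi_density k x) * H x t \<partial>lborel) \<partial>lborel)"
    by (subst nn_integral_chi) (auto simp: nn_integral_cmult)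
  also have "\<dots> = (\<integral>\<^sup>+t. (\<integral>\<^sup>+x. ennreal (chi_density k x) * H x t \<partial>lborel) \<partial>lborel)"
    by (subst lborel_pair.Fubini') auto
  also have "\<dots> \<le> (\<integral>\<^sup>+t. ennreal (chi_density k t) * ennreal ((G t)\<^sup>2 / 2) \<partial>lborel)"
  proof (intro nn_integral_mono)
    fix t :: real
    show "(\<integral>\<^sup>+x. ennreal (chi_density k x) * H x t \<partial>lborel) \<le> ennreal (chi_density k t) * ennreal ((G t)\<^sup>2 / 2)"
      using inner[of t] by (cases "t > 0") (auto simp: H_def)
  qed
  also have "\<dots> = (\<integral>\<^sup>+x. ennreal ((G x)\<^sup>2 / 2) \<partial>chi_distribution k)"
    by (subst nn_integral_chi) auto
  finally show ?thesis by (simp add: r_def)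
qed

text \<open>The substitution \<open>x = sqrt 2 * y\<close> turns the exponential factor into the density itself.\<close>

lemma exp_moment: "(\<integral>\<^sup>+x. ennreal (exp (x\<^sup>2 / 4)) \<partial>chi_distribution k) = ennreal (sqrt 2 powr k)"
proof -
  have 1: "(\<integral>\<^sup>+x. ennreal (chi_density k x) \<partial>lborel) = 1"
    using emeasure_space_1 by (simp add: chi_distribution_def emeasure_density)
  have e: "chi_density k (sqrt 2 * y) * exp ((sqrt 2 * y)\<^sup>2 / 4) = sqrt 2 powr (k - 1) * chi_density k y" for y
  proof (cases "y > 0")
    case True
    then show ?thesis
      by (simp add: chi_density_eq powr_mult power_mult_distrib exp_add[symmetric] mult_ac)
  next
    case False
    then have "sqrt 2 * y \<le> 0" by (simp add: mult_nonneg_nonpos)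
    then show ?thesis using False by (simp add: chi_density_def)
  qed
  have "(\<integral>\<^sup>+x. ennreal (exp (x\<^sup>2 / 4)) \<partial>chi_distribution k) = (\<integral>\<^sup>+x. ennreal (chi_density k x * exp (x\<^sup>2 / 4)) \<partial>lborel)"
    by (subst nn_integral_chi) (auto simp: ennreal_mult chi_density_nonneg k_pos)
  also have "\<dots> = ennreal (sqrt 2) * (\<integral>\<^sup>+y. ennreal (chi_density k (0 + sqrt 2 * y) * exp ((0 + sqrt 2 * y)\<^sup>2 / 4)) \<partial>lborel)"
    by (subst nn_integral_real_affine[of _ "sqrt 2" 0]) auto
  also have "\<dots> = ennreal (sqrt 2) * (\<integral>\<^sup>+y. ennreal (sqrt 2 powr (k - 1)) * ennreal (chi_density k y) \<partial>lborel)"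
    by (simp add: e ennreal_mult chi_density_nonneg k_pos)
  also have "\<dots> = ennreal (sqrt 2 powr k)"
    by (subst nn_integral_cmult) (auto simp: 1 ennreal_mult[symmetric] powr_diff)
  finally show ?thesis .
qed

end

section \<open>Moments of chi laws\<close>

definition poly_bounded :: "(real \<Rightarrow> real) \<Rightarrow> bool" where
  "poly_bounded f \<longleftrightarrow> (\<exists>C q. \<forall>x. \<bar>f x\<bar> \<le> C * (1 + \<bar>x\<bar> ^ q))"

lemma poly_bounded_mono: "poly_bounded g \<Longrightarrow> (\<And>x. \<bar>f x\<bar> \<le> \<bar>g x\<bar>) \<Longrightarrow> poly_bounded f"
  unfolding poly_bounded_def by (meson order_trans)

lemma abs_power_le_even: "\<bar>x::real\<bar> ^ q \<le> 1 + x ^ (2 * q)"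
proof -
  have "(\<bar>x\<bar> ^ q)\<^sup>2 = (\<bar>x\<bar>\<^sup>2) ^ q" by (simp only: power_mult[symmetric] mult.commute)
  also have "\<dots> = x ^ (2 * q)" by (simp only: power2_abs power_mult)
  finally have sq: "(\<bar>x\<bar> ^ q)\<^sup>2 = x ^ (2 * q)" .
  have "0 \<le> (\<bar>x\<bar> ^ q - 1)\<^sup>2" by simp
  also have "\<dots> = x ^ (2 * q) - 2 * \<bar>x\<bar> ^ q + 1"
    by (simp only: power2_diff sq) simp
  finally have "2 * \<bar>x\<bar> ^ q \<le> 1 + x ^ (2 * q)" by simp
  moreover have "\<bar>x\<bar> ^ q \<ge> 0" by simp
  ultimately show ?thesis by linarith
qed

lemma poly_bounded_poly: "poly_bounded (poly p)"
proof -
  have "\<bar>poly p x\<bar> \<le> (\<Sum>i\<le>degree p. \<bar>coeff p i\<bar>) * (1 + \<bar>x\<bar> ^ degree p)" for x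
  proof -
    have "\<bar>poly p x\<bar> \<le> (\<Sum>i\<le>degree p. \<bar>coeff p i\<bar> * \<bar>x\<bar> ^ i)"
      unfolding poly_altdef by (rule order_trans[OF sum_abs]) (simp add: abs_mult power_abs)
    also have "\<dots> \<le> (\<Sum>i\<le>degree p. \<bar>coeff p i\<bar> * (1 + \<bar>x\<bar> ^ degree p))"
    proof (intro sum_mono mult_left_mono)
      fix i assume i: "i \<in> {..degree p}"
      show "\<bar>x\<bar> ^ i \<le> 1 + \<bar>x\<bar> ^ degree p"
      proof (cases "\<bar>x\<bar> \<le> 1")
        case True
        then have "\<bar>x\<bar> ^ i \<le> 1" by (simp add: power_le_one)
        then show ?thesis by (simp add: add_increasing2)
      next
        case False
        then have "\<bar>x\<bar> ^ i \<le> \<bar>x\<bar> ^ degree p" using i by (intro power_increasing) auto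
        then show ?thesis by simp
      qed
    qed auto
    finally show ?thesis by (simp add: sum_distrib_right)
  qed
  then show ?thesis unfolding poly_bounded_def by blast
qed

lemma (in chi_law) integrable_poly_bounded:
  assumes f: "poly_bounded f" and [measurable]: "f \<in> borel_measurable borel"
  shows "integrable (chi_distribution k) f"
proof -
  obtain C q where C: "\<And>x. \<bar>f x\<bar> \<le> C * (1 + \<bar>x\<bar> ^ q)" using f unfolding poly_bounded_def by blast
  have "C * (1 + \<bar>0\<bar> ^ q) \<ge> 0" using C[of 0] by linarith
  moreover have "1 + \<bar>0::real\<bar> ^ q > 0" by (intro add_pos_nonneg) auto
  ultimately have C0: "C \<ge> 0" by (simp add: zero_le_mult_iff)
  (* The constant comes from the term \<open>(x\<^sup>2 / 4)\<^sup>q / q!\<close> of the exponential series. *)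
  have bd: "\<bar>f x\<bar> \<le> C * (2 + 4 ^ q * fact q) * exp (x\<^sup>2 / 4)" for x
  proof -
    have "(x\<^sup>2 / 4) ^ q / fact q \<le> exp (x\<^sup>2 / 4)"
    proof -
      have "(x\<^sup>2 / 4) ^ q / fact q = (\<Sum>n\<in>{q}. (x\<^sup>2 / 4) ^ n /\<^sub>R fact n)" by (simp add: field_simps)
      also have "\<dots> \<le> (\<Sum>n. (x\<^sup>2 / 4) ^ n /\<^sub>R fact n)"
        using summable_exp_generic[of "x\<^sup>2 / 4"] by (intro sum_le_suminf) auto
      finally show ?thesis by (simp add: exp_def)
    qed
    then have "x ^ (2 * q) \<le> 4 ^ q * fact q * exp (x\<^sup>2 / 4)"
      unfolding power_mult by (simp add: power_divide field_simps del: power_mult[symmetric])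
    moreover have "\<bar>x\<bar> ^ q \<le> 1 + x ^ (2 * q)" by (rule abs_power_le_even)
    moreover have "1 \<le> exp (x\<^sup>2 / 4)" by simp
    ultimately have "1 + \<bar>x\<bar> ^ q \<le> 2 * exp (x\<^sup>2 / 4) + 4 ^ q * fact q * exp (x\<^sup>2 / 4)" by linarith
    then have "1 + \<bar>x\<bar> ^ q \<le> (2 + 4 ^ q * fact q) * exp (x\<^sup>2 / 4)" by (simp only: distrib_right)
    then have "C * (1 + \<bar>x\<bar> ^ q) \<le> C * ((2 + 4 ^ q * fact q) * exp (x\<^sup>2 / 4))" using C0 by (rule mult_left_mono)
    then show ?thesis using C[of x] by (simp add: mult_ac)
  qed
  have "integrable (chi_distribution k) (\<lambda>x. exp (x\<^sup>2 / 4))"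
    by (rule integrableI_nonneg) (auto simp: exp_moment)
  then have "integrable (chi_distribution k) (\<lambda>x. C * (2 + 4 ^ q * fact q) * exp (x\<^sup>2 / 4))" by simp
  then show ?thesis
    by (rule Bochner_Integration.integrable_bound) (auto intro!: AE_I2 order_trans[OF bd abs_ge_self])
qed

lemma poly_boundedI: "(\<And>x. f x = poly p x) \<Longrightarrow> poly_bounded f"
  using poly_bounded_poly[of p] unfolding poly_bounded_def by simp

lemma poly_bounded_mult: "poly_bounded f \<Longrightarrow> poly_bounded g \<Longrightarrow> poly_bounded (\<lambda>x. f x * g x)"
proof -
  assume "poly_bounded f" "poly_bounded g"
  then obtain C q D r where CD: "\<And>x. \<bar>f x\<bar> \<le> C * (1 + \<bar>x\<bar> ^ q)" "\<And>x. \<bar>g x\<bar> \<le> D * (1 + \<bar>x\<bar> ^ r)"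
    unfolding poly_bounded_def by metis
  have "poly_bounded (poly ([:C:] * (1 + monom 1 (2 * q) + 1) * ([:D:] * (1 + monom 1 (2 * r) + 1))))"
    by (rule poly_bounded_poly)
  moreover have C0: "C \<ge> 0" "D \<ge> 0"
  proof -
    have p: "1 + \<bar>0::real\<bar> ^ n > 0" for n by (intro add_pos_nonneg) auto
    have "C * (1 + \<bar>0\<bar> ^ q) \<ge> 0" "D * (1 + \<bar>0\<bar> ^ r) \<ge> 0" using CD[of 0] by linarith+
    then show "C \<ge> 0" "D \<ge> 0" using p[of q] p[of r] by (simp_all add: zero_le_mult_iff)
  qed
  moreover have "\<bar>f x * g x\<bar> \<le> (C * (1 + x ^ (2 * q) + 1)) * (D * (1 + x ^ (2 * r) + 1))" for x
  proof -
    have "\<bar>f x\<bar> \<le> C * (1 + x ^ (2 * q) + 1)"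
      using CD(1)[of x] abs_power_le_even[of x q] C0 by (smt (verit) mult_left_mono)
    moreover have "\<bar>g x\<bar> \<le> D * (1 + x ^ (2 * r) + 1)"
      using CD(2)[of x] abs_power_le_even[of x r] C0 by (smt (verit) mult_left_mono)
    ultimately show ?thesis unfolding abs_mult by (intro mult_mono) (auto intro: order_trans[OF abs_ge_zero])
  qed
  ultimately show ?thesis
    by (elim poly_bounded_mono) (auto simp: poly_monom mult_ac intro!: order_trans[OF _ abs_ge_self])
qed

context chi_law begin

lemma isCont_chi_density: "x > 0 \<Longrightarrow> isCont (chi_density k) x"
proof -
  assume x: "x > 0"
  have "isCont (\<lambda>t. t * chi_density k t / t) x"
    by (rule isCont_divide[OF DERIV_isCont[OF DERIV_chi[OF x]] continuous_ident]) (use x in simp)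
  moreover have "\<forall>\<^sub>F t in nhds x. t * chi_density k t / t = chi_density k t"
    using x by (auto simp: eventually_nhds intro!: exI[of _ "{0<..}"])
  ultimately show ?thesis by (simp cong: isCont_cong)
qed

lemma integral_chi:
  fixes f :: "real \<Rightarrow> real"
  assumes [measurable]: "f \<in> borel_measurable borel"
  shows "integrable (chi_distribution k) f \<longleftrightarrow> integrable lborel (\<lambda>x. chi_density k x * f x)"
    and "(\<integral>x. f x \<partial>chi_distribution k) = (\<integral>x. chi_density k x * f x \<partial>lborel)"
  unfolding chi_distribution_def
  by (auto simp: integrable_density integral_density chi_density_nonneg k_pos)

text \<open>Integrate the derivative of \<open>x * chi_density k x * \<phi> x\<close>; the boundary terms vanish.\<close>

lemma stein:
  fixes \<phi> \<phi>' :: "real \<Rightarrow> real"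
  assumes d: "\<And>t. (\<phi> has_real_derivative \<phi>' t) (at t)" and c: "continuous_on UNIV \<phi>'"
    and pb: "poly_bounded \<phi>" "poly_bounded \<phi>'"
  shows "(\<integral>x. (x\<^sup>2 - k) * \<phi> x \<partial>chi_distribution k) = (\<integral>x. x * \<phi>' x \<partial>chi_distribution k)"
proof -
  have [measurable]: "\<phi> \<in> borel_measurable borel" "\<phi>' \<in> borel_measurable borel"
    using c d by (auto intro!: borel_measurable_continuous_onI continuous_at_imp_continuous_on DERIV_isCont)
  have "poly_bounded (\<lambda>x. x\<^sup>2 - k)" by (rule poly_boundedI[of _ "[:-k, 0, 1:]"]) (simp add: power2_eq_square)
  then have i1: "integrable (chi_distribution k) (\<lambda>x. (x\<^sup>2 - k) * \<phi> x)"
    using pb by (intro integrable_poly_bounded poly_bounded_mult) auto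
  have "poly_bounded (\<lambda>x. x)" by (rule poly_boundedI[of _ "[:0, 1:]"]) simp
  then have i2: "integrable (chi_distribution k) (\<lambda>x. x * \<phi>' x)"
    using pb by (intro integrable_poly_bounded poly_bounded_mult) auto
  define f where "f x = (k - x\<^sup>2) * chi_density k x * \<phi> x + \<phi>' x * (x * chi_density k x)" for x
  define F where "F x = x * chi_density k x * \<phi> x" for x
  have feq: "f x = chi_density k x * (x * \<phi>' x) - chi_density k x * ((x\<^sup>2 - k) * \<phi> x)" for x
    by (simp add: f_def algebra_simps)
  have fint: "integrable lborel f"
    unfolding feq[abs_def] using i1 i2 by (intro Bochner_Integration.integrable_diff) (auto simp: integral_chi)
  have "(LBINT x=0..\<infinity>. f x) = 0 - 0"
  proof (rule interval_integral_FTC_integrable)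
    fix x :: real assume "0 < ereal x"
    then have x: "x > 0" by simp
    show "(F has_vector_derivative f x) (at x)"
      using DERIV_mult[OF DERIV_chi[OF x, of k] d[of x]]
      unfolding F_def f_def by (simp add: has_real_derivative_iff_has_vector_derivative)
    show "isCont f x" unfolding f_def
      using x c d by (intro continuous_intros isCont_chi_density DERIV_isCont[OF d])
        (auto simp: continuous_on_eq_continuous_at)
  next
    have e: "einterval 0 \<infinity> = {0<..}" by (auto simp: einterval_def)
    show "set_integrable lborel (einterval 0 \<infinity>) f"
      unfolding e set_integrable_def using fint by (intro integrable_mult_indicator) auto
    have "((\<lambda>x. x * chi_density k x * \<phi> x) \<longlongrightarrow> 0 * \<phi> 0) (at_right 0)"
      using DERIV_isCont[OF d[of 0]] k_pos
      by (intro tendsto_mult chi_decay_0) (auto simp: isCont_def intro: tendsto_mono[OF at_le])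
    then show "((F \<circ> real_of_ereal) \<longlongrightarrow> 0) (at_right 0)"
      unfolding F_def[abs_def] zero_ereal_def ereal_tendsto_simps by simp
    obtain C q where C: "\<And>x. \<bar>\<phi> x\<bar> \<le> C * (1 + \<bar>x\<bar> ^ q)" using pb unfolding poly_bounded_def by blast
    have "((\<lambda>t. C * ((1 + \<bar>t\<bar> ^ q) * (t * chi_density k t))) \<longlongrightarrow> C * 0) at_top"
      by (intro tendsto_mult_left chi_decay_top)
    then have "((\<lambda>t. C * ((1 + \<bar>t\<bar> ^ q) * (t * chi_density k t))) \<longlongrightarrow> 0) at_top" by simp
    then have "(F \<longlongrightarrow> 0) at_top"
    proof (rule Lim_null_comparison[rotated])
      show "\<forall>\<^sub>F t in at_top. norm (F t) \<le> C * ((1 + \<bar>t\<bar> ^ q) * (t * chi_density k t))"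
        using eventually_ge_at_top[of 0]
      proof eventually_elim
        case (elim t)
        have "0 \<le> t * chi_density k t" using elim k_pos by (simp add: chi_density_nonneg)
        then have "t * chi_density k t * \<bar>\<phi> t\<bar> \<le> t * chi_density k t * (C * (1 + \<bar>t\<bar> ^ q))"
          using C by (intro mult_left_mono)
        then show ?case using elim k_pos by (simp add: F_def abs_mult chi_density_nonneg mult_ac)
      qed
    qed
    then show "((F \<circ> real_of_ereal) \<longlongrightarrow> 0) (at_left \<infinity>)"
      by (simp add: ereal_tendsto_simps)
  qed auto
  moreover have "(LBINT x=0..\<infinity>. f x) = (\<integral>x. f x \<partial>lborel)"
  proof -
    have "(LBINT x=0..\<infinity>. f x) = (\<integral>x. indicator {0<..} x * f x \<partial>lborel)"
      by (simp add: interval_lebesgue_integral_def set_lebesgue_integral_def einterval_def greaterThan_def)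
    also have "\<dots> = (\<integral>x. f x \<partial>lborel)"
      by (intro Bochner_Integration.integral_cong) (auto simp: indicator_def f_def chi_density_def)
    finally show ?thesis .
  qed
  ultimately have "(\<integral>x. f x \<partial>lborel) = 0" by simp
  then show ?thesis
    unfolding feq[abs_def] using i1 i2
    by (subst (asm) Bochner_Integration.integral_diff) (auto simp: integral_chi)
qed

definition central_moment :: "nat \<Rightarrow> real" where
  "central_moment q = (\<integral>x. (x\<^sup>2 - k) ^ q \<partial>chi_distribution k)"

lemma poly_bounded_central: "poly_bounded (\<lambda>x. (x\<^sup>2 - k) ^ q)"
  by (rule poly_boundedI[of _ "[:-k, 0, 1:] ^ q"]) (simp add: power2_eq_square poly_power)

lemma integrable_central: "integrable (chi_distribution k) (\<lambda>x. (x\<^sup>2 - k) ^ q)"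
  by (intro integrable_poly_bounded poly_bounded_central) auto

lemma central_moment_0: "central_moment 0 = 1"
  using prob_space by (simp add: central_moment_def)

text \<open>Stein's identity for \<open>\<phi> = (x\<^sup>2 - k)\<^sup>q\<close>, together with \<open>x\<^sup>2 = (x\<^sup>2 - k) + k\<close>.\<close>

lemma central_moment_Suc:
  "central_moment (Suc q) = 2 * real q * (central_moment q + k * central_moment (q - 1))"
proof (cases q)
  case 0
  have "central_moment (Suc 0) = (\<integral>x. x * 0 \<partial>chi_distribution k)"
    using stein[of "\<lambda>_. 1" "\<lambda>_. 0"] poly_boundedI[of "\<lambda>_. 1" 1] poly_boundedI[of "\<lambda>_. 0" 0]
    by (simp add: central_moment_def)
  then show ?thesis using 0 by simp
next
  case (Suc r)
  have "central_moment (Suc q) = (\<integral>x. x * (real q * (x\<^sup>2 - k) ^ r * (2 * x)) \<partial>chi_distribution k)"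
    unfolding central_moment_def power_Suc
  proof (rule stein)
    show "((\<lambda>x. (x\<^sup>2 - k) ^ q) has_real_derivative real q * (t\<^sup>2 - k) ^ r * (2 * t)) (at t)" for t
    proof -
      have "((\<lambda>x. x\<^sup>2 - k) has_real_derivative 2 * t) (at t)" by (auto intro!: derivative_eq_intros)
      from DERIV_power_Suc[OF this, of r] show ?thesis using Suc by (simp add: mult_ac)
    qed
    show "poly_bounded (\<lambda>t. real q * (t\<^sup>2 - k) ^ r * (2 * t))"
      by (rule poly_boundedI[of _ "Polynomial.smult (real q) ([:-k, 0, 1:] ^ r * [:0, 2:])"])
         (simp add: power2_eq_square poly_power mult_ac)
  qed (auto intro!: continuous_intros poly_bounded_central)
  also have "\<dots> = (\<integral>x. 2 * real q * ((x\<^sup>2 - k) ^ q + k * (x\<^sup>2 - k) ^ r) \<partial>chi_distribution k)"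
    by (intro Bochner_Integration.integral_cong) (auto simp: Suc algebra_simps power2_eq_square)
  also have "\<dots> = 2 * real q * (central_moment q + k * central_moment r)"
    by (simp add: integrable_central central_moment_def)
  finally show ?thesis using Suc by simp
qed

lemma central_moment_1: "central_moment 1 = 0"
  using central_moment_Suc[of 0] by simp

lemma central_moment_2: "central_moment 2 = 2 * k"
  using central_moment_Suc[of 1] central_moment_1 by (simp add: central_moment_0 numeral_2_eq_2)

end

text \<open>By the recursion two steps gain one factor \<open>k\<close>: the variable \<open>x\<^sup>2 - k\<close> has size \<open>sqrt k\<close>.\<close>

lemma central_moment_bound:
  "\<exists>A. \<forall>k\<ge>1. chi_law k \<longrightarrow> \<bar>chi_law.central_moment k q\<bar> \<le> A * k ^ (q div 2)"
proof (induction q rule: less_induct)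
  case (less q)
  show ?case
  proof (cases q)
    case 0
    then show ?thesis by (intro exI[of _ 1]) (auto simp: chi_law.central_moment_0)
  next
    case (Suc r)
    obtain A where A: "\<And>k. k \<ge> 1 \<Longrightarrow> chi_law k \<Longrightarrow> \<bar>chi_law.central_moment k r\<bar> \<le> A * k ^ (r div 2)"
    proof -
      have "\<exists>A. \<forall>k\<ge>1. chi_law k \<longrightarrow> \<bar>chi_law.central_moment k (r)\<bar> \<le> A * k ^ ((r) div 2)"
        by (rule less.IH) (simp add: Suc)
      then show ?thesis using that by blast
    qed
    obtain B where B: "\<And>k. k \<ge> 1 \<Longrightarrow> chi_law k \<Longrightarrow> \<bar>chi_law.central_moment k (r - 1)\<bar> \<le> B * k ^ ((r - 1) div 2)"
    proof -
      have "\<exists>A. \<forall>k\<ge>1. chi_law k \<longrightarrow> \<bar>chi_law.central_moment k (r - 1)\<bar> \<le> A * k ^ ((r - 1) div 2)"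
        by (rule less.IH) (simp add: Suc)
      then show ?thesis using that by blast
    qed
    have "\<bar>chi_law.central_moment k q\<bar> \<le> (2 * real r * (\<bar>A\<bar> + \<bar>B\<bar>)) * k ^ (q div 2)" if k: "k \<ge> 1" "chi_law k" for k
    proof (cases "r = 0")
      case True
      then show ?thesis using chi_law.central_moment_Suc[OF k(2), of r] Suc by simp
    next
      case False
      let ?e = "chi_law.central_moment k"
      have "\<bar>?e r\<bar> \<le> \<bar>A\<bar> * k ^ (r div 2)" using A[OF k] k by (smt (verit) mult_right_mono zero_le_power)
      also have "\<dots> \<le> \<bar>A\<bar> * k ^ (q div 2)" using k Suc by (intro mult_left_mono power_increasing) auto
      finally have 1: "\<bar>?e r\<bar> \<le> \<bar>A\<bar> * k ^ (q div 2)" .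
      have "\<bar>k * ?e (r - 1)\<bar> \<le> k * (\<bar>B\<bar> * k ^ ((r - 1) div 2))"
        using B[OF k] k unfolding abs_mult by (intro mult_mono) (auto intro: order_trans mult_right_mono)
      also have "\<dots> = \<bar>B\<bar> * k ^ Suc ((r - 1) div 2)" by simp
      also have "Suc ((r - 1) div 2) = q div 2" using False Suc by (cases r) auto
      finally have 2: "\<bar>k * ?e (r - 1)\<bar> \<le> \<bar>B\<bar> * k ^ (q div 2)" .
      have "\<bar>?e q\<bar> = 2 * real r * \<bar>?e r + k * ?e (r - 1)\<bar>"
        using chi_law.central_moment_Suc[OF k(2), of r] Suc by (simp add: abs_mult)
      also have "\<dots> \<le> 2 * real r * (\<bar>A\<bar> * k ^ (q div 2) + \<bar>B\<bar> * k ^ (q div 2))"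
        using 1 2 by (intro mult_left_mono order_trans[OF abs_triangle_ineq] add_mono) auto
      finally show ?thesis by (simp add: algebra_simps)
    qed
    then show ?thesis by blast
  qed
qed

section \<open>Normal approximation of the square of a chi variable\<close>

context chi_law begin

definition zscore :: "real \<Rightarrow> real" where "zscore x = (x\<^sup>2 - k) / sqrt (2 * k)"

lemma measurable_zscore [measurable]: "zscore \<in> borel_measurable borel"
  unfolding zscore_def[abs_def] by measurable

lemma zscore_moments:
  shows integrable_zscore: "integrable (chi_distribution k) zscore"
    and integrable_zscore_sq: "integrable (chi_distribution k) (\<lambda>x. (zscore x)\<^sup>2)"
    and expectation_zscore: "(\<integral>x. zscore x \<partial>chi_distribution k) = 0"
    and expectation_zscore_sq: "(\<integral>x. (zscore x)\<^sup>2 \<partial>chi_distribution k) = 1"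
  using integrable_central[of 1] integrable_central[of 2] central_moment_1 central_moment_2 k_pos
  by (auto simp: zscore_def[abs_def] power_divide central_moment_def)

text \<open>The Stein identity of the standard normal law with an error of relative size \<open>sqrt (2 / k)\<close>.\<close>

lemma stein_zscore:
  assumes d: "\<And>t. (f has_real_derivative f' t) (at t)" and c: "continuous_on UNIV f'"
    and b: "\<And>x. \<bar>f x\<bar> \<le> 1" "\<And>x. \<bar>f' x\<bar> \<le> 1"
  shows "(\<integral>x. zscore x * f (t * zscore x) \<partial>chi_distribution k) =
     t * (\<integral>x. f' (t * zscore x) \<partial>chi_distribution k)
     + t * sqrt (2 / k) * (\<integral>x. zscore x * f' (t * zscore x) \<partial>chi_distribution k)"
proof -
  have [measurable]: "f \<in> borel_measurable borel" "f' \<in> borel_measurable borel"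
    using c d by (auto intro!: borel_measurable_continuous_onI continuous_at_imp_continuous_on DERIV_isCont)
  define \<sigma> where "\<sigma> = sqrt (2 * k)"
  have s: "\<sigma> > 0" "\<sigma> * \<sigma> = 2 * k" using k_pos by (auto simp: \<sigma>_def)
  have z: "zscore x = (x\<^sup>2 - k) / \<sigma>" for x by (simp add: zscore_def \<sigma>_def)
  have dz: "(zscore has_real_derivative 2 * x / \<sigma>) (at x)" for x
  proof -
    have "((\<lambda>x. x\<^sup>2 - k) has_real_derivative 2 * x) (at x)" by (auto intro!: derivative_eq_intros)
    then show ?thesis unfolding z[abs_def] by (rule DERIV_cdivide)
  qed
  have i1: "integrable (chi_distribution k) (\<lambda>x. f' (t * zscore x))"
    by (rule integrable_const_bound[of _ 1]) (auto simp: b)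
  have i2: "integrable (chi_distribution k) (\<lambda>x. zscore x * f' (t * zscore x))"
    by (rule Bochner_Integration.integrable_bound[OF integrable_zscore])
       (auto simp: abs_mult intro!: mult_left_le b)
  have "(\<integral>x. (x\<^sup>2 - k) * f (t * zscore x) \<partial>chi_distribution k) =
     (\<integral>x. x * (f' (t * zscore x) * (t * (2 * x / \<sigma>))) \<partial>chi_distribution k)"
  proof (rule stein)
    show "((\<lambda>x. f (t * zscore x)) has_real_derivative f' (t * zscore x) * (t * (2 * x / \<sigma>))) (at x)" for x
      by (rule DERIV_chain2[OF d DERIV_cmult[OF dz]])
    have "continuous_on UNIV zscore" using dz DERIV_isCont by (metis continuous_at_imp_continuous_on)
    then show "continuous_on UNIV (\<lambda>x. f' (t * zscore x) * (t * (2 * x / \<sigma>)))"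
      using s by (intro continuous_intros continuous_on_compose2[OF c]) auto
    have "poly_bounded (poly [:0, 2 * t / \<sigma>:])" by (rule poly_bounded_poly)
    then show "poly_bounded (\<lambda>x. f' (t * zscore x) * (t * (2 * x / \<sigma>)))"
    proof (rule poly_bounded_mono)
      fix x
      have "\<bar>f' (t * zscore x)\<bar> * \<bar>t * (2 * x / \<sigma>)\<bar> \<le> 1 * \<bar>t * (2 * x / \<sigma>)\<bar>"
        by (intro mult_right_mono b) auto
      then show "\<bar>f' (t * zscore x) * (t * (2 * x / \<sigma>))\<bar> \<le> \<bar>poly [:0, 2 * t / \<sigma>:] x\<bar>"
        by (simp add: abs_mult mult_ac)
    qed
    show "poly_bounded (\<lambda>x. f (t * zscore x))"
      using poly_bounded_poly[of 1] by (rule poly_bounded_mono) (simp add: b)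
  qed
  also have "\<dots> = (\<integral>x. t * \<sigma> * f' (t * zscore x) + 2 * t * (zscore x * f' (t * zscore x)) \<partial>chi_distribution k)"
  proof (intro Bochner_Integration.integral_cong refl)
    fix x
    have "x\<^sup>2 = \<sigma> * zscore x + \<sigma> * \<sigma> / 2" using s by (simp add: z field_simps)
    then have "2 * (x * x) / \<sigma> = 2 * zscore x + \<sigma>" using s by (simp add: field_simps power2_eq_square)
    moreover have "x * (f' (t * zscore x) * (t * (2 * x / \<sigma>))) = t * f' (t * zscore x) * (2 * (x * x) / \<sigma>)" by simp
    ultimately show "x * (f' (t * zscore x) * (t * (2 * x / \<sigma>))) = t * \<sigma> * f' (t * zscore x) + 2 * t * (zscore x * f' (t * zscore x))"
      by (simp only:) (simp add: algebra_simps)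
  qed
  also have "\<dots> = t * \<sigma> * (\<integral>x. f' (t * zscore x) \<partial>chi_distribution k) + 2 * t * (\<integral>x. zscore x * f' (t * zscore x) \<partial>chi_distribution k)"
    using i1 i2 by simp
  finally have "(\<integral>x. (x\<^sup>2 - k) * f (t * zscore x) \<partial>chi_distribution k) / \<sigma> =
     t * (\<integral>x. f' (t * zscore x) \<partial>chi_distribution k) + t * (2 / \<sigma>) * (\<integral>x. zscore x * f' (t * zscore x) \<partial>chi_distribution k)"
    using s by (simp add: field_simps)
  moreover have "(\<integral>x. (x\<^sup>2 - k) * f (t * zscore x) \<partial>chi_distribution k) / \<sigma> = (\<integral>x. zscore x * f (t * zscore x) \<partial>chi_distribution k)"
    by (subst integral_divide_zero[symmetric]) (simp add: z mult_ac)
  moreover have "2 / \<sigma> = sqrt (2 / k)"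
    using k_pos unfolding \<sigma>_def by (simp add: real_sqrt_mult real_sqrt_divide field_simps)
  ultimately show ?thesis by simp
qed

definition zchar :: "real \<Rightarrow> complex" where
  "zchar t = (\<integral>x. iexp (t * zscore x) \<partial>chi_distribution k)"

lemma integrable_iexp_z [simp]: "integrable (chi_distribution k) (\<lambda>x. iexp (t * zscore x))"
  by (rule integrable_const_bound[of _ 1]) auto

lemma integrable_z_iexp [simp]: "integrable (chi_distribution k) (\<lambda>x. complex_of_real (zscore x) * iexp (t * zscore x))"
  by (rule Bochner_Integration.integrable_bound[OF integrable_zscore]) (auto simp: norm_mult)

lemma zchar_deriv:
  "(zchar has_vector_derivative \<i> * (\<integral>x. complex_of_real (zscore x) * iexp (t * zscore x) \<partial>chi_distribution k)) (at t)"
proof -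
  let ?M = "chi_distribution k"
  define D where "D = \<i> * (\<integral>x. complex_of_real (zscore x) * iexp (t * zscore x) \<partial>?M)"
  have bound: "norm (zchar (t + h) - zchar t - h *\<^sub>R D) \<le> h\<^sup>2 / 2" for h
  proof -
    have "zchar (t + h) - zchar t - h *\<^sub>R D =
       (\<integral>x. iexp ((t + h) * zscore x) - iexp (t * zscore x) - h *\<^sub>R (\<i> * (complex_of_real (zscore x) * iexp (t * zscore x))) \<partial>?M)"
      unfolding zchar_def D_def by (simp del: of_real_mult)
    also have "norm \<dots> \<le> (\<integral>x. (h\<^sup>2 / 2) * (zscore x)\<^sup>2 \<partial>?M)"
    proof (rule Bochner_Integration.integral_norm_bound_integral)
      show "integrable ?M (\<lambda>x. (h\<^sup>2 / 2) * (zscore x)\<^sup>2)" using integrable_zscore_sq by simp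
      fix x
      let ?z = "zscore x"
      have "iexp ((t + h) * ?z) - iexp (t * ?z) - h *\<^sub>R (\<i> * (complex_of_real ?z * iexp (t * ?z)))
        = iexp (t * ?z) * (iexp (h * ?z) - (\<Sum>k\<le>1. (\<i> * (h * ?z)) ^ k / fact k))"
        by (simp add: algebra_simps exp_add[symmetric] scaleR_conv_of_real)
      also have "norm \<dots> \<le> \<bar>h * ?z\<bar> ^ Suc 1 / fact (Suc 1)"
        unfolding norm_mult using iexp_approx1[of "h * ?z" 1] by simp
      also have "\<dots> = (h\<^sup>2 / 2) * ?z\<^sup>2" by (simp add: power_mult_distrib numeral_2_eq_2[symmetric])
      finally show "norm (iexp ((t + h) * ?z) - iexp (t * ?z) - h *\<^sub>R (\<i> * (complex_of_real ?z * iexp (t * ?z)))) \<le> (h\<^sup>2 / 2) * ?z\<^sup>2" .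
    qed (auto simp del: of_real_mult)
    also have "\<dots> = h\<^sup>2 / 2" by (simp add: expectation_zscore_sq)
    finally show ?thesis .
  qed
  have "((\<lambda>h. norm (zchar (t + h) - zchar t - h *\<^sub>R D) / norm h) \<longlongrightarrow> 0) (at 0)"
  proof (rule Lim_null_comparison)
    show "((\<lambda>h::real. \<bar>h\<bar> / 2) \<longlongrightarrow> 0) (at 0)" by (auto intro!: tendsto_eq_intros)
    have "norm (norm (zchar (t + h) - zchar t - h *\<^sub>R D) / norm h) \<le> \<bar>h\<bar> / 2" for h
    proof (cases "h = 0")
      case False
      have "norm (zchar (t + h) - zchar t - h *\<^sub>R D) / \<bar>h\<bar> \<le> (h\<^sup>2 / 2) / \<bar>h\<bar>" by (intro divide_right_mono bound) auto
      also have "\<dots> = \<bar>h\<bar> / 2" using False by (simp add: field_simps power2_eq_square)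
      finally show ?thesis by simp
    qed simp
    then show "\<forall>\<^sub>F h in at 0. norm (norm (zchar (t + h) - zchar t - h *\<^sub>R D) / norm h) \<le> \<bar>h\<bar> / 2" by simp
  qed
  then show ?thesis
    unfolding has_vector_derivative_def has_derivative_at D_def[symmetric]
    by (auto intro: bounded_linear_scaleR_left)
qed

text \<open>Stein's identity for sine and cosine is the differential equation \<open>z' = - t z\<close> of the normal
  characteristic function, up to an error of order \<open>k\<^bsup>-1/2\<^esup>\<close>.\<close>

lemma zchar_ode:
  "norm (\<i> * (\<integral>x. complex_of_real (zscore x) * iexp (t * zscore x) \<partial>chi_distribution k) + t * zchar t) \<le> \<bar>t\<bar> * sqrt (2 / k)"
proof -
  let ?M = "chi_distribution k"
  have ib: "integrable ?M (\<lambda>x. f (t * zscore x))" if [measurable]: "f \<in> borel_measurable borel" and "\<And>x. \<bar>f x\<bar> \<le> 1" for f :: "real \<Rightarrow> real"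
    by (rule integrable_const_bound[of _ 1]) (auto simp: that(2))
  have iz: "integrable ?M (\<lambda>x. zscore x * f (t * zscore x))" if [measurable]: "f \<in> borel_measurable borel" and "\<And>x. \<bar>f x\<bar> \<le> 1" for f :: "real \<Rightarrow> real"
    by (rule Bochner_Integration.integrable_bound[OF integrable_zscore])
       (auto simp: abs_mult intro!: mult_left_le that(2))
  define Ec Es Zc Zs where "Ec = (\<integral>x. cos (t * zscore x) \<partial>?M)" and "Es = (\<integral>x. sin (t * zscore x) \<partial>?M)"
    and "Zc = (\<integral>x. zscore x * cos (t * zscore x) \<partial>?M)" and "Zs = (\<integral>x. zscore x * sin (t * zscore x) \<partial>?M)"
  have split1: "zchar t = Complex Ec Es"
  proof -
    have "zchar t = (\<integral>x. of_real (cos (t * zscore x)) + \<i> * of_real (sin (t * zscore x)) \<partial>?M)"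
      unfolding zchar_def by (simp add: exp_Euler cos_of_real sin_of_real del: of_real_mult)
    also have "\<dots> = of_real Ec + \<i> * of_real Es"
      unfolding Ec_def Es_def using ib[of cos] ib[of sin] by (simp del: of_real_mult)
    finally show ?thesis by (simp add: complex_eq_iff)
  qed
  have split2: "(\<integral>x. complex_of_real (zscore x) * iexp (t * zscore x) \<partial>?M) = Complex Zc Zs"
  proof -
    have "(\<integral>x. complex_of_real (zscore x) * iexp (t * zscore x) \<partial>?M) =
       (\<integral>x. of_real (zscore x * cos (t * zscore x)) + \<i> * of_real (zscore x * sin (t * zscore x)) \<partial>?M)"
      by (intro Bochner_Integration.integral_cong refl)
         (simp add: exp_Euler cos_of_real[symmetric] sin_of_real[symmetric] algebra_simps)
    also have "\<dots> = of_real Zc + \<i> * of_real Zs"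
      unfolding Zc_def Zs_def using iz[of cos] iz[of sin] by (simp del: of_real_mult)
    finally show ?thesis by (simp add: complex_eq_iff)
  qed
  have c: "Zc = - t * Es - t * sqrt (2 / k) * Zs"
    unfolding Zc_def Es_def Zs_def
    by (subst stein_zscore[where f' = "\<lambda>x. - sin x"]) (auto intro!: derivative_eq_intros continuous_intros)
  have s: "Zs = t * Ec + t * sqrt (2 / k) * Zc"
    unfolding Zc_def Ec_def Zs_def
    by (subst stein_zscore[where f' = cos]) (auto intro!: derivative_eq_intros continuous_intros)
  have "\<i> * Complex Zc Zs + t * Complex Ec Es = - of_real (t * sqrt (2 / k)) * Complex Zc Zs"
    using c s by (simp add: complex_eq_iff)
  also have "norm \<dots> = \<bar>t\<bar> * sqrt (2 / k) * norm (Complex Zc Zs)"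
    using k_pos by (simp add: norm_mult abs_mult)
  also have "\<dots> \<le> \<bar>t\<bar> * sqrt (2 / k) * 1"
  proof (intro mult_left_mono)
    have "norm (Complex Zc Zs) \<le> (\<integral>x. (1 + (zscore x)\<^sup>2) / 2 \<partial>?M)"
      unfolding split2[symmetric]
    proof (rule Bochner_Integration.integral_norm_bound_integral)
      show "integrable ?M (\<lambda>x. (1 + (zscore x)\<^sup>2) / 2)" using integrable_zscore_sq by simp
      fix x
      have "0 \<le> (1 - \<bar>zscore x\<bar>)\<^sup>2" by simp
      then have "\<bar>zscore x\<bar> \<le> (1 + (zscore x)\<^sup>2) / 2" by (simp add: power2_diff)
      then show "norm (complex_of_real (zscore x) * iexp (t * zscore x)) \<le> (1 + (zscore x)\<^sup>2) / 2"
        by (simp add: norm_mult)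
    qed (simp del: of_real_mult)
    also have "\<dots> = 1" using integrable_zscore_sq prob_space by (simp add: expectation_zscore_sq)
    finally show "norm (Complex Zc Zs) \<le> 1" .
  qed (use k_pos in simp)
  finally show ?thesis unfolding split1 split2 by simp
qed

text \<open>Variation of constants for the perturbed equation of \<open>zchar_ode\<close>: the function
  \<open>exp (t\<^sup>2 / 2) * zchar t\<close> has a small derivative.\<close>

lemma zchar_approx: "norm (zchar t - exp (- (t\<^sup>2) / 2)) \<le> sqrt (2 / k)"
proof -
  define h where "h t = exp (t\<^sup>2 / 2) *\<^sub>R zchar t" for t
  define D where "D t = \<i> * (\<integral>x. complex_of_real (zscore x) * iexp (t * zscore x) \<partial>chi_distribution k)" for t
  define h' where "h' t = exp (t\<^sup>2 / 2) *\<^sub>R D t + (t * exp (t\<^sup>2 / 2)) *\<^sub>R zchar t" for t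
  have de: "((\<lambda>t. exp (t\<^sup>2 / 2)) has_real_derivative t * exp (t\<^sup>2 / 2)) (at t)" for t :: real
    by (auto intro!: derivative_eq_intros)
  have dh: "(h has_vector_derivative h' t) (at t)" for t
    unfolding h_def[abs_def] h'_def D_def
    by (rule has_vector_derivative_scaleR[OF de zchar_deriv])
  have bh: "norm (h' t) \<le> sqrt (2 / k) * (\<bar>t\<bar> * exp (t\<^sup>2 / 2))" for t
  proof -
    have "h' t = exp (t\<^sup>2 / 2) *\<^sub>R (D t + t * zchar t)" by (simp add: h'_def scaleR_conv_of_real algebra_simps)
    then have "norm (h' t) = exp (t\<^sup>2 / 2) * norm (D t + t * zchar t)" by simp
    also have "\<dots> \<le> exp (t\<^sup>2 / 2) * (\<bar>t\<bar> * sqrt (2 / k))"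
      using zchar_ode[of t] unfolding D_def by (intro mult_left_mono) auto
    finally show ?thesis by (simp add: mult_ac)
  qed
  have h0: "h 0 = 1" using prob_space by (simp add: h_def zchar_def)
  have ch: "continuous_on S h" for S
    using dh by (intro continuous_at_imp_continuous_on ballI) (rule has_vector_derivative_continuous)
  have main: "norm (h t - 1) \<le> sqrt (2 / k) * (exp (t\<^sup>2 / 2) - 1)"
  proof (cases t "0 :: real" rule: linorder_cases)
    case equal then show ?thesis by (simp add: h0)
  next
    case greater
    have "norm (h t - h 0) \<le> sqrt (2 / k) * exp (t\<^sup>2 / 2) - sqrt (2 / k) * exp (0\<^sup>2 / 2)"
    proof (rule differentiable_bound_general[OF greater ch _ dh])
      show "((\<lambda>t. sqrt (2 / k) * exp (t\<^sup>2 / 2)) has_vector_derivative sqrt (2 / k) * (x * exp (x\<^sup>2 / 2))) (at x)" for x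
        using DERIV_cmult[OF de] by (simp add: has_real_derivative_iff_has_vector_derivative)
      show "norm (h' x) \<le> sqrt (2 / k) * (x * exp (x\<^sup>2 / 2))" if "0 < x" for x
        using bh[of x] that by simp
    qed (intro continuous_intros, auto)
    then show ?thesis by (simp add: h0 algebra_simps)
  next
    case less
    have "norm (h 0 - h t) \<le> - (sqrt (2 / k) * exp (0\<^sup>2 / 2)) - - (sqrt (2 / k) * exp (t\<^sup>2 / 2))"
    proof (rule differentiable_bound_general[OF less ch _ dh])
      show "((\<lambda>t. - (sqrt (2 / k) * exp (t\<^sup>2 / 2))) has_vector_derivative - (sqrt (2 / k) * (x * exp (x\<^sup>2 / 2)))) (at x)" for x
        using DERIV_minus[OF DERIV_cmult[OF de]] by (simp add: has_real_derivative_iff_has_vector_derivative)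
      show "norm (h' x) \<le> - (sqrt (2 / k) * (x * exp (x\<^sup>2 / 2)))" if "x < 0" for x
        using bh[of x] that by simp
    qed (intro continuous_intros, auto)
    then show ?thesis by (simp add: h0 algebra_simps norm_minus_commute)
  qed
  have "zchar t - exp (- (t\<^sup>2) / 2) = exp (- (t\<^sup>2) / 2) *\<^sub>R (h t - 1)"
    by (simp add: h_def scaleR_diff_right scaleR_scaleR exp_add[symmetric]) (simp add: scaleR_conv_of_real)
  then have "norm (zchar t - exp (- (t\<^sup>2) / 2)) = exp (- (t\<^sup>2) / 2) * norm (h t - 1)" by simp
  also have "\<dots> \<le> exp (- (t\<^sup>2) / 2) * (sqrt (2 / k) * (exp (t\<^sup>2 / 2) - 1))"
    by (intro mult_left_mono main) auto
  also have "\<dots> = sqrt (2 / k) * (1 - exp (- (t\<^sup>2) / 2))"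
    by (simp add: algebra_simps exp_add[symmetric])
  also have "\<dots> \<le> sqrt (2 / k)" using k_pos by (simp add: mult_left_le)
  finally show ?thesis .
qed

end

section \<open>The Efron-Stein inequality\<close>

text \<open>The variance as a nonnegative extended integral, so that it can be integrated over further
  variables without integrability side conditions.\<close>

definition nnvar :: "'b measure \<Rightarrow> ('b \<Rightarrow> real) \<Rightarrow> ennreal" where
  "nnvar P f = (\<integral>\<^sup>+x. ennreal ((f x - (\<integral>y. f y \<partial>P))\<^sup>2) \<partial>P)"

lemma (in prob_space) nn_integral_square_shift:
  assumes f: "integrable M f" and f2: "integrable M (\<lambda>x. (f x)\<^sup>2)"
  shows "(\<integral>\<^sup>+x. ennreal ((f x - c)\<^sup>2) \<partial>M) = nnvar M f + ennreal ((expectation f - c)\<^sup>2)"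
proof -
  let ?e = "expectation f"
  have i: "integrable M (\<lambda>x. (f x - d)\<^sup>2)" for d
    using f f2 by (simp add: power2_diff)
  have "expectation (\<lambda>x. (f x - c)\<^sup>2) = expectation (\<lambda>x. (f x)\<^sup>2) + c\<^sup>2 - 2 * ?e * c" for c
    using f f2 by (simp add: power2_diff prob_space)
  from this[of c] this[of ?e]
  have "expectation (\<lambda>x. (f x - c)\<^sup>2) = expectation (\<lambda>x. (f x - ?e)\<^sup>2) + (?e - c)\<^sup>2"
    by (simp only:) (simp add: power2_eq_square algebra_simps)
  then show ?thesis
    unfolding nnvar_def using i
    by (subst (1 2) nn_integral_eq_integral) (auto simp: ennreal_plus[symmetric] simp del: ennreal_plus)
qed

lemma (in prob_space) nnvar_le_shift:
  assumes "f \<in> borel_measurable M"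
  shows "nnvar M f \<le> (\<integral>\<^sup>+x. ennreal ((f x - c)\<^sup>2) \<partial>M)"
proof (cases "(\<integral>\<^sup>+x. ennreal ((f x - c)\<^sup>2) \<partial>M) = \<infinity>")
  case False
  then have i2: "integrable M (\<lambda>x. (f x - c)\<^sup>2)" using assms
    by (intro integrableI_nonneg) (auto simp: less_top)
  have i1: "integrable M (\<lambda>x. f x - c)"
    by (rule square_integrable_imp_integrable[OF _ i2]) (use assms in simp)
  have f: "integrable M f" using Bochner_Integration.integrable_add[OF i1, of "\<lambda>_. c"] by simp
  have "integrable M (\<lambda>x. (f x - c)\<^sup>2 + 2 * c * f x - c\<^sup>2)" using i2 f by simp
  then have "integrable M (\<lambda>x. (f x)\<^sup>2)" by (simp add: power2_diff algebra_simps)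
  then show ?thesis using nn_integral_square_shift[OF f] by simp
qed simp

lemma (in prob_space) square_expectation_le:
  assumes "integrable M f"
  shows "ennreal ((expectation f)\<^sup>2) \<le> (\<integral>\<^sup>+x. ennreal ((f x)\<^sup>2) \<partial>M)"
proof (cases "(\<integral>\<^sup>+x. ennreal ((f x)\<^sup>2) \<partial>M) = \<infinity>")
  case False
  then have "integrable M (\<lambda>x. (f x)\<^sup>2)" using assms
    by (intro integrableI_nonneg) (auto simp: less_top)
  from nn_integral_square_shift[OF assms this, of 0] show ?thesis by simp
qed simp

text \<open>Let \<open>m\<close> and \<open>m'\<close> be the means over the second and over the first variable.  Then
  \<open>F - E = (F - m) + (m - E)\<close> is orthogonal, and \<open>m - E\<close> is the mean over the second variable of
  \<open>F - m'\<close>, so that Jensen's inequality bounds it by the variance in the first variable.\<close>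

lemma efron_stein_pair:
  fixes F :: "'b \<Rightarrow> 'c \<Rightarrow> real"
  assumes "prob_space P" "prob_space Q"
    and meas: "case_prod F \<in> borel_measurable (P \<Otimes>\<^sub>M Q)"
    and F2: "integrable (P \<Otimes>\<^sub>M Q) (\<lambda>(x, y). (F x y)\<^sup>2)"
  shows "(\<integral>\<^sup>+x. \<integral>\<^sup>+y. ennreal ((F x y - (\<integral>z. case_prod F z \<partial>(P \<Otimes>\<^sub>M Q)))\<^sup>2) \<partial>Q \<partial>P)
    \<le> (\<integral>\<^sup>+x. nnvar Q (F x) \<partial>P) + (\<integral>\<^sup>+y. nnvar P (\<lambda>x. F x y) \<partial>Q)"
proof -
  interpret P: prob_space P by fact
  interpret Q: prob_space Q by fact
  interpret PQ: pair_prob_space P Q ..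
  note [measurable] = meas
  have F1: "integrable (P \<Otimes>\<^sub>M Q) (case_prod F)"
    by (rule PQ.P.square_integrable_imp_integrable[OF meas]) (use F2 in \<open>simp add: split_def\<close>)
  define E where "E = (\<integral>z. case_prod F z \<partial>(P \<Otimes>\<^sub>M Q))"
  define m where "m x = (\<integral>y. F x y \<partial>Q)" for x
  define m' where "m' y = (\<integral>x. F x y \<partial>P)" for y
  have Em: "E = (\<integral>x. m x \<partial>P)" and Em': "E = (\<integral>y. m' y \<partial>Q)"
    unfolding E_def m_def m'_def using PQ.integral_fst'[OF F1] PQ.integral_snd[OF F1] by simp_all
  have im': "integrable Q m'" unfolding m'_def using PQ.integrable_snd[OF F1] .
  have [measurable]: "m \<in> borel_measurable P" "m' \<in> borel_measurable Q"
    unfolding m_def m'_def by measurable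
  have ae1: "AE x in P. integrable Q (F x)" using PQ.AE_integrable_fst'[OF F1] by simp
  have ae2: "AE x in P. integrable Q (\<lambda>y. (F x y)\<^sup>2)" using PQ.AE_integrable_fst'[OF F2] by simp
  have "(\<integral>\<^sup>+x. \<integral>\<^sup>+y. ennreal ((F x y - E)\<^sup>2) \<partial>Q \<partial>P) = (\<integral>\<^sup>+x. (nnvar Q (F x) + ennreal ((m x - E)\<^sup>2)) \<partial>P)"
    using ae1 ae2
    by (intro nn_integral_cong_AE, eventually_elim) (simp add: Q.nn_integral_square_shift m_def)
  also have "\<dots> = (\<integral>\<^sup>+x. nnvar Q (F x) \<partial>P) + (\<integral>\<^sup>+x. ennreal ((m x - E)\<^sup>2) \<partial>P)"
    unfolding nnvar_def by (intro nn_integral_add) (simp_all add: m_def[symmetric], measurable)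
  also have "(\<integral>\<^sup>+x. ennreal ((m x - E)\<^sup>2) \<partial>P) \<le> (\<integral>\<^sup>+x. \<integral>\<^sup>+y. ennreal ((F x y - m' y)\<^sup>2) \<partial>Q \<partial>P)"
    using ae1
  proof (intro nn_integral_mono_AE, eventually_elim)
    case (elim x)
    have "m x - E = (\<integral>y. F x y - m' y \<partial>Q)" using elim im' by (simp add: m_def Em')
    then show ?case using Q.square_expectation_le[of "\<lambda>y. F x y - m' y"] elim im' by simp
  qed
  also have "\<dots> = (\<integral>\<^sup>+y. \<integral>\<^sup>+x. ennreal ((F x y - m' y)\<^sup>2) \<partial>P \<partial>Q)"
    by (rule PQ.Fubini'[symmetric]) measurable
  also have "\<dots> = (\<integral>\<^sup>+y. nnvar P (\<lambda>x. F x y) \<partial>Q)"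
    unfolding nnvar_def m'_def ..
  finally show ?thesis unfolding E_def by (auto intro: add_left_mono)
qed

lemma nnvar_distr:
  assumes "T \<in> measurable P N" "f \<in> borel_measurable N"
  shows "nnvar (distr P N T) f = nnvar P (\<lambda>x. f (T x))"
  unfolding nnvar_def using assms by (simp add: nn_integral_distr integral_distr)

lemma measurable_nnvar:
  assumes "prob_space Q" and [measurable]: "case_prod H \<in> borel_measurable (P \<Otimes>\<^sub>M Q)"
  shows "(\<lambda>x. nnvar Q (H x)) \<in> borel_measurable P"
proof -
  interpret prob_space Q by fact
  show ?thesis unfolding nnvar_def by measurable
qed

theorem efron_stein:
  fixes N :: "'i \<Rightarrow> real measure" and F :: "('i \<Rightarrow> real) \<Rightarrow> real"
  assumes "finite I" and N: "\<And>i. prob_space (N i)" "\<And>i. sets (N i) = sets borel"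
    and meas: "F \<in> borel_measurable (PiM I N)" and F2: "integrable (PiM I N) (\<lambda>x. (F x)\<^sup>2)"
  shows "nnvar (PiM I N) F \<le> (\<Sum>i\<in>I. \<integral>\<^sup>+x. nnvar (N i) (\<lambda>t. F (x(i := t))) \<partial>PiM I N)"
  using assms(1) meas F2
proof (induction I arbitrary: F rule: finite_induct)
  case empty
  have "nnvar (PiM {} N) F = 0"
    by (simp add: nnvar_def PiM_empty nn_integral_count_space_finite lebesgue_integral_count_space_finite)
  then show ?case by simp
next
  case (insert j I F)
  interpret product_prob_space N by (rule product_prob_spaceI) (rule N)
  interpret PI: prob_space "PiM I N" by (rule prob_space_PiM) (rule N)
  interpret Nj: prob_space "N j" by (rule N)
  interpret PQ: pair_prob_space "PiM I N" "N j" ..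
  note [measurable] = insert.prems(1)
  note fub = sigma_finite_measure.nn_integral_fst[OF prob_space_imp_sigma_finite[OF N(1)[of j]]]
  let ?G = "\<lambda>x t. F (x(j := t))"
  let ?S = "PiM I N \<Otimes>\<^sub>M N j"
  have T [measurable]: "(\<lambda>(x, t). x(j := t)) \<in> measurable ?S (PiM (insert j I) N)"
    by (rule measurable_add_dim)
  have D: "PiM (insert j I) N = distr ?S (PiM (insert j I) N) (\<lambda>(x, t). x(j := t))"
  proof (rule measure_eqI)
    fix A assume A: "A \<in> sets (PiM (insert j I) N)"
    have "emeasure (PiM (insert j I) N) A = (\<integral>\<^sup>+x. indicator A x \<partial>PiM (insert j I) N)"
      using A by simp
    also have "\<dots> = (\<integral>\<^sup>+x. (\<integral>\<^sup>+t. indicator A (x(j := t)) \<partial>N j) \<partial>PiM I N)"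
      using A insert.hyps by (intro product_nn_integral_insert) auto
    also have "\<dots> = (\<integral>\<^sup>+z. indicator A ((\<lambda>(x, t). x(j := t)) z) \<partial>?S)"
      using A by (subst fub[symmetric]) (auto simp: split_def)
    also have "\<dots> = (\<integral>\<^sup>+x. indicator A x \<partial>distr ?S (PiM (insert j I) N) (\<lambda>(x, t). x(j := t)))"
      using A by (intro nn_integral_distr[symmetric] T) auto
    also have "\<dots> = emeasure (distr ?S (PiM (insert j I) N) (\<lambda>(x, t). x(j := t))) A"
      using A by simp
    finally show "emeasure (PiM (insert j I) N) A = emeasure (distr ?S (PiM (insert j I) N) (\<lambda>(x, t). x(j := t))) A" .
  qed simp
  have Gm: "case_prod ?G \<in> borel_measurable ?S"
    using measurable_compose[OF T insert.prems(1)] by (simp add: split_def)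
  have G2: "integrable ?S (\<lambda>(x, t). (?G x t)\<^sup>2)"
  proof -
    have "integrable (distr ?S (PiM (insert j I) N) (\<lambda>(x, t). x(j := t))) (\<lambda>x. (F x)\<^sup>2)"
      using insert.prems(2) D by simp
    then show ?thesis by (subst (asm) integrable_distr_eq) (auto simp: split_def)
  qed
  have nv [measurable]: "(\<lambda>x. nnvar (N i) (\<lambda>u. F (x(i := u)))) \<in> borel_measurable (PiM (insert j I) N)"
    if "i \<in> insert j I" for i
  proof (rule measurable_nnvar[OF N(1)])
    have "(\<lambda>z. (fst z)(i := snd z)) \<in> measurable (PiM (insert j I) N \<Otimes>\<^sub>M N i) (PiM (insert j I) N)"
      using that by (intro measurable_fun_upd[where J = "insert j I"]) auto
    from measurable_compose[OF this insert.prems(1)]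
    show "(\<lambda>(x, u). F (x(i := u))) \<in> borel_measurable (PiM (insert j I) N \<Otimes>\<^sub>M N i)"
      by (simp add: split_def del: fun_upd_apply)
  qed
  have ae: "AE t in N j. integrable (PiM I N) (\<lambda>x. (?G x t)\<^sup>2)"
  proof -
    interpret QP: pair_prob_space "N j" "PiM I N" ..
    have "integrable (N j \<Otimes>\<^sub>M PiM I N) (\<lambda>(t, x). (?G x t)\<^sup>2)"
      using PQ.integrable_product_swap[OF G2] by (simp add: split_def)
    from QP.AE_integrable_fst'[OF this] show ?thesis by simp
  qed
  have "nnvar (PiM (insert j I) N) F = nnvar ?S (\<lambda>z. case_prod ?G z)"
    by (subst D, subst nnvar_distr) (auto simp: split_def)
  also have "\<dots> = (\<integral>\<^sup>+x. \<integral>\<^sup>+t. ennreal ((?G x t - (\<integral>z. case_prod ?G z \<partial>?S))\<^sup>2) \<partial>N j \<partial>PiM I N)"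
    unfolding nnvar_def using Gm by (subst fub[symmetric]) (auto simp: split_def)
  also have "\<dots> \<le> (\<integral>\<^sup>+x. nnvar (N j) (?G x) \<partial>PiM I N) + (\<integral>\<^sup>+t. nnvar (PiM I N) (\<lambda>x. ?G x t) \<partial>N j)"
    by (rule efron_stein_pair[OF prob_space_PiM[OF N(1)] N(1) Gm G2])
  also have "(\<integral>\<^sup>+t. nnvar (PiM I N) (\<lambda>x. ?G x t) \<partial>N j) \<le>
      (\<integral>\<^sup>+t. (\<Sum>i\<in>I. \<integral>\<^sup>+x. nnvar (N i) (\<lambda>u. ?G (x(i := u)) t) \<partial>PiM I N) \<partial>N j)"
    using ae AE_space[of "N j"]
  proof (intro nn_integral_mono_AE, eventually_elim)
    case (elim t)
    show ?case
    proof (rule insert.IH)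
      show "(\<lambda>x. ?G x t) \<in> borel_measurable (PiM I N)"
        using measurable_compose[OF measurable_Pair2'[of t "N j" "PiM I N"] Gm] elim by simp
    qed (use elim in \<open>simp del: fun_upd_apply\<close>)
  qed
  also have "\<dots> = (\<Sum>i\<in>I. \<integral>\<^sup>+t. \<integral>\<^sup>+x. nnvar (N i) (\<lambda>u. F ((x(j := t))(i := u))) \<partial>PiM I N \<partial>N j)"
  proof -
    have "nnvar (N i) (\<lambda>u. ?G (x(i := u)) t) = nnvar (N i) (\<lambda>u. F ((x(j := t))(i := u)))" if "i \<in> I" for i x t
    proof -
      have "(x(i := u))(j := t) = (x(j := t))(i := u)" for u
        using that insert.hyps by (intro fun_upd_twist) auto
      then show ?thesis by simp
    qed
    moreover have "(\<lambda>t. \<integral>\<^sup>+x. nnvar (N i) (\<lambda>u. F ((x(j := t))(i := u))) \<partial>PiM I N) \<in> borel_measurable (N j)" if "i \<in> I" for i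
    proof (rule sigma_finite_measure.borel_measurable_nn_integral)
      show "sigma_finite_measure (PiM I N)"
        by (rule prob_space_imp_sigma_finite[OF prob_space_PiM[OF N(1)]])
      have "(\<lambda>z. (snd z)(j := fst z)) \<in> measurable (N j \<Otimes>\<^sub>M PiM I N) (PiM (insert j I) N)"
        by (intro measurable_fun_upd[where J = I]) auto
      from measurable_compose[OF this nv[of i]] that
      show "(\<lambda>(t, x). nnvar (N i) (\<lambda>u. F ((x(j := t))(i := u)))) \<in> borel_measurable (N j \<Otimes>\<^sub>M PiM I N)"
        by (simp add: split_def del: fun_upd_apply)
    qed
    ultimately show ?thesis by (simp add: nn_integral_sum cong: sum.cong nn_integral_cong)
  qed
  also have "\<dots> = (\<Sum>i\<in>I. \<integral>\<^sup>+x. nnvar (N i) (\<lambda>u. F (x(i := u))) \<partial>PiM (insert j I) N)"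
    using insert.hyps nv by (intro sum.cong refl) (simp add: product_nn_integral_insert_rev)
  also have "(\<integral>\<^sup>+x. nnvar (N j) (?G x) \<partial>PiM I N) = (\<integral>\<^sup>+x. nnvar (N j) (?G x) \<partial>PiM (insert j I) N)"
    using insert.hyps nv[of j] by (simp add: product_nn_integral_insert prob_space.emeasure_space_1[OF N(1)])
  finally show ?case using insert.hyps by (simp only: sum.insert not_False_eq_True add_left_mono simp_thms)
qed

section \<open>The Poincare inequality for independent chi variables\<close>

lemma prob_space_chi_of_distr:
  assumes "prob_space M" "X \<in> borel_measurable M" "distr M borel X = distr (chi_distribution k) borel f"
    "f \<in> borel_measurable borel"
  shows "prob_space (chi_distribution k)"
proof
  interpret prob_space M by fact
  have "prob_space (distr M borel X)" by (rule prob_space_distr) (rule assms)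
  then interpret D: prob_space "distr (chi_distribution k) borel f" using assms(3) by simp
  have "emeasure (distr (chi_distribution k) borel f) UNIV = emeasure (chi_distribution k) UNIV"
    using assms(4) by (subst emeasure_distr) auto
  then show "emeasure (chi_distribution k) (space (chi_distribution k)) = 1"
    using D.emeasure_space_1 by simp
qed

lemma (in chi_law) nnvar_scaled:
  assumes g: "\<And>t. (g has_real_derivative G t) (at t)" and G: "continuous_on UNIV G"
  shows "nnvar (distr (chi_distribution k) borel (\<lambda>x. \<theta> * x)) g \<le>
    (\<integral>\<^sup>+x. ennreal (\<theta>\<^sup>2 / 2 * (G x)\<^sup>2) \<partial>distr (chi_distribution k) borel (\<lambda>x. \<theta> * x))"
proof -
  have [measurable]: "G \<in> borel_measurable borel" "g \<in> borel_measurable borel"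
    using G g by (auto intro!: borel_measurable_continuous_onI continuous_at_imp_continuous_on DERIV_isCont)
  have "nnvar (distr (chi_distribution k) borel (\<lambda>x. \<theta> * x)) g = nnvar (chi_distribution k) (\<lambda>x. g (\<theta> * x))"
    by (subst nnvar_distr) auto
  also have "\<dots> \<le> (\<integral>\<^sup>+x. ennreal ((g (\<theta> * x) - g (\<theta> * sqrt k))\<^sup>2) \<partial>chi_distribution k)"
    by (rule nnvar_le_shift) simp
  also have "\<dots> \<le> (\<integral>\<^sup>+x. ennreal ((G (\<theta> * x) * \<theta>)\<^sup>2 / 2) \<partial>chi_distribution k)"
  proof (rule poincare)
    show "((\<lambda>x. g (\<theta> * x)) has_real_derivative G (\<theta> * t) * \<theta>) (at t)" for t
      by (rule DERIV_chain2[OF g]) (auto intro!: derivative_eq_intros)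
    show "continuous_on UNIV (\<lambda>t. G (\<theta> * t) * \<theta>)"
      by (intro continuous_intros continuous_on_compose2[OF G]) auto
  qed
  also have "\<dots> = (\<integral>\<^sup>+x. ennreal (\<theta>\<^sup>2 / 2 * (G x)\<^sup>2) \<partial>distr (chi_distribution k) borel (\<lambda>x. \<theta> * x))"
    by (subst nn_integral_distr) (auto simp: power_mult_distrib mult_ac)
  finally show ?thesis .
qed

lemma nn_integral_PiM_resample:
  fixes N :: "'i \<Rightarrow> real measure"
  assumes I: "finite I" "i \<in> I" and N: "\<And>i. prob_space (N i)"
    and h: "h \<in> borel_measurable (PiM I N)"
  shows "(\<integral>\<^sup>+x. \<integral>\<^sup>+t. h (x(i := t)) \<partial>N i \<partial>PiM I N) = (\<integral>\<^sup>+x. h x \<partial>PiM I N)"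
proof -
  interpret product_prob_space N by (rule product_prob_spaceI) (rule N)
  define J where "J = I - {i}"
  have J: "finite J" "i \<notin> J" "I = insert i J" using I by (auto simp: J_def)
  have "(\<lambda>z. (fst z)(i := snd z)) \<in> measurable (PiM I N \<Otimes>\<^sub>M N i) (PiM I N)"
    using I by (intro measurable_fun_upd[where J = I]) auto
  from measurable_compose[OF this h]
  have "(\<lambda>(x, t). h (x(i := t))) \<in> borel_measurable (PiM I N \<Otimes>\<^sub>M N i)"
    by (simp add: split_def del: fun_upd_apply)
  then have m: "(\<lambda>x. \<integral>\<^sup>+t. h (x(i := t)) \<partial>N i) \<in> borel_measurable (PiM I N)"
    by measurable
  have "(\<integral>\<^sup>+x. \<integral>\<^sup>+t. h (x(i := t)) \<partial>N i \<partial>PiM I N) = (\<integral>\<^sup>+x. \<integral>\<^sup>+y. \<integral>\<^sup>+t. h ((x(i := y))(i := t)) \<partial>N i \<partial>N i \<partial>PiM J N)"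
    by (subst J(3), rule product_nn_integral_insert[OF J(1,2)]) (use m J(3) in simp)
  also have "\<dots> = (\<integral>\<^sup>+x. \<integral>\<^sup>+t. h (x(i := t)) \<partial>N i \<partial>PiM J N)"
    by (simp add: prob_space.emeasure_space_1[OF N])
  also have "\<dots> = (\<integral>\<^sup>+x. h x \<partial>PiM I N)"
    by (subst J(3), rule product_nn_integral_insert[symmetric, OF J(1,2)]) (use h J(3) in simp)
  finally show ?thesis .
qed

text \<open>Functions of finitely many entries are represented as functions of whole sequences; \<open>pad\<close> extends a
  point of the product space by zeros.\<close>

lemma (in prob_space) indep_chi_poincare:
  fixes X :: "nat \<Rightarrow> 'a \<Rightarrow> real" and F :: "(nat \<Rightarrow> real) \<Rightarrow> real" and \<Gamma> :: "(nat \<Rightarrow> real) \<Rightarrow> nat \<Rightarrow> real"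
  defines "pad \<equiv> \<lambda>I x i. if i \<in> I then x i else (0 :: real)"
  assumes I: "finite I" "I \<noteq> {}"
    and indep: "indep_vars (\<lambda>_. borel) X I"
    and law: "\<And>i. i \<in> I \<Longrightarrow> distr M borel (X i) = distr (chi_distribution (\<kappa> i)) borel (\<lambda>x. \<theta> * x)"
    and pos: "\<And>i. i \<in> I \<Longrightarrow> \<kappa> i > 0"
    and meas: "(\<lambda>x. F (pad I x)) \<in> borel_measurable (PiM I (\<lambda>_. borel))"
      "\<And>i. i \<in> I \<Longrightarrow> (\<lambda>x. \<Gamma> (pad I x) i) \<in> borel_measurable (PiM I (\<lambda>_. borel))"
    and deriv: "\<And>x i t. i \<in> I \<Longrightarrow> ((\<lambda>t. F ((pad I x)(i := t))) has_real_derivative \<Gamma> ((pad I x)(i := t)) i) (at t)"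
    and cont: "\<And>x i. i \<in> I \<Longrightarrow> continuous_on UNIV (\<lambda>t. \<Gamma> ((pad I x)(i := t)) i)"
    and L2: "integrable M (\<lambda>\<omega>. (F (pad I (\<lambda>i. X i \<omega>)))\<^sup>2)"
  shows "nnvar M (\<lambda>\<omega>. F (pad I (\<lambda>i. X i \<omega>))) \<le>
    (\<Sum>i\<in>I. \<integral>\<^sup>+\<omega>. ennreal (\<theta>\<^sup>2 / 2 * (\<Gamma> (pad I (\<lambda>i. X i \<omega>)) i)\<^sup>2) \<partial>M)"
proof -
  have X: "\<And>i. i \<in> I \<Longrightarrow> random_variable borel (X i)" using indep by (auto simp: indep_vars_def)
  define N where "N i = (if i \<in> I then distr M borel (X i) else return borel 0)" for i
  have N: "prob_space (N i)" "sets (N i) = sets borel" for i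
    by (auto simp: N_def X intro!: prob_space_distr prob_space_return)
  have PiM_sets: "sets (PiM I N) = sets (PiM I (\<lambda>_. borel))" by (rule sets_PiM_cong) (auto simp: N(2))
  define T where "T \<omega> = (\<lambda>i\<in>I. X i \<omega>)" for \<omega>
  have Tm: "T \<in> measurable M (PiM I N)"
    unfolding T_def measurable_cong_sets[OF refl PiM_sets] by (intro measurable_restrict X)
  have D: "distr M (PiM I N) T = PiM I N"
  proof -
    have "distr M (PiM I (\<lambda>_. borel)) T = PiM I (\<lambda>i. distr M borel (X i))"
      using indep_vars_iff_distr_eq_PiM'[OF I(2) X] indep unfolding T_def by simp
    also have "\<dots> = PiM I N" by (rule PiM_cong) (auto simp: N_def)
    also have "distr M (PiM I (\<lambda>_. borel)) T = distr M (PiM I N) T"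
      by (rule distr_cong) (auto simp: PiM_sets)
    finally show ?thesis .
  qed
  define H where "H x = F (pad I x)" for x
  have Hm: "H \<in> borel_measurable (PiM I N)" unfolding H_def using meas(1) by (simp cong: measurable_cong_sets add: PiM_sets)
  have padT: "pad I (T \<omega>) = pad I (\<lambda>i. X i \<omega>)" for \<omega> by (auto simp: pad_def T_def)
  have pad_upd: "pad I (x(i := t)) = (pad I x)(i := t)" if "i \<in> I" for x i t using that by (auto simp: pad_def)
  have H2: "(\<lambda>x. (H x)\<^sup>2) \<in> borel_measurable (PiM I N)" using Hm by (rule borel_measurable_power)
  have "integrable M (\<lambda>\<omega>. (H (T \<omega>))\<^sup>2)" using L2 by (simp add: H_def padT)
  then have "integrable (distr M (PiM I N) T) (\<lambda>x. (H x)\<^sup>2)"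
    by (subst integrable_distr_eq[OF Tm H2])
  then have L2': "integrable (PiM I N) (\<lambda>x. (H x)\<^sup>2)" by (simp only: D)
  have Gm: "(\<lambda>x. ennreal (\<theta>\<^sup>2 / 2 * (\<Gamma> (pad I x) i)\<^sup>2)) \<in> borel_measurable (PiM I N)" if "i \<in> I" for i
  proof -
    have [measurable]: "(\<lambda>x. \<Gamma> (pad I x) i) \<in> borel_measurable (PiM I N)"
      using meas(2)[OF that] by (simp cong: measurable_cong_sets add: PiM_sets)
    show ?thesis by measurable
  qed
  have "nnvar M (\<lambda>\<omega>. F (pad I (\<lambda>i. X i \<omega>))) = nnvar (distr M (PiM I N) T) H"
    using nnvar_distr[OF Tm Hm] by (simp add: H_def padT)
  also have "\<dots> = nnvar (PiM I N) H" by (simp only: D)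
  also have "\<dots> \<le> (\<Sum>i\<in>I. \<integral>\<^sup>+x. nnvar (N i) (\<lambda>t. H (x(i := t))) \<partial>PiM I N)"
    by (rule efron_stein[OF I(1) N Hm L2'])
  also have "\<dots> \<le> (\<Sum>i\<in>I. \<integral>\<^sup>+x. \<integral>\<^sup>+t. ennreal (\<theta>\<^sup>2 / 2 * (\<Gamma> (pad I (x(i := t))) i)\<^sup>2) \<partial>N i \<partial>PiM I N)"
  proof (intro sum_mono nn_integral_mono)
    fix i x assume i: "i \<in> I"
    have "prob_space (chi_distribution (\<kappa> i))"
      by (rule prob_space_chi_of_distr[OF prob_space_axioms X law]) (use i in auto)
    then interpret c: chi_law "\<kappa> i" using pos[OF i] by (simp add: chi_law_def chi_law_axioms_def)
    show "nnvar (N i) (\<lambda>t. H (x(i := t))) \<le> (\<integral>\<^sup>+t. ennreal (\<theta>\<^sup>2 / 2 * (\<Gamma> (pad I (x(i := t))) i)\<^sup>2) \<partial>N i)"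
    proof -
      have Ni: "N i = distr (chi_distribution (\<kappa> i)) borel (\<lambda>x. \<theta> * x)" using i law by (simp add: N_def)
      show ?thesis
        unfolding Ni H_def pad_upd[OF i] by (rule c.nnvar_scaled[OF deriv[OF i] cont[OF i]])
    qed
  qed
  also have "\<dots> = (\<Sum>i\<in>I. \<integral>\<^sup>+x. ennreal (\<theta>\<^sup>2 / 2 * (\<Gamma> (pad I x) i)\<^sup>2) \<partial>PiM I N)"
    using I N Gm by (intro sum.cong refl nn_integral_PiM_resample) auto
  also have "\<dots> = (\<Sum>i\<in>I. \<integral>\<^sup>+x. ennreal (\<theta>\<^sup>2 / 2 * (\<Gamma> (pad I x) i)\<^sup>2) \<partial>distr M (PiM I N) T)"
    by (simp only: D)
  also have "\<dots> = (\<Sum>i\<in>I. \<integral>\<^sup>+\<omega>. ennreal (\<theta>\<^sup>2 / 2 * (\<Gamma> (pad I (\<lambda>i. X i \<omega>)) i)\<^sup>2) \<partial>M)"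
    using Gm by (intro sum.cong refl, subst nn_integral_distr[OF Tm]) (auto simp: padT)
  finally show ?thesis .
qed

section \<open>Integrals against the spectral measure\<close>

definition finsupp :: "(nat \<Rightarrow> real) \<Rightarrow> bool" where
  "finsupp s \<longleftrightarrow> (\<exists>K. \<forall>k\<ge>K. s k = 0)"

lemma finsupp_upd: "finsupp s \<Longrightarrow> finsupp (s(k := t))"
proof -
  assume "finsupp s"
  then obtain K where "\<And>k. k \<ge> K \<Longrightarrow> s k = 0" unfolding finsupp_def by blast
  then show ?thesis unfolding finsupp_def by (intro exI[of _ "max K (Suc k)"]) auto
qed

text \<open>A chosen quadrature represents the spectral measure of \<open>T\<close> at \<open>e\<^sub>0\<close>, and \<open>jint\<close> is the integral
  against it.  A nodal weight may vanish, therefore statements about the location of the nodes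
  (\<open>jquad_support\<close>) concern the nodes of nonzero weight.\<close>

definition is_quadrature :: "(nat \<Rightarrow> real) \<Rightarrow> real set \<times> (real \<Rightarrow> real) \<Rightarrow> bool" where
  "is_quadrature s q \<longleftrightarrow> finite (fst q) \<and> (\<forall>x\<in>fst q. snd q x \<ge> 0) \<and>
     (\<forall>p. jmom s p = (\<Sum>x\<in>fst q. snd q x * poly p x))"

definition jquad :: "(nat \<Rightarrow> real) \<Rightarrow> real set \<times> (real \<Rightarrow> real)" where
  "jquad s = (SOME q. is_quadrature s q)"

definition jint :: "(nat \<Rightarrow> real) \<Rightarrow> (real \<Rightarrow> real) \<Rightarrow> real" where
  "jint s h = (\<Sum>x\<in>fst (jquad s). snd (jquad s) x * h x)"

lemma is_quadrature_jquad: "finsupp s \<Longrightarrow> is_quadrature s (jquad s)"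
  unfolding jquad_def
proof (rule someI_ex)
  assume "finsupp s"
  then obtain K where "\<And>k. k \<ge> K \<Longrightarrow> s k = 0" unfolding finsupp_def by blast
  from quadrature[of K s, OF this] show "\<exists>q. is_quadrature s q"
    unfolding is_quadrature_def by (metis fst_conv snd_conv)
qed

lemma jquad_props:
  assumes "finsupp s"
  shows finite_jquad: "finite (fst (jquad s))"
    and jquad_nonneg: "x \<in> fst (jquad s) \<Longrightarrow> snd (jquad s) x \<ge> 0"
    and jint_poly: "jint s (poly p) = jmom s p"
  using is_quadrature_jquad[OF assms] by (auto simp: is_quadrature_def jint_def)

lemma jmom_monom: "jmom s (monom c N) = c * jwalk s N 0"
proof -
  have "degree (monom c N) \<le> N" by (rule degree_monom_le)
  then show ?thesis
    by (simp add: jmom_eq_jpoly jpoly_altdef[of _ N] if_distrib[of "\<lambda>x. x * _"] sum.delta cong: if_cong)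
qed

lemma jint_power: "finsupp s \<Longrightarrow> jint s (\<lambda>x. x ^ N) = jwalk s N 0"
proof -
  assume "finsupp s"
  moreover have "poly (monom 1 N) = (\<lambda>x. x ^ N :: real)" by (simp add: poly_monom fun_eq_iff)
  ultimately show ?thesis using jint_poly[of s "monom 1 N"] by (simp add: jmom_monom)
qed

lemma jint_const: "finsupp s \<Longrightarrow> jint s (\<lambda>x. c) = c"
  using jint_power[of s 0] by (simp add: jint_def sum_distrib_right[symmetric])

lemma jint_add: "jint s (\<lambda>x. f x + g x) = jint s f + jint s g"
  by (simp add: jint_def algebra_simps sum.distrib)

lemma jint_diff: "jint s (\<lambda>x. f x - g x) = jint s f - jint s g"
  by (simp add: jint_def algebra_simps sum_subtractf)

lemma jint_cmult: "jint s (\<lambda>x. c * f x) = c * jint s f"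
  by (simp add: jint_def sum_distrib_left mult_ac)

lemma jwalk_abs_le:
  assumes "\<And>k. \<bar>s k\<bar> \<le> A"
  shows "\<bar>jwalk s N i\<bar> \<le> (2 * A) ^ N"
proof (induction N arbitrary: i)
  case (Suc N)
  have A: "A \<ge> 0" using assms[of 0] by linarith
  define E where "E = A * (2 * A) ^ N"
  have E: "\<bar>s j * jwalk s N l\<bar> \<le> E" for j l
    unfolding abs_mult E_def using Suc assms A by (intro mult_mono) auto
  have "E \<ge> 0" "(2 * A) ^ Suc N = 2 * E" using A by (simp_all add: E_def)
  then show ?case
    using E[of i "Suc i"] E[of "i - 1" "i - 1"] by (auto simp: jshift_def)
qed simp

text \<open>A node \<open>x\<close> of weight \<open>c\<close> forces moments of size \<open>c x\<^bsup>2 N\<^esup>\<close>, which \<open>jwalk_abs_le\<close> limits to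
  \<open>(2 A)\<^bsup>2 N\<^esup>\<close>.\<close>

lemma jquad_support:
  assumes s: "finsupp s" and A: "\<And>k. \<bar>s k\<bar> \<le> A" and x: "x \<in> fst (jquad s)" "snd (jquad s) x \<noteq> 0"
  shows "\<bar>x\<bar> \<le> 2 * A"
proof (rule ccontr)
  assume *: "\<not> \<bar>x\<bar> \<le> 2 * A"
  have A0: "A \<ge> 0" using A[of 0] by linarith
  define c where "c = snd (jquad s) x"
  have c: "c > 0" using jquad_nonneg[OF s x(1)] x(2) by (simp add: c_def)
  have x0: "\<bar>x\<bar> > 0" using * A0 by linarith
  have le: "c \<le> ((2 * A / \<bar>x\<bar>)\<^sup>2) ^ N" for N
  proof -
    have "c * x ^ (2 * N) \<le> jint s (\<lambda>x. x ^ (2 * N))"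
      unfolding c_def jint_def using finite_jquad[OF s] x jquad_nonneg[OF s]
      by (intro member_le_sum[where f = "\<lambda>x. snd (jquad s) x * x ^ (2 * N)"]) auto
    also have "\<dots> \<le> (2 * A) ^ (2 * N)"
      using jwalk_abs_le[of s A "2 * N" 0] A by (simp add: jint_power[OF s])
    finally have "c * \<bar>x\<bar> ^ (2 * N) \<le> (2 * A) ^ (2 * N)" by (simp add: power_even_abs)
    then have "c \<le> (2 * A) ^ (2 * N) / \<bar>x\<bar> ^ (2 * N)" using x0 by (simp add: field_simps)
    then show ?thesis by (simp only: power_divide power_mult)
  qed
  have "(2 * A / \<bar>x\<bar>)\<^sup>2 < 1"
    using power_strict_mono[of "2 * A / \<bar>x\<bar>" 1 2] * A0 x0 by simp
  then have "(\<lambda>N. ((2 * A / \<bar>x\<bar>)\<^sup>2) ^ N) \<longlonglongrightarrow> 0" by (intro LIMSEQ_realpow_zero) auto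
  then have "c \<le> 0" using le by (intro LIMSEQ_le_const) auto
  then show False using c by simp
qed

lemma jint_mono:
  assumes s: "finsupp s" and A: "\<And>k. \<bar>s k\<bar> \<le> A" and "\<And>x. \<bar>x\<bar> \<le> 2 * A \<Longrightarrow> f x \<le> g x"
  shows "jint s f \<le> jint s g"
  unfolding jint_def
proof (rule sum_mono)
  fix x assume x: "x \<in> fst (jquad s)"
  show "snd (jquad s) x * f x \<le> snd (jquad s) x * g x"
    using jquad_support[OF s A x] jquad_nonneg[OF s x] assms(3)[of x]
    by (cases "snd (jquad s) x = 0") (auto intro: mult_left_mono)
qed

lemma jint_mono': "finsupp s \<Longrightarrow> (\<And>x. f x \<le> g x) \<Longrightarrow> jint s f \<le> jint s g"
  unfolding jint_def using jquad_nonneg by (intro sum_mono mult_left_mono) auto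

lemma jint_abs_le:
  assumes s: "finsupp s" and A: "\<And>k. \<bar>s k\<bar> \<le> A" and b: "\<And>x. \<bar>x\<bar> \<le> 2 * A \<Longrightarrow> \<bar>f x\<bar> \<le> c"
  shows "\<bar>jint s f\<bar> \<le> c"
proof -
  have "jint s f \<le> jint s (\<lambda>_. c)" using b by (intro jint_mono[OF s A]) (auto simp: abs_le_iff)
  moreover have "jint s (\<lambda>_. - c) \<le> jint s f" using b by (intro jint_mono[OF s A]) (auto simp: abs_le_iff minus_le_iff)
  ultimately show ?thesis by (simp add: jint_const[OF s] abs_le_iff)
qed

lemma finsupp_bounded:
  assumes "finsupp s"
  shows "\<exists>A\<ge>0. \<forall>k. \<bar>s k\<bar> \<le> A"
proof -
  obtain K where K: "\<And>k. k \<ge> K \<Longrightarrow> s k = 0" using assms unfolding finsupp_def by blast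
  have "\<bar>s k\<bar> \<le> (\<Sum>i<K. \<bar>s i\<bar>)" for k
  proof (cases "k < K")
    case True then show ?thesis by (intro member_le_sum[where f = "\<lambda>i. \<bar>s i\<bar>"]) auto
  next
    case False then show ?thesis using K[of k] by (simp add: sum_nonneg)
  qed
  moreover have "(\<Sum>i<K. \<bar>s i\<bar>) \<ge> 0" by (simp add: sum_nonneg)
  ultimately show ?thesis by blast
qed

lemma jmom_diff: "jmom s (p - q) = jmom s p - jmom s q"
  using jpoly_add[of s "p - q" q 0] by (simp add: jmom_eq_jpoly)

lemma jgrad_diff: "jgrad s (p - q) k = jgrad s p k - jgrad s q k"
proof -
  have "((\<lambda>t. jmom (s(k := t)) p - jmom (s(k := t)) q) has_real_derivative jgrad (s(k := s k)) p k - jgrad (s(k := s k)) q k) (at (s k))"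
    by (intro DERIV_diff has_derivative_jmom)
  moreover have "((\<lambda>t. jmom (s(k := t)) p - jmom (s(k := t)) q) has_real_derivative jgrad (s(k := s k)) (p - q) k) (at (s k))"
    unfolding jmom_diff[symmetric] by (rule has_derivative_jmom)
  ultimately have "jgrad (s(k := s k)) p k - jgrad (s(k := s k)) q k = jgrad (s(k := s k)) (p - q) k"
    by (rule DERIV_unique)
  then show ?thesis by simp
qed

text \<open>By the mean value theorem a divided difference is a value of \<open>p'\<close> between the two nodes, and an even
  power is largest at an end point; the majorant then integrates to a moment.\<close>

lemma sum_jgrad_le:
  assumes s: "finsupp s" and A: "\<And>k. \<bar>s k\<bar> \<le> A"
    and b: "\<And>x. \<bar>x\<bar> \<le> 2 * A \<Longrightarrow> (poly (pderiv p) x)\<^sup>2 \<le> e + c * x ^ (2 * L)" and c: "c \<ge> 0"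
  shows "(\<Sum>k<K. (jgrad s p k)\<^sup>2) \<le> 2 * (e + 2 * c * jwalk s (2 * L) 0)"
proof -
  let ?S = "fst (jquad s)" and ?w = "snd (jquad s)"
  have rep: "jwalk s N 0 = (\<Sum>x\<in>?S. ?w x * x ^ N)" for N
    using jint_power[OF s, of N] by (simp add: jint_def)
  have mass: "(\<Sum>x\<in>?S. ?w x) = 1" using rep[of 0] by simp
  have "(\<Sum>k<K. (jgrad s p k)\<^sup>2) \<le> 2 * (\<Sum>x\<in>?S. \<Sum>y\<in>?S. ?w x * ?w y * (divdiff p x y)\<^sup>2)"
    by (rule sum_jgrad_square_le[OF finite_jquad[OF s] rep])
  also have "(\<Sum>x\<in>?S. \<Sum>y\<in>?S. ?w x * ?w y * (divdiff p x y)\<^sup>2) \<le>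
     (\<Sum>x\<in>?S. \<Sum>y\<in>?S. ?w x * ?w y * (e + c * x ^ (2 * L) + c * y ^ (2 * L)))"
  proof (intro sum_mono)
    fix x y assume x: "x \<in> ?S" and y: "y \<in> ?S"
    show "?w x * ?w y * (divdiff p x y)\<^sup>2 \<le> ?w x * ?w y * (e + c * x ^ (2 * L) + c * y ^ (2 * L))"
    proof (cases "?w x = 0 \<or> ?w y = 0")
      case False
      have xy: "\<bar>x\<bar> \<le> 2 * A" "\<bar>y\<bar> \<le> 2 * A" using False jquad_support[OF s A] x y by auto
      obtain z where z: "min x y \<le> z" "z \<le> max x y" "divdiff p x y = poly (pderiv p) z" by (rule divdiff_mvt)
      have zz: "\<bar>z\<bar> \<le> \<bar>x\<bar> \<or> \<bar>z\<bar> \<le> \<bar>y\<bar>" using z by linarith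
      then have "z ^ (2 * L) \<le> x ^ (2 * L) \<or> z ^ (2 * L) \<le> y ^ (2 * L)"
        by (metis abs_ge_zero power_even_abs power_mono even_mult_iff even_numeral)
      moreover have "0 \<le> x ^ (2 * L)" "0 \<le> y ^ (2 * L)" by auto
      ultimately have "z ^ (2 * L) \<le> x ^ (2 * L) + y ^ (2 * L)" by linarith
      then have "c * z ^ (2 * L) \<le> c * (x ^ (2 * L) + y ^ (2 * L))" using c by (rule mult_left_mono)
      moreover have "\<bar>z\<bar> \<le> 2 * A" using zz xy by linarith
      ultimately have "(divdiff p x y)\<^sup>2 \<le> e + c * x ^ (2 * L) + c * y ^ (2 * L)"
        using b[of z] z(3) by (simp add: algebra_simps)
      then show ?thesis using jquad_nonneg[OF s] x y by (intro mult_left_mono) auto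
    qed auto
  qed
  also have "\<dots> = e * ((\<Sum>x\<in>?S. ?w x) * (\<Sum>y\<in>?S. ?w y))
      + c * ((\<Sum>x\<in>?S. ?w x * x ^ (2 * L)) * (\<Sum>y\<in>?S. ?w y)) + c * ((\<Sum>x\<in>?S. ?w x) * (\<Sum>y\<in>?S. ?w y * y ^ (2 * L)))"
    unfolding sum_product by (simp add: sum_distrib_left sum.distrib[symmetric] algebra_simps)
  also have "\<dots> = e + 2 * c * jwalk s (2 * L) 0" by (simp add: mass rep[symmetric])
  finally show ?thesis by simp
qed

text \<open>Integrate Weierstrass approximations of \<open>g'\<close>.  On \<open>[-j, j]\<close> an error \<open>1 / (j + 1)\<^sup>2\<close> of the derivative
  integrates to at most \<open>j / (j + 1)\<^sup>2\<close>, which still tends to 0.\<close>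

lemma c1_polynomial_approx:
  assumes d: "\<And>x. (g has_real_derivative g' x) (at x)" and c: "continuous_on UNIV g'"
  shows "\<exists>p :: nat \<Rightarrow> real poly. \<forall>R. \<forall>e>0. \<forall>\<^sub>F j in sequentially. \<forall>x. \<bar>x\<bar> \<le> R \<longrightarrow>
    \<bar>poly (p j) x - g x\<bar> \<le> e \<and> \<bar>poly (pderiv (p j)) x - g' x\<bar> \<le> e"
proof -
  have "\<exists>p. \<forall>x. \<bar>x\<bar> \<le> real j \<longrightarrow> \<bar>poly p x - g x\<bar> \<le> real j / (real (Suc j))\<^sup>2 \<and> \<bar>poly (pderiv p) x - g' x\<bar> \<le> 1 / (real (Suc j))\<^sup>2" for j
  proof -
    have "continuous_on {- real j..real j} g'" using c continuous_on_subset by blast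
    then obtain q where q: "real_polynomial_function q" "\<And>x. x \<in> {- real j..real j} \<Longrightarrow> \<bar>g' x - q x\<bar> < 1 / (real (Suc j))\<^sup>2"
      using Stone_Weierstrass_real_polynomial_function[of "{- real j..real j}" g' "1 / (real (Suc j))\<^sup>2"] by auto
    obtain a n where a: "q = (\<lambda>x. \<Sum>i\<le>n. a i * x ^ i)" using q(1) real_polynomial_function_iff_sum by auto
    define p where "p = [:g 0:] + (\<Sum>i\<le>n. monom (a i / real (Suc i)) (Suc i))"
    have pds: "pderiv (sum f S) = (\<Sum>i\<in>S. pderiv (f i))" for f :: "nat \<Rightarrow> real poly" and S
      by (induction S rule: infinite_finite_induct) (auto simp: pderiv_add)
    have pd: "poly (pderiv p) x = q x" for x
    proof -
      have m: "pderiv (monom (a i / real (Suc i)) (Suc i)) = monom (a i) i" for i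
        by (simp add: pderiv_monom del: of_nat_Suc)
      have "pderiv p = (\<Sum>i\<le>n. monom (a i) i)"
        unfolding p_def pderiv_add pds m by (simp add: pderiv_pCons)
      then show ?thesis by (simp only: a poly_sum poly_monom)
    qed
    have p0: "poly p 0 = g 0" by (simp only: p_def poly_add poly_sum poly_monom poly_pCons poly_0) simp
    have "\<bar>poly p x - g x\<bar> \<le> real j / (real (Suc j))\<^sup>2" if x: "\<bar>x\<bar> \<le> real j" for x
    proof -
      have "norm ((poly p x - g x) - (poly p 0 - g 0)) \<le> 1 / (real (Suc j))\<^sup>2 * norm (x - 0)"
      proof (rule field_differentiable_bound[where S = "{- real j..real j}" and f = "\<lambda>x. poly p x - g x"
          and f' = "\<lambda>x. q x - g' x" and B = "1 / (real (Suc j))\<^sup>2" and x = x and y = 0])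
        show "((\<lambda>x. poly p x - g x) has_field_derivative q z - g' z) (at z within {- real j..real j})" for z
          unfolding pd[symmetric] by (rule has_field_derivative_at_within[OF DERIV_diff[OF poly_DERIV d]])
        show "norm (q z - g' z) \<le> 1 / (real (Suc j))\<^sup>2" if "z \<in> {- real j..real j}" for z
          using q(2)[OF that] by (simp add: abs_minus_commute)
      qed (use x in auto)
      also have "\<dots> \<le> 1 / (real (Suc j))\<^sup>2 * real j" using x by (intro mult_left_mono) auto
      finally show ?thesis by (simp add: p0)
    qed
    moreover have "\<bar>poly (pderiv p) x - g' x\<bar> \<le> 1 / (real (Suc j))\<^sup>2" if "\<bar>x\<bar> \<le> real j" for x
    proof -
      have "x \<in> {- real j..real j}" using that by auto
      from less_imp_le[OF q(2)[OF this]] show ?thesis by (simp add: pd abs_minus_commute)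
    qed
    ultimately show ?thesis by blast
  qed
  then obtain p where p: "\<And>j x. \<bar>x\<bar> \<le> real j \<Longrightarrow> \<bar>poly (p j) x - g x\<bar> \<le> real j / (real (Suc j))\<^sup>2"
      "\<And>j x. \<bar>x\<bar> \<le> real j \<Longrightarrow> \<bar>poly (pderiv (p j)) x - g' x\<bar> \<le> 1 / (real (Suc j))\<^sup>2"
    by metis
  have "\<forall>\<^sub>F j in sequentially. \<forall>x. \<bar>x\<bar> \<le> R \<longrightarrow>
    \<bar>poly (p j) x - g x\<bar> \<le> e \<and> \<bar>poly (pderiv (p j)) x - g' x\<bar> \<le> e" if "e > 0" for R e
  proof -
    have "(\<lambda>j. real j / (real (Suc j))\<^sup>2) \<longlonglongrightarrow> 0" "(\<lambda>j. 1 / (real (Suc j))\<^sup>2) \<longlonglongrightarrow> 0" by real_asymp+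
    then have "\<forall>\<^sub>F j in sequentially. real j / (real (Suc j))\<^sup>2 < e" "\<forall>\<^sub>F j in sequentially. 1 / (real (Suc j))\<^sup>2 < e"
      using that by (auto intro: order_tendstoD)
    moreover have "\<forall>\<^sub>F j in sequentially. R \<le> real j"
      using filterlim_real_sequentially by (simp add: filterlim_at_top)
    ultimately show ?thesis
    proof eventually_elim
      case (elim j)
      show ?case using p[of _ j] elim by (meson less_imp_le order_trans)
    qed
  qed
  then show ?thesis by blast
qed

definition c1_approx :: "(real \<Rightarrow> real) \<Rightarrow> (real \<Rightarrow> real) \<Rightarrow> (nat \<Rightarrow> real poly) \<Rightarrow> bool" where
  "c1_approx g g' p \<longleftrightarrow> (\<forall>R. \<forall>e>0. \<forall>\<^sub>F j in sequentially. \<forall>x. \<bar>x\<bar> \<le> R \<longrightarrow>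
    \<bar>poly (p j) x - g x\<bar> \<le> e \<and> \<bar>poly (pderiv (p j)) x - g' x\<bar> \<le> e)"

lemma c1_approxD:
  assumes "c1_approx g g' p" "e > 0"
  shows "\<forall>\<^sub>F j in sequentially. \<forall>x. \<bar>x\<bar> \<le> R \<longrightarrow>
    \<bar>poly (p j) x - g x\<bar> \<le> e \<and> \<bar>poly (pderiv (p j)) x - g' x\<bar> \<le> e"
  using assms unfolding c1_approx_def by blast

lemma jint_approx:
  assumes p: "c1_approx g g' p" and s: "finsupp s"
  shows "(\<lambda>j. jmom s (p j)) \<longlonglongrightarrow> jint s g"
proof (rule LIMSEQ_I)
  fix r :: real assume r: "r > 0"
  obtain A where A: "A \<ge> 0" "\<And>k. \<bar>s k\<bar> \<le> A" using finsupp_bounded[OF s] by blast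
  have "\<forall>\<^sub>F j in sequentially. \<forall>x. \<bar>x\<bar> \<le> 2 * A \<longrightarrow> \<bar>poly (p j) x - g x\<bar> \<le> r / 2"
    using c1_approxD[OF p, of "r / 2" "2 * A"] r by (auto elim!: eventually_mono)
  then have "\<forall>\<^sub>F j in sequentially. norm (jmom s (p j) - jint s g) < r"
  proof eventually_elim
    case (elim j)
    have "\<bar>jint s (\<lambda>x. poly (p j) x - g x)\<bar> \<le> r / 2" using elim by (intro jint_abs_le[OF s A(2)]) auto
    then show ?case using r by (simp add: jint_diff jint_poly[OF s])
  qed
  then show "\<exists>no. \<forall>j\<ge>no. norm (jmom s (p j) - jint s g) < r" by (simp add: eventually_sequentially)
qed

lemma jgrad_cauchy:
  assumes p: "c1_approx g g' p" and e: "e > 0"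
  shows "\<exists>N. \<forall>i\<ge>N. \<forall>j\<ge>N. \<forall>s. finsupp s \<longrightarrow> (\<forall>k. \<bar>s k\<bar> \<le> A) \<longrightarrow> \<bar>jgrad s (p i) k - jgrad s (p j) k\<bar> \<le> e"
proof -
  define d where "d = e / 4"
  have d: "d > 0" using e by (simp add: d_def)
  obtain N where N: "\<And>j x. j \<ge> N \<Longrightarrow> \<bar>x\<bar> \<le> 2 * A \<Longrightarrow> \<bar>poly (pderiv (p j)) x - g' x\<bar> \<le> d"
    using p d unfolding c1_approx_def eventually_sequentially by meson
  have "\<bar>jgrad s (p i) k - jgrad s (p j) k\<bar> \<le> e" if ij: "i \<ge> N" "j \<ge> N" and s: "finsupp s" and A: "\<And>k. \<bar>s k\<bar> \<le> A" for i j s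
  proof -
    have "(poly (pderiv (p i - p j)) x)\<^sup>2 \<le> (2 * d)\<^sup>2 + 0 * x ^ (2 * 0)" if "\<bar>x\<bar> \<le> 2 * A" for x
    proof -
      have "\<bar>poly (pderiv (p i - p j)) x\<bar> \<le> 2 * d"
        using N[OF ij(1) that] N[OF ij(2) that] by (simp add: pderiv_diff)
      then show ?thesis using power_mono[of "\<bar>poly (pderiv (p i - p j)) x\<bar>" "2 * d" 2] by simp
    qed
    then have "(\<Sum>l<Suc k. (jgrad s (p i - p j) l)\<^sup>2) \<le> 2 * ((2 * d)\<^sup>2 + 2 * 0 * jwalk s (2 * 0) 0)"
      by (intro sum_jgrad_le[OF s A]) auto
    moreover have "(jgrad s (p i - p j) k)\<^sup>2 \<le> (\<Sum>l<Suc k. (jgrad s (p i - p j) l)\<^sup>2)"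
      by (rule member_le_sum) auto
    moreover have "2 * ((2 * d)\<^sup>2 + 2 * 0 * jwalk s (2 * 0) 0) = 8 * d\<^sup>2" by (simp add: power_mult_distrib)
    ultimately have "(jgrad s (p i - p j) k)\<^sup>2 \<le> 8 * d\<^sup>2" by linarith
    also have "\<dots> \<le> e\<^sup>2" by (simp add: d_def power_divide)
    finally have "\<bar>jgrad s (p i - p j) k\<bar> \<le> \<bar>e\<bar>" by (simp only: abs_le_square_iff)
    then have "\<bar>jgrad s (p i - p j) k\<bar> \<le> e" using e by simp
    then show ?thesis by (simp add: jgrad_diff)
  qed
  then show ?thesis by blast
qed

text \<open>The partial derivative of \<open>s \<mapsto> jint s g\<close> for a function \<open>g\<close> that is merely \<open>C\<^sup>1\<close>.  The nodes and
  weights need not depend smoothly on \<open>s\<close> in any obvious way; the derivative is obtained as a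
  uniform limit over polynomial approximations (\<open>jgrad_cauchy\<close>, \<open>has_derivative_jint\<close>).\<close>

definition jgrad_lim :: "(nat \<Rightarrow> real poly) \<Rightarrow> (nat \<Rightarrow> real) \<Rightarrow> nat \<Rightarrow> real" where
  "jgrad_lim p s k = lim (\<lambda>j. jgrad s (p j) k)"

lemma jgrad_lim:
  assumes p: "c1_approx g g' p" and s: "finsupp s"
  shows "(\<lambda>j. jgrad s (p j) k) \<longlonglongrightarrow> jgrad_lim p s k"
proof -
  obtain A where A: "A \<ge> 0" "\<And>k. \<bar>s k\<bar> \<le> A" using finsupp_bounded[OF s] by blast
  have "Cauchy (\<lambda>j. jgrad s (p j) k)"
  proof (rule metric_CauchyI)
    fix e :: real assume "e > 0"
    then show "\<exists>M. \<forall>m\<ge>M. \<forall>n\<ge>M. dist (jgrad s (p m) k) (jgrad s (p n) k) < e"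
    proof -
      obtain N where N: "\<forall>i\<ge>N. \<forall>j\<ge>N. \<forall>s. finsupp s \<longrightarrow> (\<forall>k. \<bar>s k\<bar> \<le> A) \<longrightarrow> \<bar>jgrad s (p i) k - jgrad s (p j) k\<bar> \<le> e / 2"
        using jgrad_cauchy[OF p, of "e / 2" A k] \<open>e > 0\<close> by auto
      have "\<bar>jgrad s (p m) k - jgrad s (p n) k\<bar> < e" if "m \<ge> N" "n \<ge> N" for m n
      proof -
        have "\<bar>jgrad s (p m) k - jgrad s (p n) k\<bar> \<le> e / 2" using N that s A(2) by blast
        then show ?thesis using \<open>e > 0\<close> by linarith
      qed
      then show ?thesis unfolding dist_real_def by blast
    qed
  qed
  then show ?thesis unfolding jgrad_lim_def
    by (simp add: Cauchy_convergent_iff convergent_LIMSEQ_iff[symmetric])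
qed

lemma jgrad_lim_uniform:
  assumes p: "c1_approx g g' p" and e: "e > 0"
  shows "\<exists>N. \<forall>i\<ge>N. \<forall>s. finsupp s \<longrightarrow> (\<forall>k. \<bar>s k\<bar> \<le> A) \<longrightarrow> \<bar>jgrad s (p i) k - jgrad_lim p s k\<bar> \<le> e"
proof -
  obtain N where N: "\<And>i j s. i \<ge> N \<Longrightarrow> j \<ge> N \<Longrightarrow> finsupp s \<Longrightarrow> (\<And>k. \<bar>s k\<bar> \<le> A) \<Longrightarrow> \<bar>jgrad s (p i) k - jgrad s (p j) k\<bar> \<le> e"
    using jgrad_cauchy[OF p e, of A k] by blast
  have "\<bar>jgrad s (p i) k - jgrad_lim p s k\<bar> \<le> e" if "i \<ge> N" and s: "finsupp s" "\<And>k. \<bar>s k\<bar> \<le> A" for i s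
  proof (rule tendsto_upperbound)
    show "(\<lambda>j. \<bar>jgrad s (p i) k - jgrad s (p j) k\<bar>) \<longlonglongrightarrow> \<bar>jgrad s (p i) k - jgrad_lim p s k\<bar>"
      by (intro tendsto_intros jgrad_lim[OF p s(1)])
    show "\<forall>\<^sub>F j in sequentially. \<bar>jgrad s (p i) k - jgrad s (p j) k\<bar> \<le> e"
      using N[OF that(1) _ s] by (auto simp: eventually_sequentially)
  qed simp
  then show ?thesis by blast
qed

lemma isCont_jwalk: "isCont (\<lambda>t. jwalk (s(k := t)) N i) x"
  using has_derivative_jwalk[of s k N i x] by (rule DERIV_isCont)

lemma continuous_jgrad: "continuous_on S (\<lambda>t. jgrad (s(k := t)) p l)"
  unfolding jgrad_def jcross_def
  by (intro continuous_at_imp_continuous_on ballI continuous_intros isCont_jwalk)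

lemma has_derivative_jint:
  assumes p: "c1_approx g g' p" and s: "finsupp s"
  shows "((\<lambda>t. jint (s(k := t)) g) has_real_derivative jgrad_lim p (s(k := t)) k) (at t)"
    and "continuous_on UNIV (\<lambda>t. jgrad_lim p (s(k := t)) k)"
proof -
  obtain A where A: "A \<ge> 0" "\<And>k. \<bar>s k\<bar> \<le> A" using finsupp_bounded[OF s] by blast
  have bd: "\<bar>(s(k := u)) l\<bar> \<le> A + R" if "\<bar>u\<bar> \<le> R" for u l R using A(1) A(2)[of l] that by auto
  have unif: "\<exists>N. \<forall>i\<ge>N. \<forall>u. \<bar>u\<bar> \<le> R \<longrightarrow> \<bar>jgrad (s(k := u)) (p i) k - jgrad_lim p (s(k := u)) k\<bar> \<le> e" if "e > 0" for e R
    using jgrad_lim_uniform[OF p that, of "A + R" k] finsupp_upd[OF s] bd by blast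
  show "((\<lambda>t. jint (s(k := t)) g) has_real_derivative jgrad_lim p (s(k := t)) k) (at t)"
  proof -
    define S where "S = {- (\<bar>t\<bar> + 1)<..<\<bar>t\<bar> + 1}"
    have "t \<in> S" by (auto simp: S_def)
    have "\<exists>h. \<forall>x\<in>S. (\<lambda>n. jmom (s(k := x)) (p n)) \<longlonglongrightarrow> h x \<and>
        (h has_derivative (\<lambda>u. jgrad_lim p (s(k := x)) k * u)) (at x within S)"
    proof (rule has_derivative_sequence)
      show "convex S" unfolding S_def by simp
      show "((\<lambda>x. jmom (s(k := x)) (p n)) has_derivative (\<lambda>u. jgrad (s(k := x)) (p n) k * u)) (at x within S)" for n x
        using has_derivative_jmom[of s k "p n" x]
        by (simp add: has_field_derivative_def has_derivative_at_withinI)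
      show "t \<in> S" by fact
      show "(\<lambda>n. jmom (s(k := t)) (p n)) \<longlonglongrightarrow> jint (s(k := t)) g"
        by (rule jint_approx[OF p finsupp_upd[OF s]])
      fix e :: real assume "e > 0"
      then obtain N where N: "\<And>i u. i \<ge> N \<Longrightarrow> \<bar>u\<bar> \<le> \<bar>t\<bar> + 1 \<Longrightarrow> \<bar>jgrad (s(k := u)) (p i) k - jgrad_lim p (s(k := u)) k\<bar> \<le> e"
        using unif by blast
      have "norm (jgrad (s(k := x)) (p i) k * u - jgrad_lim p (s(k := x)) k * u) \<le> e * norm u" if "i \<ge> N" "x \<in> S" for i x u
        using N[OF that(1), of x] that(2)
        by (auto simp: S_def abs_mult left_diff_distrib[symmetric] intro!: mult_right_mono)
      then show "\<forall>\<^sub>F n in sequentially. \<forall>x\<in>S. \<forall>u. norm (jgrad (s(k := x)) (p n) k * u - jgrad_lim p (s(k := x)) k * u) \<le> e * norm u"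
        by (auto simp: eventually_sequentially)
    qed
    then obtain h where h: "\<And>x. x \<in> S \<Longrightarrow> (\<lambda>n. jmom (s(k := x)) (p n)) \<longlonglongrightarrow> h x"
       "\<And>x. x \<in> S \<Longrightarrow> (h has_derivative (\<lambda>u. jgrad_lim p (s(k := x)) k * u)) (at x within S)" by blast
    have hj: "h x = jint (s(k := x)) g" if "x \<in> S" for x
      using LIMSEQ_unique[OF h(1)[OF that] jint_approx[OF p finsupp_upd[OF s]]] .
    have "(h has_real_derivative jgrad_lim p (s(k := t)) k) (at t)"
      using h(2)[OF \<open>t \<in> S\<close>] \<open>t \<in> S\<close> unfolding has_field_derivative_def
      by (subst (asm) at_within_open) (auto simp: S_def)
    then show ?thesis
      by (rule has_field_derivative_transform_within_open[of _ _ _ S]) (use \<open>t \<in> S\<close> hj in \<open>auto simp: S_def\<close>)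
  qed
  have "continuous_on {-R<..<R} (\<lambda>t. jgrad_lim p (s(k := t)) k)" for R
  proof (rule uniform_limit_theorem[where F = sequentially and f = "\<lambda>j t. jgrad (s(k := t)) (p j) k"])
    show "\<forall>\<^sub>F n in sequentially. continuous_on {-R<..<R} (\<lambda>t. jgrad (s(k := t)) (p n) k)"
      by (simp add: continuous_jgrad)
    show "uniform_limit {-R<..<R} (\<lambda>j t. jgrad (s(k := t)) (p j) k) (\<lambda>t. jgrad_lim p (s(k := t)) k) sequentially"
    proof (rule uniform_limitI)
      fix e :: real assume "e > 0"
      then obtain N where N: "\<And>i u. i \<ge> N \<Longrightarrow> \<bar>u\<bar> \<le> R \<Longrightarrow> \<bar>jgrad (s(k := u)) (p i) k - jgrad_lim p (s(k := u)) k\<bar> \<le> e / 2"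
        using unif[of "e / 2" R] by auto
      have "dist (jgrad (s(k := x)) (p n) k) (jgrad_lim p (s(k := x)) k) < e" if "n \<ge> N" "x \<in> {-R<..<R}" for n x
      proof -
        have "\<bar>x\<bar> \<le> R" using that(2) by auto
        then show ?thesis using N[OF that(1), of x] \<open>e > 0\<close> by (simp add: dist_real_def)
      qed
      then show "\<forall>\<^sub>F n in sequentially. \<forall>x\<in>{-R<..<R}. dist (jgrad (s(k := x)) (p n) k) (jgrad_lim p (s(k := x)) k) < e"
        by (intro eventually_sequentiallyI[of N]) blast
    qed
  qed simp
  then have "isCont (\<lambda>t. jgrad_lim p (s(k := t)) k) x" for x
    by (rule continuous_on_interior[where S = "{- (\<bar>x\<bar> + 1)<..<\<bar>x\<bar> + 1}"]) (auto simp: interior_open)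
  then show "continuous_on UNIV (\<lambda>t. jgrad_lim p (s(k := t)) k)"
    by (simp add: continuous_at_imp_continuous_on)
qed

lemma sum_jgrad_lim_le:
  assumes p: "c1_approx g g' p" and s: "finsupp s" and g': "continuous_on UNIV g'"
    and b: "\<And>x. (g' x)\<^sup>2 \<le> e + c * x ^ (2 * L)" and c: "c \<ge> 0"
  shows "(\<Sum>k<K. (jgrad_lim p s k)\<^sup>2) \<le> 2 * (e + 2 * c * jwalk s (2 * L) 0)"
proof (rule field_le_epsilon)
  fix r :: real assume r: "r > 0"
  obtain A where A: "A \<ge> 0" "\<And>k. \<bar>s k\<bar> \<le> A" using finsupp_bounded[OF s] by blast
  have "compact (g' ` {-(2*A)..2*A})"
    by (intro compact_continuous_image continuous_on_subset[OF g']) auto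
  then have "bounded (g' ` {-(2*A)..2*A})" by (rule compact_imp_bounded)
  then obtain G where G0: "G > 0" "\<forall>y\<in>g' ` {-(2*A)..2*A}. norm y \<le> G" unfolding bounded_pos by blast
  have G: "G > 0" "\<And>x. \<bar>x\<bar> \<le> 2 * A \<Longrightarrow> \<bar>g' x\<bar> \<le> G" using G0 by (auto simp: abs_le_iff)
  (* Chosen so that an error \<open>d\<close> in \<open>g'\<close> changes \<open>(g')\<^sup>2\<close> by at most \<open>2 G d + d\<^sup>2 \<le> r / 2\<close>. *)
  define d where "d = min 1 (r / (2 * (2 * G + 1)))"
  have d: "d > 0" "d \<le> 1" using r G(1) by (auto simp: d_def)
  have "d * (2 * G + 1) \<le> r / (2 * (2 * G + 1)) * (2 * G + 1)"
    using G(1) by (intro mult_right_mono) (auto simp: d_def)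
  moreover have "r / (2 * (2 * G + 1)) * (2 * G + 1) = r / 2" using G(1) by (simp add: field_simps)
  ultimately have d3: "d * (2 * G + 1) \<le> r / 2" by linarith
  have "\<forall>\<^sub>F j in sequentially. \<forall>x. \<bar>x\<bar> \<le> 2 * A \<longrightarrow> \<bar>poly (pderiv (p j)) x - g' x\<bar> \<le> d"
    using c1_approxD[OF p d(1), of "2 * A"] by (auto elim!: eventually_mono)
  then have "\<forall>\<^sub>F j in sequentially. (\<Sum>k<K. (jgrad s (p j) k)\<^sup>2) \<le> 2 * ((e + r / 2) + 2 * c * jwalk s (2 * L) 0)"
  proof eventually_elim
    case (elim j)
    show ?case
    proof (rule sum_jgrad_le[OF s A(2) _ c])
      fix x assume x: "\<bar>x\<bar> \<le> 2 * A"
      define u where "u = poly (pderiv (p j)) x - g' x"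
      have u: "\<bar>u\<bar> \<le> d" using elim x by (simp add: u_def)
      have "(poly (pderiv (p j)) x)\<^sup>2 = (g' x)\<^sup>2 + (2 * g' x * u + u * u)"
        by (simp add: u_def power2_eq_square algebra_simps)
      also have "2 * g' x * u + u * u \<le> \<bar>2 * g' x * u\<bar> + \<bar>u * u\<bar>" by linarith
      also have "\<dots> \<le> 2 * G * d + d * 1"
        unfolding abs_mult using u G(2)[OF x] d by (intro add_mono mult_mono) auto
      also have "\<dots> \<le> r / 2" using d3 by (simp add: algebra_simps)
      finally show "(poly (pderiv (p j)) x)\<^sup>2 \<le> (e + r / 2) + c * x ^ (2 * L)" using b[of x] by linarith
    qed
  qed
  moreover have "(\<lambda>j. \<Sum>k<K. (jgrad s (p j) k)\<^sup>2) \<longlonglongrightarrow> (\<Sum>k<K. (jgrad_lim p s k)\<^sup>2)"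
    by (intro tendsto_intros jgrad_lim[OF p s])
  ultimately have "(\<Sum>k<K. (jgrad_lim p s k)\<^sup>2) \<le> 2 * ((e + r / 2) + 2 * c * jwalk s (2 * L) 0)"
    by (intro tendsto_upperbound) auto
  then show "(\<Sum>k<K. (jgrad_lim p s k)\<^sup>2) \<le> 2 * (e + 2 * c * jwalk s (2 * L) 0) + r" by simp
qed

section \<open>Convergence to constants in all moments\<close>

text \<open>The entries of the random matrices converge to constants in \<open>L\<^sup>p\<close> for every \<open>p\<close>.  This mode of
  convergence is stable under products, hence under all polynomials in the entries.\<close>

context prob_space begin

definition lp_null :: "(nat \<Rightarrow> 'a \<Rightarrow> real) \<Rightarrow> bool" where
  "lp_null X \<longleftrightarrow> (\<forall>n. random_variable borel (X n)) \<and>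
    (\<forall>p. (\<forall>n. integrable M (\<lambda>\<omega>. X n \<omega> ^ (2 * p)))) \<and>
    (\<forall>p>0. (\<lambda>n. expectation (\<lambda>\<omega>. X n \<omega> ^ (2 * p))) \<longlonglongrightarrow> 0)"

definition lp_tendsto :: "(nat \<Rightarrow> 'a \<Rightarrow> real) \<Rightarrow> real \<Rightarrow> bool" where
  "lp_tendsto X x \<longleftrightarrow> lp_null (\<lambda>n \<omega>. X n \<omega> - x)"

lemma lp_null_dominated:
  assumes "\<And>n. random_variable borel (Z n)"
    and i: "\<And>n p. integrable M (B n p)" and l: "\<And>p. p > 0 \<Longrightarrow> (\<lambda>n. expectation (B n p)) \<longlonglongrightarrow> 0"
    and le: "\<And>n p \<omega>. Z n \<omega> ^ (2 * p) \<le> B n p \<omega>"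
  shows "lp_null Z"
proof -
  note [measurable] = assms(1)
  have int: "integrable M (\<lambda>\<omega>. Z n \<omega> ^ (2 * p))" for n p
    by (rule Bochner_Integration.integrable_bound[OF i[of n p]]) (auto intro!: AE_I2 order_trans[OF le abs_ge_self])
  have "(\<lambda>n. expectation (\<lambda>\<omega>. Z n \<omega> ^ (2 * p))) \<longlonglongrightarrow> 0" if "p > 0" for p
  proof (rule tendsto_sandwich[OF _ _ tendsto_const l[OF that]])
    show "\<forall>\<^sub>F n in sequentially. expectation (\<lambda>\<omega>. Z n \<omega> ^ (2 * p)) \<le> expectation (B n p)"
      using int i le by (intro always_eventually allI integral_mono) auto
  qed simp
  then show ?thesis unfolding lp_null_def using assms(1) int by blast
qed

lemma lp_null_add:
  assumes X: "lp_null X" and Y: "lp_null Y"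
  shows "lp_null (\<lambda>n \<omega>. X n \<omega> + Y n \<omega>)"
proof (rule lp_null_dominated[where B = "\<lambda>n p \<omega>. 2 ^ (2 * p) * (X n \<omega> ^ (2 * p) + Y n \<omega> ^ (2 * p))"])
  show "random_variable borel (\<lambda>\<omega>. X n \<omega> + Y n \<omega>)" for n
    using X Y unfolding lp_null_def by (intro borel_measurable_add) blast+
  show "integrable M (\<lambda>\<omega>. 2 ^ (2 * p) * (X n \<omega> ^ (2 * p) + Y n \<omega> ^ (2 * p)))" for n p
    using X Y by (auto simp: lp_null_def)
  show "(\<lambda>n. expectation (\<lambda>\<omega>. 2 ^ (2 * p) * (X n \<omega> ^ (2 * p) + Y n \<omega> ^ (2 * p)))) \<longlonglongrightarrow> 0" if "p > 0" for p
  proof -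
    have "(\<lambda>n. 2 ^ (2 * p) * (expectation (\<lambda>\<omega>. X n \<omega> ^ (2 * p)) + expectation (\<lambda>\<omega>. Y n \<omega> ^ (2 * p)))) \<longlonglongrightarrow> 2 ^ (2 * p) * (0 + 0)"
      using X Y that by (intro tendsto_intros) (auto simp: lp_null_def)
    then show ?thesis using X Y by (simp add: lp_null_def)
  qed
  fix n p \<omega>
  let ?m = "max \<bar>X n \<omega>\<bar> \<bar>Y n \<omega>\<bar>"
  have "(X n \<omega> + Y n \<omega>) ^ (2 * p) = \<bar>X n \<omega> + Y n \<omega>\<bar> ^ (2 * p)" by (simp add: power_even_abs)
  also have "\<dots> \<le> (2 * ?m) ^ (2 * p)" by (intro power_mono) auto
  also have "\<dots> = 2 ^ (2 * p) * ?m ^ (2 * p)" by (simp add: power_mult_distrib)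
  also have "?m ^ (2 * p) \<le> X n \<omega> ^ (2 * p) + Y n \<omega> ^ (2 * p)"
    by (cases "\<bar>X n \<omega>\<bar> \<le> \<bar>Y n \<omega>\<bar>") (simp_all add: max_def power_even_abs)
  finally show "(X n \<omega> + Y n \<omega>) ^ (2 * p) \<le> 2 ^ (2 * p) * (X n \<omega> ^ (2 * p) + Y n \<omega> ^ (2 * p))"
    by simp
qed

lemma lp_null_mult:
  assumes X: "lp_null X" and Y: "lp_null Y"
  shows "lp_null (\<lambda>n \<omega>. X n \<omega> * Y n \<omega>)"
proof (rule lp_null_dominated[where B = "\<lambda>n p \<omega>. X n \<omega> ^ (2 * (2 * p)) + Y n \<omega> ^ (2 * (2 * p))"])
  show "random_variable borel (\<lambda>\<omega>. X n \<omega> * Y n \<omega>)" for n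
    using X Y unfolding lp_null_def by (intro borel_measurable_times) blast+
  show "integrable M (\<lambda>\<omega>. X n \<omega> ^ (2 * (2 * p)) + Y n \<omega> ^ (2 * (2 * p)))" for n p
    using X Y unfolding lp_null_def by (intro Bochner_Integration.integrable_add) blast+
  show "(\<lambda>n. expectation (\<lambda>\<omega>. X n \<omega> ^ (2 * (2 * p)) + Y n \<omega> ^ (2 * (2 * p)))) \<longlonglongrightarrow> 0" if "p > 0" for p
  proof -
    have p: "2 * p > 0" using that by simp
    have i: "integrable M (\<lambda>\<omega>. X n \<omega> ^ (2 * (2 * p)))" "integrable M (\<lambda>\<omega>. Y n \<omega> ^ (2 * (2 * p)))" for n
      using X Y unfolding lp_null_def by blast+
    have "(\<lambda>n. expectation (\<lambda>\<omega>. X n \<omega> ^ (2 * (2 * p))) + expectation (\<lambda>\<omega>. Y n \<omega> ^ (2 * (2 * p)))) \<longlonglongrightarrow> 0 + 0"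
      using X Y p unfolding lp_null_def by (intro tendsto_add) blast+
    then show ?thesis using i by simp
  qed
  fix n p \<omega>
  define a b where "a = X n \<omega> ^ (2 * p)" and "b = Y n \<omega> ^ (2 * p)"
  have e: "u ^ (2 * (2 * p)) = (u ^ (2 * p))\<^sup>2" for u :: real
    by (subst power_mult[symmetric]) (rule arg_cong[where f = "(^) u"], simp)
  have "0 \<le> a" "0 \<le> b" by (simp_all add: a_def b_def)
  then have "0 \<le> a * b" by (rule mult_nonneg_nonneg)
  then have "a * b \<le> a\<^sup>2 + b\<^sup>2" using sum_squares_bound[of a b] by linarith
  then show "(X n \<omega> * Y n \<omega>) ^ (2 * p) \<le> X n \<omega> ^ (2 * (2 * p)) + Y n \<omega> ^ (2 * (2 * p))"
    unfolding e by (simp only: power_mult_distrib a_def b_def)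
qed

lemma lp_null_cmult: "lp_null X \<Longrightarrow> lp_null (\<lambda>n \<omega>. c * X n \<omega>)"
  unfolding lp_null_def by (auto simp: power_mult_distrib intro!: tendsto_mult_right_zero borel_measurable_times)

lemma lp_tendsto_seq: "c \<longlonglongrightarrow> x \<Longrightarrow> lp_tendsto (\<lambda>n \<omega>. c n) x"
  unfolding lp_tendsto_def lp_null_def
proof (intro conjI allI impI)
  fix p :: nat assume c: "c \<longlonglongrightarrow> x" and p: "p > 0"
  have "(\<lambda>n. (c n - x) ^ (2 * p)) \<longlonglongrightarrow> (x - x) ^ (2 * p)" using c by (intro tendsto_intros)
  then show "(\<lambda>n. expectation (\<lambda>\<omega>. (c n - x) ^ (2 * p))) \<longlonglongrightarrow> 0"
    using p by (simp only: diff_self power_0_left prob_space integral_const) (simp add: prob_space)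
qed auto

lemma lp_tendsto_const: "lp_tendsto (\<lambda>n \<omega>. c) c"
  by (rule lp_tendsto_seq) simp

lemma lp_tendsto_add:
  assumes "lp_tendsto X x" "lp_tendsto Y y"
  shows "lp_tendsto (\<lambda>n \<omega>. X n \<omega> + Y n \<omega>) (x + y)"
  using lp_null_add[OF assms[unfolded lp_tendsto_def]] unfolding lp_tendsto_def by (simp add: algebra_simps)

lemma lp_tendsto_mult:
  assumes "lp_tendsto X x" "lp_tendsto Y y"
  shows "lp_tendsto (\<lambda>n \<omega>. X n \<omega> * Y n \<omega>) (x * y)"
proof -
  have "lp_null (\<lambda>n \<omega>. (X n \<omega> - x) * (Y n \<omega> - y) + (x * (Y n \<omega> - y) + y * (X n \<omega> - x)))"
    using assms unfolding lp_tendsto_def by (intro lp_null_add lp_null_mult lp_null_cmult)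
  then show ?thesis unfolding lp_tendsto_def by (simp add: algebra_simps)
qed

lemma lp_tendsto_cmult: "lp_tendsto X x \<Longrightarrow> lp_tendsto (\<lambda>n \<omega>. c * X n \<omega>) (c * x)"
  by (rule lp_tendsto_mult[OF lp_tendsto_const])

lemma lp_tendsto_diff:
  assumes "lp_tendsto X x" "lp_tendsto Y y"
  shows "lp_tendsto (\<lambda>n \<omega>. X n \<omega> - Y n \<omega>) (x - y)"
  using lp_tendsto_add[OF assms(1) lp_tendsto_cmult[OF assms(2), of "-1"]] by simp

lemma lp_tendsto_sum:
  "(\<And>i. i \<in> A \<Longrightarrow> lp_tendsto (X i) (x i)) \<Longrightarrow> lp_tendsto (\<lambda>n \<omega>. \<Sum>i\<in>A. X i n \<omega>) (\<Sum>i\<in>A. x i)"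
  by (induction A rule: infinite_finite_induct) (auto intro: lp_tendsto_const lp_tendsto_add)

lemma lp_tendsto_power: "lp_tendsto X x \<Longrightarrow> lp_tendsto (\<lambda>n \<omega>. X n \<omega> ^ q) (x ^ q)"
  by (induction q) (auto intro: lp_tendsto_const lp_tendsto_mult)

lemma lp_tendsto_measurable: "lp_tendsto X x \<Longrightarrow> random_variable borel (X n)"
proof -
  assume "lp_tendsto X x"
  then have "random_variable borel (\<lambda>\<omega>. (X n \<omega> - x) + x)"
    unfolding lp_tendsto_def lp_null_def by (intro borel_measurable_add) auto
  then show ?thesis by simp
qed

lemma lp_tendsto_expectation:
  assumes "lp_tendsto X x"
  shows "integrable M (X n)" "(\<lambda>n. expectation (X n)) \<longlonglongrightarrow> x"
proof -
  have m: "random_variable borel (X n)" for n by (rule lp_tendsto_measurable[OF assms])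
  have i2: "integrable M (\<lambda>\<omega>. (X n \<omega> - x)\<^sup>2)" for n
    using assms[unfolded lp_tendsto_def lp_null_def, THEN conjunct2, THEN conjunct1, rule_format, of n 1] by simp
  have l2: "(\<lambda>n. expectation (\<lambda>\<omega>. (X n \<omega> - x)\<^sup>2)) \<longlonglongrightarrow> 0"
    using assms[unfolded lp_tendsto_def lp_null_def, THEN conjunct2, THEN conjunct2, rule_format, of 1] by simp
  have i1: "integrable M (\<lambda>\<omega>. X n \<omega> - x)" for n
    by (rule square_integrable_imp_integrable[OF _ i2]) (use m in simp)
  show i: "integrable M (X n)" for n using Bochner_Integration.integrable_add[OF i1[of n], of "\<lambda>_. x"] by simp
  have sq: "(expectation (X n) - x)\<^sup>2 \<le> expectation (\<lambda>\<omega>. (X n \<omega> - x)\<^sup>2)" for n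
  proof -
    have "0 \<le> variance (\<lambda>\<omega>. X n \<omega> - x)" by simp
    also have "\<dots> = expectation (\<lambda>\<omega>. (X n \<omega> - x)\<^sup>2) - (expectation (\<lambda>\<omega>. X n \<omega> - x))\<^sup>2"
      by (rule variance_eq[OF i1 i2])
    finally show ?thesis using i by (simp add: prob_space)
  qed
  have "(\<lambda>n. (expectation (X n) - x)\<^sup>2) \<longlonglongrightarrow> 0"
    by (rule tendsto_sandwich[OF _ _ tendsto_const l2]) (use sq in auto)
  then have "(\<lambda>n. sqrt ((expectation (X n) - x)\<^sup>2)) \<longlonglongrightarrow> 0" using tendsto_real_sqrt by fastforce
  then have "(\<lambda>n. expectation (X n) - x) \<longlonglongrightarrow> 0" by (simp add: tendsto_rabs_zero_iff)
  then show "(\<lambda>n. expectation (X n)) \<longlonglongrightarrow> x" by (simp add: LIM_zero_iff)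
qed

lemma lp_tendsto_jwalk:
  assumes "\<And>k. lp_tendsto (\<lambda>n \<omega>. S n \<omega> k) (s k)"
  shows "lp_tendsto (\<lambda>n \<omega>. jwalk (S n \<omega>) N i) (jwalk s N i)"
proof (induction N arbitrary: i)
  case 0 show ?case by (auto intro: lp_tendsto_const)
next
  case (Suc N)
  show ?case
    unfolding jwalk.simps jshift_def
    by (cases "i = 0") (auto intro!: lp_tendsto_add lp_tendsto_mult assms Suc lp_tendsto_const)
qed

lemma lp_tendsto_jmom:
  assumes "\<And>k. lp_tendsto (\<lambda>n \<omega>. S n \<omega> k) (s k)"
  shows "lp_tendsto (\<lambda>n \<omega>. jmom (S n \<omega>) p) (jmom s p)"
  unfolding jmom_def by (intro lp_tendsto_sum lp_tendsto_cmult lp_tendsto_jwalk assms)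

lemma lp_tendsto_jgrad:
  assumes "\<And>k. lp_tendsto (\<lambda>n \<omega>. S n \<omega> k) (s k)"
  shows "lp_tendsto (\<lambda>n \<omega>. jgrad (S n \<omega>) p k) (jgrad s p k)"
  unfolding jgrad_def jcross_def
  by (intro lp_tendsto_cmult lp_tendsto_sum lp_tendsto_mult lp_tendsto_jwalk assms)

end

text \<open>Since \<open>x\<^sup>2 / k - 1 = (x / sqrt k - 1) (x / sqrt k + 1)\<close> and the last factor is at least 1 for
  \<open>x > 0\<close>, moments of \<open>x / sqrt k - 1\<close> are bounded by those of \<open>x\<^sup>2 - k\<close>.\<close>

lemma (in chi_law) abs_ratio_moment:
  shows "integrable (chi_distribution k) (\<lambda>x. (x / sqrt k - 1) ^ (2 * p))"
    and "(\<integral>x. (x / sqrt k - 1) ^ (2 * p) \<partial>chi_distribution k) \<le> central_moment (2 * p) / k ^ (2 * p)"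
proof -
  show i: "integrable (chi_distribution k) (\<lambda>x. (x / sqrt k - 1) ^ (2 * p))"
    by (intro integrable_poly_bounded poly_boundedI[of _ "[:-1, 1 / sqrt k:] ^ (2 * p)"]) (auto simp: poly_power)
  have "(\<integral>x. (x / sqrt k - 1) ^ (2 * p) \<partial>chi_distribution k) \<le> (\<integral>x. (x\<^sup>2 - k) ^ (2 * p) / k ^ (2 * p) \<partial>chi_distribution k)"
  proof (rule integral_mono_AE[OF i])
    show "integrable (chi_distribution k) (\<lambda>x. (x\<^sup>2 - k) ^ (2 * p) / k ^ (2 * p))" using integrable_central by simp
    show "AE x in chi_distribution k. (x / sqrt k - 1) ^ (2 * p) \<le> (x\<^sup>2 - k) ^ (2 * p) / k ^ (2 * p)"
      using AE_chi_pos
    proof eventually_elim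
      case (elim x)
      define u where "u = x / sqrt k"
      have u: "u > 0" using elim k_pos by (simp add: u_def)
      have e: "(x\<^sup>2 - k) / k = (u - 1) * (u + 1)" using k_pos
        by (simp add: u_def power2_eq_square field_simps)
      have "\<bar>u - 1\<bar> * 1 \<le> \<bar>u - 1\<bar> * \<bar>u + 1\<bar>" using u by (intro mult_left_mono) auto
      then have "\<bar>u - 1\<bar> \<le> \<bar>(x\<^sup>2 - k) / k\<bar>" unfolding e abs_mult by simp
      then have "\<bar>u - 1\<bar> ^ (2 * p) \<le> \<bar>(x\<^sup>2 - k) / k\<bar> ^ (2 * p)" by (intro power_mono) auto
      then show ?case by (simp add: power_even_abs u_def power_divide)
    qed
  qed
  then show "(\<integral>x. (x / sqrt k - 1) ^ (2 * p) \<partial>chi_distribution k) \<le> central_moment (2 * p) / k ^ (2 * p)"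
    by (simp add: central_moment_def)
qed

section \<open>Random Jacobi matrices with chi entries\<close>

text \<open>The entry \<open>S n \<omega> k\<close> is \<open>\<theta> n\<close> times a chi variable with \<open>\<kappa> n k\<close> degrees of freedom.  The scale is common
  to all entries of one matrix, because it is the factor in the Poincare inequality.  The empty matrix
  for \<open>n = 0\<close> lets the statements without limits hold for all \<open>n\<close>.\<close>

locale chi_jacobi = prob_space +
  fixes S :: "nat \<Rightarrow> 'a \<Rightarrow> nat \<Rightarrow> real" and K :: "nat \<Rightarrow> nat" and \<kappa> :: "nat \<Rightarrow> nat \<Rightarrow> real"
    and \<theta> :: "nat \<Rightarrow> real" and sbar :: "nat \<Rightarrow> real"
  assumes S_beyond: "\<And>n \<omega> k. k \<ge> K n \<Longrightarrow> S n \<omega> k = 0"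
    and K_pos: "\<And>n. n \<ge> 1 \<Longrightarrow> K n > 0" and K_0: "K 0 = 0"
    and indep: "\<And>n. n \<ge> 1 \<Longrightarrow> indep_vars (\<lambda>_. borel) (\<lambda>k \<omega>. S n \<omega> k) {..<K n}"
    and law: "\<And>n k. n \<ge> 1 \<Longrightarrow> k < K n \<Longrightarrow>
       distr M borel (\<lambda>\<omega>. S n \<omega> k) = distr (chi_distribution (\<kappa> n k)) borel (\<lambda>x. \<theta> n * x)"
    and \<kappa>_pos: "\<And>n k. k < K n \<Longrightarrow> \<kappa> n k > 0"
    and \<theta>_pos: "\<And>n. n \<ge> 1 \<Longrightarrow> \<theta> n > 0"
    and K_lim: "\<And>k. \<forall>\<^sub>F n in sequentially. k < K n"
    and \<kappa>_growth: "\<And>k. \<exists>b>0. \<forall>\<^sub>F n in sequentially. \<kappa> n k \<ge> b * real n"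
    and scale_lim: "\<And>k. (\<lambda>n. \<theta> n * sqrt (\<kappa> n k)) \<longlonglongrightarrow> sbar k"
    and sbar_pos: "\<And>k. sbar k > 0"
begin

lemma K_pos_imp: "k < K n \<Longrightarrow> n \<ge> 1"
  using K_0 by (cases n) auto

lemma S_measurable [measurable]: "random_variable borel (\<lambda>\<omega>. S n \<omega> k)"
proof (cases "k < K n")
  case True
  then show ?thesis using indep[OF K_pos_imp[OF True]] by (auto simp: indep_vars_def)
next
  case False then show ?thesis by (simp add: S_beyond)
qed

lemma finsupp_S: "finsupp (S n \<omega>)"
  unfolding finsupp_def using S_beyond by blast

lemma chi_law: "k < K n \<Longrightarrow> chi_law (\<kappa> n k)"
  using prob_space_chi_of_distr[OF prob_space_axioms S_measurable law[OF K_pos_imp]] \<kappa>_pos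
  by (simp add: chi_law_def chi_law_axioms_def)

lemma expectation_S:
  fixes f :: "real \<Rightarrow> 'b::{banach, second_countable_topology}"
  assumes k: "k < K n" and [measurable]: "f \<in> borel_measurable borel"
  shows "integrable M (\<lambda>\<omega>. f (S n \<omega> k)) \<longleftrightarrow> integrable (chi_distribution (\<kappa> n k)) (\<lambda>x. f (\<theta> n * x))"
    and "expectation (\<lambda>\<omega>. f (S n \<omega> k)) = (\<integral>x. f (\<theta> n * x) \<partial>chi_distribution (\<kappa> n k))"
proof -
  have "integrable M (\<lambda>\<omega>. f (S n \<omega> k)) \<longleftrightarrow> integrable (distr M borel (\<lambda>\<omega>. S n \<omega> k)) f"
    by (subst integrable_distr_eq) auto
  also have "\<dots> \<longleftrightarrow> integrable (chi_distribution (\<kappa> n k)) (\<lambda>x. f (\<theta> n * x))"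
    unfolding law[OF K_pos_imp[OF k] k] by (subst integrable_distr_eq) auto
  finally show "integrable M (\<lambda>\<omega>. f (S n \<omega> k)) \<longleftrightarrow> integrable (chi_distribution (\<kappa> n k)) (\<lambda>x. f (\<theta> n * x))" .
  have "expectation (\<lambda>\<omega>. f (S n \<omega> k)) = (\<integral>x. f x \<partial>distr M borel (\<lambda>\<omega>. S n \<omega> k))"
    by (subst integral_distr) auto
  also have "\<dots> = (\<integral>x. f (\<theta> n * x) \<partial>chi_distribution (\<kappa> n k))"
    unfolding law[OF K_pos_imp[OF k] k] by (subst integral_distr) auto
  finally show "expectation (\<lambda>\<omega>. f (S n \<omega> k)) = (\<integral>x. f (\<theta> n * x) \<partial>chi_distribution (\<kappa> n k))" .
qed

definition amp :: "nat \<Rightarrow> nat \<Rightarrow> real" where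
  "amp n k = (if k < K n then \<theta> n * sqrt (\<kappa> n k) else 0)"

definition rel :: "nat \<Rightarrow> nat \<Rightarrow> 'a \<Rightarrow> real" where
  "rel k n \<omega> = (if k < K n then S n \<omega> k / amp n k else 1)"

lemma amp_pos: "k < K n \<Longrightarrow> amp n k > 0"
  using \<kappa>_pos \<theta>_pos[OF K_pos_imp] by (simp add: amp_def)

lemma S_eq_amp_rel: "S n \<omega> k = amp n k * rel k n \<omega>"
  using amp_pos[of k n] S_beyond[of n k] by (auto simp: rel_def amp_def)

lemma amp_lim: "(\<lambda>n. amp n k) \<longlonglongrightarrow> sbar k"
  by (rule Lim_transform_eventually[OF scale_lim[of k]])
     (use K_lim[of k] in \<open>eventually_elim, simp add: amp_def\<close>)

lemma rel_measurable [measurable]: "random_variable borel (rel k n)"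
  unfolding rel_def[abs_def] by (cases "k < K n") simp_all

lemma rel_moment:
  assumes k: "k < K n"
  shows "integrable M (\<lambda>\<omega>. (rel k n \<omega> - 1) ^ (2 * p))"
    and "expectation (\<lambda>\<omega>. (rel k n \<omega> - 1) ^ (2 * p)) \<le> chi_law.central_moment (\<kappa> n k) (2 * p) / \<kappa> n k ^ (2 * p)"
proof -
  interpret c: chi_law "\<kappa> n k" by (rule chi_law[OF k])
  have e: "(\<lambda>\<omega>. (rel k n \<omega> - 1) ^ (2 * p)) = (\<lambda>\<omega>. (\<lambda>s. (s / amp n k - 1) ^ (2 * p)) (S n \<omega> k))"
    using k by (simp add: rel_def)
  have t: "\<theta> n * x / amp n k = x / sqrt (\<kappa> n k)" for x
    using k \<theta>_pos[OF K_pos_imp[OF k]] by (simp add: amp_def)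
  show "integrable M (\<lambda>\<omega>. (rel k n \<omega> - 1) ^ (2 * p))"
    unfolding e by (subst expectation_S[OF k]) (auto simp only: t c.abs_ratio_moment, measurable)
  have "expectation (\<lambda>\<omega>. (rel k n \<omega> - 1) ^ (2 * p)) = (\<integral>x. (x / sqrt (\<kappa> n k) - 1) ^ (2 * p) \<partial>chi_distribution (\<kappa> n k))"
    unfolding e by (subst expectation_S[OF k]) (auto simp only: t, measurable)
  also have "\<dots> \<le> c.central_moment (2 * p) / \<kappa> n k ^ (2 * p)" by (rule c.abs_ratio_moment)
  finally show "expectation (\<lambda>\<omega>. (rel k n \<omega> - 1) ^ (2 * p)) \<le> c.central_moment (2 * p) / \<kappa> n k ^ (2 * p)" .
qed

lemma rel_moment_bound:
  "\<exists>A. \<forall>\<^sub>F n in sequentially. expectation (\<lambda>\<omega>. (rel k n \<omega> - 1) ^ (2 * p)) \<le> A / real n ^ p"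
proof -
  obtain A where A: "\<And>k. k \<ge> 1 \<Longrightarrow> chi_law k \<Longrightarrow> \<bar>chi_law.central_moment k (2 * p)\<bar> \<le> A * k ^ p"
    using central_moment_bound[of "2 * p"] by auto
  obtain b where b: "b > 0" "\<forall>\<^sub>F n in sequentially. \<kappa> n k \<ge> b * real n" using \<kappa>_growth[of k] by blast
  have "\<forall>\<^sub>F n in sequentially. b * real n \<ge> 1" using b(1) by real_asymp
  then have "\<forall>\<^sub>F n in sequentially. expectation (\<lambda>\<omega>. (rel k n \<omega> - 1) ^ (2 * p)) \<le> (\<bar>A\<bar> / b ^ p) / real n ^ p"
    using b(2) K_lim[of k] eventually_gt_at_top[of 0]
  proof eventually_elim
    case (elim n)
    let ?\<kappa> = "\<kappa> n k"
    have \<kappa>: "?\<kappa> \<ge> 1" using elim by linarith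
    have "expectation (\<lambda>\<omega>. (rel k n \<omega> - 1) ^ (2 * p)) \<le> chi_law.central_moment ?\<kappa> (2 * p) / ?\<kappa> ^ (2 * p)"
      by (rule rel_moment) (rule elim)
    also have "\<dots> \<le> \<bar>A\<bar> * ?\<kappa> ^ p / ?\<kappa> ^ (2 * p)"
    proof (rule divide_right_mono)
      have "A * ?\<kappa> ^ p \<le> \<bar>A\<bar> * ?\<kappa> ^ p" using \<kappa> by (intro mult_right_mono) auto
      then show "chi_law.central_moment ?\<kappa> (2 * p) \<le> \<bar>A\<bar> * ?\<kappa> ^ p" using A[OF \<kappa> chi_law[OF elim(3)]] by linarith
    qed (use \<kappa> in simp)
    also have "\<dots> = \<bar>A\<bar> / ?\<kappa> ^ p" using \<kappa> by (simp add: mult_2 power_add)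
    also have "\<dots> \<le> \<bar>A\<bar> / (b * real n) ^ p"
      using elim b(1) by (intro divide_left_mono power_mono mult_pos_pos zero_less_power) auto
    finally show ?case by (simp add: power_mult_distrib)
  qed
  then show ?thesis by blast
qed

lemma lp_tendsto_rel: "lp_tendsto (rel k) 1"
  unfolding lp_tendsto_def lp_null_def
proof (intro conjI allI impI)
  show "integrable M (\<lambda>\<omega>. (rel k n \<omega> - 1) ^ (2 * p))" for n p
    by (cases "k < K n") (simp_all add: rel_moment, simp add: rel_def)
  fix p :: nat assume p: "p > 0"
  obtain A where A: "\<forall>\<^sub>F n in sequentially. expectation (\<lambda>\<omega>. (rel k n \<omega> - 1) ^ (2 * p)) \<le> A / real n ^ p"
    using rel_moment_bound by blast
  have "(\<lambda>n. A / real n ^ p) \<longlonglongrightarrow> 0" using p by real_asymp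
  then show "(\<lambda>n. expectation (\<lambda>\<omega>. (rel k n \<omega> - 1) ^ (2 * p))) \<longlonglongrightarrow> 0"
    by (rule tendsto_sandwich[OF _ A tendsto_const, rotated]) simp
qed simp

lemma lp_tendsto_S: "lp_tendsto (\<lambda>n \<omega>. S n \<omega> k) (sbar k)"
  using lp_tendsto_mult[OF lp_tendsto_seq[OF amp_lim[of k]] lp_tendsto_rel[of k]]
  by (simp add: S_eq_amp_rel[symmetric])

text \<open>The fourth centred moment is of order \<open>1 / n\<^sup>2\<close>, hence summable, and a series of nonnegative variables
  with summable expectations converges almost surely.\<close>

lemma AE_S_tendsto: "AE \<omega> in M. \<forall>k. (\<lambda>n. S n \<omega> k) \<longlonglongrightarrow> sbar k"
proof (subst AE_all_countable, rule allI)
  fix k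
  define W where "W n \<omega> = (rel k n \<omega> - 1) ^ 4" for n \<omega>
  have Wi: "integrable M (W n)" for n
    using rel_moment(1)[of k n 2] by (cases "k < K n") (auto simp: W_def[abs_def], simp add: rel_def)
  obtain A where A: "\<forall>\<^sub>F n in sequentially. expectation (W n) \<le> A / real n ^ 2"
    using rel_moment_bound[of k 2] by (auto simp: W_def[abs_def])
  have "summable (\<lambda>n. expectation (W n))"
  proof (rule summable_comparison_test_ev)
    show "\<forall>\<^sub>F n in sequentially. norm (expectation (W n)) \<le> A * (1 / real n ^ 2)"
      using A by eventually_elim (simp add: W_def)
    show "summable (\<lambda>n. A * (1 / real n ^ 2))"
      by (intro summable_mult inverse_power_summable[where 'a = real, unfolded inverse_eq_divide]) simp
  qed
  then have fin: "(\<Sum>n. ennreal (expectation (W n))) < \<infinity>"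
    by (simp add: suminf_ennreal2 W_def)
  have "(\<integral>\<^sup>+\<omega>. (\<Sum>n. ennreal (W n \<omega>)) \<partial>M) = (\<Sum>n. \<integral>\<^sup>+\<omega>. ennreal (W n \<omega>) \<partial>M)"
    by (rule nn_integral_suminf) (simp add: W_def)
  also have "\<dots> = (\<Sum>n. ennreal (expectation (W n)))"
    by (intro suminf_cong nn_integral_eq_integral Wi) (simp_all add: W_def)
  finally have "(\<integral>\<^sup>+\<omega>. (\<Sum>n. ennreal (W n \<omega>)) \<partial>M) \<noteq> \<infinity>" using fin by simp
  then have "AE \<omega> in M. (\<Sum>n. ennreal (W n \<omega>)) \<noteq> \<infinity>"
    by (intro nn_integral_PInf_AE) (simp_all add: W_def)
  then show "AE \<omega> in M. (\<lambda>n. S n \<omega> k) \<longlonglongrightarrow> sbar k"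
  proof eventually_elim
    case (elim \<omega>)
    have "summable (\<lambda>n. W n \<omega>)"
      by (rule summable_suminf_not_top) (use elim in \<open>auto simp: W_def\<close>)
    then have "(\<lambda>n. W n \<omega>) \<longlonglongrightarrow> 0" by (rule summable_LIMSEQ_zero)
    then have "(\<lambda>n. root 4 (\<bar>rel k n \<omega> - 1\<bar> ^ 4)) \<longlonglongrightarrow> root 4 0"
      unfolding W_def by (intro tendsto_real_root) (simp add: power_even_abs)
    moreover have "root 4 (\<bar>u\<bar> ^ 4) = \<bar>u\<bar>" for u :: real by (rule real_root_power_cancel) auto
    ultimately have "(\<lambda>n. \<bar>rel k n \<omega> - 1\<bar>) \<longlonglongrightarrow> 0" by (simp only: real_root_zero)
    then have "(\<lambda>n. rel k n \<omega> - 1) \<longlonglongrightarrow> 0" by (simp only: tendsto_rabs_zero_iff)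
    then have "(\<lambda>n. rel k n \<omega>) \<longlonglongrightarrow> 1" by (simp add: LIM_zero_iff)
    from tendsto_mult[OF amp_lim[of k] this] show ?case by (simp add: S_eq_amp_rel[symmetric])
  qed
qed

lemma AE_jwalk_tendsto: "AE \<omega> in M. \<forall>N. (\<lambda>n. jwalk (S n \<omega>) N 0) \<longlonglongrightarrow> jwalk sbar N 0"
  using AE_S_tendsto
proof eventually_elim
  case (elim \<omega>)
  have "(\<lambda>n. jwalk (S n \<omega>) N i) \<longlonglongrightarrow> jwalk sbar N i" for N i
  proof (induction N arbitrary: i)
    case (Suc N)
    show ?case unfolding jwalk.simps jshift_def
      using elim by (cases "i = 0") (auto intro!: tendsto_intros Suc)
  qed simp
  then show ?case by blast
qed

lemmas lp_jwalk = lp_tendsto_jwalk[OF lp_tendsto_S] and lp_jmom = lp_tendsto_jmom[OF lp_tendsto_S]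
  and lp_jgrad = lp_tendsto_jgrad[OF lp_tendsto_S]

end

lemma measurable_jwalk:
  assumes "\<And>k. (\<lambda>x. s x k) \<in> borel_measurable M"
  shows "(\<lambda>x. jwalk (s x) N i) \<in> borel_measurable M"
proof (induction N arbitrary: i)
  case (Suc N)
  show ?case unfolding jwalk.simps jshift_def
    by (cases "i = 0") (auto intro!: borel_measurable_add borel_measurable_times assms Suc)
qed simp

lemma measurable_jmom:
  assumes "\<And>k. (\<lambda>x. s x k) \<in> borel_measurable M"
  shows "(\<lambda>x. jmom (s x) p) \<in> borel_measurable M"
  unfolding jmom_def by (intro borel_measurable_sum borel_measurable_times measurable_jwalk assms) auto

lemma measurable_jgrad:
  assumes "\<And>k. (\<lambda>x. s x k) \<in> borel_measurable M"
  shows "(\<lambda>x. jgrad (s x) p k) \<in> borel_measurable M"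
  unfolding jgrad_def jcross_def
  by (intro borel_measurable_sum borel_measurable_times measurable_jwalk assms) auto

lemma measurable_jint:
  assumes p: "c1_approx g g' p" and s: "\<And>x. finsupp (s x)" "\<And>k. (\<lambda>x. s x k) \<in> borel_measurable M"
  shows "(\<lambda>x. jint (s x) g) \<in> borel_measurable M"
  by (rule borel_measurable_LIMSEQ_real[OF jint_approx[OF p s(1)] measurable_jmom[OF s(2)]])

lemma measurable_jgrad_lim:
  assumes p: "c1_approx g g' p" and s: "\<And>x. finsupp (s x)" "\<And>k. (\<lambda>x. s x k) \<in> borel_measurable M"
  shows "(\<lambda>x. jgrad_lim p (s x) k) \<in> borel_measurable M"
  by (rule borel_measurable_LIMSEQ_real[OF jgrad_lim[OF p s(1)] measurable_jgrad[OF s(2)]])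

lemma poly_bounded_even:
  assumes "poly_bounded g"
  shows "\<exists>C q. C \<ge> 0 \<and> (\<forall>x. \<bar>g x\<bar> \<le> C * (2 + x ^ (2 * q)))"
proof -
  obtain C q where C: "\<And>x. \<bar>g x\<bar> \<le> C * (1 + \<bar>x\<bar> ^ q)" using assms unfolding poly_bounded_def by blast
  have "\<bar>g x\<bar> \<le> \<bar>C\<bar> * (2 + x ^ (2 * q))" for x
  proof -
    have "C * (1 + \<bar>x\<bar> ^ q) \<le> \<bar>C\<bar> * (1 + \<bar>x\<bar> ^ q)" by (intro mult_right_mono) auto
    also have "\<dots> \<le> \<bar>C\<bar> * (2 + x ^ (2 * q))"
      using abs_power_le_even[of x q] by (intro mult_left_mono) auto
    finally show ?thesis using C[of x] by linarith
  qed
  then show ?thesis by (intro exI[of _ "\<bar>C\<bar>"] exI[of _ q]) auto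
qed

lemma jint_growth:
  assumes s: "finsupp s" and g: "\<And>x. \<bar>g x\<bar> \<le> C * (2 + x ^ (2 * q))"
  shows "\<bar>jint s g\<bar> \<le> C * (2 + jwalk s (2 * q) 0)"
proof -
  have b: "jint s (\<lambda>x. C * (2 + x ^ (2 * q))) = C * (2 + jwalk s (2 * q) 0)"
    by (simp only: jint_cmult jint_add jint_const[OF s] jint_power[OF s])
  have "jint s g \<le> jint s (\<lambda>x. C * (2 + x ^ (2 * q)))"
    using g by (intro jint_mono'[OF s]) (auto simp: abs_le_iff)
  moreover have "jint s (\<lambda>x. (-1) * (C * (2 + x ^ (2 * q)))) \<le> jint s g"
    using g by (intro jint_mono'[OF s]) (simp add: abs_le_iff minus_le_iff)
  ultimately show ?thesis unfolding jint_cmult[of s "-1"] b by (simp add: abs_le_iff)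
qed

lemma jgrad_eq_0: "degree p \<le> k \<Longrightarrow> jgrad s p k = 0"
  unfolding jgrad_def jcross_def by (auto intro!: sum.neutral simp: jwalk_eq_0)

lemma (in prob_space) nnvar_eq:
  assumes "integrable M X" "integrable M (\<lambda>\<omega>. (X \<omega>)\<^sup>2)"
  shows "nnvar M X = ennreal (variance X)"
  unfolding nnvar_def
proof (rule nn_integral_eq_integral)
  show "integrable M (\<lambda>\<omega>. (X \<omega> - expectation X)\<^sup>2)" using assms by (simp add: power2_diff)
qed simp

text \<open>From \<open>\<bar>exp (i a) - exp (i b)\<bar> \<le> \<bar>a - b\<bar>\<close>.\<close>

lemma (in prob_space) char_distr_diff:
  fixes X Y :: "'a \<Rightarrow> real"
  assumes [measurable]: "random_variable borel X" "random_variable borel Y"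
    and i: "integrable M (\<lambda>\<omega>. (X \<omega> - Y \<omega>)\<^sup>2)"
  shows "norm (char (distr M borel X) t - char (distr M borel Y) t) \<le> \<bar>t\<bar> * sqrt (expectation (\<lambda>\<omega>. (X \<omega> - Y \<omega>)\<^sup>2))"
proof -
  let ?D = "\<lambda>\<omega>. X \<omega> - Y \<omega>"
  have iX: "integrable M (\<lambda>\<omega>. iexp (t * Z \<omega>))" if "random_variable borel Z" for Z :: "'a \<Rightarrow> real"
    using that by (intro integrable_const_bound[of _ 1]) auto
  have iD: "integrable M (\<lambda>\<omega>. \<bar>?D \<omega>\<bar>)"
    by (rule integrable_abs, rule square_integrable_imp_integrable[OF _ i]) simp
  have "char (distr M borel X) t - char (distr M borel Y) t = expectation (\<lambda>\<omega>. iexp (t * X \<omega>) - iexp (t * Y \<omega>))"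
    unfolding char_def using iX[of X] iX[of Y] by (simp add: integral_distr del: of_real_mult)
  also have "norm \<dots> \<le> expectation (\<lambda>\<omega>. norm (iexp (t * X \<omega>) - iexp (t * Y \<omega>)))"
    by (rule integral_norm_bound)
  also have "\<dots> \<le> expectation (\<lambda>\<omega>. \<bar>t\<bar> * \<bar>?D \<omega>\<bar>)"
  proof (rule integral_mono)
    show "integrable M (\<lambda>\<omega>. norm (iexp (t * X \<omega>) - iexp (t * Y \<omega>)))"
      using iX[of X] iX[of Y] by (intro integrable_norm Bochner_Integration.integrable_diff) auto
    show "integrable M (\<lambda>\<omega>. \<bar>t\<bar> * \<bar>?D \<omega>\<bar>)" using iD by simp
    fix \<omega>
    have "iexp (t * X \<omega>) - iexp (t * Y \<omega>) = iexp (t * Y \<omega>) * (iexp (t * ?D \<omega>) - (\<Sum>k\<le>0. (\<i> * (t * ?D \<omega>)) ^ k / fact k))"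
      by (simp add: algebra_simps exp_add[symmetric])
    also have "norm \<dots> \<le> \<bar>t * ?D \<omega>\<bar> ^ Suc 0 / fact (Suc 0)"
      unfolding norm_mult using iexp_approx1[of "t * ?D \<omega>" 0] by simp
    finally show "norm (iexp (t * X \<omega>) - iexp (t * Y \<omega>)) \<le> \<bar>t\<bar> * \<bar>?D \<omega>\<bar>" by (simp add: abs_mult)
  qed
  also have "\<dots> = \<bar>t\<bar> * expectation (\<lambda>\<omega>. \<bar>?D \<omega>\<bar>)" by simp
  also have "expectation (\<lambda>\<omega>. \<bar>?D \<omega>\<bar>) \<le> sqrt (expectation (\<lambda>\<omega>. (?D \<omega>)\<^sup>2))"
  proof (rule real_le_rsqrt)
    have "0 \<le> variance (\<lambda>\<omega>. \<bar>?D \<omega>\<bar>)" by simp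
    also have "\<dots> = expectation (\<lambda>\<omega>. \<bar>?D \<omega>\<bar>\<^sup>2) - (expectation (\<lambda>\<omega>. \<bar>?D \<omega>\<bar>))\<^sup>2"
      using iD i by (intro variance_eq) auto
    finally show "(expectation (\<lambda>\<omega>. \<bar>?D \<omega>\<bar>))\<^sup>2 \<le> expectation (\<lambda>\<omega>. (?D \<omega>)\<^sup>2)" by simp
  qed
  finally show ?thesis by (simp add: mult_left_mono)
qed

context chi_jacobi begin

lemma pad_S: "(\<lambda>i. if i \<in> {..<K n} then S n \<omega> i else 0) = S n \<omega>"
  by (auto simp: fun_eq_iff S_beyond)

lemma pad_measurable:
  "(\<lambda>x. if k \<in> {..<K n} then x k else (0::real)) \<in> borel_measurable (PiM {..<K n} (\<lambda>_. borel))"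
  by (cases "k < K n") auto

lemma finsupp_pad: "finsupp (\<lambda>i. if i \<in> {..<m::nat} then x i else 0)"
  unfolding finsupp_def by (intro exI[of _ m]) auto

text \<open>Measurability of \<open>F\<close> and \<open>\<Gamma>\<close> is required in the form that they preserve measurable dependence of
  finitely supported sequences on a parameter, since no \<open>\<sigma>\<close>-algebra on the set of sequences is fixed.\<close>

lemma poincare_S:
  assumes n: "n \<ge> 1"
    and meas: "\<And>(N :: (nat \<Rightarrow> real) measure) s. (\<And>x. finsupp (s x)) \<Longrightarrow> (\<And>k. (\<lambda>x. s x k) \<in> borel_measurable N) \<Longrightarrow>
        (\<lambda>x. F (s x)) \<in> borel_measurable N"
      "\<And>(N :: (nat \<Rightarrow> real) measure) s k. (\<And>x. finsupp (s x)) \<Longrightarrow> (\<And>k. (\<lambda>x. s x k) \<in> borel_measurable N) \<Longrightarrow>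
        (\<lambda>x. \<Gamma> (s x) k) \<in> borel_measurable N"
    and deriv: "\<And>s k t. finsupp s \<Longrightarrow> ((\<lambda>t. F (s(k := t))) has_real_derivative \<Gamma> (s(k := t)) k) (at t)"
    and cont: "\<And>s k. finsupp s \<Longrightarrow> continuous_on UNIV (\<lambda>t. \<Gamma> (s(k := t)) k)"
    and L2: "integrable M (\<lambda>\<omega>. (F (S n \<omega>))\<^sup>2)"
  shows "nnvar M (\<lambda>\<omega>. F (S n \<omega>)) \<le> (\<Sum>k<K n. \<integral>\<^sup>+\<omega>. ennreal ((\<theta> n)\<^sup>2 / 2 * (\<Gamma> (S n \<omega>) k)\<^sup>2) \<partial>M)"
proof -
  have "{..<K n} \<noteq> {}" using K_pos[OF n] by auto
  note P = indep_chi_poincare[where I = "{..<K n}" and X = "\<lambda>k \<omega>. S n \<omega> k" and F = F and \<Gamma> = \<Gamma>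
      and \<kappa> = "\<kappa> n" and \<theta> = "\<theta> n", OF finite_lessThan this indep[OF n], unfolded pad_S]
  show ?thesis
  proof (rule P)
    show "(\<lambda>x. F (\<lambda>i. if i \<in> {..<K n} then x i else 0)) \<in> borel_measurable (PiM {..<K n} (\<lambda>_. borel))"
      by (rule meas(1)[OF finsupp_pad pad_measurable])
    show "(\<lambda>x. \<Gamma> (\<lambda>i. if i \<in> {..<K n} then x i else 0) k) \<in> borel_measurable (PiM {..<K n} (\<lambda>_. borel))" for k
      by (rule meas(2)[OF finsupp_pad pad_measurable])
  next
    fix x :: "nat \<Rightarrow> real" and i t
    show "((\<lambda>t. F ((\<lambda>i. if i \<in> {..<K n} then x i else 0)(i := t))) has_real_derivative
        \<Gamma> ((\<lambda>i. if i \<in> {..<K n} then x i else 0)(i := t)) i) (at t)"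
      by (rule deriv[OF finsupp_pad])
    show "continuous_on UNIV (\<lambda>t. \<Gamma> ((\<lambda>i. if i \<in> {..<K n} then x i else 0)(i := t)) i)"
      by (rule cont[OF finsupp_pad])
  qed (use law[OF n] \<kappa>_pos L2 in auto)
qed

lemma jint_L2:
  assumes p: "c1_approx g g' p" and g: "poly_bounded g"
  shows "integrable M (\<lambda>\<omega>. jint (S n \<omega>) g)" "integrable M (\<lambda>\<omega>. (jint (S n \<omega>) g)\<^sup>2)"
proof -
  obtain C q where C: "C \<ge> 0" "\<And>x. \<bar>g x\<bar> \<le> C * (2 + x ^ (2 * q))" using poly_bounded_even[OF g] by blast
  have [measurable]: "random_variable borel (\<lambda>\<omega>. jint (S n \<omega>) g)"
    by (rule measurable_jint[OF p finsupp_S S_measurable])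
  have "lp_tendsto (\<lambda>n \<omega>. (C * (2 + jwalk (S n \<omega>) (2 * q) 0)) ^ 2) ((C * (2 + jwalk sbar (2 * q) 0)) ^ 2)"
    by (intro lp_tendsto_power lp_tendsto_cmult lp_tendsto_add lp_tendsto_const lp_jwalk)
  from lp_tendsto_expectation(1)[OF this]
  show i2: "integrable M (\<lambda>\<omega>. (jint (S n \<omega>) g)\<^sup>2)"
  proof (rule Bochner_Integration.integrable_bound)
    have "\<bar>jint (S n \<omega>) g\<bar>\<^sup>2 \<le> (C * (2 + jwalk (S n \<omega>) (2 * q) 0))\<^sup>2" for \<omega>
      by (rule power_mono[OF jint_growth[OF finsupp_S C(2)]]) simp
    then show "AE \<omega> in M. norm ((jint (S n \<omega>) g)\<^sup>2) \<le> norm ((C * (2 + jwalk (S n \<omega>) (2 * q) 0))\<^sup>2)"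
      by simp
  qed simp
  show "integrable M (\<lambda>\<omega>. jint (S n \<omega>) g)"
    by (rule square_integrable_imp_integrable[OF _ i2]) simp
qed

text \<open>The central estimate: with \<open>\<theta> n\<^sup>2\<close> of order \<open>1 / n\<close> it bounds the fluctuations of \<open>jint\<close> by the size of
  \<open>g'\<close> near the spectrum, while the monomial \<open>x\<^bsup>2 L\<^esup>\<close> takes care of growth at infinity.\<close>

lemma variance_jint:
  assumes n: "n \<ge> 1" and p: "c1_approx g g' p" and g: "poly_bounded g" and g': "continuous_on UNIV g'"
    and b: "\<And>x. (g' x)\<^sup>2 \<le> e + c * x ^ (2 * L)" and c: "c \<ge> 0"
  shows "variance (\<lambda>\<omega>. jint (S n \<omega>) g) \<le> (\<theta> n)\<^sup>2 * (e + 2 * c * expectation (\<lambda>\<omega>. jwalk (S n \<omega>) (2 * L) 0))"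
proof -
  have iw: "integrable M (\<lambda>\<omega>. jwalk (S n \<omega>) (2 * L) 0)"
    by (rule lp_tendsto_expectation(1)[OF lp_jwalk])
  have nn: "0 \<le> e + 2 * c * jwalk (S n \<omega>) (2 * L) 0" for \<omega>
  proof -
    have "0 \<le> 2 * (e + 2 * c * jwalk (S n \<omega>) (2 * L) 0)"
      using sum_jgrad_lim_le[OF p finsupp_S[of n \<omega>] g' b c, where K = 0] by simp
    moreover have "0 \<le> 2 * X \<Longrightarrow> 0 \<le> X" for X :: real by simp
    ultimately show ?thesis by blast
  qed
  have "ennreal (variance (\<lambda>\<omega>. jint (S n \<omega>) g)) = nnvar M (\<lambda>\<omega>. jint (S n \<omega>) g)"
    by (rule nnvar_eq[symmetric, OF jint_L2[OF p g]])
  also have "\<dots> \<le> (\<Sum>k<K n. \<integral>\<^sup>+\<omega>. ennreal ((\<theta> n)\<^sup>2 / 2 * (jgrad_lim p (S n \<omega>) k)\<^sup>2) \<partial>M)"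
    by (rule poincare_S[OF n]) (auto simp del: fun_upd_apply intro: measurable_jint[OF p] measurable_jgrad_lim[OF p]
        has_derivative_jint[OF p] jint_L2[OF p g])
  also have "\<dots> = (\<integral>\<^sup>+\<omega>. (\<Sum>k<K n. ennreal ((\<theta> n)\<^sup>2 / 2 * (jgrad_lim p (S n \<omega>) k)\<^sup>2)) \<partial>M)"
    using measurable_jgrad_lim[OF p finsupp_S S_measurable]
    by (intro nn_integral_sum[symmetric]) auto
  also have "\<dots> \<le> (\<integral>\<^sup>+\<omega>. ennreal ((\<theta> n)\<^sup>2 * (e + 2 * c * jwalk (S n \<omega>) (2 * L) 0)) \<partial>M)"
  proof (intro nn_integral_mono)
    fix \<omega>
    have "(\<Sum>k<K n. ennreal ((\<theta> n)\<^sup>2 / 2 * (jgrad_lim p (S n \<omega>) k)\<^sup>2)) = ennreal ((\<theta> n)\<^sup>2 / 2 * (\<Sum>k<K n. (jgrad_lim p (S n \<omega>) k)\<^sup>2))"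
      by (simp add: sum_distrib_left)
    also have "\<dots> \<le> ennreal ((\<theta> n)\<^sup>2 / 2 * (2 * (e + 2 * c * jwalk (S n \<omega>) (2 * L) 0)))"
      by (intro ennreal_leI mult_left_mono sum_jgrad_lim_le[OF p finsupp_S g' b c]) auto
    also have "(\<theta> n)\<^sup>2 / 2 * (2 * X) = (\<theta> n)\<^sup>2 * X" for X by simp
    finally show "(\<Sum>k<K n. ennreal ((\<theta> n)\<^sup>2 / 2 * (jgrad_lim p (S n \<omega>) k)\<^sup>2)) \<le> ennreal ((\<theta> n)\<^sup>2 * (e + 2 * c * jwalk (S n \<omega>) (2 * L) 0))" .
  qed
  also have "\<dots> = ennreal (expectation (\<lambda>\<omega>. (\<theta> n)\<^sup>2 * (e + 2 * c * jwalk (S n \<omega>) (2 * L) 0)))"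
  proof (rule nn_integral_eq_integral)
    show "integrable M (\<lambda>\<omega>. (\<theta> n)\<^sup>2 * (e + 2 * c * jwalk (S n \<omega>) (2 * L) 0))" using iw by simp
    have "0 \<le> e + 2 * c * jwalk (S n \<omega>) (2 * L) 0" for \<omega>
      by (rule nn)
    then show "AE \<omega> in M. 0 \<le> (\<theta> n)\<^sup>2 * (e + 2 * c * jwalk (S n \<omega>) (2 * L) 0)" by simp
  qed
  also have "expectation (\<lambda>\<omega>. (\<theta> n)\<^sup>2 * (e + 2 * c * jwalk (S n \<omega>) (2 * L) 0)) = (\<theta> n)\<^sup>2 * (e + 2 * c * expectation (\<lambda>\<omega>. jwalk (S n \<omega>) (2 * L) 0))"
    using iw by (simp add: prob_space)
  finally have *: "ennreal (variance (\<lambda>\<omega>. jint (S n \<omega>) g)) \<le> ennreal ((\<theta> n)\<^sup>2 * (e + 2 * c * expectation (\<lambda>\<omega>. jwalk (S n \<omega>) (2 * L) 0)))" .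
  have "0 \<le> expectation (\<lambda>\<omega>. e + 2 * c * jwalk (S n \<omega>) (2 * L) 0)" using nn by (intro integral_nonneg_AE) auto
  then have "0 \<le> e + 2 * c * expectation (\<lambda>\<omega>. jwalk (S n \<omega>) (2 * L) 0)" using iw by (simp add: prob_space)
  then show ?thesis using * by (subst (asm) ennreal_le_iff) auto
qed

end

section \<open>The central limit theorem for polynomials\<close>

locale chi_jacobi_clt = chi_jacobi +
  fixes c :: "nat \<Rightarrow> real" and \<gamma> :: real
  assumes c_lim: "(\<lambda>n. c n * \<theta> n) \<longlonglongrightarrow> sqrt (\<gamma> / 2)" and \<gamma>_pos: "\<gamma> > 0"
begin

text \<open>\<open>lin p\<close> is the combination of the squares \<open>(S n \<omega> k)\<^sup>2\<close> whose gradient \<open>2 * coef p k * s k\<close> agrees with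
  that of \<open>jmom s p\<close> at the limit point \<open>s = sbar\<close>.  Squares are used because the normal
  approximation is available for them.\<close>

definition coef :: "real poly \<Rightarrow> nat \<Rightarrow> real" where
  "coef p k = jgrad sbar p k / (2 * sbar k)"

definition lin :: "real poly \<Rightarrow> nat \<Rightarrow> 'a \<Rightarrow> real" where
  "lin p n \<omega> = (\<Sum>k<degree p. coef p k * (S n \<omega> k)\<^sup>2)"

definition clt_var :: "real poly \<Rightarrow> real" where
  "clt_var p = (\<Sum>k<degree p. (sqrt \<gamma> / 2 * jgrad sbar p k)\<^sup>2)"

lemma lp_lin: "lp_tendsto (lin p) (\<Sum>k<degree p. coef p k * (sbar k)\<^sup>2)"
  unfolding lin_def[abs_def] by (intro lp_tendsto_sum lp_tendsto_cmult lp_tendsto_power lp_tendsto_S)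

text \<open>The Poincare inequality applied to the difference: its gradient vanishes at the limit point, hence
  tends to 0 in \<open>L\<^sup>2\<close>.\<close>

lemma lin_residual:
  "(\<lambda>n. (c n)\<^sup>2 * variance (\<lambda>\<omega>. jmom (S n \<omega>) p - lin p n \<omega>)) \<longlonglongrightarrow> 0"
proof -
  define G where "G n \<omega> k = jgrad (S n \<omega>) p k - (if k < degree p then 2 * coef p k * S n \<omega> k else 0)" for n \<omega> k
  have lpR: "lp_tendsto (\<lambda>n \<omega>. jmom (S n \<omega>) p - lin p n \<omega>) (jmom sbar p - (\<Sum>k<degree p. coef p k * (sbar k)\<^sup>2))"
    by (intro lp_tendsto_diff lp_jmom lp_lin)
  have lpG: "lp_tendsto (\<lambda>n \<omega>. (G n \<omega> k)\<^sup>2) 0" if "k < degree p" for k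
  proof -
    have "lp_tendsto (\<lambda>n \<omega>. (jgrad (S n \<omega>) p k - 2 * coef p k * S n \<omega> k)\<^sup>2) ((jgrad sbar p k - 2 * coef p k * sbar k)\<^sup>2)"
      by (intro lp_tendsto_power lp_tendsto_diff lp_jgrad lp_tendsto_cmult lp_tendsto_S)
    moreover have "jgrad sbar p k - 2 * coef p k * sbar k = 0"
      using sbar_pos[of k] by (simp add: coef_def)
    ultimately show ?thesis using that by (simp add: G_def)
  qed
  have G0: "G n \<omega> k = 0" if "k \<ge> degree p" for n \<omega> k using that by (simp add: G_def jgrad_eq_0)
  have Gi: "integrable M (\<lambda>\<omega>. (G n \<omega> k)\<^sup>2)" for n k
    by (cases "k < degree p") (use lp_tendsto_expectation(1)[OF lpG] G0 in auto)
  have var: "variance (\<lambda>\<omega>. jmom (S n \<omega>) p - lin p n \<omega>) \<le> (\<theta> n)\<^sup>2 / 2 * (\<Sum>k<degree p. expectation (\<lambda>\<omega>. (G n \<omega> k)\<^sup>2))"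
    if n: "n \<ge> 1" for n
  proof -
    have i1: "integrable M (\<lambda>\<omega>. jmom (S n \<omega>) p - lin p n \<omega>)"
      by (rule lp_tendsto_expectation(1)[OF lpR])
    have i2: "integrable M (\<lambda>\<omega>. (jmom (S n \<omega>) p - lin p n \<omega>)\<^sup>2)"
      by (rule lp_tendsto_expectation(1)[OF lp_tendsto_power[OF lpR]])
    have "ennreal (variance (\<lambda>\<omega>. jmom (S n \<omega>) p - lin p n \<omega>)) = nnvar M (\<lambda>\<omega>. jmom (S n \<omega>) p - lin p n \<omega>)"
      by (rule nnvar_eq[symmetric, OF i1 i2])
    also have "\<dots> \<le> (\<Sum>k<K n. \<integral>\<^sup>+\<omega>. ennreal ((\<theta> n)\<^sup>2 / 2 * (G n \<omega> k)\<^sup>2) \<partial>M)"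
      unfolding lin_def G_def
    proof (rule poincare_S[OF n, where F = "\<lambda>s. jmom s p - (\<Sum>k<degree p. coef p k * (s k)\<^sup>2)"
          and \<Gamma> = "\<lambda>s k. jgrad s p k - (if k < degree p then 2 * coef p k * s k else 0)"])
      fix N :: "(nat \<Rightarrow> real) measure" and s :: "(nat \<Rightarrow> real) \<Rightarrow> nat \<Rightarrow> real" and k
      assume s: "\<And>k. (\<lambda>x. s x k) \<in> borel_measurable N"
      show "(\<lambda>x. jmom (s x) p - (\<Sum>k<degree p. coef p k * (s x k)\<^sup>2)) \<in> borel_measurable N"
        by (intro borel_measurable_diff borel_measurable_sum borel_measurable_times borel_measurable_power
            borel_measurable_const measurable_jmom s)
      show "(\<lambda>x. jgrad (s x) p k - (if k < degree p then 2 * coef p k * s x k else 0)) \<in> borel_measurable N"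
        by (cases "k < degree p") (auto intro!: borel_measurable_diff borel_measurable_times measurable_jgrad s)
    next
      fix s :: "nat \<Rightarrow> real" and i t
      have sq: "((\<lambda>t. \<Sum>k<degree p. coef p k * ((s(i := t)) k)\<^sup>2) has_real_derivative (if i < degree p then 2 * coef p i * (s(i := t)) i else 0)) (at t)" for t
      proof -
        have "((\<lambda>t. coef p k * ((s(i := t)) k)\<^sup>2) has_real_derivative (if k = i then 2 * coef p i * t else 0)) (at t)" for k
          by (cases "k = i") (auto intro!: derivative_eq_intros)
        then have "((\<lambda>t. \<Sum>k<degree p. coef p k * ((s(i := t)) k)\<^sup>2) has_real_derivative (\<Sum>k<degree p. if k = i then 2 * coef p i * t else 0)) (at t)"
          by (intro DERIV_sum)
        also have "(\<Sum>k<degree p. if k = i then 2 * coef p i * t else 0) = (if i < degree p then 2 * coef p i * (s(i := t)) i else 0)"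
          by simp
        finally show ?thesis .
      qed
      show "((\<lambda>t. jmom (s(i := t)) p - (\<Sum>k<degree p. coef p k * ((s(i := t)) k)\<^sup>2)) has_real_derivative
          jgrad (s(i := t)) p i - (if i < degree p then 2 * coef p i * (s(i := t)) i else 0)) (at t)"
        by (rule DERIV_diff[OF has_derivative_jmom sq])
      have "continuous_on UNIV (\<lambda>t. jgrad (s(i := t)) p i - (if i < degree p then 2 * coef p i * t else 0))"
        by (cases "i < degree p") (auto intro!: continuous_intros continuous_jgrad simp del: fun_upd_apply)
      then show "continuous_on UNIV (\<lambda>t. jgrad (s(i := t)) p i - (if i < degree p then 2 * coef p i * (s(i := t)) i else 0))"
        by (simp only: fun_upd_same)
    next
      show "integrable M (\<lambda>\<omega>. (jmom (S n \<omega>) p - (\<Sum>k<degree p. coef p k * (S n \<omega> k)\<^sup>2))\<^sup>2)"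
        using i2 unfolding lin_def .
    qed
    also have "\<dots> = (\<Sum>k<K n. ennreal ((\<theta> n)\<^sup>2 / 2 * expectation (\<lambda>\<omega>. (G n \<omega> k)\<^sup>2)))"
      using Gi
      by (intro sum.cong refl) (simp add: nn_integral_eq_integral)
    also have "\<dots> = ennreal ((\<theta> n)\<^sup>2 / 2 * (\<Sum>k<K n. expectation (\<lambda>\<omega>. (G n \<omega> k)\<^sup>2)))"
      by (simp add: sum_distrib_left)
    finally have "variance (\<lambda>\<omega>. jmom (S n \<omega>) p - lin p n \<omega>) \<le> (\<theta> n)\<^sup>2 / 2 * (\<Sum>k<K n. expectation (\<lambda>\<omega>. (G n \<omega> k)\<^sup>2))"
      by (subst (asm) ennreal_le_iff) (auto intro!: mult_nonneg_nonneg sum_nonneg)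
    also have "(\<Sum>k<K n. expectation (\<lambda>\<omega>. (G n \<omega> k)\<^sup>2)) \<le> (\<Sum>k<max (K n) (degree p). expectation (\<lambda>\<omega>. (G n \<omega> k)\<^sup>2))"
      by (rule sum_mono2) auto
    also have "\<dots> = (\<Sum>k<degree p. expectation (\<lambda>\<omega>. (G n \<omega> k)\<^sup>2))"
      by (rule sum.mono_neutral_right) (auto simp: G0)
    finally show ?thesis by (simp add: mult_left_mono)
  qed
  have "(\<lambda>n. (c n * \<theta> n)\<^sup>2 / 2 * (\<Sum>k<degree p. expectation (\<lambda>\<omega>. (G n \<omega> k)\<^sup>2))) \<longlonglongrightarrow> (sqrt (\<gamma> / 2))\<^sup>2 / 2 * (\<Sum>k<degree p. 0)"
    using lp_tendsto_expectation(2)[OF lpG] by (intro tendsto_intros c_lim) auto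
  then have lim: "(\<lambda>n. (c n * \<theta> n)\<^sup>2 / 2 * (\<Sum>k<degree p. expectation (\<lambda>\<omega>. (G n \<omega> k)\<^sup>2))) \<longlonglongrightarrow> 0" by simp
  show ?thesis
  proof (rule tendsto_sandwich[OF _ _ tendsto_const lim])
    show "\<forall>\<^sub>F n in sequentially. (c n)\<^sup>2 * variance (\<lambda>\<omega>. jmom (S n \<omega>) p - lin p n \<omega>) \<le>
        (c n * \<theta> n)\<^sup>2 / 2 * (\<Sum>k<degree p. expectation (\<lambda>\<omega>. (G n \<omega> k)\<^sup>2))"
      using eventually_ge_at_top[of 1]
    proof eventually_elim
      case (elim n)
      have "(c n)\<^sup>2 * variance (\<lambda>\<omega>. jmom (S n \<omega>) p - lin p n \<omega>) \<le> (c n)\<^sup>2 * ((\<theta> n)\<^sup>2 / 2 * (\<Sum>k<degree p. expectation (\<lambda>\<omega>. (G n \<omega> k)\<^sup>2)))"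
        by (intro mult_left_mono var elim) auto
      then show ?case by (simp add: power_mult_distrib mult_ac)
    qed
  qed simp
qed

text \<open>A product of \<open>degree p\<close> characteristic functions, each close to a normal one by \<open>zchar_approx\<close>.\<close>

lemma lin_clt:
  "(\<lambda>n. char (distr M borel (\<lambda>\<omega>. c n * (lin p n \<omega> - expectation (lin p n)))) t)
     \<longlonglongrightarrow> complex_of_real (exp (- (t\<^sup>2 * clt_var p / 2)))"
proof -
  define b where "b n k = c n * coef p k * ((\<theta> n)\<^sup>2 * sqrt (2 * \<kappa> n k))" for n k
  define T where "T n k \<omega> = c n * coef p k * ((S n \<omega> k)\<^sup>2 - expectation (\<lambda>\<omega>. (S n \<omega> k)\<^sup>2))" for n k \<omega>
  have iS: "integrable M (\<lambda>\<omega>. (S n \<omega> k)\<^sup>2)" for n k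
    by (rule lp_tendsto_expectation(1)[OF lp_tendsto_power[OF lp_tendsto_S]])
  have eq: "c n * (lin p n \<omega> - expectation (lin p n)) = (\<Sum>k<degree p. T n k \<omega>)" for n \<omega>
    unfolding lin_def[abs_def] T_def using iS
    by (simp add: sum_distrib_left sum_subtractf right_diff_distrib mult_ac)
  have Tz: "char (distr M borel (T n k)) t = chi_law.zchar (\<kappa> n k) (t * b n k)" if k: "k < K n" for n k
  proof -
    interpret chi: chi_law "\<kappa> n k" by (rule chi_law[OF k])
    have th: "\<theta> n > 0" by (rule \<theta>_pos[OF K_pos_imp[OF k]])
    have sq: "(\<theta> n * x)\<^sup>2 = (\<theta> n)\<^sup>2 * \<kappa> n k + (\<theta> n)\<^sup>2 * sqrt (2 * \<kappa> n k) * chi.zscore x" for x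
    proof -
      have z: "sqrt (2 * \<kappa> n k) * chi.zscore x = x\<^sup>2 - \<kappa> n k"
        using chi.k_pos by (simp add: chi.zscore_def)
      show ?thesis by (simp only: mult.assoc z) (simp add: power_mult_distrib algebra_simps)
    qed
    have "expectation (\<lambda>\<omega>. (S n \<omega> k)\<^sup>2) = (\<integral>x. (\<theta> n * x)\<^sup>2 \<partial>chi_distribution (\<kappa> n k))"
      by (rule expectation_S(2)[OF k]) simp
    also have "\<dots> = (\<theta> n)\<^sup>2 * \<kappa> n k"
      unfolding sq using chi.integrable_zscore chi.prob_space by (simp add: chi.expectation_zscore)
    finally have eS: "expectation (\<lambda>\<omega>. (S n \<omega> k)\<^sup>2) = (\<theta> n)\<^sup>2 * \<kappa> n k" .
    have "char (distr M borel (T n k)) t = expectation (\<lambda>\<omega>. (\<lambda>s. iexp (t * (c n * coef p k * (s\<^sup>2 - (\<theta> n)\<^sup>2 * \<kappa> n k)))) (S n \<omega> k))"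
      unfolding char_def T_def[abs_def] eS by (subst integral_distr) auto
    also have "\<dots> = (\<integral>x. iexp (t * (c n * coef p k * ((\<theta> n * x)\<^sup>2 - (\<theta> n)\<^sup>2 * \<kappa> n k))) \<partial>chi_distribution (\<kappa> n k))"
      by (rule expectation_S(2)[OF k]) simp
    also have "\<dots> = chi.zchar (t * b n k)"
      unfolding chi.zchar_def sq b_def by (simp add: mult_ac)
    finally show ?thesis .
  qed
  have blim: "(\<lambda>n. b n k) \<longlonglongrightarrow> sqrt \<gamma> / 2 * jgrad sbar p k" for k
  proof -
    have "(\<lambda>n. (c n * \<theta> n) * coef p k * (sqrt 2 * (\<theta> n * sqrt (\<kappa> n k)))) \<longlonglongrightarrow> sqrt (\<gamma> / 2) * coef p k * (sqrt 2 * sbar k)"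
      by (intro tendsto_intros c_lim scale_lim)
    moreover have "(c n * \<theta> n) * coef p k * (sqrt 2 * (\<theta> n * sqrt (\<kappa> n k))) = b n k" for n
      by (simp add: b_def power2_eq_square real_sqrt_mult)
    moreover have "sqrt (\<gamma> / 2) * coef p k * (sqrt 2 * sbar k) = sqrt \<gamma> / 2 * jgrad sbar p k"
      using sbar_pos[of k] by (simp add: coef_def real_sqrt_divide)
    ultimately show ?thesis by simp
  qed
  have \<kappa>lim: "(\<lambda>n. sqrt (2 / \<kappa> n k)) \<longlonglongrightarrow> 0" for k
  proof -
    obtain d where d: "d > 0" "\<forall>\<^sub>F n in sequentially. \<kappa> n k \<ge> d * real n" using \<kappa>_growth by blast
    have "filterlim (\<lambda>n. d * real n) at_top sequentially" using d(1) by real_asymp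
    then have "filterlim (\<lambda>n. \<kappa> n k) at_top sequentially" using d(2) by (rule filterlim_at_top_mono)
    then have "(\<lambda>n. 2 / \<kappa> n k) \<longlonglongrightarrow> 0"
      by (intro tendsto_divide_0[OF tendsto_const] filterlim_at_top_imp_at_infinity)
    then show ?thesis using tendsto_real_sqrt by fastforce
  qed
  define \<tau> where "\<tau> k = sqrt \<gamma> / 2 * jgrad sbar p k" for k
  have lim1: "(\<lambda>n. char (distr M borel (T n k)) t) \<longlonglongrightarrow> complex_of_real (exp (- ((t * \<tau> k)\<^sup>2) / 2))" for k
  proof -
    have "(\<lambda>n. complex_of_real (exp (- ((t * b n k)\<^sup>2) / 2))) \<longlonglongrightarrow> complex_of_real (exp (- ((t * \<tau> k)\<^sup>2) / 2))"
      using blim[of k] unfolding \<tau>_def by (intro tendsto_intros) auto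
    moreover have "(\<lambda>n. char (distr M borel (T n k)) t - complex_of_real (exp (- ((t * b n k)\<^sup>2) / 2))) \<longlonglongrightarrow> 0"
    proof (rule Lim_null_comparison[OF _ \<kappa>lim[of k]])
      show "\<forall>\<^sub>F n in sequentially. norm (char (distr M borel (T n k)) t - complex_of_real (exp (- ((t * b n k)\<^sup>2) / 2))) \<le> sqrt (2 / \<kappa> n k)"
        using K_lim[of k] by eventually_elim (simp only: Tz chi_law.zchar_approx[OF chi_law])
    qed
    ultimately show ?thesis using tendsto_add by fastforce
  qed
  have "(\<lambda>n. \<Prod>k<degree p. char (distr M borel (T n k)) t) \<longlonglongrightarrow> (\<Prod>k<degree p. complex_of_real (exp (- ((t * \<tau> k)\<^sup>2) / 2)))"
    by (intro tendsto_prod lim1)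
  also have "(\<Prod>k<degree p. complex_of_real (exp (- ((t * \<tau> k)\<^sup>2) / 2))) = complex_of_real (exp (- (t\<^sup>2 * clt_var p / 2)))"
  proof -
    have "(\<Prod>k<degree p. exp (- ((t * \<tau> k)\<^sup>2) / 2)) = exp (\<Sum>k<degree p. - ((t * \<tau> k)\<^sup>2) / 2)"
      by (simp add: exp_sum)
    also have "(\<Sum>k<degree p. - ((t * \<tau> k)\<^sup>2) / 2) = - (t\<^sup>2 * clt_var p / 2)"
    proof -
      have "clt_var p = (\<Sum>k<degree p. (\<tau> k)\<^sup>2)" by (simp only: clt_var_def \<tau>_def)
      then show ?thesis by (simp add: power_mult_distrib sum_negf sum_divide_distrib sum_distrib_left)
    qed
    finally show ?thesis by (simp only: of_real_prod[symmetric])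
  qed
  finally have lim2: "(\<lambda>n. \<Prod>k<degree p. char (distr M borel (T n k)) t) \<longlonglongrightarrow> complex_of_real (exp (- (t\<^sup>2 * clt_var p / 2)))" .
  have "\<forall>\<^sub>F n in sequentially. \<forall>k\<in>{..<degree p}. k < K n"
    by (rule eventually_ball_finite) (auto intro: K_lim)
  then have "\<forall>\<^sub>F n in sequentially. (\<Prod>k<degree p. char (distr M borel (T n k)) t) =
      char (distr M borel (\<lambda>\<omega>. c n * (lin p n \<omega> - expectation (lin p n)))) t"
    using eventually_ge_at_top[of 1]
  proof eventually_elim
    case (elim n)
    have "indep_vars (\<lambda>_. borel) (\<lambda>k \<omega>. S n \<omega> k) {..<degree p}"
      by (rule indep_vars_subset[OF indep[OF elim(2)]]) (use elim(1) in auto)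
    then have "indep_vars (\<lambda>_. borel) (\<lambda>k \<omega>. (\<lambda>s. c n * coef p k * (s\<^sup>2 - expectation (\<lambda>\<omega>. (S n \<omega> k)\<^sup>2))) (S n \<omega> k)) {..<degree p}"
      by (rule indep_vars_compose2) simp
    then have "indep_vars (\<lambda>_. borel) (T n) {..<degree p}" by (simp add: T_def[abs_def])
    from char_distr_sum[OF this, of t] show ?case by (simp only: eq)
  qed
  with lim2 show ?thesis by (rule Lim_transform_eventually)
qed

end

section \<open>Walks on the alternating Jacobi matrix\<close>

definition alt_seq :: "real \<Rightarrow> nat \<Rightarrow> real" where
  "alt_seq \<gamma> k = (if even k then 1 else sqrt \<gamma>)"

lemma alt_seq_simps [simp]:
  "alt_seq \<gamma> 0 = 1" "alt_seq \<gamma> (2 * l) = 1" "alt_seq \<gamma> (Suc (2 * l)) = sqrt \<gamma>"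
  "alt_seq \<gamma> (Suc 0) = sqrt \<gamma>" "alt_seq \<gamma> (Suc (Suc k)) = alt_seq \<gamma> k"
  by (auto simp: alt_seq_def)

lemma jwalk_two_steps:
  shows "jwalk s (Suc (Suc M)) 0 = s 0 * (s 1 * jwalk s M (Suc (Suc 0)) + s 0 * jwalk s M 0)"
    and "jwalk s (Suc (Suc M)) (Suc 0) = s 1 * (s (Suc (Suc 0)) * jwalk s M (Suc (Suc (Suc 0))) + s 1 * jwalk s M (Suc 0)) + s 0 * (s 0 * jwalk s M (Suc 0))"
    and "jwalk s (Suc (Suc M)) (Suc (Suc i)) =
      s (Suc (Suc i)) * (s (Suc (Suc (Suc i))) * jwalk s M (Suc (Suc (Suc (Suc i)))) + s (Suc (Suc i)) * jwalk s M (Suc (Suc i)))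
      + s (Suc i) * (s (Suc i) * jwalk s M (Suc (Suc i)) + s i * jwalk s M i)"
  by (simp_all add: jshift_def)

text \<open>On the even and on the odd sites \<open>T\<^sup>2\<close> is a Jacobi matrix with constant coefficients \<open>1 + \<gamma>\<close> and
  \<open>sqrt \<gamma>\<close>; only at the site 0 the diagonal entry is 1.\<close>

lemma jwalk_alt_even:
  assumes "\<gamma> \<ge> 0"
  shows "jwalk (alt_seq \<gamma>) (Suc (Suc M)) (2 * m) =
    (if m = 0 then jwalk (alt_seq \<gamma>) M 0 + sqrt \<gamma> * jwalk (alt_seq \<gamma>) M 2
     else sqrt \<gamma> * jwalk (alt_seq \<gamma>) M (2 * (m - 1)) + (1 + \<gamma>) * jwalk (alt_seq \<gamma>) M (2 * m)
       + sqrt \<gamma> * jwalk (alt_seq \<gamma>) M (2 * (m + 1)))"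
proof (cases m)
  case 0
  then show ?thesis by (simp add: jwalk_two_steps numeral_2_eq_2 del: jwalk.simps)
next
  case (Suc l)
  have i: "2 * Suc l = Suc (Suc (2 * l))" "2 * (Suc l + 1) = Suc (Suc (Suc (Suc (2 * l))))" by simp_all
  show ?thesis using assms unfolding Suc i jwalk_two_steps(3) alt_seq_simps by (simp add: algebra_simps del: jwalk.simps)
qed

lemma jwalk_alt_odd:
  assumes "\<gamma> \<ge> 0"
  shows "jwalk (alt_seq \<gamma>) (Suc (Suc M)) (Suc (2 * m)) =
    (if m = 0 then 0 else sqrt \<gamma> * jwalk (alt_seq \<gamma>) M (Suc (2 * (m - 1)))) + (1 + \<gamma>) * jwalk (alt_seq \<gamma>) M (Suc (2 * m))
       + sqrt \<gamma> * jwalk (alt_seq \<gamma>) M (Suc (2 * (m + 1)))"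
proof (cases m)
  case 0
  have i: "Suc (2 * (0 + 1)) = Suc (Suc (Suc 0))" by simp
  show ?thesis using assms unfolding 0 i by (simp add: jwalk_two_steps algebra_simps del: jwalk.simps)
next
  case (Suc l)
  have i: "2 * Suc l = Suc (Suc (2 * l))" "2 * (Suc l + 1) = Suc (Suc (Suc (Suc (2 * l))))" by simp_all
  show ?thesis using assms unfolding Suc i jwalk_two_steps(3) alt_seq_simps by (simp add: algebra_simps del: jwalk.simps)
qed

text \<open>Let \<open>G\<^sub>l(z)\<close> be the generating function of the walk counts ending at the site \<open>l\<close>.  Two further sites
  cost a fixed factor \<open>q(z)\<close>, so \<open>G\<close> is \<open>q\<^sup>i G\<^sub>0\<close> at the site \<open>2 i\<close> and \<open>q\<^sup>j G\<^sub>1\<close> at the site \<open>2 j + 1\<close>, and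
  \<open>sqrt \<gamma> z G\<^sub>1 = q\<close>; the identity is the product of these relations.  The proof avoids generating
  functions: lengthening the second factor by two steps with the recurrence on the odd sites gives the
  recurrence of the right-hand side on the even sites.\<close>

lemma jwalk_alt_convolution:
  assumes \<gamma>: "\<gamma> \<ge> 0"
  shows "sqrt \<gamma> * (\<Sum>a<2 * N. jwalk (alt_seq \<gamma>) a (2 * i) * jwalk (alt_seq \<gamma>) (2 * N - 1 - a) (Suc (2 * j))) =
    jwalk (alt_seq \<gamma>) (2 * N) (2 * (i + j + 1))"
proof (induction N arbitrary: j)
  case 0 then show ?case by simp
next
  case (Suc N)
  let ?w = "jwalk (alt_seq \<gamma>)" and ?r = "sqrt \<gamma>"
  define M where "M = 2 * N"
  define f where "f j = (\<Sum>a<M. ?w a (2 * i) * ?w (M - 1 - a) (Suc (2 * j)))" for j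
  have IH: "?r * f j = ?w M (2 * (i + j + 1))" for j using Suc.IH[of j] by (simp add: f_def M_def)
  have one: "?w 1 (Suc (2 * j)) = (if j = 0 then 1 else 0)" for j
    by (cases j) (auto simp: jshift_def alt_seq_def)
  have "(\<Sum>a<Suc (Suc M). ?w a (2 * i) * ?w (Suc M - a) (Suc (2 * j))) =
     (\<Sum>a<M. ?w a (2 * i) * ?w (Suc (Suc (M - 1 - a))) (Suc (2 * j))) + ?w M (2 * i) * ?w 1 (Suc (2 * j))"
  proof -
    have "(\<Sum>a<M. ?w a (2 * i) * ?w (Suc M - a) (Suc (2 * j))) = (\<Sum>a<M. ?w a (2 * i) * ?w (Suc (Suc (M - 1 - a))) (Suc (2 * j)))"
    proof (rule sum.cong[OF refl])
      fix a assume "a \<in> {..<M}"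
      then have "Suc M - a = Suc (Suc (M - 1 - a))" by auto
      then show "?w a (2 * i) * ?w (Suc M - a) (Suc (2 * j)) = ?w a (2 * i) * ?w (Suc (Suc (M - 1 - a))) (Suc (2 * j))" by (simp only:)
    qed
    moreover have "Suc M - M = 1" "Suc M - Suc M = 0" by simp_all
    moreover have "?w 0 (Suc (2 * j)) = 0" by simp
    ultimately show ?thesis by (simp only: sum.lessThan_Suc mult_zero_right add_0_right)
  qed
  also have "(\<Sum>a<M. ?w a (2 * i) * ?w (Suc (Suc (M - 1 - a))) (Suc (2 * j))) =
     (if j = 0 then 0 else ?r * f (j - 1)) + (1 + \<gamma>) * f j + ?r * f (j + 1)"
    unfolding jwalk_alt_odd[OF \<gamma>] f_def
    by (auto simp: algebra_simps sum.distrib sum_distrib_left)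
  finally have "(\<Sum>a<Suc (Suc M). ?w a (2 * i) * ?w (Suc M - a) (Suc (2 * j))) =
     (if j = 0 then 0 else ?r * f (j - 1)) + (1 + \<gamma>) * f j + ?r * f (j + 1) + ?w M (2 * i) * (if j = 0 then 1 else 0)"
    by (simp only: one)
  then have "?r * (\<Sum>a<Suc (Suc M). ?w a (2 * i) * ?w (Suc M - a) (Suc (2 * j))) =
     ?r * (if j = 0 then ?w M (2 * i) else ?r * f (j - 1)) + (1 + \<gamma>) * (?r * f j) + ?r * (?r * f (j + 1))"
    by (simp only:) (auto simp: algebra_simps)
  also have "\<dots> = ?w (Suc (Suc M)) (2 * (i + j + 1))"
    unfolding jwalk_alt_even[OF \<gamma>] IH by (cases j) (auto simp: algebra_simps)
  finally show ?case by (simp add: M_def)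
qed

lemma jwalk_even_inner:
  assumes "2 * N + 2 * M < 2 * L"
  shows "(\<Sum>k<L. jwalk s (2 * N) (2 * k) * jwalk s (2 * M) (2 * k)) = jwalk s (2 * (N + M)) 0"
proof -
  have "(\<Sum>k<L. jwalk s (2 * N) (2 * k) * jwalk s (2 * M) (2 * k)) = (\<Sum>i\<in>(\<lambda>k. 2 * k) ` {..<L}. jwalk s (2 * N) i * jwalk s (2 * M) i)"
    by (subst sum.reindex) (auto simp: inj_on_def)
  also have "\<dots> = (\<Sum>i<2 * L. jwalk s (2 * N) i * jwalk s (2 * M) i)"
  proof (rule sum.mono_neutral_left)
    show "\<forall>i\<in>{..<2 * L} - (\<lambda>k. 2 * k) ` {..<L}. jwalk s (2 * N) i * jwalk s (2 * M) i = 0"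
    proof
      fix i assume i: "i \<in> {..<2 * L} - (\<lambda>k. 2 * k) ` {..<L}"
      have "odd i"
      proof
        assume "even i"
        then obtain k where "i = 2 * k" by (auto elim: evenE)
        then show False using i by auto
      qed
      then show "jwalk s (2 * N) i * jwalk s (2 * M) i = 0" by (simp add: jwalk_parity)
    qed
  qed auto
  also have "\<dots> = jwalk s (2 * (N + M)) 0"
    using jwalk_shift_inner[of "2 * N" "2 * M" "2 * L" s] assms by simp
  finally show ?thesis .
qed

definition even_poly :: "real poly \<Rightarrow> real poly" where
  "even_poly P = (\<Sum>N\<le>degree P. monom (coeff P N) (2 * N))"

lemma poly_even_poly: "poly (even_poly P) x = poly P (x\<^sup>2)"
  by (simp add: even_poly_def poly_sum poly_monom poly_altdef[of P] power_mult)

lemma sum_even_poly: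
  "(\<Sum>M\<le>degree (even_poly P). coeff (even_poly P) M * h M) = (\<Sum>N\<le>degree P. coeff P N * h (2 * N))"
proof -
  have co: "coeff (even_poly P) M = (\<Sum>N\<le>degree P. if 2 * N = M then coeff P N else 0)" for M
    by (simp add: even_poly_def coeff_sum)
  have "degree (even_poly P) \<le> 2 * degree P"
    by (rule degree_le) (auto simp: co intro!: sum.neutral)
  then have "(\<Sum>M\<le>degree (even_poly P). coeff (even_poly P) M * h M) = (\<Sum>M\<le>2 * degree P. coeff (even_poly P) M * h M)"
    by (intro sum.mono_neutral_left) (auto simp: coeff_eq_0)
  also have "\<dots> = (\<Sum>M\<le>2 * degree P. \<Sum>N\<le>degree P. if 2 * N = M then coeff P N * h M else 0)"
    unfolding co sum_distrib_right by (intro sum.cong refl) auto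
  also have "\<dots> = (\<Sum>N\<le>degree P. \<Sum>M\<le>2 * degree P. if 2 * N = M then coeff P N * h M else 0)"
    by (rule sum.swap)
  also have "\<dots> = (\<Sum>N\<le>degree P. coeff P N * h (2 * N))"
    by (intro sum.cong refl) (simp add: sum.delta)
  finally show ?thesis .
qed

lemma jmom_even_poly: "jmom s (even_poly P) = (\<Sum>N\<le>degree P. coeff P N * jwalk s (2 * N) 0)"
  unfolding jmom_def by (rule sum_even_poly)

lemma jgrad_alt_even_poly:
  assumes "\<gamma> \<ge> 0"
  shows "sqrt \<gamma> / 2 * jgrad (alt_seq \<gamma>) (even_poly P) k = (\<Sum>N\<le>degree P. coeff P N * jwalk (alt_seq \<gamma>) (2 * N) (2 * Suc k))"
proof -
  let ?w = "jwalk (alt_seq \<gamma>)"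
  have "sqrt \<gamma> * (\<Sum>a<2 * N. ?w a k * ?w (2 * N - 1 - a) (Suc k)) = ?w (2 * N) (2 * Suc k)" for N
  proof (cases "even k")
    case True
    then obtain i where "k = 2 * i" by (auto elim: evenE)
    then show ?thesis using jwalk_alt_convolution[OF assms, where N = N and i = i and j = i] by (simp add: mult_2)
  next
    case False
    then obtain j where k: "k = Suc (2 * j)" by (auto elim: oddE)
    have "(\<Sum>a<2 * N. ?w a k * ?w (2 * N - 1 - a) (Suc k)) = (\<Sum>a<2 * N. ?w a (Suc k) * ?w (2 * N - 1 - a) k)"
      by (subst sum.nat_diff_reindex[symmetric]) (auto intro!: sum.cong simp: mult.commute)
    then show ?thesis using jwalk_alt_convolution[OF assms, where N = N and i = "Suc j" and j = j] k by (simp add: mult_2)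
  qed
  then have "(\<Sum>N\<le>degree P. coeff P N * (sqrt \<gamma> * (\<Sum>a<2 * N. ?w a k * ?w (2 * N - 1 - a) (Suc k)))) =
     (\<Sum>N\<le>degree P. coeff P N * ?w (2 * N) (2 * Suc k))" by simp
  moreover have "sqrt \<gamma> / 2 * jgrad (alt_seq \<gamma>) (even_poly P) k =
     (\<Sum>N\<le>degree P. coeff P N * (sqrt \<gamma> * (\<Sum>a<2 * N. ?w a k * ?w (2 * N - 1 - a) (Suc k))))"
    unfolding jgrad_def jcross_def sum_even_poly by (simp add: sum_distrib_left mult_ac)
  ultimately show ?thesis by simp
qed

text \<open>The squared norm of \<open>P(T\<^sup>2) e\<^sub>0\<close>, which lives on the even sites.\<close>

lemma sum_walk_parseval:
  assumes L: "2 * degree P < L"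
  shows "(\<Sum>k<L. (\<Sum>N\<le>degree P. coeff P N * jwalk s (2 * N) (2 * k))\<^sup>2) =
    (\<Sum>N\<le>degree P. \<Sum>M\<le>degree P. coeff P N * coeff P M * jwalk s (2 * (N + M)) 0)"
proof -
  have "(\<Sum>k<L. (\<Sum>N\<le>degree P. coeff P N * jwalk s (2 * N) (2 * k))\<^sup>2) =
    (\<Sum>k<L. \<Sum>N\<le>degree P. \<Sum>M\<le>degree P. coeff P N * coeff P M * (jwalk s (2 * N) (2 * k) * jwalk s (2 * M) (2 * k)))"
    by (simp add: power2_eq_square sum_product mult_ac)
  also have "\<dots> = (\<Sum>N\<le>degree P. \<Sum>k<L. \<Sum>M\<le>degree P. coeff P N * coeff P M * (jwalk s (2 * N) (2 * k) * jwalk s (2 * M) (2 * k)))"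
    by (rule sum.swap)
  also have "\<dots> = (\<Sum>N\<le>degree P. \<Sum>M\<le>degree P. \<Sum>k<L. coeff P N * coeff P M * (jwalk s (2 * N) (2 * k) * jwalk s (2 * M) (2 * k)))"
    by (rule sum.cong[OF refl sum.swap])
  also have "\<dots> = (\<Sum>N\<le>degree P. \<Sum>M\<le>degree P. coeff P N * coeff P M * jwalk s (2 * (N + M)) 0)"
  proof (intro sum.cong refl)
    fix N M assume "N \<in> {..degree P}" "M \<in> {..degree P}"
    then have "2 * N + 2 * M < 2 * L" using L by auto
    then show "(\<Sum>k<L. coeff P N * coeff P M * (jwalk s (2 * N) (2 * k) * jwalk s (2 * M) (2 * k))) =
        coeff P N * coeff P M * jwalk s (2 * (N + M)) 0"
      by (simp only: sum_distrib_left[symmetric] jwalk_even_inner)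
  qed
  finally show ?thesis .
qed

section \<open>Moments of the Marchenko-Pastur law\<close>

locale mp_law =
  fixes \<gamma> :: real
  assumes \<gamma>: "0 < \<gamma>" "\<gamma> < 1"
begin

text \<open>The substitution \<open>x = arc \<phi>\<close> maps \<open>[0, \<pi>]\<close> onto the support \<open>[(1 - r)\<^sup>2, (1 + r)\<^sup>2]\<close> and turns the square
  root in the density into a sine.\<close>

definition r where "r = sqrt \<gamma>"
definition arc :: "real \<Rightarrow> real" where "arc \<phi> = 1 + \<gamma> - 2 * r * cos \<phi>"

lemma r: "0 < r" "r < 1" "r * r = \<gamma>" "r\<^sup>2 = \<gamma>" using \<gamma> by (auto simp: r_def)

lemma rr: "r * r = \<gamma>" "r * (r * z) = \<gamma> * z" using r(3) by (simp_all add: mult.assoc[symmetric])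

lemma arc_ge: "(1 - r)\<^sup>2 \<le> arc \<phi>"
proof -
  have "2 * r * cos \<phi> \<le> 2 * r * 1" using r by (intro mult_left_mono) auto
  then show ?thesis using r by (simp add: arc_def power2_eq_square algebra_simps)
qed

lemma l_pos: "0 < (1 - r)\<^sup>2" using r by simp

lemma arc_pos: "arc \<phi> > 0" using arc_ge l_pos less_le_trans by blast

lemma arc_nz [simp]: "arc \<phi> \<noteq> 0" using arc_pos[of \<phi>] by simp

lemma continuous_arc: "continuous_on S arc"
  unfolding arc_def[abs_def] by (intro continuous_intros)

lemma mp_eq: "(1 - r)\<^sup>2 \<le> x \<Longrightarrow> x \<le> (1 + r)\<^sup>2 \<Longrightarrow>
    mp_density \<gamma> x = sqrt (((1 + r)\<^sup>2 - x) * (x - (1 - r)\<^sup>2)) / (2 * pi * \<gamma> * x)"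
  by (auto simp: mp_density_def Let_def r_def[symmetric])

lemma mp_outside: "x \<notin> {(1 - r)\<^sup>2..(1 + r)\<^sup>2} \<Longrightarrow> mp_density \<gamma> x = 0"
  by (auto simp: mp_density_def Let_def r_def[symmetric])

lemma mp_nonneg: "mp_density \<gamma> x \<ge> 0"
proof (cases "x \<in> {(1 - r)\<^sup>2..(1 + r)\<^sup>2}")
  case True
  then have "x > 0" using l_pos by (metis atLeastAtMost_iff less_le_trans)
  then show ?thesis using True \<gamma> by (simp add: mp_eq)
qed (simp add: mp_outside)

lemma mp_measurable [measurable]: "mp_density \<gamma> \<in> borel_measurable borel"
  unfolding mp_density_def[abs_def] Let_def by measurable

lemma mp_substitution:
  assumes h: "continuous_on UNIV h"
  shows "integrable (marchenko_pastur \<gamma>) h"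
    and "(\<integral>x. h x \<partial>marchenko_pastur \<gamma>) = integral {0..pi} (\<lambda>\<phi>. h (arc \<phi>) * (2 / pi * (sin \<phi>)\<^sup>2 / arc \<phi>))"
proof -
  have [measurable]: "h \<in> borel_measurable borel" using h by (rule borel_measurable_continuous_onI)
  let ?l = "(1 - r)\<^sup>2" and ?u = "(1 + r)\<^sup>2"
  have ends: "arc 0 = ?l" "arc pi = ?u" using r by (auto simp: arc_def power2_eq_square algebra_simps)
  have cont: "continuous_on {?l..?u} (\<lambda>x. h x * (sqrt ((?u - x) * (x - ?l)) / (2 * pi * \<gamma> * x)))"
  proof (intro continuous_intros continuous_on_subset[OF h] ballI)
    fix x assume "x \<in> {?l..?u}"
    then have "x > 0" using l_pos by (metis atLeastAtMost_iff less_le_trans)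
    then show "2 * pi * \<gamma> * x \<noteq> 0" using \<gamma> by simp
  qed auto
  have si: "set_integrable lborel {?l..?u} (\<lambda>x. h x * mp_density \<gamma> x)"
    using borel_integrable_atLeastAtMost'[OF cont]
    by (rule set_integrable_cong[THEN iffD1, rotated -1]) (auto simp: mp_eq)
  have ind: "mp_density \<gamma> x * h x = indicator {?l..?u} x *\<^sub>R (h x * mp_density \<gamma> x)" for x
    by (cases "x \<in> {?l..?u}") (auto simp: mp_outside)
  have int: "integrable lborel (\<lambda>x. mp_density \<gamma> x * h x)"
    unfolding ind using si by (simp add: set_integrable_def)
  show "integrable (marchenko_pastur \<gamma>) h"
    unfolding marchenko_pastur_def using int mp_nonneg by (subst integrable_density) auto
  have "(\<integral>x. h x \<partial>marchenko_pastur \<gamma>) = (\<integral>x. mp_density \<gamma> x * h x \<partial>lborel)"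
    unfolding marchenko_pastur_def using mp_nonneg by (subst integral_density) auto
  also have "\<dots> = (\<integral>x. (h x * mp_density \<gamma> x) * indicator {arc 0..arc pi} x \<partial>lborel)"
    unfolding ind ends by (simp add: mult.commute)
  also have "\<dots> = (\<integral>\<phi>. (h (arc \<phi>) * mp_density \<gamma> (arc \<phi>)) * (2 * r * sin \<phi>) * indicator {0..pi} \<phi> \<partial>lborel)"
  proof (rule integral_substitution(2))
    show "set_integrable lborel {arc 0..arc pi} (\<lambda>x. h x * mp_density \<gamma> x)" unfolding ends by (rule si)
    show "(arc has_real_derivative 2 * r * sin \<phi>) (at \<phi>)" for \<phi>
      unfolding arc_def[abs_def] by (auto intro!: derivative_eq_intros)
    show "0 \<le> 2 * r * sin \<phi>" if "\<phi> \<in> {0..pi}" for \<phi> using that r by (auto intro!: mult_nonneg_nonneg sin_ge_zero)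
  qed (auto intro!: continuous_intros)
  also have "\<dots> = (\<integral>\<phi>. indicator {0..pi} \<phi> *\<^sub>R (h (arc \<phi>) * (2 / pi * (sin \<phi>)\<^sup>2 / arc \<phi>)) \<partial>lborel)"
  proof (intro Bochner_Integration.integral_cong refl)
    fix \<phi>
    show "(h (arc \<phi>) * mp_density \<gamma> (arc \<phi>)) * (2 * r * sin \<phi>) * indicator {0..pi} \<phi> = indicator {0..pi} \<phi> *\<^sub>R (h (arc \<phi>) * (2 / pi * (sin \<phi>)\<^sup>2 / arc \<phi>))"
    proof (cases "\<phi> \<in> {0..pi}")
      case True
      have s: "sin \<phi> \<ge> 0" using True by (intro sin_ge_zero) auto
      have "2 * r * (- cos \<phi>) \<le> 2 * r * 1" using r by (intro mult_left_mono) (auto simp: minus_le_iff)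
      then have le: "arc \<phi> \<le> ?u" using r by (simp add: arc_def power2_eq_square algebra_simps)
      have "(?u - arc \<phi>) * (arc \<phi> - ?l) = 4 * (r * r) * (1 - (cos \<phi>)\<^sup>2)"
        by (simp add: arc_def power2_eq_square algebra_simps rr)
      also have "\<dots> = (2 * r * sin \<phi>)\<^sup>2"
        by (simp add: power_mult_distrib sin_squared_eq) (simp add: power2_eq_square)
      finally have "sqrt ((?u - arc \<phi>) * (arc \<phi> - ?l)) = 2 * r * sin \<phi>" using r s by simp
      then have "mp_density \<gamma> (arc \<phi>) = 2 * r * sin \<phi> / (2 * pi * \<gamma> * arc \<phi>)" using mp_eq[OF arc_ge le] by simp
      moreover have "2 * r * sin \<phi> / (2 * pi * \<gamma> * arc \<phi>) * (2 * r * sin \<phi>) = 2 / pi * (sin \<phi>)\<^sup>2 / arc \<phi>"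
      proof -
        have "2 * r * sin \<phi> / (2 * pi * \<gamma> * arc \<phi>) * (2 * r * sin \<phi>) = (4 * (r * r) * (sin \<phi>)\<^sup>2) / (2 * pi * \<gamma> * arc \<phi>)"
          by (simp add: power2_eq_square mult_ac)
        then show ?thesis using \<gamma> unfolding r(3) by simp
      qed
      ultimately have "mp_density \<gamma> (arc \<phi>) * (2 * r * sin \<phi>) = 2 / pi * (sin \<phi>)\<^sup>2 / arc \<phi>" by (simp only:)
      moreover have "indicator {0..pi} \<phi> = (1 :: real)" using True by simp
      ultimately show ?thesis by (simp only: scaleR_one mult_1_right mult.assoc[of "h (arc \<phi>)"])
    qed simp
  qed
  also have "\<dots> = integral {0..pi} (\<lambda>\<phi>. h (arc \<phi>) * (2 / pi * (sin \<phi>)\<^sup>2 / arc \<phi>))"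
  proof -
    have "continuous_on {0..pi} (\<lambda>\<phi>. h (arc \<phi>) * (2 / pi * (sin \<phi>)\<^sup>2 / arc \<phi>))"
      by (intro continuous_intros continuous_arc continuous_on_compose2[OF h continuous_arc]) auto
    from borel_integrable_atLeastAtMost'[OF this] show ?thesis
      by (simp add: set_borel_integral_eq_integral(2)[symmetric] set_lebesgue_integral_def)
  qed
  finally show "(\<integral>x. h x \<partial>marchenko_pastur \<gamma>) = integral {0..pi} (\<lambda>\<phi>. h (arc \<phi>) * (2 / pi * (sin \<phi>)\<^sup>2 / arc \<phi>))" .
qed

text \<open>\<open>orth j \<phi> / sin \<phi>\<close> are the orthogonal polynomials of the Jacobi matrix on the even sites, evaluated
  at \<open>arc \<phi>\<close>: they satisfy the same three-term recurrence (\<open>arc_orth\<close>).\<close>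

definition sn :: "nat \<Rightarrow> real \<Rightarrow> real" where "sn j \<phi> = sin (real j * \<phi>)"

definition orth :: "nat \<Rightarrow> real \<Rightarrow> real" where
  "orth j \<phi> = (-1) ^ j * (sn (Suc j) \<phi> - r * sn j \<phi>)"

lemma sn_0 [simp]: "sn 0 \<phi> = 0" and sn_1: "sn (Suc 0) \<phi> = sin \<phi>" by (simp_all add: sn_def)

lemma sn_rec: "2 * cos \<phi> * sn (Suc j) \<phi> = sn (Suc (Suc j)) \<phi> + sn j \<phi>"
proof -
  have "real (Suc (Suc j)) * \<phi> = real (Suc j) * \<phi> + \<phi>" "real j * \<phi> = real (Suc j) * \<phi> - \<phi>" by (simp_all add: algebra_simps)
  then show ?thesis unfolding sn_def by (simp only: sin_add sin_diff) simp
qed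

lemma arc_orth:
  "arc \<phi> * orth 0 \<phi> = orth 0 \<phi> + r * orth 1 \<phi>"
  "arc \<phi> * orth (Suc i) \<phi> = r * orth i \<phi> + (1 + \<gamma>) * orth (Suc i) \<phi> + r * orth (Suc (Suc i)) \<phi>"
proof -
  have "arc \<phi> * sn (Suc j) \<phi> = (1 + \<gamma>) * sn (Suc j) \<phi> - r * (sn (Suc (Suc j)) \<phi> + sn j \<phi>)" for j
    unfolding sn_rec[symmetric] arc_def by (simp add: algebra_simps)
  note a = this
  have a0: "arc \<phi> * (sn (Suc j) \<phi> - r * sn j \<phi>) =
      (1 + \<gamma>) * sn (Suc j) \<phi> - r * (sn (Suc (Suc j)) \<phi> + sn j \<phi>) - r * (arc \<phi> * sn j \<phi>)" for j
    using a[of j] by (simp add: algebra_simps)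
  show "arc \<phi> * orth 0 \<phi> = orth 0 \<phi> + r * orth 1 \<phi>"
    using a0[of 0] by (simp add: orth_def algebra_simps rr)
  have "arc \<phi> * (sn (Suc (Suc i)) \<phi> - r * sn (Suc i) \<phi>) = - (r * (sn (Suc i) \<phi> - r * sn i \<phi>)) +
      (1 + \<gamma>) * (sn (Suc (Suc i)) \<phi> - r * sn (Suc i) \<phi>) - r * (sn (Suc (Suc (Suc i))) \<phi> - r * sn (Suc (Suc i)) \<phi>)"
    unfolding a0 a[of i] by (simp add: algebra_simps rr)
  then have "(-1) ^ Suc i * (arc \<phi> * (sn (Suc (Suc i)) \<phi> - r * sn (Suc i) \<phi>)) = (-1) ^ Suc i * (- (r * (sn (Suc i) \<phi> - r * sn i \<phi>)) +
      (1 + \<gamma>) * (sn (Suc (Suc i)) \<phi> - r * sn (Suc i) \<phi>) - r * (sn (Suc (Suc (Suc i))) \<phi> - r * sn (Suc (Suc i)) \<phi>))"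
    by simp
  then show "arc \<phi> * orth (Suc i) \<phi> = r * orth i \<phi> + (1 + \<gamma>) * orth (Suc i) \<phi> + r * orth (Suc (Suc i)) \<phi>"
    unfolding orth_def by (simp add: algebra_simps)
qed

abbreviation "v N i \<equiv> jwalk (alt_seq \<gamma>) (2 * N) (2 * i)"

lemma v_rec:
  "v (Suc N) 0 = v N 0 + r * v N 1"
  "v (Suc N) (Suc i) = r * v N i + (1 + \<gamma>) * v N (Suc i) + r * v N (Suc (Suc i))"
  using jwalk_alt_even[of \<gamma> "2 * N" 0] jwalk_alt_even[of \<gamma> "2 * N" "Suc i"] \<gamma>
  by (simp_all add: r_def del: jwalk.simps)

text \<open>A discrete Green identity for two solutions of the same recurrence; the boundary term vanishes once
  \<open>n > N\<close>.\<close>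

lemma v_orth_transfer:
  "(\<Sum>i<Suc n. v (Suc N) i * orth i \<phi>) - arc \<phi> * (\<Sum>i<Suc n. v N i * orth i \<phi>) =
     r * (v N (Suc n) * orth n \<phi> - v N n * orth (Suc n) \<phi>)"
proof (induction n)
  case 0
  have "v (Suc N) 0 * orth 0 \<phi> - arc \<phi> * (v N 0 * orth 0 \<phi>) = v (Suc N) 0 * orth 0 \<phi> - v N 0 * (arc \<phi> * orth 0 \<phi>)"
    by simp
  also have "\<dots> = r * (v N 1 * orth 0 \<phi> - v N 0 * orth 1 \<phi>)"
    unfolding arc_orth v_rec by (simp add: algebra_simps)
  finally show ?case by (simp del: jwalk.simps)
next
  case (Suc n)
  have "v (Suc N) (Suc n) * orth (Suc n) \<phi> - arc \<phi> * (v N (Suc n) * orth (Suc n) \<phi>) =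
      v (Suc N) (Suc n) * orth (Suc n) \<phi> - v N (Suc n) * (arc \<phi> * orth (Suc n) \<phi>)" by simp
  also have "\<dots> = r * (v N n * orth (Suc n) \<phi> + v N (Suc (Suc n)) * orth (Suc n) \<phi> - v N (Suc n) * (orth n \<phi> + orth (Suc (Suc n)) \<phi>))"
    unfolding arc_orth v_rec by (simp add: algebra_simps)
  finally have e: "v (Suc N) (Suc n) * orth (Suc n) \<phi> - arc \<phi> * (v N (Suc n) * orth (Suc n) \<phi>) =
      r * (v N n * orth (Suc n) \<phi> + v N (Suc (Suc n)) * orth (Suc n) \<phi> - v N (Suc n) * (orth n \<phi> + orth (Suc (Suc n)) \<phi>))" .
  define A B where "A = (\<Sum>i<Suc n. v (Suc N) i * orth i \<phi>)" and "B = (\<Sum>i<Suc n. v N i * orth i \<phi>)"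
  have "(\<Sum>i<Suc (Suc n). v (Suc N) i * orth i \<phi>) - arc \<phi> * (\<Sum>i<Suc (Suc n). v N i * orth i \<phi>) =
     (A - arc \<phi> * B) + (v (Suc N) (Suc n) * orth (Suc n) \<phi> - arc \<phi> * (v N (Suc n) * orth (Suc n) \<phi>))"
    unfolding A_def B_def by (simp only: sum.lessThan_Suc) (simp add: algebra_simps del: jwalk.simps)
  also have "A - arc \<phi> * B = r * (v N (Suc n) * orth n \<phi> - v N n * orth (Suc n) \<phi>)" using Suc.IH by (simp only: A_def B_def)
  finally show ?case unfolding e by (simp add: algebra_simps del: jwalk.simps)
qed

lemma power_arc_expansion:
  assumes "N < n"
  shows "arc \<phi> ^ N * sin \<phi> = (\<Sum>i<n. v N i * orth i \<phi>)"
  using assms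
proof (induction N)
  case 0
  have "(\<Sum>i<n. v 0 i * orth i \<phi>) = (\<Sum>i<n. if i = 0 then orth i \<phi> else 0)" by (intro sum.cong) auto
  also have "\<dots> = sin \<phi>" using 0 by (simp add: sum.delta orth_def sn_1)
  finally show ?case by simp
next
  case (Suc N)
  obtain m where m: "n = Suc m" using Suc.prems by (cases n) auto
  have z: "v N (Suc m) = 0" "v N m = 0" using Suc.prems m by (auto intro!: jwalk_eq_0)
  have "(\<Sum>i<n. v (Suc N) i * orth i \<phi>) = arc \<phi> * (\<Sum>i<n. v N i * orth i \<phi>)"
    using v_orth_transfer[of N \<phi> m] unfolding z m by simp
  also have "\<dots> = arc \<phi> ^ Suc N * sin \<phi>" using Suc by simp
  finally show ?case by simp
qed

definition orth_mass :: "nat \<Rightarrow> real" where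
  "orth_mass j = integral {0..pi} (\<lambda>\<phi>. 2 / pi * sin \<phi> * orth j \<phi> / arc \<phi>)"

lemma continuous_orth [continuous_intros]: "continuous_on S (orth j)"
  unfolding orth_def[abs_def] sn_def by (intro continuous_intros)

lemma orth_mass_integrable: "(\<lambda>\<phi>. 2 / pi * sin \<phi> * orth j \<phi> / arc \<phi>) integrable_on {0..pi}"
  by (intro integrable_continuous_interval continuous_intros continuous_arc) auto

lemma integral_sin_sn: "((\<lambda>\<phi>. sin \<phi> * sn (Suc j) \<phi>) has_integral (if j = 0 then pi / 2 else 0)) {0..pi}"
proof (cases "j = 0")
  case True
  have "((\<lambda>\<phi>. sin \<phi> * sin \<phi>) has_integral ((pi / 2 - sin (2 * pi) / 4) - (0 / 2 - sin (2 * 0) / 4))) {0..pi}"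
  proof (rule fundamental_theorem_of_calculus)
    fix x :: real
    have "((\<lambda>x. x / 2 - sin (2 * x) / 4) has_real_derivative (1 / 2 - cos (2 * x) * 2 / 4)) (at x within {0..pi})"
      by (auto intro!: derivative_eq_intros)
    also have "1 / 2 - cos (2 * x) * 2 / 4 = sin x * sin x"
      unfolding cos_double_sin by (simp add: power2_eq_square diff_divide_distrib)
    finally show "((\<lambda>x. x / 2 - sin (2 * x) / 4) has_vector_derivative sin x * sin x) (at x within {0..pi})"
      by (simp add: has_real_derivative_iff_has_vector_derivative)
  qed simp
  then show ?thesis using True by (simp add: sn_1)
next
  case False
  define a b where "a = real j" and "b = real j + 2"
  have ab: "a \<noteq> 0" "b \<noteq> 0" using False by (auto simp: a_def b_def)
  have "((\<lambda>\<phi>. sin \<phi> * sn (Suc j) \<phi>) has_integral ((sin (a * pi) / a - sin (b * pi) / b) / 2 - (sin (a * 0) / a - sin (b * 0) / b) / 2)) {0..pi}"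
  proof (rule fundamental_theorem_of_calculus)
    fix x :: real
    have "((\<lambda>x. (sin (a * x) / a - sin (b * x) / b) / 2) has_real_derivative ((cos (a * x) * a / a - cos (b * x) * b / b) / 2)) (at x within {0..pi})"
      using ab by (auto intro!: derivative_eq_intros)
    also have "(cos (a * x) * a / a - cos (b * x) * b / b) / 2 = (cos (a * x) - cos (b * x)) / 2" using ab by simp
    also have "\<dots> = sin x * sn (Suc j) x"
    proof -
      have "a * x = real (Suc j) * x - x" "b * x = real (Suc j) * x + x" by (simp_all add: a_def b_def algebra_simps)
      then show ?thesis unfolding sn_def by (simp only: cos_add cos_diff) simp
    qed
    finally show "((\<lambda>x. (sin (a * x) / a - sin (b * x) / b) / 2) has_vector_derivative sin x * sn (Suc j) x) (at x within {0..pi})"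
      by (simp add: has_real_derivative_iff_has_vector_derivative)
  qed simp
  moreover have "sin (a * pi) = 0" "sin (b * pi) = 0"
    using sin_npi[of j] sin_npi[of "j + 2"] by (simp_all add: a_def b_def add_ac)
  ultimately show ?thesis using False by simp
qed

text \<open>In \<open>orth j + r * orth (Suc j)\<close> the factor \<open>arc \<phi>\<close> splits off and cancels the denominator, which leaves
  the orthogonality of sines.\<close>

lemma orth_mass_step: "orth_mass j + r * orth_mass (Suc j) = (if j = 0 then 1 else 0)"
proof -
  have "((\<lambda>\<phi>. 2 / pi * sin \<phi> * orth j \<phi> / arc \<phi> + r * (2 / pi * sin \<phi> * orth (Suc j) \<phi> / arc \<phi>)) has_integral
      (orth_mass j + r * orth_mass (Suc j))) {0..pi}"
    unfolding orth_mass_def by (intro has_integral_add has_integral_mult_right integrable_integral orth_mass_integrable)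
  from integral_unique[OF this, symmetric]
  have "orth_mass j + r * orth_mass (Suc j) = integral {0..pi} (\<lambda>\<phi>. 2 / pi * sin \<phi> * orth j \<phi> / arc \<phi> + r * (2 / pi * sin \<phi> * orth (Suc j) \<phi> / arc \<phi>))" .
  also have "\<dots> = integral {0..pi} (\<lambda>\<phi>. (2 / pi * (-1) ^ j) * (sin \<phi> * sn (Suc j) \<phi>))"
  proof (intro Henstock_Kurzweil_Integration.integral_cong)
    fix \<phi>
    have s: "sn (Suc (Suc j)) \<phi> = 2 * cos \<phi> * sn (Suc j) \<phi> - sn j \<phi>" using sn_rec[of \<phi> j] by simp
    have "orth j \<phi> + r * orth (Suc j) \<phi> = (-1) ^ j * (arc \<phi> * sn (Suc j) \<phi>)"
      unfolding orth_def s arc_def by (simp add: algebra_simps rr)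
    then have "(orth j \<phi> + r * orth (Suc j) \<phi>) / arc \<phi> = (-1) ^ j * sn (Suc j) \<phi>" by simp
    moreover have "2 / pi * sin \<phi> * orth j \<phi> / arc \<phi> + r * (2 / pi * sin \<phi> * orth (Suc j) \<phi> / arc \<phi>) =
       2 / pi * sin \<phi> * ((orth j \<phi> + r * orth (Suc j) \<phi>) / arc \<phi>)" by (simp add: field_simps)
    ultimately show "2 / pi * sin \<phi> * orth j \<phi> / arc \<phi> + r * (2 / pi * sin \<phi> * orth (Suc j) \<phi> / arc \<phi>) =
      (2 / pi * (-1) ^ j) * (sin \<phi> * sn (Suc j) \<phi>)" by simp
  qed
  also have "\<dots> = (2 / pi * (-1) ^ j) * (if j = 0 then pi / 2 else 0)"
    by (rule integral_unique[OF has_integral_mult_right[OF integral_sin_sn]])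
  finally show ?thesis by simp
qed

text \<open>A solution of \<open>x\<^sub>j = - r x\<^bsub>j + 1\<^esub>\<close> for \<open>j \<ge> 1\<close> that is bounded must vanish, because \<open>r < 1\<close>.\<close>

lemma orth_mass_eq: "orth_mass j = (if j = 0 then 1 else 0)"
proof -
  define C where "C = 4 / (1 - r)\<^sup>2 * pi"
  have bound: "\<bar>orth_mass j\<bar> \<le> C" for j
  proof -
    have "norm (integral {0..pi} (\<lambda>\<phi>. 2 / pi * sin \<phi> * orth j \<phi> / arc \<phi>)) \<le> integral {0..pi} (\<lambda>\<phi>. 4 / (1 - r)\<^sup>2)"
    proof (rule Henstock_Kurzweil_Integration.integral_norm_bound_integral[OF orth_mass_integrable])
      fix \<phi>
      have "\<bar>orth j \<phi>\<bar> = \<bar>sn (Suc j) \<phi> - r * sn j \<phi>\<bar>" by (simp add: orth_def abs_mult)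
      also have "\<dots> \<le> \<bar>sn (Suc j) \<phi>\<bar> + \<bar>r * sn j \<phi>\<bar>" by (rule abs_triangle_ineq4)
      also have "\<dots> \<le> 1 + 1 * 1" unfolding abs_mult sn_def using r by (intro add_mono mult_mono) auto
      finally have o: "\<bar>orth j \<phi>\<bar> \<le> 2" by simp
      have "2 / pi \<le> 1" using pi_ge_two by simp
      then have "\<bar>2 / pi * sin \<phi> * orth j \<phi>\<bar> \<le> 1 * 1 * 2"
        unfolding abs_mult using o by (intro mult_mono) auto
      also have "\<dots> \<le> 4 / (1 - r)\<^sup>2 * arc \<phi>"
      proof -
        have "1 \<le> arc \<phi> / (1 - r)\<^sup>2" using arc_ge[of \<phi>] l_pos by simp
        then show ?thesis by simp
      qed
      finally show "norm (2 / pi * sin \<phi> * orth j \<phi> / arc \<phi>) \<le> 4 / (1 - r)\<^sup>2"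
        using arc_pos[of \<phi>] by (simp add: abs_div_pos pos_divide_le_eq abs_mult mult_ac)
    qed auto
    then show ?thesis by (simp add: orth_mass_def C_def mult.commute)
  qed
  have zero: "orth_mass j = 0" if "j > 0" for j
  proof -
    have it: "\<bar>orth_mass j\<bar> = r ^ k * \<bar>orth_mass (j + k)\<bar>" for k
    proof (induction k)
      case (Suc k)
      have "orth_mass (j + k) = - (r * orth_mass (Suc (j + k)))" using orth_mass_step[of "j + k"] that by simp
      then have "\<bar>orth_mass (j + k)\<bar> = r * \<bar>orth_mass (Suc (j + k))\<bar>" using r by (simp add: abs_mult)
      then show ?case using Suc by simp
    qed simp
    have "\<bar>orth_mass j\<bar> \<le> r ^ k * C" for k
      unfolding it[of k] using bound[of "j + k"] r by (intro mult_left_mono) auto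
    moreover have "(\<lambda>k. r ^ k * C) \<longlonglongrightarrow> 0 * C" using r by (intro tendsto_mult_right LIMSEQ_realpow_zero) auto
    ultimately have "\<bar>orth_mass j\<bar> \<le> 0 * C" by (intro LIMSEQ_le_const[of _ "0 * C"]) auto
    then show ?thesis by simp
  qed
  show ?thesis using zero orth_mass_step[of 0] by (cases "j = 0") auto
qed

text \<open>Expand \<open>arc \<phi> ^ N * sin \<phi>\<close> in the functions \<open>orth i\<close>; only the first of them has nonzero mass.\<close>

theorem mp_moment: "(\<integral>x. x ^ N \<partial>marchenko_pastur \<gamma>) = jwalk (alt_seq \<gamma>) (2 * N) 0"
proof -
  have "(\<integral>x. x ^ N \<partial>marchenko_pastur \<gamma>) = integral {0..pi} (\<lambda>\<phi>. arc \<phi> ^ N * (2 / pi * (sin \<phi>)\<^sup>2 / arc \<phi>))"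
    by (rule mp_substitution) (intro continuous_intros)
  also have "\<dots> = integral {0..pi} (\<lambda>\<phi>. \<Sum>i<Suc N. v N i * (2 / pi * sin \<phi> * orth i \<phi> / arc \<phi>))"
  proof (intro Henstock_Kurzweil_Integration.integral_cong)
    fix \<phi>
    have "arc \<phi> ^ N * (2 / pi * (sin \<phi>)\<^sup>2 / arc \<phi>) = (arc \<phi> ^ N * sin \<phi>) * (2 / pi * sin \<phi> / arc \<phi>)"
      by (simp add: power2_eq_square)
    also have "\<dots> = (\<Sum>i<Suc N. v N i * orth i \<phi>) * (2 / pi * sin \<phi> / arc \<phi>)"
      by (subst power_arc_expansion[of N "Suc N"]) auto
    also have "\<dots> = (\<Sum>i<Suc N. v N i * (2 / pi * sin \<phi> * orth i \<phi> / arc \<phi>))"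
      unfolding sum_distrib_right by (intro sum.cong) (auto simp: field_simps)
    finally show "arc \<phi> ^ N * (2 / pi * (sin \<phi>)\<^sup>2 / arc \<phi>) = (\<Sum>i<Suc N. v N i * (2 / pi * sin \<phi> * orth i \<phi> / arc \<phi>))" .
  qed
  also have "\<dots> = (\<Sum>i<Suc N. v N i * orth_mass i)"
    unfolding orth_mass_def
    by (intro integral_unique has_integral_sum has_integral_mult_right integrable_integral orth_mass_integrable) auto
  also have "\<dots> = (\<Sum>i<Suc N. if i = 0 then v N i else 0)"
    by (intro sum.cong) (auto simp: orth_mass_eq)
  also have "\<dots> = jwalk (alt_seq \<gamma>) (2 * N) 0" by (subst sum.delta) auto
  finally show ?thesis .
qed

end

section \<open>The spectral measure of a Wishart matrix\<close>

text \<open>The diagonal entries \<open>B (i, i)\<close> sit at the even places \<open>2 i\<close>, the subdiagonal entries \<open>B (i + 1, i)\<close> at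
  the odd places \<open>2 i + 1\<close>.\<close>

definition interleave :: "nat \<Rightarrow> real mat \<Rightarrow> nat \<Rightarrow> real" where
  "interleave n B k = (if k < 2 * n - 1 then B $$ (Suc k div 2, k div 2) else 0)"

lemma finsupp_interleave: "finsupp (interleave n B)"
  unfolding finsupp_def interleave_def by (intro exI[of _ "2 * n - 1"]) auto

lemma interleave_even: "i < n \<Longrightarrow> interleave n B (2 * i) = B $$ (i, i)"
  by (simp add: interleave_def)

lemma interleave_odd: "interleave n B (Suc (2 * i)) = (if Suc i < n then B $$ (Suc i, i) else 0)"
  by (auto simp: interleave_def)

definition lower_bidiagonal :: "nat \<Rightarrow> real mat \<Rightarrow> bool" where
  "lower_bidiagonal n B \<longleftrightarrow> B \<in> carrier_mat n n \<and>
     (\<forall>i<n. \<forall>j<n. (i, j) \<notin> bidiagonal_indices n \<longrightarrow> B $$ (i, j) = 0)"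

lemma sum_two:
  fixes f :: "nat \<Rightarrow> real"
  assumes "j < n" "\<And>l. l < n \<Longrightarrow> l \<noteq> j \<Longrightarrow> l \<noteq> Suc j \<Longrightarrow> f l = 0"
  shows "(\<Sum>l<n. f l) = f j + (if Suc j < n then f (Suc j) else 0)"
proof -
  have "(\<Sum>l<n. f l) = (\<Sum>l\<in>{j, Suc j} \<inter> {..<n}. f l)"
    using assms by (intro sum.mono_neutral_right) auto
  also have "{j, Suc j} \<inter> {..<n} = (if Suc j < n then {j, Suc j} else {j})" using assms by auto
  finally show ?thesis by auto
qed

text \<open>On the splitting of \<open>\<nat>\<close> into even and odd sites \<open>T\<close> has the off-diagonal blocks \<open>B\<close> and \<open>B\<^sup>t\<close>, so
  its square is \<open>B B\<^sup>t\<close> on the even sites.\<close>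

lemma wishart_power_entry:
  assumes B: "lower_bidiagonal n B" and i: "i < n"
  shows "((B * transpose_mat B) ^\<^sub>m N) $$ (0, i) = jwalk (interleave n B) (2 * N) (2 * i)"
  using i
proof (induction N arbitrary: i)
  case 0
  then show ?case using B by (auto simp: lower_bidiagonal_def)
next
  case (Suc N)
  let ?A = "B * transpose_mat B" and ?w = "jwalk (interleave n B)"
  have Bc: "B \<in> carrier_mat n n" and zero: "\<And>i j. i < n \<Longrightarrow> j < n \<Longrightarrow> i \<noteq> j \<Longrightarrow> i \<noteq> Suc j \<Longrightarrow> B $$ (i, j) = 0"
    using B by (auto simp: lower_bidiagonal_def bidiagonal_indices_def)
  have Ac: "?A \<in> carrier_mat n n" using Bc by auto
  have Pc: "?A ^\<^sub>m N \<in> carrier_mat n n" using Ac by simp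
  have Aent: "?A $$ (l, i) = (\<Sum>j<n. B $$ (l, j) * B $$ (i, j))" if "l < n" for l
    using Bc that Suc.prems by (auto simp: scalar_prod_def lessThan_atLeast0)
  have n0: "0 < n" using Suc.prems by auto
  have col: "(\<Sum>l<n. ?w (2 * N) (2 * l) * B $$ (l, j)) = ?w (Suc (2 * N)) (Suc (2 * j))" if j: "j < n" for j
  proof -
    have "(\<Sum>l<n. ?w (2 * N) (2 * l) * B $$ (l, j)) = ?w (2 * N) (2 * j) * B $$ (j, j)
        + (if Suc j < n then ?w (2 * N) (2 * Suc j) * B $$ (Suc j, j) else 0)"
      using zero j by (intro sum_two) auto
    then show ?thesis using j
      by (auto simp: jshift_def interleave_even interleave_odd)
  qed
  have "(?A ^\<^sub>m Suc N) $$ (0, i) = (\<Sum>l<n. (?A ^\<^sub>m N) $$ (0, l) * ?A $$ (l, i))"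
    using Pc Ac Suc.prems n0 by (auto simp: scalar_prod_def lessThan_atLeast0)
  also have "\<dots> = (\<Sum>l<n. \<Sum>j<n. ?w (2 * N) (2 * l) * B $$ (l, j) * B $$ (i, j))"
    using Suc.IH Aent by (intro sum.cong refl) (simp add: sum_distrib_left mult.assoc)
  also have "\<dots> = (\<Sum>j<n. (\<Sum>l<n. ?w (2 * N) (2 * l) * B $$ (l, j)) * B $$ (i, j))"
    by (subst sum.swap) (simp add: sum_distrib_right)
  also have "\<dots> = (\<Sum>j<n. ?w (Suc (2 * N)) (Suc (2 * j)) * B $$ (i, j))"
    using col by (intro sum.cong) auto
  also have "\<dots> = ?w (Suc (Suc (2 * N))) (2 * i)"
  proof (cases i)
    case 0
    have "(\<Sum>j<n. ?w (Suc (2 * N)) (Suc (2 * j)) * B $$ (i, j)) = (\<Sum>j<n. if j = 0 then ?w (Suc (2 * N)) (Suc (2 * j)) * B $$ (i, j) else 0)"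
      using zero Suc.prems 0 by (intro sum.cong) auto
    also have "\<dots> = ?w (Suc (2 * N)) 1 * B $$ (0, 0)" using n0 0 by (simp add: sum.delta)
    finally show ?thesis using n0 0 interleave_even[of 0 n B]
      by (simp add: jshift_def[of _ "jwalk _ (Suc _)"] del: jwalk.simps(2)) (simp add: jshift_def)
  next
    case (Suc k)
    have "(\<Sum>j<n. ?w (Suc (2 * N)) (Suc (2 * j)) * B $$ (i, j)) = ?w (Suc (2 * N)) (Suc (2 * k)) * B $$ (i, k)
       + (if Suc k < n then ?w (Suc (2 * N)) (Suc (2 * Suc k)) * B $$ (i, Suc k) else 0)"
      using zero \<open>i < n\<close> Suc by (intro sum_two) auto
    also have "\<dots> = interleave n B (2 * i) * ?w (Suc (2 * N)) (Suc (2 * i)) + interleave n B (2 * i - 1) * ?w (Suc (2 * N)) (2 * i - 1)"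
      using \<open>i < n\<close> Suc interleave_even[of i n B] interleave_odd[of n B k] by simp
    also have "\<dots> = ?w (Suc (Suc (2 * N))) (2 * i)"
      unfolding jwalk.simps(2)[of _ "Suc (2 * N)"] jshift_def[of _ "jwalk _ (Suc (2 * N))"] using Suc by simp
    finally show ?thesis .
  qed
  finally show ?case by simp
qed

lemma polynomial_interpolation:
  assumes "finite T"
  shows "\<exists>p :: real poly. \<forall>t\<in>T. poly p t = f t"
  using assms
proof (induction T rule: finite_induct)
  case (insert x T)
  then obtain p where p: "\<And>t. t \<in> T \<Longrightarrow> poly p t = f t" by blast
  define q where "q = (\<Prod>t\<in>T. [:-t, 1:])"
  have qx: "poly q x \<noteq> 0" using insert.hyps by (auto simp: q_def poly_prod)
  have qt: "poly q t = 0" if "t \<in> T" for t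
    unfolding q_def poly_prod using that insert.hyps by (intro prod_zero) auto
  show ?case
    by (rule exI[of _ "p + Polynomial.smult ((f x - poly p x) / poly q x) q"]) (use p qx qt in auto)
qed auto

lemma integral_poly_moments:
  fixes N :: "real measure" and p :: "real poly"
  assumes "\<And>k. integrable N (\<lambda>x. x ^ k)" "sets N = sets borel"
  shows "integrable N (poly p)" "(\<integral>x. poly p x \<partial>N) = (\<Sum>i\<le>degree p. coeff p i * (\<integral>x. x ^ i \<partial>N))"
proof -
  have e: "poly p = (\<lambda>x. \<Sum>i\<le>degree p. coeff p i * x ^ i)" by (simp add: fun_eq_iff poly_altdef)
  show "integrable N (poly p)" "(\<integral>x. poly p x \<partial>N) = (\<Sum>i\<le>degree p. coeff p i * (\<integral>x. x ^ i \<partial>N))"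
    unfolding e using assms(1) by simp_all
qed

text \<open>The moments see the polynomial vanishing doubly on \<open>T\<close>, so the second measure is carried by \<open>T\<close> too;
  on a finite set every function is a polynomial.\<close>

lemma moments_finite_support_unique:
  assumes N1: "real_distribution N1" and N2: "real_distribution N2"
    and i: "\<And>k. integrable N1 (\<lambda>x. x ^ k)" "\<And>k. integrable N2 (\<lambda>x. x ^ k)"
    and eq: "\<And>k. (\<integral>x. x ^ k \<partial>N1) = (\<integral>x. x ^ k \<partial>N2)"
    and T: "finite T" "AE x in N1. x \<in> T"
  shows "N2 = N1"
proof -
  interpret N1: real_distribution N1 by fact
  interpret N2: real_distribution N2 by fact
  have peq: "(\<integral>x. poly p x \<partial>N1) = (\<integral>x. poly p x \<partial>N2)" for p
    using integral_poly_moments(2)[OF i(1)] integral_poly_moments(2)[OF i(2)] eq by simp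
  define q where "q = (\<Prod>t\<in>T. [:-t, 1:])\<^sup>2"
  have q0: "poly q x = 0 \<longleftrightarrow> x \<in> T" for x using T(1) by (auto simp: q_def poly_prod)
  have qnn: "poly q x \<ge> 0" for x by (simp add: q_def)
  have "(\<integral>x. poly q x \<partial>N1) = (\<integral>x. 0 \<partial>N1)"
  proof (rule integral_cong_AE)
    show "AE x in N1. poly q x = 0" using T(2) by eventually_elim (simp add: q0)
  qed (use integral_poly_moments(1)[OF i(1)] in auto)
  then have "(\<integral>x. poly q x \<partial>N2) = 0" using peq by simp
  then have "AE x in N2. poly q x = 0"
    using integral_nonneg_eq_0_iff_AE[OF integral_poly_moments(1)[OF i(2)], of q] qnn by auto
  then have T2: "AE x in N2. x \<in> T" by (simp add: q0)
  show "N2 = N1"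
  proof (rule measure_eqI)
    fix A assume A: "A \<in> sets N2"
    obtain p :: "real poly" where p: "\<And>t. t \<in> T \<Longrightarrow> poly p t = indicator A t"
      using polynomial_interpolation[OF T(1), of "indicator A"] by blast
    have A1: "A \<in> sets N1" using A by simp
    have "measure N2 A = (\<integral>x. indicator A x \<partial>N2)" using A by simp
    also have "\<dots> = (\<integral>x. poly p x \<partial>N2)"
      using A integral_poly_moments(1)[OF i(2)]
      by (intro integral_cong_AE) (auto intro: AE_mp[OF T2] simp: p)
    also have "\<dots> = (\<integral>x. poly p x \<partial>N1)" using peq by simp
    also have "\<dots> = (\<integral>x. indicator A x \<partial>N1)"
      using A1 integral_poly_moments(1)[OF i(1)]
      by (intro integral_cong_AE) (auto intro: AE_mp[OF T(2)] simp: p)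
    also have "\<dots> = measure N1 A" using A1 by simp
    finally show "emeasure N2 A = emeasure N1 A" by (simp add: N1.emeasure_eq_measure N2.emeasure_eq_measure)
  qed simp
qed

definition square_quadrature :: "(nat \<Rightarrow> real) \<Rightarrow> real measure" where
  "square_quadrature s = distr (point_measure (fst (jquad s)) (\<lambda>x. ennreal (snd (jquad s) x))) borel (\<lambda>x. x\<^sup>2)"

lemma square_quadrature:
  assumes s: "finsupp s"
  shows "real_distribution (square_quadrature s)"
    and "f \<in> borel_measurable borel \<Longrightarrow> integrable (square_quadrature s) (f :: real \<Rightarrow> real)"
    and "f \<in> borel_measurable borel \<Longrightarrow> (\<integral>x. f x \<partial>square_quadrature s) = jint s (\<lambda>x. f (x\<^sup>2))"
    and "AE x in square_quadrature s. x \<in> (\<lambda>x. x\<^sup>2) ` fst (jquad s)"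
proof -
  let ?S = "fst (jquad s)" and ?w = "snd (jquad s)"
  let ?P = "point_measure ?S (\<lambda>x. ennreal (?w x))"
  note fin = finite_jquad[OF s] and nn = jquad_nonneg[OF s]
  have m: "(\<lambda>x. x\<^sup>2) \<in> measurable ?P (borel :: real measure)" by simp
  have "emeasure ?P (space ?P) = (\<Sum>x\<in>?S. ennreal (?w x))"
    using fin by (simp add: space_point_measure emeasure_point_measure_finite)
  also have "\<dots> = ennreal (\<Sum>x\<in>?S. ?w x)" using nn by (intro sum_ennreal) auto
  also have "(\<Sum>x\<in>?S. ?w x) = 1" using jint_const[OF s, of 1] by (simp add: jint_def)
  finally interpret P: prob_space ?P by (intro prob_spaceI) simp
  have "prob_space (square_quadrature s)" unfolding square_quadrature_def by (rule P.prob_space_distr[OF m])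
  then show "real_distribution (square_quadrature s)"
    by (simp add: real_distribution_def real_distribution_axioms_def square_quadrature_def)
  show "integrable (square_quadrature s) f" if "f \<in> borel_measurable borel" for f :: "real \<Rightarrow> real"
    unfolding square_quadrature_def using that fin
    by (subst integrable_distr_eq[OF m]) (auto intro: integrable_point_measure_finite)
  show "(\<integral>x. f x \<partial>square_quadrature s) = jint s (\<lambda>x. f (x\<^sup>2))" if "f \<in> borel_measurable borel" for f :: "real \<Rightarrow> real"
    unfolding square_quadrature_def using that fin nn
    by (subst integral_distr[OF m]) (auto simp: lebesgue_integral_point_measure_finite jint_def)
  show "AE x in square_quadrature s. x \<in> (\<lambda>x. x\<^sup>2) ` ?S"
    unfolding square_quadrature_def using fin
    by (subst AE_distr_iff[OF m]) (auto simp: AE_point_measure intro: finite_imp_closed borel_closed)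
qed

lemma spectral_measure_wishart:
  assumes B: "lower_bidiagonal n B" and n: "n \<ge> 1"
  shows "spectral_measure (B * transpose_mat B) = square_quadrature (interleave n B)"
proof -
  let ?s = "interleave n B" and ?J = "B * transpose_mat B"
  note s = finsupp_interleave[of n B]
  note Q = square_quadrature[OF s]
  have mom: "(\<integral>x. x ^ k \<partial>square_quadrature ?s) = (?J ^\<^sub>m k) $$ (0, 0)" for k
  proof -
    have "(\<integral>x. x ^ k \<partial>square_quadrature ?s) = jint ?s (\<lambda>x. (x\<^sup>2) ^ k)" by (rule Q(3)) simp
    also have "\<dots> = jwalk ?s (2 * k) 0" unfolding power_mult[symmetric] by (rule jint_power[OF s])
    also have "\<dots> = (?J ^\<^sub>m k) $$ (0, 0)" using wishart_power_entry[OF B, of 0 k] n by simp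
    finally show ?thesis .
  qed
  have int: "integrable (square_quadrature ?s) (\<lambda>x. x ^ k)" for k by (rule Q(2)) simp
  have spec: "is_spectral_measure ?J (square_quadrature ?s)"
    unfolding is_spectral_measure_def using Q(1) int mom by blast
  show ?thesis
    unfolding spectral_measure_def
  proof (rule the_equality)
    show "is_spectral_measure ?J (square_quadrature ?s)" by (rule spec)
  next
    fix \<mu> assume \<mu>: "is_spectral_measure ?J \<mu>"
    show "\<mu> = square_quadrature ?s"
    proof (rule moments_finite_support_unique)
      show "finite ((\<lambda>x. x\<^sup>2) ` fst (jquad ?s))" using finite_jquad[OF s] by simp
      show "AE x in square_quadrature ?s. x \<in> (\<lambda>x. x\<^sup>2) ` fst (jquad ?s)" by (rule Q(4))
    qed (use \<mu> Q(1) int mom in \<open>auto simp only: is_spectral_measure_def\<close>)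
  qed
qed

section \<open>Weak convergence from convergence of moments\<close>

text \<open>A high even power is negligible on \<open>[-R0, R0]\<close> and dominates any polynomial beyond \<open>R\<close>.  It absorbs the
  behaviour of a test function away from the spectrum.\<close>

lemma polynomial_majorant:
  fixes \<phi> :: "real \<Rightarrow> real"
  assumes pb: "poly_bounded \<phi>" and R: "R \<ge> 1" "0 \<le> R0" "R0 < R" and e: "e > 0"
    and small: "\<And>y. \<bar>y\<bar> \<le> R \<Longrightarrow> \<bar>\<phi> y\<bar> \<le> e"
  shows "\<exists>\<kappa> L. \<kappa> \<ge> 0 \<and> (\<forall>y. \<bar>\<phi> y\<bar> \<le> e + \<kappa> * y ^ (2 * L)) \<and> \<kappa> * R0 ^ (2 * L) \<le> e"
proof -
  obtain C q where C: "C \<ge> 0" "\<And>x. \<bar>\<phi> x\<bar> \<le> C * (2 + x ^ (2 * q))" using poly_bounded_even[OF pb] by blast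
  have "(\<lambda>l. 3 * C * R0 ^ (2 * q) * ((R0 / R)\<^sup>2) ^ l) \<longlonglongrightarrow> 3 * C * R0 ^ (2 * q) * 0"
  proof (intro tendsto_mult_left LIMSEQ_realpow_zero)
    show "(R0 / R)\<^sup>2 < 1" using power_strict_mono[of "R0 / R" 1 2] R by simp
  qed simp
  then have "\<forall>\<^sub>F l in sequentially. 3 * C * R0 ^ (2 * q) * ((R0 / R)\<^sup>2) ^ l < e"
    using e by (intro order_tendstoD) auto
  then obtain l where l: "3 * C * R0 ^ (2 * q) * ((R0 / R)\<^sup>2) ^ l < e" by (auto simp: eventually_sequentially)
  (* For \<open>\<bar>y\<bar> > R \<ge> 1\<close> one has \<open>2 + y\<^bsup>2 q\<^esup> \<le> 3 y\<^bsup>2 q\<^esup>\<close>; the exponent \<open>l\<close> makes \<open>\<kappa>\<close> small on \<open>[-R0, R0]\<close>. *)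
  define \<kappa> where "\<kappa> = 3 * C / R ^ (2 * l)"
  have \<kappa>0: "\<kappa> \<ge> 0" using C R by (simp add: \<kappa>_def)
  have "\<bar>\<phi> y\<bar> \<le> e + \<kappa> * y ^ (2 * (q + l))" for y
  proof (cases "\<bar>y\<bar> \<le> R")
    case True
    have "0 \<le> \<kappa> * y ^ (2 * (q + l))" by (intro mult_nonneg_nonneg \<kappa>0 zero_le_even_power) simp
    then show ?thesis using small[OF True] by linarith
  next
    case False
    then have y: "\<bar>y\<bar> \<ge> 1" "\<bar>y\<bar> > R" using R by auto
    have "1 \<le> \<bar>y\<bar> ^ (2 * q)" using y(1) by (rule one_le_power)
    then have y1: "1 \<le> y ^ (2 * q)" by (simp add: power_even_abs)
    have "R ^ (2 * l) \<le> \<bar>y\<bar> ^ (2 * l)" using y R by (intro power_mono) auto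
    then have y2: "1 \<le> y ^ (2 * l) / R ^ (2 * l)" using R by (simp add: power_even_abs)
    have "\<bar>\<phi> y\<bar> \<le> C * (2 + y ^ (2 * q))" by (rule C)
    also have "\<dots> \<le> C * (3 * y ^ (2 * q))" using y1 C(1) by (intro mult_left_mono) auto
    also have "\<dots> \<le> C * (3 * y ^ (2 * q)) * (y ^ (2 * l) / R ^ (2 * l))"
      using mult_left_mono[OF y2, of "C * (3 * y ^ (2 * q))"] C(1) by simp
    also have "\<dots> = \<kappa> * y ^ (2 * (q + l))" by (simp add: \<kappa>_def power_add distrib_left)
    finally show ?thesis using e by linarith
  qed
  moreover have "\<kappa> * R0 ^ (2 * (q + l)) = 3 * C * R0 ^ (2 * q) * ((R0 / R)\<^sup>2) ^ l"
    by (simp add: \<kappa>_def power_add distrib_left power_divide power_mult)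
  ultimately show ?thesis using l \<kappa>0 by (intro exI[of _ \<kappa>] exI[of _ "q + l"]) auto
qed

context mp_law begin

definition edge :: real where "edge = (1 + r)\<^sup>2"

lemma edge_pos: "edge \<ge> 1" unfolding edge_def by (rule one_le_power) (use r in simp)

lemma mp_prob: "prob_space (marchenko_pastur \<gamma>)"
proof
  have i: "integrable (marchenko_pastur \<gamma>) (\<lambda>x. 1 :: real)" by (rule mp_substitution) (rule continuous_on_const)
  have "emeasure (marchenko_pastur \<gamma>) (space (marchenko_pastur \<gamma>)) = (\<integral>\<^sup>+x. ennreal 1 \<partial>marchenko_pastur \<gamma>)" by simp
  also have "\<dots> = ennreal (\<integral>x. 1 \<partial>marchenko_pastur \<gamma>)" by (rule nn_integral_eq_integral[OF i]) simp
  also have "(\<integral>x. (1 :: real) \<partial>marchenko_pastur \<gamma>) = 1" using mp_moment[of 0] by simp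
  finally show "emeasure (marchenko_pastur \<gamma>) (space (marchenko_pastur \<gamma>)) = 1" by simp
qed

lemma sets_mp [simp]: "sets (marchenko_pastur \<gamma>) = sets borel" and space_mp [simp]: "space (marchenko_pastur \<gamma>) = UNIV"
  by (simp_all add: marchenko_pastur_def)

lemma mp_real_distribution: "real_distribution (marchenko_pastur \<gamma>)"
  using mp_prob by (simp add: real_distribution_def real_distribution_axioms_def)

lemma mp_support: "AE x in marchenko_pastur \<gamma>. 0 < x \<and> x \<le> edge"
proof -
  have "AE x in lborel. 0 < ennreal (mp_density \<gamma> x) \<longrightarrow> 0 < x \<and> x \<le> edge"
  proof (rule AE_I2, rule impI)
    fix x assume "0 < ennreal (mp_density \<gamma> x)"
    then have "x \<in> {(1 - r)\<^sup>2..(1 + r)\<^sup>2}" using mp_outside[of x] by auto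
    then have "(1 - r)\<^sup>2 \<le> x" "x \<le> (1 + r)\<^sup>2" by auto
    then show "0 < x \<and> x \<le> edge" using l_pos unfolding edge_def by linarith
  qed
  then show ?thesis unfolding marchenko_pastur_def by (subst AE_density) auto
qed

lemma mp_integral_le:
  fixes h :: "real \<Rightarrow> real"
  assumes h: "continuous_on UNIV h" and le: "\<And>x. 0 \<le> x \<Longrightarrow> x \<le> edge \<Longrightarrow> h x \<le> c"
  shows "(\<integral>x. h x \<partial>marchenko_pastur \<gamma>) \<le> c"
proof -
  interpret prob_space "marchenko_pastur \<gamma>" by (rule mp_prob)
  have "(\<integral>x. h x \<partial>marchenko_pastur \<gamma>) \<le> (\<integral>x. c \<partial>marchenko_pastur \<gamma>)"
  proof (rule integral_mono_AE[OF mp_substitution(1)[OF h]])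
    show "AE x in marchenko_pastur \<gamma>. h x \<le> c"
      using mp_support by eventually_elim (rule le, auto)
  qed simp
  then show ?thesis using prob_space by simp
qed

lemma mp_integral_abs_le:
  fixes h :: "real \<Rightarrow> real"
  assumes h: "continuous_on UNIV h" and le: "\<And>x. 0 \<le> x \<Longrightarrow> x \<le> edge \<Longrightarrow> \<bar>h x\<bar> \<le> c"
  shows "\<bar>\<integral>x. h x \<partial>marchenko_pastur \<gamma>\<bar> \<le> c"
proof -
  have "(\<integral>x. h x \<partial>marchenko_pastur \<gamma>) \<le> c"
    by (rule mp_integral_le[OF h]) (rule order_trans[OF abs_ge_self le])
  moreover have "(\<integral>x. - h x \<partial>marchenko_pastur \<gamma>) \<le> c"
    by (rule mp_integral_le[OF continuous_on_minus[OF h]]) (rule order_trans[OF abs_ge_minus_self le])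
  ultimately show ?thesis by (simp add: abs_le_iff)
qed

lemma mp_moment_le: "jwalk (alt_seq \<gamma>) (2 * N) 0 \<le> edge ^ N"
  unfolding mp_moment[symmetric] by (intro mp_integral_le continuous_intros) (auto intro: power_mono)

lemma mp_poly: "(\<integral>x. poly P x \<partial>marchenko_pastur \<gamma>) = (\<Sum>N\<le>degree P. coeff P N * jwalk (alt_seq \<gamma>) (2 * N) 0)"
proof -
  have i: "integrable (marchenko_pastur \<gamma>) (\<lambda>x. x ^ N)" for N by (rule mp_substitution) (intro continuous_intros)
  show ?thesis unfolding integral_poly_moments(2)[OF i sets_mp] mp_moment ..
qed

text \<open>The left-hand side sums the squared coordinates of \<open>P(T\<^sup>2) e\<^sub>0\<close> at the even sites except 0.  Parseval
  turns the full sum into the second moment, and the coordinate at 0 is the mean.\<close>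

lemma mp_poly_variance:
  assumes D: "D \<ge> degree (even_poly P)"
  shows "(\<Sum>k<D. (sqrt \<gamma> / 2 * jgrad (alt_seq \<gamma>) (even_poly P) k)\<^sup>2) =
    (\<integral>x. (poly P x)\<^sup>2 \<partial>marchenko_pastur \<gamma>) - (\<integral>x. poly P x \<partial>marchenko_pastur \<gamma>)\<^sup>2"
proof -
  define V where "V k = (\<Sum>N\<le>degree P. coeff P N * jwalk (alt_seq \<gamma>) (2 * N) (2 * k))" for k
  define L where "L = max D (2 * degree P + 1)"
  have i: "integrable (marchenko_pastur \<gamma>) (\<lambda>x. x ^ N)" for N by (rule mp_substitution) (intro continuous_intros)
  have tau: "sqrt \<gamma> / 2 * jgrad (alt_seq \<gamma>) (even_poly P) k = V (Suc k)" for k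
    unfolding V_def using \<gamma> by (intro jgrad_alt_even_poly) auto
  have V0: "V (Suc k) = 0" if "k \<ge> D" for k
    using tau[of k] jgrad_eq_0[of "even_poly P" k] D that by simp
  have "(\<Sum>k<D. (V (Suc k))\<^sup>2) = (\<Sum>k<L. (V (Suc k))\<^sup>2)"
    by (rule sum.mono_neutral_left) (auto simp: L_def V0)
  then have "(V 0)\<^sup>2 + (\<Sum>k<D. (V (Suc k))\<^sup>2) = (\<Sum>k<Suc L. (V k)\<^sup>2)"
    by (subst sum.lessThan_Suc_shift) simp
  also have "\<dots> = (\<Sum>N\<le>degree P. \<Sum>M\<le>degree P. coeff P N * coeff P M * jwalk (alt_seq \<gamma>) (2 * (N + M)) 0)"
    unfolding V_def by (rule sum_walk_parseval) (simp add: L_def)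
  also have "\<dots> = (\<integral>x. (\<Sum>N\<le>degree P. \<Sum>M\<le>degree P. coeff P N * coeff P M * x ^ (N + M)) \<partial>marchenko_pastur \<gamma>)"
    unfolding mp_moment[symmetric] using i
    by (simp only: Bochner_Integration.integral_sum Bochner_Integration.integrable_sum integrable_mult_right integral_mult_right_zero)
  also have "\<dots> = (\<integral>x. (poly P x)\<^sup>2 \<partial>marchenko_pastur \<gamma>)"
    by (intro Bochner_Integration.integral_cong) (auto simp: poly_altdef power2_eq_square sum_product power_add mult_ac)
  finally have "(V 0)\<^sup>2 + (\<Sum>k<D. (V (Suc k))\<^sup>2) = (\<integral>x. (poly P x)\<^sup>2 \<partial>marchenko_pastur \<gamma>)" .
  moreover have "V 0 = (\<integral>x. poly P x \<partial>marchenko_pastur \<gamma>)" by (simp add: V_def mp_poly)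
  ultimately show ?thesis unfolding tau by simp
qed

text \<open>Approximate \<open>f\<close> by a polynomial near the support; the error away from the support is controlled by a
  power whose moments converge to something small.\<close>

lemma moments_imp_convergence:
  assumes s: "\<And>n. finsupp (s n)" and lim: "\<And>N. (\<lambda>n. jwalk (s n) (2 * N) 0) \<longlonglongrightarrow> jwalk (alt_seq \<gamma>) (2 * N) 0"
    and f: "continuous_on UNIV f" "bounded (range f)"
  shows "(\<lambda>n. jint (s n) (\<lambda>x. f (x\<^sup>2))) \<longlonglongrightarrow> (\<integral>x. f x \<partial>marchenko_pastur \<gamma>)"
proof (rule LIMSEQ_I)
  fix e0 :: real assume "e0 > 0"
  define e where "e = e0 / 8"
  have e: "e > 0" using \<open>e0 > 0\<close> by (simp add: e_def)
  define R where "R = edge + 1"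
  have R: "R \<ge> 1" "0 \<le> edge" "edge < R" using edge_pos by (auto simp: R_def)
  have "continuous_on {-R..R} f" using f(1) continuous_on_subset by blast
  then obtain q where q: "real_polynomial_function q" "\<And>x. x \<in> {-R..R} \<Longrightarrow> \<bar>f x - q x\<bar> < e"
    using Stone_Weierstrass_real_polynomial_function[of "{-R..R}" f e] e by auto
  obtain a d where a: "q = (\<lambda>x. \<Sum>i\<le>d. a i * x ^ i)" using q(1) real_polynomial_function_iff_sum by auto
  define P where "P = (\<Sum>i\<le>d. monom (a i) i)"
  have Pq: "poly P x = q x" for x by (simp add: P_def a poly_sum poly_monom)
  define \<phi> where "\<phi> x = f x - poly P x" for x
  have small: "\<bar>\<phi> y\<bar> \<le> e" if "\<bar>y\<bar> \<le> R" for y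
  proof -
    have "y \<in> {-R..R}" using that by auto
    from less_imp_le[OF q(2)[OF this]] show ?thesis by (simp add: \<phi>_def Pq)
  qed
  have pb\<phi>: "poly_bounded \<phi>"
  proof -
    obtain b where b: "\<And>x. \<bar>f x\<bar> \<le> b" using f(2) by (auto simp: bounded_iff)
    obtain C k where C: "\<And>x. \<bar>poly P x\<bar> \<le> C * (1 + \<bar>x\<bar> ^ k)" using poly_bounded_poly[of P] unfolding poly_bounded_def by blast
    have "\<bar>\<phi> x\<bar> \<le> (\<bar>b\<bar> + C) * (1 + \<bar>x\<bar> ^ k)" for x
    proof -
      have "\<bar>\<phi> x\<bar> \<le> \<bar>f x\<bar> + \<bar>poly P x\<bar>" unfolding \<phi>_def by (rule abs_triangle_ineq4)
      also have "\<dots> \<le> \<bar>b\<bar> * 1 + C * (1 + \<bar>x\<bar> ^ k)" using b[of x] C[of x] by linarith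
      also have "\<bar>b\<bar> * 1 \<le> \<bar>b\<bar> * (1 + \<bar>x\<bar> ^ k)" by (intro mult_left_mono) auto
      finally show ?thesis by (simp add: algebra_simps)
    qed
    then show ?thesis unfolding poly_bounded_def by blast
  qed
  obtain \<kappa> L where \<kappa>: "\<kappa> \<ge> 0" "\<And>y. \<bar>\<phi> y\<bar> \<le> e + \<kappa> * y ^ (2 * L)" "\<kappa> * edge ^ (2 * L) \<le> e"
    using polynomial_majorant[OF pb\<phi> R e small] by metis
  have c\<phi>: "continuous_on UNIV \<phi>" unfolding \<phi>_def[abs_def] by (intro continuous_intros f)
  have mp\<phi>: "\<bar>\<integral>x. \<phi> x \<partial>marchenko_pastur \<gamma>\<bar> \<le> e"
    using R by (intro mp_integral_abs_le[OF c\<phi>] small) auto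
  have jP: "(\<lambda>n. jint (s n) (\<lambda>x. poly P (x\<^sup>2))) \<longlonglongrightarrow> (\<integral>x. poly P x \<partial>marchenko_pastur \<gamma>)"
    unfolding poly_even_poly[symmetric] jint_poly[OF s] jmom_even_poly mp_poly
    by (intro tendsto_intros lim)
  have jk: "(\<lambda>n. \<kappa> * jwalk (s n) (2 * (2 * L)) 0) \<longlonglongrightarrow> \<kappa> * jwalk (alt_seq \<gamma>) (2 * (2 * L)) 0"
    by (intro tendsto_intros lim)
  have "\<kappa> * jwalk (alt_seq \<gamma>) (2 * (2 * L)) 0 \<le> \<kappa> * edge ^ (2 * L)" using \<kappa>(1) mp_moment_le by (intro mult_left_mono)
  then have "\<kappa> * jwalk (alt_seq \<gamma>) (2 * (2 * L)) 0 < 2 * e" using \<kappa>(3) e by linarith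
  then have ev1: "\<forall>\<^sub>F n in sequentially. \<kappa> * jwalk (s n) (2 * (2 * L)) 0 < 2 * e" by (rule order_tendstoD(2)[OF jk])
  have ev2: "\<forall>\<^sub>F n in sequentially. dist (jint (s n) (\<lambda>x. poly P (x\<^sup>2))) (\<integral>x. poly P x \<partial>marchenko_pastur \<gamma>) < e"
    using jP e by (rule tendstoD)
  have "\<forall>\<^sub>F n in sequentially. norm (jint (s n) (\<lambda>x. f (x\<^sup>2)) - (\<integral>x. f x \<partial>marchenko_pastur \<gamma>)) < e0"
    using ev1 ev2
  proof eventually_elim
    case (elim n)
    have b: "jint (s n) (\<lambda>x. e + \<kappa> * (x\<^sup>2) ^ (2 * L)) = e + \<kappa> * jwalk (s n) (2 * (2 * L)) 0"
    proof -
      have "jint (s n) (\<lambda>x. e + \<kappa> * (x\<^sup>2) ^ (2 * L)) = jint (s n) (\<lambda>x. e) + jint (s n) (\<lambda>x. \<kappa> * (x\<^sup>2) ^ (2 * L))"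
        by (rule jint_add)
      also have "jint (s n) (\<lambda>x. \<kappa> * (x\<^sup>2) ^ (2 * L)) = \<kappa> * jint (s n) (\<lambda>x. x ^ (2 * (2 * L)))"
        unfolding power_mult[of _ 2 "2 * L"] by (rule jint_cmult)
      finally show ?thesis by (simp only: jint_const[OF s] jint_power[OF s])
    qed
    have "jint (s n) (\<lambda>x. \<phi> (x\<^sup>2)) \<le> jint (s n) (\<lambda>x. e + \<kappa> * (x\<^sup>2) ^ (2 * L))"
      using \<kappa>(2) by (intro jint_mono'[OF s]) (auto simp: abs_le_iff)
    moreover have "jint (s n) (\<lambda>x. (-1) * (e + \<kappa> * (x\<^sup>2) ^ (2 * L))) \<le> jint (s n) (\<lambda>x. \<phi> (x\<^sup>2))"
    proof (intro jint_mono'[OF s])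
      show "(-1) * (e + \<kappa> * (x\<^sup>2) ^ (2 * L)) \<le> \<phi> (x\<^sup>2)" for x
        using order_trans[OF abs_ge_minus_self \<kappa>(2)[of "x\<^sup>2"]] unfolding mult_minus1 by (subst minus_le_iff)
    qed
    ultimately have j\<phi>: "\<bar>jint (s n) (\<lambda>x. \<phi> (x\<^sup>2))\<bar> \<le> 3 * e"
      using elim(1) unfolding jint_cmult[of _ "-1"] b by (simp add: abs_le_iff)
    have ip: "integrable (marchenko_pastur \<gamma>) f" "integrable (marchenko_pastur \<gamma>) (poly P)"
      using f by (auto intro!: mp_substitution continuous_intros)
    have "jint (s n) (\<lambda>x. \<phi> (x\<^sup>2)) = jint (s n) (\<lambda>x. f (x\<^sup>2)) - jint (s n) (\<lambda>x. poly P (x\<^sup>2))"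
      unfolding \<phi>_def by (rule jint_diff)
    moreover have "(\<integral>x. \<phi> x \<partial>marchenko_pastur \<gamma>) = (\<integral>x. f x \<partial>marchenko_pastur \<gamma>) - (\<integral>x. poly P x \<partial>marchenko_pastur \<gamma>)"
      unfolding \<phi>_def using ip by simp
    ultimately have "\<bar>jint (s n) (\<lambda>x. f (x\<^sup>2)) - (\<integral>x. f x \<partial>marchenko_pastur \<gamma>)\<bar> \<le> 3 * e + e + e"
      using j\<phi> mp\<phi> elim(2) unfolding dist_real_def by linarith
    then show ?case using e by (simp add: e_def)
  qed
  then show "\<exists>no. \<forall>n\<ge>no. norm (jint (s n) (\<lambda>x. f (x\<^sup>2)) - (\<integral>x. f x \<partial>marchenko_pastur \<gamma>)) < e0"
    by (simp add: eventually_sequentially)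
qed

end

lemma centered_normal_char:
  assumes "v \<ge> 0"
  shows "real_distribution (centered_normal v)" "char (centered_normal v) t = complex_of_real (exp (- (t\<^sup>2 * v / 2)))"
proof -
  have *: "real_distribution (centered_normal v) \<and> char (centered_normal v) t = complex_of_real (exp (- (t\<^sup>2 * v / 2)))"
  proof (cases "v = 0")
    case True
    have "real_distribution (return borel 0 :: real measure)"
      by (simp add: real_distribution_def real_distribution_axioms_def prob_space_return)
    moreover have "char (return borel 0) t = 1" unfolding char_def by (subst integral_return) auto
    ultimately show ?thesis using True by (simp add: centered_normal_def)
  next
    case False
    then have v: "sqrt v > 0" using assms by simp
    have "distributed std_normal_distribution lborel (\<lambda>x. 0 + sqrt v * x) (normal_density (0 + sqrt v * 0) (\<bar>sqrt v\<bar> * 1))"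
    proof (rule prob_space.normal_density_affine)
      show "prob_space std_normal_distribution" by (rule prob_space_normal_density) simp
      show "distributed std_normal_distribution lborel (\<lambda>x. x) (normal_density 0 1)"
        by (simp add: distributed_def distr_id2)
    qed (use v in auto)
    then have D: "distr std_normal_distribution borel (\<lambda>x. sqrt v * x) = centered_normal v"
      using v False by (simp add: distributed_def centered_normal_def cong: distr_cong)
    interpret sn: real_distribution std_normal_distribution by (rule real_dist_normal_dist)
    have m: "(\<lambda>x. sqrt v * x) \<in> measurable std_normal_distribution borel" by simp
    have "real_distribution (centered_normal v)"
      unfolding D[symmetric] by (simp add: real_distribution_def real_distribution_axioms_def sn.prob_space_distr)
    moreover have "char (centered_normal v) t = char std_normal_distribution (t * sqrt v)"
      unfolding D[symmetric] char_def by (subst integral_distr[OF m]) (auto simp: mult_ac)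
    moreover have "(t * sqrt v)\<^sup>2 = t\<^sup>2 * v" using assms by (simp add: power_mult_distrib)
    ultimately show ?thesis by (simp add: char_std_normal_distribution)
  qed
  then show "real_distribution (centered_normal v)" "char (centered_normal v) t = complex_of_real (exp (- (t\<^sup>2 * v / 2)))" by auto
qed

section \<open>The Wishart ensemble\<close>

lemma (in prob_space) indep_vars_reindex:
  assumes ind: "indep_vars N X I" and f: "inj_on f J" "f ` J \<subseteq> I"
  shows "indep_vars (\<lambda>j. N (f j)) (\<lambda>j. X (f j)) J"
proof -
  define E where "E i = {X i -` A \<inter> space M | A. A \<in> sets (N i)}" for i
  have E: "indep_sets E I" and rv: "\<And>i. i \<in> I \<Longrightarrow> random_variable (N i) (X i)"
    using ind unfolding indep_vars_def2 E_def by auto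
  have "indep_sets (\<lambda>j. E (f j)) J"
    unfolding indep_sets_def
  proof (intro conjI allI impI ballI)
    show "E (f j) \<subseteq> events" if "j \<in> J" for j using E f that unfolding indep_sets_def by blast
    fix L A assume L: "L \<subseteq> J" "L \<noteq> {}" "finite L" and A: "A \<in> Pi L (\<lambda>j. E (f j))"
    define A' where "A' i = A (inv_into L f i)" for i
    have inj: "inj_on f L" using f(1) L(1) by (rule inj_on_subset)
    have A': "A' (f j) = A j" if "j \<in> L" for j using inj that by (simp add: A'_def inv_into_f_f)
    have "prob (\<Inter>i\<in>f ` L. A' i) = (\<Prod>i\<in>f ` L. prob (A' i))"
    proof -
      have "f ` L \<subseteq> I" "f ` L \<noteq> {}" "finite (f ` L)" using L f by auto
      moreover have "A' \<in> Pi (f ` L) E" using A A' by auto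
      ultimately show ?thesis using E unfolding indep_sets_def by blast
    qed
    then show "prob (\<Inter>j\<in>L. A j) = (\<Prod>j\<in>L. prob (A j))"
      using A' by (simp add: prod.reindex[OF inj] cong: prod.cong INF_cong)
  qed
  then show ?thesis
    unfolding indep_vars_def2 using rv f(2) by (auto simp: E_def)
qed

text \<open>The numbers of degrees of freedom of the entries, in interleaved order.\<close>

definition wishart_shape :: "(nat \<Rightarrow> real) \<Rightarrow> real \<Rightarrow> nat \<Rightarrow> nat \<Rightarrow> real" where
  "wishart_shape m \<beta> n k = \<beta> * (if even k then m n - real (k div 2) else real n - real (k div 2) - 1)"

lemma wishart_dimension_limits:
  assumes m: "\<And>n. n \<ge> 1 \<Longrightarrow> m n > real n - 1" and lim: "(\<lambda>n. real n / m n) \<longlonglongrightarrow> \<gamma>"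
  shows "(\<lambda>n. (m n - a) / m n) \<longlonglongrightarrow> 1" "(\<lambda>n. (real n - a) / m n) \<longlonglongrightarrow> \<gamma>"
proof -
  have "filterlim (\<lambda>n. real n - 1) at_top sequentially" by real_asymp
  then have top: "filterlim m at_top sequentially"
    by (rule filterlim_at_top_mono) (use m in \<open>auto simp: eventually_sequentially intro!: exI[of _ 1] less_imp_le\<close>)
  have a0: "(\<lambda>n. a / m n) \<longlonglongrightarrow> 0"
    by (rule tendsto_divide_0[OF tendsto_const filterlim_at_top_imp_at_infinity[OF top]])
  have "(\<lambda>n. 1 - a / m n) \<longlonglongrightarrow> 1 - 0" by (intro tendsto_intros a0)
  moreover have "\<forall>\<^sub>F n in sequentially. 1 - a / m n = (m n - a) / m n"
    using filterlim_at_top_dense[THEN iffD1, OF top, rule_format, of 0]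
    by eventually_elim (simp add: diff_divide_distrib)
  ultimately show "(\<lambda>n. (m n - a) / m n) \<longlonglongrightarrow> 1" by (auto intro: Lim_transform_eventually)
  have "(\<lambda>n. real n / m n - a / m n) \<longlonglongrightarrow> \<gamma> - 0" by (intro tendsto_intros lim a0)
  then show "(\<lambda>n. (real n - a) / m n) \<longlonglongrightarrow> \<gamma>" by (simp add: diff_divide_distrib)
qed

text \<open>Only \<open>m n > n - 1\<close> is assumed; it makes all numbers of degrees of freedom positive, and together with
  \<open>n / m n \<longlonglongrightarrow> \<gamma>\<close> it makes them grow linearly in \<open>n\<close>.\<close>

lemma wishart_chi_jacobi_clt:
  assumes M: "prob_space M" and \<beta>: "\<beta> > 0" and \<gamma>: "0 < \<gamma>"
    and m: "\<And>n. n \<ge> 1 \<Longrightarrow> m n > real n - 1" and lim: "(\<lambda>n. real n / m n) \<longlonglongrightarrow> \<gamma>"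
    and B: "\<And>n. n \<ge> 1 \<Longrightarrow> wishart_bidiagonal M (m n) n \<beta> (B n)"
  shows "chi_jacobi_clt M (\<lambda>n \<omega>. interleave n (B n \<omega>)) (\<lambda>n. 2 * n - 1) (wishart_shape m \<beta>)
     (\<lambda>n. 1 / sqrt (m n * \<beta>)) (alt_seq \<gamma>) (\<lambda>n. sqrt (real n * \<beta>) / sqrt 2) \<gamma>"
proof -
  interpret prob_space M by (rule M)
  have mpos: "m n > 0" if "n \<ge> 1" for n using m[OF that] that by linarith
  (* The position in the matrix of the entry at place \<open>k\<close> of the interleaved sequence. *)
  define f where "f k = (Suc k div 2, k div 2)" for k :: nat
  have split: "(\<exists>i. k = 2 * i) \<or> (\<exists>i. k = Suc (2 * i))" for k :: nat by presburger
  have f_even: "f (2 * i) = (i, i)" and f_odd: "f (Suc (2 * i)) = (Suc i, i)" for i by (simp_all add: f_def)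
  show ?thesis
  proof (unfold_locales, goal_cases)
    case (1 n k \<omega>) then show ?case by (simp add: interleave_def)
  next
    case (2 n) then show ?case by simp
  next
    case 3 show ?case by simp
  next
    case (4 n)
    have ind: "indep_vars (\<lambda>_. borel) (\<lambda>ij \<omega>. B n \<omega> $$ ij) (bidiagonal_indices n)"
      using B[OF 4] unfolding wishart_bidiagonal_def by blast
    have "inj_on f {..<2 * n - 1}"
    proof (rule inj_on_inverseI[where g = "\<lambda>(i, j). i + j"])
      have "Suc k div 2 + k div 2 = k" for k by presburger
      then show "(case f k of (i, j) \<Rightarrow> i + j) = k" for k by (simp add: f_def)
    qed
    moreover have "f ` {..<2 * n - 1} \<subseteq> bidiagonal_indices n"
    proof (rule image_subsetI)
      fix k assume k: "k \<in> {..<2 * n - 1}"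
      from split[of k] show "f k \<in> bidiagonal_indices n"
        using k by (elim disjE exE) (auto simp: f_even f_odd bidiagonal_indices_def)
    qed
    ultimately have "indep_vars (\<lambda>_. borel) (\<lambda>k \<omega>. B n \<omega> $$ f k) {..<2 * n - 1}"
      by (rule indep_vars_reindex[OF ind])
    then show ?case
      by (rule indep_vars_cong[THEN iffD1, rotated -1]) (auto simp: interleave_def f_def)
  next
    case (5 n k)
    show ?case
    proof (cases "even k")
      case True
      then obtain i where k: "k = 2 * i" by (auto elim: evenE)
      then have i: "i < n" using 5 by auto
      have "distr M borel (\<lambda>\<omega>. B n \<omega> $$ (i, i)) =
          distr (chi_distribution (\<beta> * (m n - real i))) borel (\<lambda>x. 1 / sqrt (m n * \<beta>) * x)"
        using B[OF 5(1)] i unfolding wishart_bidiagonal_def by blast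
      then show ?thesis unfolding k interleave_even[OF i] wishart_shape_def by simp
    next
      case False
      then obtain i where k: "k = Suc (2 * i)" by (auto elim: oddE)
      then have i: "Suc i < n" using 5 by auto
      have "distr M borel (\<lambda>\<omega>. B n \<omega> $$ (Suc i, i)) =
          distr (chi_distribution (\<beta> * (real n - real i - 1))) borel (\<lambda>x. 1 / sqrt (m n * \<beta>) * x)"
        using B[OF 5(1)] i unfolding wishart_bidiagonal_def by blast
      then show ?thesis using i unfolding k interleave_odd wishart_shape_def by simp
    qed
  next
    case (6 n k)
    then have n: "n \<ge> 1" by auto
    from split[of k] show ?case
    proof (elim disjE exE)
      fix i assume k: "k = 2 * i"
      then have "real i \<le> real n - 1" using 6 by auto
      then show ?case using m[OF n] \<beta> by (simp add: wishart_shape_def k)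
    next
      fix i assume k: "k = Suc (2 * i)"
      then have "real i + 1 < real n" using 6 by auto
      then show ?case using \<beta> by (simp add: wishart_shape_def k)
    qed
  next
    case (7 n) then show ?case using mpos[OF 7] \<beta> by simp
  next
    case (8 k)
    show ?case using eventually_ge_at_top[of "k + 2"] by eventually_elim auto
  next
    case (9 k)
    have "\<forall>\<^sub>F n in sequentially. \<beta> / 2 * real n \<le> wishart_shape m \<beta> n k"
      using eventually_ge_at_top[of "2 * k + 4"]
    proof eventually_elim
      case (elim n)
      have "real n / 2 \<le> real n - real (k div 2) - 1" using elim by linarith
      moreover have "real n - real (k div 2) - 1 \<le> m n - real (k div 2)" using m[of n] elim by auto
      ultimately have "real n / 2 \<le> (if even k then m n - real (k div 2) else real n - real (k div 2) - 1)" by auto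
      then have "\<beta> * (real n / 2) \<le> wishart_shape m \<beta> n k"
        unfolding wishart_shape_def using \<beta> by (intro mult_left_mono) auto
      then show ?case by simp
    qed
    then show ?case using \<beta> by (intro exI[of _ "\<beta> / 2"]) auto
  next
    case (10 k)
    define h where "h n = (if even k then m n - real (k div 2) else real n - real (k div 2) - 1) / m n" for n
    have "h \<longlonglongrightarrow> (if even k then 1 else \<gamma>)"
      using wishart_dimension_limits[OF m lim, of "real (k div 2)"] wishart_dimension_limits(2)[OF m lim, of "real (k div 2) + 1"]
      by (auto simp: h_def[abs_def] algebra_simps)
    then have "(\<lambda>n. sqrt (h n)) \<longlonglongrightarrow> sqrt (if even k then 1 else \<gamma>)" by (rule tendsto_real_sqrt)
    moreover have "sqrt (if even k then 1 else \<gamma>) = alt_seq \<gamma> k" by (simp add: alt_seq_def)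
    moreover have "\<forall>\<^sub>F n in sequentially. sqrt (h n) = 1 / sqrt (m n * \<beta>) * sqrt (wishart_shape m \<beta> n k)"
      using eventually_ge_at_top[of 1]
    proof eventually_elim
      case (elim n)
      then show ?case using mpos[of n] \<beta>
        by (simp add: h_def wishart_shape_def real_sqrt_mult real_sqrt_divide)
    qed
    ultimately show ?case by (auto intro: Lim_transform_eventually)
  next
    case (11 k) show ?case using \<gamma> by (simp add: alt_seq_def)
  next
    case 12
    have "(\<lambda>n. sqrt (real n / m n) / sqrt 2) \<longlonglongrightarrow> sqrt \<gamma> / sqrt 2" by (intro tendsto_intros lim) auto
    moreover have "\<forall>\<^sub>F n in sequentially. sqrt (real n / m n) / sqrt 2 = sqrt (real n * \<beta>) / sqrt 2 * (1 / sqrt (m n * \<beta>))"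
      using eventually_ge_at_top[of 1]
    proof eventually_elim
      case (elim n)
      then show ?case using mpos[of n] \<beta> by (simp add: real_sqrt_mult real_sqrt_divide)
    qed
    ultimately show ?case by (auto simp: real_sqrt_divide intro: Lim_transform_eventually)
  next
    case 13 show ?case by (rule \<gamma>)
  qed
qed

section \<open>Central limit theorem for continuously differentiable functions\<close>

lemma poly_bounded_antiderivative:
  assumes d: "\<And>x. (f has_real_derivative f' x) (at x)" and pb: "poly_bounded f'"
  shows "poly_bounded f"
proof -
  obtain C q where C: "C \<ge> 0" "\<And>x. \<bar>f' x\<bar> \<le> C * (2 + x ^ (2 * q))" using poly_bounded_even[OF pb] by blast
  have "\<bar>f x\<bar> \<le> (\<bar>f 0\<bar> + 3 * C) * (1 + \<bar>x\<bar> ^ Suc (2 * q))" for x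
  proof -
    have "norm (f x - f 0) \<le> C * (2 + \<bar>x\<bar> ^ (2 * q)) * norm (x - 0)"
    proof (rule field_differentiable_bound[where S = "{-\<bar>x\<bar>..\<bar>x\<bar>}" and f = f and f' = f' and x = x and y = 0])
      show "(f has_field_derivative f' z) (at z within {-\<bar>x\<bar>..\<bar>x\<bar>})" for z
        by (rule has_field_derivative_at_within[OF d])
      show "norm (f' z) \<le> C * (2 + \<bar>x\<bar> ^ (2 * q))" if "z \<in> {-\<bar>x\<bar>..\<bar>x\<bar>}" for z
      proof -
        have "\<bar>z\<bar> ^ (2 * q) \<le> \<bar>x\<bar> ^ (2 * q)" using that by (intro power_mono) auto
        then have "C * (2 + z ^ (2 * q)) \<le> C * (2 + \<bar>x\<bar> ^ (2 * q))" using C(1) by (intro mult_left_mono) (auto simp: power_even_abs)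
        then show ?thesis using C(2)[of z] by simp
      qed
    qed auto
    then have 1: "\<bar>f x\<bar> \<le> \<bar>f 0\<bar> + C * (2 * \<bar>x\<bar> + \<bar>x\<bar> ^ Suc (2 * q))" by (simp add: algebra_simps)
    have 2: "\<bar>x\<bar> \<le> 1 + \<bar>x\<bar> ^ Suc (2 * q)"
    proof (cases "\<bar>x\<bar> \<le> 1")
      case True then show ?thesis by (simp add: add_increasing2)
    next
      case False
      then have "\<bar>x\<bar> ^ 1 \<le> \<bar>x\<bar> ^ Suc (2 * q)" by (intro power_increasing) auto
      then show ?thesis by simp
    qed
    define E where "E = 1 + \<bar>x\<bar> ^ Suc (2 * q)"
    have "E \<ge> 1" unfolding E_def by simp
    have "C * (2 * \<bar>x\<bar> + \<bar>x\<bar> ^ Suc (2 * q)) \<le> C * (3 * E)"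
      using 2 C(1) unfolding E_def by (intro mult_left_mono) auto
    moreover have "\<bar>f 0\<bar> * 1 \<le> \<bar>f 0\<bar> * E" using \<open>E \<ge> 1\<close> by (intro mult_left_mono) auto
    ultimately show ?thesis using 1 unfolding E_def[symmetric] by (simp add: algebra_simps)
  qed
  then show ?thesis unfolding poly_bounded_def by blast
qed

lemma poly_bounded_square: "poly_bounded f \<Longrightarrow> poly_bounded (\<lambda>x. f (x\<^sup>2))"
proof -
  assume "poly_bounded f"
  then obtain C q where C: "\<And>x. \<bar>f x\<bar> \<le> C * (1 + \<bar>x\<bar> ^ q)" unfolding poly_bounded_def by blast
  have "\<bar>f (x\<^sup>2)\<bar> \<le> C * (1 + \<bar>x\<bar> ^ (2 * q))" for x using C[of "x\<^sup>2"] by (simp add: power_abs power_mult)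
  then show ?thesis unfolding poly_bounded_def by blast
qed

lemma poly_bounded_diff: "poly_bounded f \<Longrightarrow> poly_bounded g \<Longrightarrow> poly_bounded (\<lambda>x. f x - g x)"
proof -
  assume "poly_bounded f" "poly_bounded g"
  then obtain C q D k where CD: "C \<ge> 0" "\<And>x. \<bar>f x\<bar> \<le> C * (2 + x ^ (2 * q))" "D \<ge> 0" "\<And>x. \<bar>g x\<bar> \<le> D * (2 + x ^ (2 * k))"
    using poly_bounded_even by meson
  have "poly_bounded (poly (Polynomial.smult C ([:2:] + monom 1 (2 * q)) + Polynomial.smult D ([:2:] + monom 1 (2 * k))))"
    by (rule poly_bounded_poly)
  then show ?thesis
  proof (rule poly_bounded_mono)
    fix x
    have "\<bar>f x - g x\<bar> \<le> C * (2 + x ^ (2 * q)) + D * (2 + x ^ (2 * k))"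
      using CD(2)[of x] CD(4)[of x] by linarith
    then show "\<bar>f x - g x\<bar> \<le> \<bar>poly (Polynomial.smult C ([:2:] + monom 1 (2 * q)) + Polynomial.smult D ([:2:] + monom 1 (2 * k))) x\<bar>"
      by (simp add: poly_monom)
  qed
qed

text \<open>The fluctuation of \<open>jint g\<close> is that of \<open>lin p\<close> plus those of the approximation error \<open>h\<close>
  (\<open>variance_jint\<close>) and of the nonlinear remainder (\<open>lin_residual\<close>).\<close>

lemma (in chi_jacobi_clt) fluctuation_close_to_linear:
  assumes p: "c1_approx h h' a" and h: "poly_bounded h" and h': "continuous_on UNIV h'"
    and b: "\<And>x. (h' x)\<^sup>2 \<le> e + d * x ^ (2 * L)" and d: "d \<ge> 0"
    and g: "\<And>x. g x = h x + poly p x"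
    and B: "\<gamma> * (e + 2 * d * jwalk sbar (2 * L) 0) < B"
  shows "\<forall>\<^sub>F n in sequentially.
     cmod (char (distr M borel (\<lambda>\<omega>. c n * (jint (S n \<omega>) g - expectation (\<lambda>\<omega>. jint (S n \<omega>) g)))) t -
           char (distr M borel (\<lambda>\<omega>. c n * (lin p n \<omega> - expectation (lin p n)))) t) \<le> \<bar>t\<bar> * sqrt B"
proof -
  define J where "J n \<omega> = jint (S n \<omega>) h" for n \<omega>
  define R where "R n \<omega> = jmom (S n \<omega>) p - lin p n \<omega>" for n \<omega>
  define Q where "Q n \<omega> = J n \<omega> - expectation (J n)" for n \<omega>
  define U where "U n \<omega> = R n \<omega> - expectation (R n)" for n \<omega>
  have jg: "jint (S n \<omega>) g = J n \<omega> + R n \<omega> + lin p n \<omega>" for n \<omega>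
    unfolding g J_def R_def jint_add jint_poly[OF finsupp_S] by simp
  have iJ: "integrable M (J n)" and iJ2: "integrable M (\<lambda>\<omega>. (J n \<omega>)\<^sup>2)" for n
    unfolding J_def[abs_def] by (rule jint_L2[OF p h])+
  have lpR: "lp_tendsto R (jmom sbar p - (\<Sum>k<degree p. coef p k * (sbar k)\<^sup>2))"
    unfolding R_def[abs_def] by (intro lp_tendsto_diff lp_jmom lp_lin)
  have iR: "integrable M (R n)" and iR2: "integrable M (\<lambda>\<omega>. (R n \<omega>)\<^sup>2)" for n
    by (rule lp_tendsto_expectation(1)[OF lpR], rule lp_tendsto_expectation(1)[OF lp_tendsto_power[OF lpR]])
  have il: "integrable M (lin p n)" for n by (rule lp_tendsto_expectation(1)[OF lp_lin])
  note [measurable] = borel_measurable_integrable[OF iJ] borel_measurable_integrable[OF iR] borel_measurable_integrable[OF il]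
  have iQ2: "integrable M (\<lambda>\<omega>. (Q n \<omega>)\<^sup>2)" and iU2: "integrable M (\<lambda>\<omega>. (U n \<omega>)\<^sup>2)" for n
    unfolding Q_def U_def power2_diff using iJ iJ2 iR iR2 by auto
  let ?X = "\<lambda>n \<omega>. c n * (jint (S n \<omega>) g - expectation (\<lambda>\<omega>. jint (S n \<omega>) g))"
  let ?Y = "\<lambda>n \<omega>. c n * (lin p n \<omega> - expectation (lin p n))"
  have D: "?X n \<omega> - ?Y n \<omega> = c n * (Q n \<omega> + U n \<omega>)" for n \<omega>
    unfolding jg Q_def U_def using iJ iR il by (simp add: algebra_simps)
  have sq: "(c n * (x + y))\<^sup>2 \<le> 2 * (c n)\<^sup>2 * (x\<^sup>2 + y\<^sup>2)" for n and x y :: real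
  proof -
    have "(x + y)\<^sup>2 + (x - y)\<^sup>2 = 2 * (x\<^sup>2 + y\<^sup>2)" by (simp add: power2_eq_square algebra_simps)
    then have "(x + y)\<^sup>2 \<le> 2 * (x\<^sup>2 + y\<^sup>2)" using zero_le_power2[of "x - y"] by linarith
    then have "(c n)\<^sup>2 * (x + y)\<^sup>2 \<le> (c n)\<^sup>2 * (2 * (x\<^sup>2 + y\<^sup>2))" by (intro mult_left_mono) auto
    then show ?thesis unfolding power_mult_distrib by (simp only: mult_ac)
  qed
  have iD: "integrable M (\<lambda>\<omega>. (?X n \<omega> - ?Y n \<omega>)\<^sup>2)" for n
    unfolding D
  proof (rule Bochner_Integration.integrable_bound)
    show "integrable M (\<lambda>\<omega>. 2 * (c n)\<^sup>2 * ((Q n \<omega>)\<^sup>2 + (U n \<omega>)\<^sup>2))" using iQ2 iU2 by auto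
    show "AE \<omega> in M. norm ((c n * (Q n \<omega> + U n \<omega>))\<^sup>2) \<le> norm (2 * (c n)\<^sup>2 * ((Q n \<omega>)\<^sup>2 + (U n \<omega>)\<^sup>2))"
      using sq by (intro AE_I2) (simp del: power_mult_distrib add: order_trans[OF sq abs_ge_self])
  qed (simp add: Q_def U_def)
  have split: "expectation (\<lambda>\<omega>. (?X n \<omega> - ?Y n \<omega>)\<^sup>2) \<le> 2 * ((c n)\<^sup>2 * variance (J n)) + 2 * ((c n)\<^sup>2 * variance (R n))" for n
  proof -
    have "expectation (\<lambda>\<omega>. (?X n \<omega> - ?Y n \<omega>)\<^sup>2) \<le> expectation (\<lambda>\<omega>. 2 * (c n)\<^sup>2 * ((Q n \<omega>)\<^sup>2 + (U n \<omega>)\<^sup>2))"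
    proof (rule integral_mono[OF iD])
      show "integrable M (\<lambda>\<omega>. 2 * (c n)\<^sup>2 * ((Q n \<omega>)\<^sup>2 + (U n \<omega>)\<^sup>2))" using iQ2 iU2 by auto
      show "(?X n \<omega> - ?Y n \<omega>)\<^sup>2 \<le> 2 * (c n)\<^sup>2 * ((Q n \<omega>)\<^sup>2 + (U n \<omega>)\<^sup>2)" for \<omega>
        unfolding D by (rule sq)
    qed
    also have "\<dots> = 2 * (c n)\<^sup>2 * (expectation (\<lambda>\<omega>. (Q n \<omega>)\<^sup>2) + expectation (\<lambda>\<omega>. (U n \<omega>)\<^sup>2))"
      using iQ2 iU2 by simp
    finally show ?thesis unfolding Q_def U_def by (simp only: distrib_left mult.assoc)
  qed
  have lim: "(\<lambda>n. 2 * ((c n * \<theta> n)\<^sup>2 * (e + 2 * d * expectation (\<lambda>\<omega>. jwalk (S n \<omega>) (2 * L) 0))) + 2 * ((c n)\<^sup>2 * variance (R n)))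
      \<longlonglongrightarrow> 2 * ((sqrt (\<gamma> / 2))\<^sup>2 * (e + 2 * d * jwalk sbar (2 * L) 0)) + 2 * 0"
    unfolding R_def by (intro tendsto_intros c_lim lin_residual lp_tendsto_expectation(2)[OF lp_jwalk])
  have "2 * ((sqrt (\<gamma> / 2))\<^sup>2 * (e + 2 * d * jwalk sbar (2 * L) 0)) + 2 * 0 < B"
    using B \<gamma>_pos by simp
  from order_tendstoD(2)[OF lim this]
  have "\<forall>\<^sub>F n in sequentially. expectation (\<lambda>\<omega>. (?X n \<omega> - ?Y n \<omega>)\<^sup>2) \<le> B"
    using eventually_ge_at_top[of 1]
  proof eventually_elim
    case (elim n)
    have "variance (J n) \<le> (\<theta> n)\<^sup>2 * (e + 2 * d * expectation (\<lambda>\<omega>. jwalk (S n \<omega>) (2 * L) 0))"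
      unfolding J_def by (rule variance_jint[OF elim(2) p h h' b d])
    then have "(c n)\<^sup>2 * variance (J n) \<le> (c n)\<^sup>2 * ((\<theta> n)\<^sup>2 * (e + 2 * d * expectation (\<lambda>\<omega>. jwalk (S n \<omega>) (2 * L) 0)))"
      by (intro mult_left_mono) auto
    also have "\<dots> = (c n * \<theta> n)\<^sup>2 * (e + 2 * d * expectation (\<lambda>\<omega>. jwalk (S n \<omega>) (2 * L) 0))"
      by (simp only: power_mult_distrib mult.assoc)
    finally show ?case using elim(1) split[of n] by linarith
  qed
  then show ?thesis
  proof eventually_elim
    case (elim n)
    have "cmod (char (distr M borel (?X n)) t - char (distr M borel (?Y n)) t) \<le> \<bar>t\<bar> * sqrt (expectation (\<lambda>\<omega>. (?X n \<omega> - ?Y n \<omega>)\<^sup>2))"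
      by (rule char_distr_diff[OF _ _ iD]) (simp_all add: jg)
    also have "\<dots> \<le> \<bar>t\<bar> * sqrt B" using elim by (intro mult_left_mono) auto
    finally show ?case .
  qed
qed

lemma (in mp_law) mp_tendsto_uniform:
  fixes h :: "nat \<Rightarrow> real \<Rightarrow> real"
  assumes h: "\<And>j. continuous_on UNIV (h j)" "continuous_on UNIV g" and u: "uniform_limit {0..edge} h g sequentially"
  shows "(\<lambda>j. \<integral>x. h j x \<partial>marchenko_pastur \<gamma>) \<longlonglongrightarrow> (\<integral>x. g x \<partial>marchenko_pastur \<gamma>)"
proof (rule tendstoI)
  fix \<epsilon> :: real assume \<epsilon>: "\<epsilon> > 0"
  then have "\<epsilon> / 2 > 0" by simp
  from uniform_limitD[OF u this]
  show "\<forall>\<^sub>F j in sequentially. dist (\<integral>x. h j x \<partial>marchenko_pastur \<gamma>) (\<integral>x. g x \<partial>marchenko_pastur \<gamma>) < \<epsilon>"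
  proof eventually_elim
    case (elim j)
    have "\<bar>\<integral>x. h j x - g x \<partial>marchenko_pastur \<gamma>\<bar> \<le> \<epsilon> / 2"
      using elim by (intro mp_integral_abs_le continuous_on_diff h) (auto simp: dist_real_def intro: less_imp_le)
    moreover have "(\<integral>x. h j x - g x \<partial>marchenko_pastur \<gamma>) = (\<integral>x. h j x \<partial>marchenko_pastur \<gamma>) - (\<integral>x. g x \<partial>marchenko_pastur \<gamma>)"
      by (intro Bochner_Integration.integral_diff mp_substitution(1) h)
    ultimately show ?case using \<epsilon> by (simp add: dist_real_def)
  qed
qed

lemma (in mp_law) mp_variance_nonneg:
  fixes f :: "real \<Rightarrow> real"
  assumes f: "continuous_on UNIV f"
  shows "0 \<le> (\<integral>x. (f x)\<^sup>2 \<partial>marchenko_pastur \<gamma>) - (\<integral>x. f x \<partial>marchenko_pastur \<gamma>)\<^sup>2"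
proof -
  interpret mp: prob_space "marchenko_pastur \<gamma>" by (rule mp_prob)
  have "mp.variance f = (\<integral>x. (f x)\<^sup>2 \<partial>marchenko_pastur \<gamma>) - (\<integral>x. f x \<partial>marchenko_pastur \<gamma>)\<^sup>2"
    by (rule mp.variance_eq; intro mp_substitution(1) continuous_intros f)
  then show ?thesis using mp.variance_positive[of f] by simp
qed

text \<open>Approximate \<open>f\<close> in \<open>C\<^sup>1\<close> by a polynomial \<open>P\<close> near the support.  The statement for \<open>P\<close> is \<open>lin_clt\<close>, the
  remainder \<open>f - P\<close> has small variance uniformly in \<open>n\<close>, and the limiting variances converge.\<close>

lemma chi_jacobi_clt_c1:
  assumes clt: "chi_jacobi_clt M S K \<kappa> \<theta> (alt_seq \<gamma>) c \<gamma>" and \<gamma>1: "\<gamma> < 1"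
    and f: "\<And>x. (f has_real_derivative f' x) (at x)" and f': "continuous_on UNIV f'" and pb': "poly_bounded f'"
  shows "(\<lambda>n. char (distr M borel (\<lambda>\<omega>. c n * (jint (S n \<omega>) (\<lambda>x. f (x\<^sup>2)) - (\<integral>\<omega>. jint (S n \<omega>) (\<lambda>x. f (x\<^sup>2)) \<partial>M)))) t)
    \<longlonglongrightarrow> complex_of_real (exp (- (t\<^sup>2 * ((\<integral>x. (f x)\<^sup>2 \<partial>marchenko_pastur \<gamma>) - (\<integral>x. f x \<partial>marchenko_pastur \<gamma>)\<^sup>2) / 2)))"
    (is "?C \<longlonglongrightarrow> ?G")
proof (rule tendstoI)
  interpret chi_jacobi_clt M S K \<kappa> \<theta> "alt_seq \<gamma>" c \<gamma> by (rule clt)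
  interpret mp: mp_law \<gamma> using \<gamma>_pos \<gamma>1 by unfold_locales
  let ?mp = "marchenko_pastur \<gamma>"
  fix \<epsilon> :: real assume \<epsilon>: "\<epsilon> > 0"
  (* With this choice \<open>\<bar>t\<bar> * sqrt (4 * e) \<le> \<epsilon> / 3\<close>, the error allowed in \<open>fluctuation_close_to_linear\<close>. *)
  define a where "a = \<epsilon> / (6 * (\<bar>t\<bar> + 1))"
  define e where "e = a\<^sup>2"
  have a: "a > 0" using \<epsilon> by (simp add: a_def)
  then have e: "e > 0" by (simp add: e_def)
  have sqrt_e: "sqrt (4 * e) = 2 * a" using a by (simp add: e_def real_sqrt_mult)
  have ta: "\<bar>t\<bar> * sqrt (4 * e) \<le> \<epsilon> / 3"
    unfolding sqrt_e using \<epsilon> by (simp add: a_def field_simps)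
  define R where "R = mp.edge + 1"
  have R: "R \<ge> 1" "0 \<le> mp.edge" "mp.edge < R" using mp.edge_pos by (auto simp: R_def)
  (* The derivative of \<open>f (x\<^sup>2)\<close> has the extra factor \<open>2 x\<close>, at most \<open>2 R\<close> on \<open>[-R, R]\<close>. *)
  define \<delta> where "\<delta> = a / (2 * R)"
  have \<delta>: "\<delta> > 0" using a R by (simp add: \<delta>_def)
  have pbf: "poly_bounded f" by (rule poly_bounded_antiderivative[OF f pb'])
  have cf: "continuous_on UNIV f" using f by (auto intro: DERIV_continuous_on)
  obtain P where P: "c1_approx f f' P" using c1_polynomial_approx[OF f f'] unfolding c1_approx_def by blast
  have u: "uniform_limit {0..mp.edge} (\<lambda>j. poly (P j)) f sequentially"
  proof (rule uniform_limitI)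
    fix \<eta> :: real assume \<eta>: "\<eta> > 0"
    then have "\<eta> / 2 > 0" by simp
    from c1_approxD[OF P this, of mp.edge]
    show "\<forall>\<^sub>F j in sequentially. \<forall>x\<in>{0..mp.edge}. dist (poly (P j) x) (f x) < \<eta>"
    proof eventually_elim
      case (elim j)
      show ?case
      proof
        fix x assume "x \<in> {0..mp.edge}"
        then have "\<bar>poly (P j) x - f x\<bar> \<le> \<eta> / 2" using elim by auto
        then show "dist (poly (P j) x) (f x) < \<eta>" using \<eta> unfolding dist_real_def by linarith
      qed
    qed
  qed
  have bnd: "bounded (f ` {0..mp.edge})"
    by (intro compact_imp_bounded compact_continuous_image continuous_on_subset[OF cf]) auto
  have u2: "uniform_limit {0..mp.edge} (\<lambda>j x. (poly (P j) x)\<^sup>2) (\<lambda>x. (f x)\<^sup>2) sequentially"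
    unfolding power2_eq_square by (rule uniform_lim_mult[OF u u bnd bnd])
  have var: "clt_var (even_poly (P j)) = (\<integral>x. (poly (P j) x)\<^sup>2 \<partial>?mp) - (\<integral>x. poly (P j) x \<partial>?mp)\<^sup>2" for j
    unfolding clt_var_def by (rule mp.mp_poly_variance) simp
  have "(\<lambda>j. clt_var (even_poly (P j))) \<longlonglongrightarrow> (\<integral>x. (f x)\<^sup>2 \<partial>?mp) - (\<integral>x. f x \<partial>?mp)\<^sup>2"
    unfolding var by (intro tendsto_intros mp.mp_tendsto_uniform u u2 cf continuous_intros)
  then have "(\<lambda>j. complex_of_real (exp (- (t\<^sup>2 * clt_var (even_poly (P j)) / 2)))) \<longlonglongrightarrow> ?G"
    by (intro tendsto_intros) auto
  moreover have "\<epsilon> / 3 > 0" using \<epsilon> by simp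
  ultimately have "\<forall>\<^sub>F j in sequentially. dist (complex_of_real (exp (- (t\<^sup>2 * clt_var (even_poly (P j)) / 2)))) ?G < \<epsilon> / 3"
    by (rule tendstoD)
  then have "\<forall>\<^sub>F j in sequentially. dist (complex_of_real (exp (- (t\<^sup>2 * clt_var (even_poly (P j)) / 2)))) ?G < \<epsilon> / 3 \<and>
      (\<forall>x. \<bar>x\<bar> \<le> R\<^sup>2 \<longrightarrow> \<bar>poly (P j) x - f x\<bar> \<le> \<delta> \<and> \<bar>poly (pderiv (P j)) x - f' x\<bar> \<le> \<delta>)"
    using c1_approxD[OF P \<delta>] by (rule eventually_conj)
  then obtain j where j: "dist (complex_of_real (exp (- (t\<^sup>2 * clt_var (even_poly (P j)) / 2)))) ?G < \<epsilon> / 3"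
    "\<And>x. \<bar>x\<bar> \<le> R\<^sup>2 \<Longrightarrow> \<bar>poly (pderiv (P j)) x - f' x\<bar> \<le> \<delta>"
    by (auto simp: eventually_sequentially)
  define p where "p = even_poly (P j)"
  define h where "h x = f (x\<^sup>2) - poly (P j) (x\<^sup>2)" for x
  define h' where "h' x = (f' (x\<^sup>2) - poly (pderiv (P j)) (x\<^sup>2)) * (2 * x)" for x
  have dh: "(h has_real_derivative h' x) (at x)" for x
    unfolding h_def[abs_def] h'_def by (rule derivative_eq_intros DERIV_chain2[OF f] DERIV_chain2[OF poly_DERIV] refl | simp add: algebra_simps)+
  have ch': "continuous_on UNIV h'"
    unfolding h'_def[abs_def] by (intro continuous_intros continuous_on_compose2[OF f']) auto
  have pbh: "poly_bounded h"
    unfolding h_def[abs_def] by (intro poly_bounded_diff poly_bounded_square[where f = f] poly_bounded_square[where f = "poly (P j)"] pbf poly_bounded_poly)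
  have pbh': "poly_bounded h'"
    unfolding h'_def[abs_def]
    by (intro poly_bounded_mult poly_bounded_diff poly_bounded_square[where f = f'] poly_bounded_square[where f = "poly (pderiv (P j))"]
        pb' poly_bounded_poly poly_boundedI[of _ "[:0, 2:]"]) (simp add: mult.commute)
  have small: "\<bar>h' x * h' x\<bar> \<le> e" if x: "\<bar>x\<bar> \<le> R" for x
  proof -
    have "x\<^sup>2 \<le> R\<^sup>2" using power_mono[OF x, of 2] by simp
    then have "\<bar>f' (x\<^sup>2) - poly (pderiv (P j)) (x\<^sup>2)\<bar> \<le> \<delta>" using j(2)[of "x\<^sup>2"] by (simp add: abs_minus_commute)
    moreover have "\<bar>2 * x\<bar> \<le> 2 * R" using x by simp
    ultimately have "\<bar>h' x\<bar> \<le> \<delta> * (2 * R)" unfolding h'_def abs_mult by (intro mult_mono) (use \<delta> in auto)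
    also have "\<dots> = a" using R by (simp add: \<delta>_def)
    finally have "\<bar>h' x\<bar> * \<bar>h' x\<bar> \<le> a * a" using a by (intro mult_mono) auto
    then show ?thesis by (simp add: e_def power2_eq_square abs_mult)
  qed
  obtain d L where d: "d \<ge> 0" "\<And>x. \<bar>h' x * h' x\<bar> \<le> e + d * x ^ (2 * L)" "d * mp.edge ^ (2 * L) \<le> e"
    using polynomial_majorant[OF poly_bounded_mult[OF pbh' pbh'] R e small] by metis
  have b: "(h' x)\<^sup>2 \<le> e + d * x ^ (2 * L)" for x using d(2)[of x] by (simp add: power2_eq_square)
  obtain q where q: "c1_approx h h' q" using c1_polynomial_approx[OF dh ch'] unfolding c1_approx_def by blast
  have "jwalk (alt_seq \<gamma>) (2 * L) 0 \<le> mp.edge ^ (2 * L)"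
    using mp.mp_moment_le[of L] power_increasing[of L "2 * L" mp.edge] mp.edge_pos by linarith
  then have "d * jwalk (alt_seq \<gamma>) (2 * L) 0 \<le> e" using d(3) mult_left_mono[OF _ d(1)] by fastforce
  then have "\<gamma> * (e + 2 * d * jwalk (alt_seq \<gamma>) (2 * L) 0) \<le> \<gamma> * (3 * e)"
    using \<gamma>_pos by (intro mult_left_mono) auto
  also have "\<dots> \<le> 1 * (3 * e)" using \<gamma>1 e by (intro mult_right_mono) auto
  also have "\<dots> < 4 * e" using e by simp
  finally have B: "\<gamma> * (e + 2 * d * jwalk (alt_seq \<gamma>) (2 * L) 0) < 4 * e" .
  have g: "f (x\<^sup>2) = h x + poly p x" for x by (simp add: h_def p_def poly_even_poly)
  have lin: "\<forall>\<^sub>F n in sequentially. dist (char (distr M borel (\<lambda>\<omega>. c n * (lin p n \<omega> - expectation (lin p n)))) t)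
      (complex_of_real (exp (- (t\<^sup>2 * clt_var p / 2)))) < \<epsilon> / 3"
    using lin_clt \<open>\<epsilon> / 3 > 0\<close> by (rule tendstoD)
  show "\<forall>\<^sub>F n in sequentially. dist (?C n) ?G < \<epsilon>"
    using lin fluctuation_close_to_linear[where g = "\<lambda>x. f (x\<^sup>2)" and p = p and t = t, OF q pbh ch' b d(1) g B]
  proof eventually_elim
    case (elim n)
    let ?Y = "char (distr M borel (\<lambda>\<omega>. c n * (lin p n \<omega> - expectation (lin p n)))) t"
    have "dist (?C n) ?Y \<le> \<epsilon> / 3" using elim(2) ta unfolding dist_norm by linarith
    moreover have "dist (complex_of_real (exp (- (t\<^sup>2 * clt_var p / 2)))) ?G < \<epsilon> / 3" using j(1) unfolding p_def .
    ultimately show ?case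
      using elim(1) dist_triangle[of "?C n" ?G ?Y] dist_triangle[of ?Y ?G "complex_of_real (exp (- (t\<^sup>2 * clt_var p / 2)))"]
      by linarith
  qed
qed

section \<open>Proof of the theorem\<close>

text \<open>Nothing is known about the measure with index 0 (for \<open>n = 0\<close> the ensemble is unconstrained), so the
  criteria for weak convergence are applied to the shifted sequence.\<close>

lemma weak_conv_of_bounded_continuous_Suc:
  fixes \<nu> :: "nat \<Rightarrow> real measure"
  assumes \<nu>: "\<And>n. n \<ge> 1 \<Longrightarrow> real_distribution (\<nu> n)" and \<nu>': "real_distribution \<nu>'"
    and lim: "\<And>f :: real \<Rightarrow> real. continuous_on UNIV f \<Longrightarrow> bounded (range f) \<Longrightarrow>
      (\<lambda>n. \<integral>x. f x \<partial>\<nu> n) \<longlonglongrightarrow> (\<integral>x. f x \<partial>\<nu>')"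
  shows "weak_conv_m \<nu> \<nu>'"
proof -
  have "weak_conv_m (\<lambda>n. \<nu> (Suc n)) \<nu>'"
  proof (rule integral_cts_step_conv_imp_weak_conv)
    show "real_distribution (\<nu> (Suc n))" for n by (rule \<nu>) simp
    show "real_distribution \<nu>'" by (rule \<nu>')
    fix x y :: real assume xy: "x < y"
    have "bounded (range (cts_step x y))"
      unfolding bounded_iff using xy by (intro exI[of _ 1]) (auto simp: cts_step_def field_simps)
    with uniformly_continuous_imp_continuous[OF cts_step_uniformly_continuous[OF xy]]
    have "(\<lambda>n. \<integral>z. cts_step x y z \<partial>\<nu> n) \<longlonglongrightarrow> (\<integral>z. cts_step x y z \<partial>\<nu>')" by (rule lim)
    then show "(\<lambda>n. \<integral>z. cts_step x y z \<partial>\<nu> (Suc n)) \<longlonglongrightarrow> (\<integral>z. cts_step x y z \<partial>\<nu>')" by (rule LIMSEQ_Suc)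
  qed
  then show ?thesis unfolding weak_conv_m_def weak_conv_def by (simp add: filterlim_sequentially_Suc[where f = "\<lambda>n. cdf (\<nu> n) _"])
qed

lemma weak_conv_of_char_Suc:
  fixes \<nu> :: "nat \<Rightarrow> real measure"
  assumes \<nu>: "\<And>n. n \<ge> 1 \<Longrightarrow> real_distribution (\<nu> n)" and \<nu>': "real_distribution \<nu>'"
    and lim: "\<And>t. (\<lambda>n. char (\<nu> n) t) \<longlonglongrightarrow> char \<nu>' t"
  shows "weak_conv_m \<nu> \<nu>'"
proof -
  have "weak_conv_m (\<lambda>n. \<nu> (Suc n)) \<nu>'"
  proof (rule levy_continuity)
    show "real_distribution (\<nu> (Suc n))" for n by (rule \<nu>) simp
    show "(\<lambda>n. char (\<nu> (Suc n)) t) \<longlonglongrightarrow> char \<nu>' t" for t by (rule LIMSEQ_Suc[OF lim])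
  qed (rule \<nu>')
  then show ?thesis unfolding weak_conv_m_def weak_conv_def by (simp add: filterlim_sequentially_Suc[where f = "\<lambda>n. cdf (\<nu> n) _"])
qed

theorem mainTheorem3:
  fixes M :: "'a measure" and \<beta> \<gamma> :: real and m :: "nat \<Rightarrow> real"
    and B :: "nat \<Rightarrow> 'a \<Rightarrow> real mat" and \<mu> :: "nat \<Rightarrow> 'a \<Rightarrow> real measure"
  assumes "prob_space M"
    and "\<beta> > 0" and "0 < \<gamma>" and "\<gamma> < 1"
    and "\<And>n. n \<ge> 1 \<Longrightarrow> m n > real n - 1"
    and "(\<lambda>n. real n / m n) \<longlonglongrightarrow> \<gamma>"
    and "\<And>n. n \<ge> 1 \<Longrightarrow> wishart_bidiagonal M (m n) n \<beta> (B n)"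
    and "\<And>n \<omega>. \<mu> n \<omega> = spectral_measure (B n \<omega> * transpose_mat (B n \<omega>))"
  shows "(AE \<omega> in M. weak_conv_m (\<lambda>n. \<mu> n \<omega>) (marchenko_pastur \<gamma>)) \<and>
    (\<forall>f :: real \<Rightarrow> real. continuous_on UNIV f \<longrightarrow> bounded (range f) \<longrightarrow>
      (AE \<omega> in M. (\<lambda>n. \<integral>x. f x \<partial>\<mu> n \<omega>) \<longlonglongrightarrow> (\<integral>x. f x \<partial>marchenko_pastur \<gamma>))) \<and>
    (\<forall>f f' :: real \<Rightarrow> real.
      (\<forall>x. (f has_real_derivative f' x) (at x)) \<longrightarrow> continuous_on UNIV f' \<longrightarrow>
      polynomial_growth f' \<longrightarrow>
      (\<forall>n\<ge>1. integrable M (\<lambda>\<omega>. \<integral>x. f x \<partial>\<mu> n \<omega>)) \<and>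
      weak_conv_m
        (\<lambda>n. distr M borel (\<lambda>\<omega>. sqrt (real n * \<beta>) / sqrt 2 *
           ((\<integral>x. f x \<partial>\<mu> n \<omega>) - prob_space.expectation M (\<lambda>\<omega>'. \<integral>x. f x \<partial>\<mu> n \<omega>'))))
        (centered_normal ((\<integral>x. (f x)\<^sup>2 \<partial>marchenko_pastur \<gamma>) - (\<integral>x. f x \<partial>marchenko_pastur \<gamma>)\<^sup>2)))"
proof -
  define S where "S n \<omega> = interleave n (B n \<omega>)" for n \<omega>
  define c where "c n = sqrt (real n * \<beta>) / sqrt 2" for n
  have clt: "chi_jacobi_clt M S (\<lambda>n. 2 * n - 1) (wishart_shape m \<beta>) (\<lambda>n. 1 / sqrt (m n * \<beta>)) (alt_seq \<gamma>) c \<gamma>"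
    unfolding S_def[abs_def] c_def[abs_def] using assms(1-3,5-7) by (rule wishart_chi_jacobi_clt)
  interpret chi_jacobi_clt M S "\<lambda>n. 2 * n - 1" "wishart_shape m \<beta>" "\<lambda>n. 1 / sqrt (m n * \<beta>)" "alt_seq \<gamma>" c \<gamma>
    by (rule clt)
  interpret mp: mp_law \<gamma> using assms(3,4) by unfold_locales
  have \<mu>: "\<mu> n \<omega> = square_quadrature (S n \<omega>)" if n: "n \<ge> 1" and \<omega>: "\<omega> \<in> space M" for n \<omega>
  proof -
    have "lower_bidiagonal n (B n \<omega>)"
      using assms(7)[OF n] \<omega> unfolding wishart_bidiagonal_def lower_bidiagonal_def by blast
    then show ?thesis unfolding assms(8) S_def using n by (rule spectral_measure_wishart)
  qed
  have int\<mu>: "(\<integral>x. f x \<partial>\<mu> n \<omega>) = jint (S n \<omega>) (\<lambda>x. f (x\<^sup>2))"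
    if "n \<ge> 1" "\<omega> \<in> space M" "continuous_on UNIV f" for n \<omega> and f :: "real \<Rightarrow> real"
    unfolding \<mu>[OF that(1,2)] by (rule square_quadrature(3)[OF finsupp_S borel_measurable_continuous_onI[OF that(3)]])
  (* One exceptional null set serves all test functions, as needed for almost sure weak convergence. *)
  have good: "AE \<omega> in M. \<forall>f :: real \<Rightarrow> real. continuous_on UNIV f \<longrightarrow> bounded (range f) \<longrightarrow>
      (\<lambda>n. \<integral>x. f x \<partial>\<mu> n \<omega>) \<longlonglongrightarrow> (\<integral>x. f x \<partial>marchenko_pastur \<gamma>)"
    using AE_jwalk_tendsto AE_space
  proof eventually_elim
    case (elim \<omega>)
    show ?case
    proof (intro allI impI)
      fix f :: "real \<Rightarrow> real" assume f: "continuous_on UNIV f" "bounded (range f)"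
      have "(\<lambda>n. jint (S n \<omega>) (\<lambda>x. f (x\<^sup>2))) \<longlonglongrightarrow> (\<integral>x. f x \<partial>marchenko_pastur \<gamma>)"
        using elim(1) by (intro mp.moments_imp_convergence[OF finsupp_S _ f]) auto
      moreover have "\<forall>\<^sub>F n in sequentially. jint (S n \<omega>) (\<lambda>x. f (x\<^sup>2)) = (\<integral>x. f x \<partial>\<mu> n \<omega>)"
        using eventually_ge_at_top[of 1] by eventually_elim (simp add: int\<mu> elim(2) f)
      ultimately show "(\<lambda>n. \<integral>x. f x \<partial>\<mu> n \<omega>) \<longlonglongrightarrow> (\<integral>x. f x \<partial>marchenko_pastur \<gamma>)"
        by (rule Lim_transform_eventually)
    qed
  qed
  have weak: "AE \<omega> in M. weak_conv_m (\<lambda>n. \<mu> n \<omega>) (marchenko_pastur \<gamma>)"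
    using good AE_space
  proof eventually_elim
    case (elim \<omega>)
    show ?case
    proof (rule weak_conv_of_bounded_continuous_Suc)
      show "real_distribution (\<mu> n \<omega>)" if "n \<ge> 1" for n
        unfolding \<mu>[OF that elim(2)] by (rule square_quadrature(1)[OF finsupp_S])
      show "real_distribution (marchenko_pastur \<gamma>)" by (rule mp.mp_real_distribution)
    qed (use elim(1) in blast)
  qed
  have ae: "AE \<omega> in M. (\<lambda>n. \<integral>x. f x \<partial>\<mu> n \<omega>) \<longlonglongrightarrow> (\<integral>x. f x \<partial>marchenko_pastur \<gamma>)"
    if "continuous_on UNIV f" "bounded (range f)" for f :: "real \<Rightarrow> real"
    using good by eventually_elim (use that in blast)
  have fluct: "(\<forall>n\<ge>1. integrable M (\<lambda>\<omega>. \<integral>x. f x \<partial>\<mu> n \<omega>)) \<and>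
      weak_conv_m (\<lambda>n. distr M borel (\<lambda>\<omega>. c n * ((\<integral>x. f x \<partial>\<mu> n \<omega>) - expectation (\<lambda>\<omega>'. \<integral>x. f x \<partial>\<mu> n \<omega>'))))
        (centered_normal ((\<integral>x. (f x)\<^sup>2 \<partial>marchenko_pastur \<gamma>) - (\<integral>x. f x \<partial>marchenko_pastur \<gamma>)\<^sup>2))"
    if f: "\<And>x. (f has_real_derivative f' x) (at x)" and f': "continuous_on UNIV f'" and gr: "polynomial_growth f'"
    for f f' :: "real \<Rightarrow> real"
  proof -
    define J where "J n \<omega> = jint (S n \<omega>) (\<lambda>x. f (x\<^sup>2))" for n \<omega>
    define V where "V = (\<integral>x. (f x)\<^sup>2 \<partial>marchenko_pastur \<gamma>) - (\<integral>x. f x \<partial>marchenko_pastur \<gamma>)\<^sup>2"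
    have cf: "continuous_on UNIV f" using f by (auto intro: DERIV_continuous_on)
    obtain p where p: "\<And>x. \<bar>f' x\<bar> \<le> poly p x" using gr unfolding polynomial_growth_def by blast
    have pb': "poly_bounded f'"
      by (rule poly_bounded_mono[OF poly_bounded_poly[of p]]) (rule order_trans[OF p abs_ge_self])
    have pb: "poly_bounded (\<lambda>x. f (x\<^sup>2))"
      by (rule poly_bounded_square[OF poly_bounded_antiderivative[OF f pb']])
    have d: "((\<lambda>x. f (x\<^sup>2)) has_real_derivative f' (x\<^sup>2) * (2 * x)) (at x)" for x
      by (rule DERIV_chain2[OF f]) (auto intro!: derivative_eq_intros)
    have "continuous_on UNIV (\<lambda>x. f' (x\<^sup>2) * (2 * x))"
      by (intro continuous_intros continuous_on_compose2[OF f']) auto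
    from c1_polynomial_approx[OF d this] obtain q where q: "c1_approx (\<lambda>x. f (x\<^sup>2)) (\<lambda>x. f' (x\<^sup>2) * (2 * x)) q"
      unfolding c1_approx_def by blast
    have iJ: "integrable M (J n)" for n unfolding J_def[abs_def] by (rule jint_L2[OF q pb])
    have eq: "(\<integral>x. f x \<partial>\<mu> n \<omega>) = J n \<omega>" if "n \<ge> 1" "\<omega> \<in> space M" for n \<omega>
      unfolding J_def by (rule int\<mu>[OF that cf])
    have int: "integrable M (\<lambda>\<omega>. \<integral>x. f x \<partial>\<mu> n \<omega>)" if "n \<ge> 1" for n
      using iJ[of n] by (subst Bochner_Integration.integrable_cong[OF refl eq[OF that]])
    let ?D = "\<lambda>n. distr M borel (\<lambda>\<omega>. c n * ((\<integral>x. f x \<partial>\<mu> n \<omega>) - expectation (\<lambda>\<omega>'. \<integral>x. f x \<partial>\<mu> n \<omega>')))"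
    have D: "?D n = distr M borel (\<lambda>\<omega>. c n * (J n \<omega> - expectation (J n)))" if n: "n \<ge> 1" for n
    proof -
      have "expectation (\<lambda>\<omega>'. \<integral>x. f x \<partial>\<mu> n \<omega>') = expectation (J n)"
        by (rule Bochner_Integration.integral_cong[OF refl eq[OF n]])
      then show ?thesis by (intro distr_cong refl) (simp add: eq[OF n])
    qed
    have V: "V \<ge> 0" unfolding V_def by (rule mp.mp_variance_nonneg[OF cf])
    have "weak_conv_m ?D (centered_normal V)"
    proof (rule weak_conv_of_char_Suc)
      show "real_distribution (?D n)" if "n \<ge> 1" for n
        unfolding D[OF that] real_distribution_def real_distribution_axioms_def
        using borel_measurable_integrable[OF iJ[of n]] by (auto intro!: prob_space_distr)
      show "real_distribution (centered_normal V)" by (rule centered_normal_char(1)[OF V])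
      fix t
      have "(\<lambda>n. char (distr M borel (\<lambda>\<omega>. c n * (J n \<omega> - expectation (J n)))) t) \<longlonglongrightarrow> char (centered_normal V) t"
        unfolding centered_normal_char(2)[OF V] unfolding V_def J_def by (rule chi_jacobi_clt_c1[where f = f and f' = f' and t = t, OF clt assms(4) f f' pb'])
      moreover have "\<forall>\<^sub>F n in sequentially. char (distr M borel (\<lambda>\<omega>. c n * (J n \<omega> - expectation (J n)))) t = char (?D n) t"
        using eventually_ge_at_top[of 1] by eventually_elim (simp only: D)
      ultimately show "(\<lambda>n. char (?D n) t) \<longlonglongrightarrow> char (centered_normal V) t" by (rule Lim_transform_eventually)
    qed
    then show ?thesis unfolding V_def using int by blast
  qed
  show ?thesis using weak ae fluct unfolding c_def by blast
qed

end
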